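(* Let $(c_k)_{k\in\mathbb{Z}}$ be a sequence of nonnegative real numbers, not identically zero, with $(c_k)\in\ell^1(\mathbb{Z})$. Let $u_0^\omega(x)=\sum_{k\in\mathbb{Z}}c_k g_k e^{ikx}$, and for $\varepsilon>0$ let $u=u_\varepsilon(t,x)$ be the solution of $$i\partial_t u+\partial_x^2 u=\varepsilon^2|u|^2u,\qquad u|_{t=0}=u_0^\omega,\qquad x\in\mathbb{T}.$$ For any $t=t_\varepsilon\ge 0$ with $t_\varepsilon=\mathcal{O}(\varepsilon^{-1}|\log\varepsilon|)$ as $\varepsilon\to0^+$ and any $z_0>0$, $$\lim_{\varepsilon\to0^+}\varepsilon\log\mathbb{P}\Big(\sup_{x\in\mathbb{T}}|u(t,x)|>z_0\varepsilon^{-1/2}\Big)=-\frac{z_0^2}{\sum_{k\in\mathbb{Z}}c_k^2}.$$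
   Context: $\mathbb{T}=\mathbb{R}/(2\pi\mathbb{Z})$. $(g_k)_{k\in\mathbb{Z}}$ are i.i.d. complex Gaussian random variables with $\mathbb{E}g_k=0$, $\mathbb{E}g_kg_j=0$, $\mathbb{E}g_k\overline{g_j}=\delta_{kj}$. For initial data in $L^2(\mathbb{T})$ the solution is the unique global $L^2$ solution of the cubic NLS on $\mathbb{T}$ (Bourgain). *)

theory Defs
  imports "HOL-Probability.Probability" "HOL-Library.Landau_Symbols"
begin

text \<open>
  Functions on the circle of length 2 pi are 2 pi-periodic functions on the reals, and integrals over
  the circle are integrals over the fundamental domain [0, 2 pi).
\<close>

definition periodic :: "(real \<Rightarrow> 'a) \<Rightarrow> bool" where
  "periodic f \<longleftrightarrow> (\<forall>x. f (x + 2 * pi) = f x)"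

definition circle_measure :: "real measure" where
  "circle_measure = restrict_space lborel {0..<2 * pi}"

definition in_L2 :: "(real \<Rightarrow> complex) \<Rightarrow> bool" where
  "in_L2 f \<longleftrightarrow> periodic f \<and> f \<in> borel_measurable circle_measure \<and>
     integrable circle_measure (\<lambda>x. (cmod (f x))\<^sup>2)"

definition fourier_coeff :: "(real \<Rightarrow> complex) \<Rightarrow> int \<Rightarrow> complex" where
  "fourier_coeff f k = (LINT x|circle_measure. f x * cis (- (of_int k * x))) / (2 * pi)"

text \<open>
  A single L2 class has no pointwise supremum, so the supremum over the circle is the L-infinity norm.
  For a continuous function it is the ordinary supremum (lemma \<open>sup_circle_continuous\<close>).
\<close>

definition sup_circle :: "(real \<Rightarrow> complex) \<Rightarrow> ereal" where
  "sup_circle f = esssup circle_measure (\<lambda>x. ereal (cmod (f x)))"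

text \<open>
  Bourgain's class for $L^2$ data is $C([0,\infty);L^2) \cap L^4_{loc}$, in which the solution of
  $i u_t + u_{xx} = \varepsilon^2 |u|^2 u$, $u(0) = u_0$ is unique. The equation is meant in the
  integral (Duhamel) sense
  $u(t) = e^{it\partial_x^2} u_0 - i\varepsilon^2 \int_0^t e^{i(t-s)\partial_x^2} (|u|^2 u)(s)\,ds$,
  written mode by mode: $e^{it\partial_x^2}$ multiplies the $k$-th Fourier coefficient by
  $e^{-ik^2t}$. The values of $u$ at negative times are irrelevant.
\<close>

definition L2_solution_class :: "(real \<Rightarrow> real \<Rightarrow> complex) \<Rightarrow> bool" where
  "L2_solution_class u \<longleftrightarrow>
     (\<lambda>(t, x). u t x) \<in> borel_measurable (restrict_space lborel {0..} \<Otimes>\<^sub>M circle_measure) \<and>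
     (\<forall>t\<ge>0. in_L2 (u t)) \<and>
     (\<forall>t\<ge>0. ((\<lambda>s. LINT x|circle_measure. (cmod (u s x - u t x))\<^sup>2) \<longlongrightarrow> 0) (at t within {0..})) \<and>
     (\<forall>T>0. integrable (restrict_space lborel {0..T} \<Otimes>\<^sub>M circle_measure)
               (\<lambda>(t, x). (cmod (u t x)) ^ 4))"

definition nls_solution ::
  "real \<Rightarrow> (real \<Rightarrow> complex) \<Rightarrow> (real \<Rightarrow> real \<Rightarrow> complex) \<Rightarrow> bool" where
  "nls_solution \<epsilon> u0 u \<longleftrightarrow>
     L2_solution_class u \<and>
     (AE x in circle_measure. u 0 x = u0 x) \<and>
     (\<forall>t\<ge>0. \<forall>k. fourier_coeff (u t) k =
        cis (- ((of_int k)\<^sup>2 * t)) * fourier_coeff u0 k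
        - \<i> * of_real (\<epsilon>\<^sup>2) *
          (LINT s|restrict_space lborel {0..t}. cis (- ((of_int k)\<^sup>2 * (t - s))) *
             fourier_coeff (\<lambda>x. of_real ((cmod (u s x))\<^sup>2) * u s x) k))"

text \<open>Constants count as (degenerate) Gaussian variables.\<close>

definition gaussian_rv :: "'a measure \<Rightarrow> ('a \<Rightarrow> real) \<Rightarrow> bool" where
  "gaussian_rv M Y \<longleftrightarrow> Y \<in> borel_measurable M \<and>
     (\<exists>\<mu> \<sigma>. (\<sigma> > 0 \<and> distributed M lborel Y (normal_density \<mu> \<sigma>)) \<or> (AE \<omega> in M. Y \<omega> = \<mu>))"

text \<open>Complex Gaussian: real and imaginary part are jointly Gaussian.\<close>

definition complex_gaussian_rv :: "'a measure \<Rightarrow> ('a \<Rightarrow> complex) \<Rightarrow> bool" where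
  "complex_gaussian_rv M X \<longleftrightarrow>
     (\<forall>a b. gaussian_rv M (\<lambda>\<omega>. a * Re (X \<omega>) + b * Im (X \<omega>)))"

definition iid_standard_complex_gaussians :: "'a measure \<Rightarrow> (int \<Rightarrow> 'a \<Rightarrow> complex) \<Rightarrow> bool" where
  "iid_standard_complex_gaussians M g \<longleftrightarrow>
     prob_space.indep_vars M (\<lambda>_. borel) g UNIV \<and>
     (\<forall>k j. distr M borel (g k) = distr M borel (g j)) \<and>
     (\<forall>k. complex_gaussian_rv M (g k)) \<and>
     (\<forall>k. (LINT \<omega>|M. g k \<omega>) = 0) \<and>
     (\<forall>k j. (LINT \<omega>|M. g k \<omega> * g j \<omega>) = 0) \<and>
     (\<forall>k j. (LINT \<omega>|M. g k \<omega> * cnj (g j \<omega>)) = (if k = j then 1 else 0))"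

text \<open>
  For summable nonnegative \<open>c\<close> the series converges absolutely for almost every \<open>\<omega>\<close>; on the
  exceptional null set (which does not depend on \<open>x\<close>) \<open>infsum\<close> makes the datum 0.
\<close>

definition random_data ::
  "(int \<Rightarrow> real) \<Rightarrow> (int \<Rightarrow> 'a \<Rightarrow> complex) \<Rightarrow> 'a \<Rightarrow> real \<Rightarrow> complex" where
  "random_data c g \<omega> x = (\<Sum>\<^sub>\<infinity>k\<in>UNIV. of_real (c k) * g k \<omega> * cis (of_int k * x))"

lemma periodic_shift_int:
  assumes "periodic f" shows "f (x + 2 * pi * of_int n) = f x"
proof -
  have nat: "f (y + 2 * pi * of_nat m) = f y" for y m
  proof (induction m)
    case (Suc m)
    have "f (y + 2 * pi * of_nat (Suc m)) = f ((y + 2 * pi * of_nat m) + 2 * pi)"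
      by (simp add: algebra_simps)
    also have "\<dots> = f y" using assms Suc by (simp add: periodic_def)
    finally show ?case .
  qed simp
  show ?thesis
  proof (cases "n \<ge> 0")
    case True
    then show ?thesis using nat[of x "nat n"] by simp
  next
    case False
    then show ?thesis using nat[of "x + 2 * pi * of_int n" "nat (- n)"] by simp
  qed
qed

lemma sup_circle_continuous:
  assumes per: "periodic f" and cont: "continuous_on UNIV f"
  shows "sup_circle f = (SUP x. ereal (cmod (f x)))"
proof (rule antisym)
  let ?h = "\<lambda>x. ereal (cmod (f x))"
  have fm: "f \<in> borel_measurable borel" using cont by (rule borel_measurable_continuous_onI)
  have m: "?h \<in> borel_measurable circle_measure"
    unfolding circle_measure_def by (rule measurable_restrict_space1) (use fm in measurable)
  show "sup_circle f \<le> (SUP x. ?h x)"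
    unfolding sup_circle_def by (rule esssup_I[OF m], rule AE_I2) (rule SUP_upper, simp)
  show "(SUP x. ?h x) \<le> sup_circle f"
  proof (rule SUP_least, rule ccontr)
    fix x assume "\<not> ?h x \<le> sup_circle f"
    define n where "n = - \<lfloor>x / (2 * pi)\<rfloor>"
    define y where "y = x + 2 * pi * of_int n"
    have fy: "f y = f x" unfolding y_def by (rule periodic_shift_int[OF per])
    have y0: "0 \<le> y"
      using mult_left_mono[OF of_int_floor_le[of "x / (2 * pi)"], of "2 * pi"]
      by (simp add: y_def n_def)
    have y1: "y < 2 * pi"
      using mult_strict_left_mono[OF floor_correct[THEN conjunct2, of "x / (2 * pi)"], of "2 * pi"]
      by (simp add: y_def n_def algebra_simps)
    define U where "U = {z. sup_circle f < ?h z}"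
    have "continuous_on UNIV ?h" using cont by (intro continuous_intros)
    then have "open U" unfolding U_def by (intro open_Collect_less) auto
    moreover have "y \<in> U" using \<open>\<not> ?h x \<le> sup_circle f\<close> by (simp add: U_def fy)
    ultimately obtain d where d: "d > 0" "ball y d \<subseteq> U" by (meson openE)
    define e where "e = min (y + d) (2 * pi)"
    have ye: "y < e" using d y1 by (simp add: e_def)
    have sub: "{y<..<e} \<subseteq> U \<inter> {0..<2 * pi}"
      using d y0 by (auto simp: e_def subset_iff ball_def dist_real_def)
    have "AE z in circle_measure. ?h z \<le> sup_circle f"
      unfolding sup_circle_def by (rule esssup_AE)
    then have "AE z in lborel. z \<in> {0..<2 * pi} \<longrightarrow> ?h z \<le> sup_circle f"
      unfolding circle_measure_def by (subst (asm) AE_restrict_space_iff) auto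
    then have "AE z in lborel. z \<notin> {y<..<e}"
      by (rule AE_mp) (use sub in \<open>auto simp: U_def subset_iff intro!: AE_I2\<close>)
    then have "{y<..<e} \<in> null_sets lborel" by (subst AE_iff_null_sets) auto
    then show False using ye by (simp add: null_sets_def)
  qed
qed

end

theory Submission
  imports Defs "HOL-Real_Asymp.Real_Asymp"
begin

text \<open>
  In the interaction picture the Fourier modes \<open>a\<^sub>k\<close> satisfy a cubic system whose non-resonant terms carry
  the phases \<open>2pqt\<close> with \<open>pq \<noteq> 0\<close>. Differentiation by parts turns them into boundary terms and quintic
  terms weighted by \<open>1/|pq|\<close>. This shows first that summability of the modes propagates in time, and then,
  for data of Wiener norm at most \<open>A \<epsilon>\<^sup>-\<^sup>1\<^sup>/\<^sup>2\<close> and times of order \<open>\<epsilon>\<^sup>-\<^sup>1 |log \<epsilon>|\<close>, that the solution differs in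
  the Wiener norm by \<open>o(\<epsilon>\<^sup>-\<^sup>1\<^sup>/\<^sup>2)\<close> from the resonant flow, which only rotates every mode by a phase that, up
  to a common factor, depends on the modulus of that mode alone.

  Hence the supremum is at most the Wiener norm \<open>\<Sum> c\<^sub>k |g\<^sub>k|\<close> of the datum up to a negligible error, and a
  Chernoff bound gives the upper rate. At \<open>x = 0\<close> the resonant flow has the modulus of a sum of twisted Gaussians,
  which are again independent standard Gaussians; the tail of the real part of a finite partial sum gives the
  lower rate, since the remaining modes and the event of a large Wiener norm are exponentially smaller.
\<close>

section \<open>Fourier series on the circle\<close>

text \<open>The solution is known only in C(L2) and locally in L4. At that level the cubic term of a
  mode is an iterated sum, meaningful at almost every time because |u|^2 is in L2; absolute
  convergence over pairs appears only after division by pq. Hence densities in time instead of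
  derivatives, and duality with test sequences before any Wiener norm is known to be finite. With
  coupling \<epsilon>^2 and Wiener norm L of order \<epsilon>^(-1/2), \<kappa> = \<epsilon>^2 L^2 is
  of order \<epsilon>, and the relative error of the resonant flow is \<kappa> times a quadratic
  polynomial in \<kappa> t. The time scale makes \<kappa> t of order |log \<epsilon>|, and
  \<epsilon> |log \<epsilon>|^2 tends to 0. The two rates meet because E exp(\<theta> |g|) is at
  most exp(C \<theta> + \<theta>^2/(4a)) for every a < 1: as c is summable, the terms linear in
  \<theta> contribute O(\<epsilon>^(-1/2)) to an exponent of size 1/\<epsilon>. Passing to the
  Wiener norm thus costs nothing in the rate. The solutions are given separately for each outcome,
  so the measurability of the event needs its own argument.\<close>

lemma csum_finite:
  fixes g :: "'i \<Rightarrow> 'b::{banach, second_countable_topology}"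
  assumes "finite F"
  shows "(LINT m|count_space UNIV. indicator F m *\<^sub>R g m) = (\<Sum>m\<in>F. g m)"
    and "integrable (count_space UNIV) (\<lambda>m. indicator F m *\<^sub>R g m)"
proof -
  have sub: "{a. indicator F a *\<^sub>R g a \<noteq> 0} \<subseteq> F"
    by (auto simp: indicator_def)
  show "(LINT m|count_space UNIV. indicator F m *\<^sub>R g m) = (\<Sum>m\<in>F. g m)"
    using finite_subset[OF sub assms] sub assms
    by (subst lebesgue_integral_count_space_finite_support)
       (auto intro!: sum.mono_neutral_cong_left)
  have "integrable (count_space F) g" using assms by (rule integrable_count_space)
  then have "set_integrable (count_space UNIV) F g"
    unfolding set_integrable_def by (subst integrable_restrict_space[symmetric]) (auto simp: restrict_count_space)
  then show "integrable (count_space UNIV) (\<lambda>m. indicator F m *\<^sub>R g m)"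
    by (simp add: set_integrable_def)
qed

text \<open>Dominated convergence with majorant \<open>norm (g m)\<close>. Sums over the integers
  are mostly written as integrals over \<open>count_space\<close>, so that the convergence and
  Fubini theorems of integration apply to them.\<close>

lemma csum_lim:
  fixes g :: "int \<Rightarrow> 'b::{banach, second_countable_topology}"
  assumes "integrable (count_space UNIV) g"
  shows "(\<lambda>K. \<Sum>m\<in>{- int K..int K}. g m) \<longlonglongrightarrow> (LINT m|count_space UNIV. g m)"
proof -
  have "(\<lambda>K. LINT m|count_space UNIV. indicator {- int K..int K} m *\<^sub>R g m)
      \<longlonglongrightarrow> (LINT m|count_space UNIV. g m)"
  proof (rule integral_dominated_convergence[where w = "\<lambda>m. norm (g m)"])
    show "AE m in count_space UNIV. (\<lambda>K. indicator {- int K..int K} m *\<^sub>R g m) \<longlonglongrightarrow> g m"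
    proof (rule AE_I2)
      fix m :: int
      have "\<forall>\<^sub>F K in sequentially. indicator {- int K..int K} m *\<^sub>R g m = g m"
        by (rule eventually_sequentiallyI[of "nat \<bar>m\<bar>"]) (auto simp: indicator_def)
      then show "(\<lambda>K. indicator {- int K..int K} m *\<^sub>R g m) \<longlonglongrightarrow> g m"
        by (rule tendsto_eventually)
    qed
  qed (use assms in \<open>auto simp: indicator_def\<close>)
  then show ?thesis by (simp add: csum_finite)
qed

lemma cseq_lim_nn:
  fixes g :: "int \<Rightarrow> real"
  assumes "integrable (count_space UNIV) g" "\<And>m. g m \<ge> 0" "finite F"
  shows "(\<Sum>m\<in>F. g m) \<le> (LINT m|count_space UNIV. g m)"
  unfolding csum_finite(1)[OF assms(3), of g, symmetric]
  by (rule integral_mono[OF csum_finite(2)[OF assms(3), of g] assms(1)])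
     (use assms(2) in \<open>auto simp: indicator_def\<close>)

text \<open>Monotone convergence over symmetric windows. Summability is obtained below from a bound
  of the partial sums that does not depend on the window.\<close>

lemma csum_integrable_bound:
  fixes g :: "int \<Rightarrow> 'b::{banach, second_countable_topology}"
  assumes "\<And>K. (\<Sum>m\<in>{- int K..int K}. norm (g m)) \<le> B"
  shows "integrable (count_space UNIV) g"
    and "(LINT m|count_space UNIV. norm (g m)) \<le> B"
proof -
  have eq: "(\<integral>\<^sup>+m. indicator {- int K..int K} m * ennreal (norm (g m)) \<partial>count_space UNIV)
     = ennreal (\<Sum>m\<in>{- int K..int K}. norm (g m))" for K
    by (simp add: mult.commute[of "indicator _ _"] flip: nn_integral_count_space_indicator)
       (simp add: nn_integral_count_space_finite)
  have mono: "incseq (\<lambda>K m. indicator {- int K..int K} m * ennreal (norm (g m)))"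
    by (auto simp: incseq_def le_fun_def indicator_def)
  have sup: "(SUP K. indicator {- int K..int K} m * ennreal (norm (g m))) = ennreal (norm (g m))" for m
  proof (rule antisym)
    show "ennreal (norm (g m)) \<le> (SUP K. indicator {- int K..int K} m * ennreal (norm (g m)))"
      by (rule SUP_upper2[of "nat \<bar>m\<bar>"]) (auto simp: indicator_def)
  qed (rule SUP_least, auto simp: indicator_def)
  have "(\<integral>\<^sup>+m. ennreal (norm (g m)) \<partial>count_space UNIV)
     = (\<integral>\<^sup>+m. (SUP K. indicator {- int K..int K} m * ennreal (norm (g m))) \<partial>count_space UNIV)"
    by (simp add: sup)
  also have "\<dots> = (SUP K. \<integral>\<^sup>+m. indicator {- int K..int K} m * ennreal (norm (g m)) \<partial>count_space UNIV)"
    by (rule nn_integral_monotone_convergence_SUP[OF mono]) auto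
  also have "\<dots> \<le> ennreal B"
    by (rule SUP_least) (use assms in \<open>auto simp: eq intro!: ennreal_leI\<close>)
  finally have le: "(\<integral>\<^sup>+m. ennreal (norm (g m)) \<partial>count_space UNIV) \<le> ennreal B" .
  then show int: "integrable (count_space UNIV) g"
    by (intro integrableI_bounded) (auto simp: top_unique intro: le_less_trans)
  have "B \<ge> 0" using assms[of 0] by (meson norm_ge_zero order_trans sum_nonneg)
  then show "(LINT m|count_space UNIV. norm (g m)) \<le> B"
    using le int by (simp add: nn_integral_eq_integral)
qed

section \<open>Square-integrable functions on the circle\<close>

abbreviation (input) "CM \<equiv> circle_measure"
abbreviation (input) "fc \<equiv> fourier_coeff"

lemma space_CM [simp]: "space CM = {0..<2 * pi}"
  by (simp add: circle_measure_def space_restrict_space)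

lemma emeasure_CM: "emeasure CM (space CM) = ennreal (2 * pi)"
  unfolding space_CM by (simp add: circle_measure_def emeasure_restrict_space)

lemma finite_measure_CM: "finite_measure CM"
  by (rule finite_measureI) (simp add: emeasure_CM del: space_CM)

interpretation CM: finite_measure CM by (rule finite_measure_CM)

lemma measure_CM [simp]: "measure CM {0..<2 * pi} = 2 * pi"
  using emeasure_CM by (simp add: measure_def)

lemma borel_measurable_CM: "f \<in> borel_measurable borel \<Longrightarrow> f \<in> borel_measurable CM"
  unfolding circle_measure_def by (rule measurable_restrict_space1) simp

lemma cis_measurable_CM [measurable]: "(\<lambda>x. cis (a * x)) \<in> borel_measurable CM"
  by (rule borel_measurable_CM, rule borel_measurable_continuous_onI) (intro continuous_intros)

lemma cis_neg_measurable_CM [measurable]: "(\<lambda>x. cis (- (a * x))) \<in> borel_measurable CM"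
  using cis_measurable_CM[of "- a"] by simp

definition sqint :: "(real \<Rightarrow> complex) \<Rightarrow> bool" where
  "sqint f \<longleftrightarrow> f \<in> borel_measurable CM \<and> integrable CM (\<lambda>x. (cmod (f x))\<^sup>2)"

lemma sqint_measurable [measurable_dest]: "sqint f \<Longrightarrow> f \<in> borel_measurable CM"
  by (simp add: sqint_def)

lemma sqint_mult_integrable:
  assumes "sqint f" "sqint h"
  shows "integrable CM (\<lambda>x. f x * h x)"
proof (rule Bochner_Integration.integrable_bound)
  show "integrable CM (\<lambda>x. (cmod (f x))\<^sup>2 + (cmod (h x))\<^sup>2)"
    using assms by (auto simp: sqint_def)
  have "norm (f x * h x) \<le> norm ((cmod (f x))\<^sup>2 + (cmod (h x))\<^sup>2)" for x
    using sum_squares_bound[of "cmod (f x)" "cmod (h x)"] mult_nonneg_nonneg[OF norm_ge_zero norm_ge_zero, of "f x" "h x"]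
    unfolding norm_mult real_norm_def by linarith
  then show "AE x in CM. norm (f x * h x) \<le> norm ((cmod (f x))\<^sup>2 + (cmod (h x))\<^sup>2)" by simp
  show "(\<lambda>x. f x * h x) \<in> borel_measurable CM" using assms by measurable
qed

lemma sqint_bounded:
  assumes [measurable]: "f \<in> borel_measurable CM" and "\<And>x. x \<in> {0..<2*pi} \<Longrightarrow> cmod (f x) \<le> B"
  shows "sqint f"
  unfolding sqint_def
proof
  show "integrable CM (\<lambda>x. (cmod (f x))\<^sup>2)"
    by (rule CM.integrable_const_bound[where B = "B\<^sup>2"]) (use assms in \<open>auto intro!: power_mono\<close>)
qed (fact assms)

lemma sqint_cis [simp]: "sqint (\<lambda>x. cis (a * x))" "sqint (\<lambda>x. cis (- (a * x)))"
  by (rule sqint_bounded[of _ 1]; simp)+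

lemma sqint_const [simp]: "sqint (\<lambda>x. c)"
  by (rule sqint_bounded[of _ "cmod c"]) auto

lemma sqint_add:
  assumes f: "sqint f" and h: "sqint h"
  shows "sqint (\<lambda>x. f x + h x)"
  unfolding sqint_def
proof
  have b: "norm ((cmod (f x + h x))\<^sup>2) \<le> norm (2 * (cmod (f x))\<^sup>2 + 2 * (cmod (h x))\<^sup>2)" for x
  proof -
    have "(cmod (f x + h x))\<^sup>2 \<le> (cmod (f x) + cmod (h x))\<^sup>2"
      by (intro power_mono norm_triangle_ineq) auto
    also have "\<dots> \<le> 2 * (cmod (f x))\<^sup>2 + 2 * (cmod (h x))\<^sup>2"
      using sum_squares_bound[of "cmod (f x)" "cmod (h x)"] by (simp add: power2_sum)
    finally show ?thesis by simp
  qed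
  show m: "(\<lambda>x. f x + h x) \<in> borel_measurable CM" using assms by measurable
  show "integrable CM (\<lambda>x. (cmod (f x + h x))\<^sup>2)"
    by (rule Bochner_Integration.integrable_bound[where f = "\<lambda>x. 2 * (cmod (f x))\<^sup>2 + 2 * (cmod (h x))\<^sup>2"])
       (use f h b m in \<open>auto simp: sqint_def\<close>)
qed

lemma sqint_cmult: "sqint f \<Longrightarrow> sqint (\<lambda>x. c * f x)"
  unfolding sqint_def by (auto simp: norm_mult power_mult_distrib)

lemma sqint_diff: "sqint f \<Longrightarrow> sqint h \<Longrightarrow> sqint (\<lambda>x. f x - h x)"
  using sqint_add[of f "\<lambda>x. (-1) * h x"] sqint_cmult[of h "-1"] by simp

lemma sqint_cnj: "sqint f \<Longrightarrow> sqint (\<lambda>x. cnj (f x))"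
  unfolding sqint_def by (auto intro: borel_measurable_continuous_on[where f = cnj] continuous_intros)

lemma sqint_sum: "(\<And>i. i \<in> F \<Longrightarrow> sqint (f i)) \<Longrightarrow> sqint (\<lambda>x. \<Sum>i\<in>F. f i x)"
  by (induction F rule: infinite_finite_induct) (auto intro: sqint_add)

section \<open>Trigonometric polynomials and orthogonal projection\<close>

definition trig :: "int set \<Rightarrow> (int \<Rightarrow> complex) \<Rightarrow> real \<Rightarrow> complex" where
  "trig F c x = (\<Sum>k\<in>F. c k * cis (of_int k * x))"

lemma sqint_trig: "sqint (trig F c)"
  unfolding trig_def by (intro sqint_sum sqint_cmult sqint_cis)

lemma integral_cis_int:
  "(LINT x|CM. cis (of_int k * x)) = (if k = 0 then 2 * pi else 0)"
proof (cases "k = 0")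
  case True
  then show ?thesis by (simp add: scaleR_conv_of_real)
next
  case False
  have "(LINT x|CM. cis (of_int k * x)) = set_lebesgue_integral lborel {0..<2*pi} (\<lambda>x. cis (of_int k * x))"
    unfolding circle_measure_def set_lebesgue_integral_def
    by (subst integral_restrict_space) auto
  also have "\<dots> = set_lebesgue_integral lborel {0..2*pi} (\<lambda>x. cis (of_int k * x))"
    unfolding set_lebesgue_integral_def
  proof (rule integral_cong_AE)
    have "(\<lambda>x. cis (of_int k * x)) \<in> borel_measurable borel"
      by (rule borel_measurable_continuous_onI) (intro continuous_intros)
    then show "(\<lambda>x. indicat_real {0..<2 * pi} x *\<^sub>R cis (of_int k * x)) \<in> borel_measurable lborel"
      "(\<lambda>x. indicat_real {0..2 * pi} x *\<^sub>R cis (of_int k * x)) \<in> borel_measurable lborel"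
      by auto
    have "AE x in lborel. x \<noteq> 2 * pi" by (rule AE_lborel_singleton)
    then show "AE x in lborel. indicat_real {0..<2 * pi} x *\<^sub>R cis (of_int k * x)
        = indicat_real {0..2 * pi} x *\<^sub>R cis (of_int k * x)"
      by eventually_elim (auto simp: indicator_def)
  qed
  also have "\<dots> = (cis (of_int k * (2 * pi)) / (\<i> * of_int k) - cis (of_int k * 0) / (\<i> * of_int k))"
    unfolding set_lebesgue_integral_def
  proof (rule integral_FTC_atLeastAtMost)
    show "continuous_on {0..2 * pi} (\<lambda>x. cis (of_int k * x))" by (intro continuous_intros)
    show "((\<lambda>x. cis (of_int k * x) / (\<i> * of_int k)) has_vector_derivative cis (of_int k * x)) (at x within {0..2 * pi})" for x
    proof -
      have d: "((\<lambda>z. exp (\<i> * (of_int k * z)) / (\<i> * of_int k)) has_field_derivative exp (\<i> * (of_int k * of_real x)))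
          (at (of_real x) within of_real ` {0..2 * pi})"
        using False by (auto intro!: derivative_eq_intros simp: complex_eq_iff)
      show ?thesis
        using field_vector_diff_chain_within[OF has_vector_derivative_of_real[OF DERIV_ident] d]
        by (simp add: o_def cis_conv_exp)
    qed
  qed simp
  also have "cis (of_int k * (2 * pi)) = 1"
    using cis_multiple_2pi[of "of_int k"] by (simp add: mult.commute)
  finally show ?thesis using False by simp
qed

lemma fourier_coeff_cis:
  "fourier_coeff (\<lambda>x. cis (of_int j * x)) k = (if j = k then 1 else 0)"
proof -
  have "(\<lambda>x. cis (of_int j * x) * cis (- (of_int k * x))) = (\<lambda>x. cis (of_int (j - k) * x))"
    by (auto simp: cis_mult algebra_simps)
  then show ?thesis unfolding fourier_coeff_def using integral_cis_int[of "j - k"] by simp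
qed

lemma fourier_coeff_add:
  "sqint f \<Longrightarrow> sqint h \<Longrightarrow> fc (\<lambda>x. f x + h x) k = fc f k + fc h k"
  unfolding fourier_coeff_def
  by (simp add: distrib_right sqint_mult_integrable add_divide_distrib)

lemma fourier_coeff_cmult: "fc (\<lambda>x. c * f x) k = c * fc f k"
  unfolding fourier_coeff_def by (simp add: mult.assoc)

lemma fourier_coeff_sum:
  "(\<And>i. i \<in> F \<Longrightarrow> sqint (f i)) \<Longrightarrow> fc (\<lambda>x. \<Sum>i\<in>F. f i x) k = (\<Sum>i\<in>F. fc (f i) k)"
proof (induction F rule: infinite_finite_induct)
  case (insert x F)
  then show ?case by (simp add: fourier_coeff_add sqint_sum)
qed (simp_all add: fourier_coeff_def)

lemma fourier_coeff_trig:
  "finite F \<Longrightarrow> fc (trig F c) k = (if k \<in> F then c k else 0)"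
  unfolding trig_def
  by (subst fourier_coeff_sum) (auto simp: sqint_cmult fourier_coeff_cmult fourier_coeff_cis if_distrib sum.delta cong: if_cong)

lemma fourier_coeff_cnj: "fc (\<lambda>x. cnj (f x)) k = cnj (fc f (- k))"
proof -
  have "(LINT x|CM. cnj (f x) * cis (- (of_int k * x))) = (LINT x|CM. cnj (f x * cis (- (of_int (- k) * x))))"
    by (rule Bochner_Integration.integral_cong) (auto simp: cis_cnj)
  then show ?thesis unfolding fourier_coeff_def Bochner_Integration.integral_cnj by simp
qed

lemma L2_Cauchy_Schwarz:
  assumes f: "sqint f" and h: "sqint h"
  shows "cmod (LINT x|CM. f x * h x) \<le> sqrt (LINT x|CM. (cmod (f x))\<^sup>2) * sqrt (LINT x|CM. (cmod (h x))\<^sup>2)"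
proof -
  note [measurable] = sqint_measurable[OF f] sqint_measurable[OF h]
  have i1: "integrable CM (\<lambda>x. cmod (f x) * cmod (h x))"
    using integrable_norm[OF sqint_mult_integrable[OF f h]] by (simp add: norm_mult)
  have i2: "integrable CM (\<lambda>x. (cmod (f x))\<^sup>2)" "integrable CM (\<lambda>x. (cmod (h x))\<^sup>2)"
    using f h by (auto simp: sqint_def)
  have "(\<integral>\<^sup>+x. ennreal (cmod (f x)) * ennreal (cmod (h x)) \<partial>CM)\<^sup>2 \<le>
    (\<integral>\<^sup>+x. (ennreal (cmod (f x)))\<^sup>2 \<partial>CM) * (\<integral>\<^sup>+x. (ennreal (cmod (h x)))\<^sup>2 \<partial>CM)"
    by (rule Cauchy_Schwarz_nn_integral) measurable
  then have "(LINT x|CM. cmod (f x) * cmod (h x))\<^sup>2 \<le> (LINT x|CM. (cmod (f x))\<^sup>2) * (LINT x|CM. (cmod (h x))\<^sup>2)"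
    using i1 i2 by (simp add: ennreal_mult[symmetric] ennreal_power nn_integral_eq_integral)
  then have "(LINT x|CM. cmod (f x) * cmod (h x)) \<le> sqrt ((LINT x|CM. (cmod (f x))\<^sup>2) * (LINT x|CM. (cmod (h x))\<^sup>2))"
    by (rule real_le_rsqrt)
  moreover have "cmod (LINT x|CM. f x * h x) \<le> (LINT x|CM. cmod (f x) * cmod (h x))"
    using integral_norm_bound[of CM "\<lambda>x. f x * h x"] by (simp add: norm_mult)
  ultimately show ?thesis by (simp add: real_sqrt_mult)
qed

text \<open>Expanding the square leaves a single term that depends on the coefficients, the last
  one. Taking them equal to the Fourier coefficients makes it vanish, which yields Bessel's
  inequality and the best approximation property at once.\<close>

lemma L2_dist_trig:
  assumes f: "sqint f" and F: "finite F"
  shows "(LINT x|CM. (cmod (f x - trig F c x))\<^sup>2) =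
    (LINT x|CM. (cmod (f x))\<^sup>2) - 2 * pi * (\<Sum>k\<in>F. (cmod (fc f k))\<^sup>2) + 2 * pi * (\<Sum>k\<in>F. (cmod (fc f k - c k))\<^sup>2)"
proof -
  have sq: "of_real ((cmod z)\<^sup>2) = z * cnj z" for z by (metis complex_norm_square)
  have inner: "(LINT x|CM. g x * cnj (trig F c x)) = 2 * pi * (\<Sum>k\<in>F. cnj (c k) * fc g k)" if g: "sqint g" for g
  proof -
    have "(LINT x|CM. g x * cnj (trig F c x)) = (LINT x|CM. (\<Sum>k\<in>F. cnj (c k) * (g x * cis (- (of_int k * x)))))"
      by (rule Bochner_Integration.integral_cong) (auto simp: trig_def cis_cnj sum_distrib_left mult_ac)
    also have "\<dots> = (\<Sum>k\<in>F. LINT x|CM. cnj (c k) * (g x * cis (- (of_int k * x))))"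
      by (rule Bochner_Integration.integral_sum) (intro integrable_mult_right sqint_mult_integrable g sqint_cis)
    also have "\<dots> = (\<Sum>k\<in>F. 2 * pi * (cnj (c k) * fc g k))"
      by (rule sum.cong) (auto simp: fourier_coeff_def)
    finally show ?thesis by (simp add: sum_distrib_left)
  qed
  have T: "sqint (trig F c)" by (rule sqint_trig)
  have "of_real (LINT x|CM. (cmod (f x - trig F c x))\<^sup>2) = (LINT x|CM. (f x - trig F c x) * cnj (f x - trig F c x))"
    by (simp only: sq flip: integral_complex_of_real)
  also have "\<dots> = (LINT x|CM. f x * cnj (f x) - cnj (f x * cnj (trig F c x)) - f x * cnj (trig F c x) + trig F c x * cnj (trig F c x))"
    by (rule Bochner_Integration.integral_cong) (auto simp: algebra_simps)
  also have "\<dots> = (LINT x|CM. f x * cnj (f x)) - (LINT x|CM. cnj (f x * cnj (trig F c x)))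
      - (LINT x|CM. f x * cnj (trig F c x)) + (LINT x|CM. trig F c x * cnj (trig F c x))"
  proof -
    have "integrable CM (\<lambda>x. f x * cnj (f x))" "integrable CM (\<lambda>x. f x * cnj (trig F c x))"
      "integrable CM (\<lambda>x. trig F c x * cnj (trig F c x))"
      by (intro sqint_mult_integrable sqint_cnj f T)+
    moreover from this(2) have "integrable CM (\<lambda>x. cnj (f x * cnj (trig F c x)))"
      using integrable_cnj by blast
    ultimately show ?thesis by simp
  qed
  also have "(LINT x|CM. f x * cnj (f x)) = of_real (LINT x|CM. (cmod (f x))\<^sup>2)"
    by (simp only: sq flip: integral_complex_of_real)
  also have "(LINT x|CM. cnj (f x * cnj (trig F c x))) = cnj (LINT x|CM. f x * cnj (trig F c x))"
    by (rule Bochner_Integration.integral_cnj)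
  also have "(LINT x|CM. f x * cnj (trig F c x)) = 2 * pi * (\<Sum>k\<in>F. cnj (c k) * fc f k)"
    by (rule inner[OF f])
  also have "(LINT x|CM. trig F c x * cnj (trig F c x)) = 2 * pi * (\<Sum>k\<in>F. cnj (c k) * c k)"
    unfolding inner[OF T] by (simp add: fourier_coeff_trig[OF F])
  finally have eq: "of_real (LINT x|CM. (cmod (f x - trig F c x))\<^sup>2) =
    of_real (LINT x|CM. (cmod (f x))\<^sup>2) - cnj (2 * pi * (\<Sum>k\<in>F. cnj (c k) * fc f k))
     - 2 * pi * (\<Sum>k\<in>F. cnj (c k) * fc f k) + 2 * pi * (\<Sum>k\<in>F. cnj (c k) * c k)" .
  have "of_real (LINT x|CM. (cmod (f x - trig F c x))\<^sup>2) = (of_real ((LINT x|CM. (cmod (f x))\<^sup>2)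
     - 2 * pi * (\<Sum>k\<in>F. (cmod (fc f k))\<^sup>2) + 2 * pi * (\<Sum>k\<in>F. (cmod (fc f k - c k))\<^sup>2)) :: complex)"
    unfolding eq of_real_add of_real_diff of_real_mult of_real_sum sq
    by (simp add: sum_distrib_left sum.distrib sum_subtractf algebra_simps)
  then show ?thesis by (simp only: of_real_eq_iff)
qed

lemma Bessel_finite:
  assumes "sqint f" "finite F"
  shows "2 * pi * (\<Sum>k\<in>F. (cmod (fc f k))\<^sup>2) \<le> (LINT x|CM. (cmod (f x))\<^sup>2)"
  using L2_dist_trig[OF assms, of "fc f"] Bochner_Integration.integral_nonneg[of CM "\<lambda>x. (cmod (f x - trig F (fc f) x))\<^sup>2"]
  by simp

lemma Bessel:
  assumes "sqint f"
  shows "integrable (count_space UNIV) (\<lambda>k. (cmod (fc f k))\<^sup>2)"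
    and "(LINT k|count_space UNIV. (cmod (fc f k))\<^sup>2) \<le> (LINT x|CM. (cmod (f x))\<^sup>2) / (2 * pi)"
  using csum_integrable_bound[where g = "\<lambda>k. (cmod (fc f k))\<^sup>2" and B = "(LINT x|circle_measure. (cmod (f x))\<^sup>2) / (2 * pi)"]
    Bessel_finite[OF assms] by (simp_all add: field_simps)

section \<open>Density of trigonometric polynomials in L2\<close>

lemma trig_add:
  assumes "finite F" "finite G"
  shows "\<exists>H e. finite H \<and> (\<forall>x. trig F c x + trig G d x = trig H e x)"
proof (intro exI conjI allI)
  fix x
  let ?e = "\<lambda>k. (if k \<in> F then c k else 0) + (if k \<in> G then d k else 0)"
  have "trig F c x = trig (F \<union> G) (\<lambda>k. if k \<in> F then c k else 0) x"
    "trig G d x = trig (F \<union> G) (\<lambda>k. if k \<in> G then d k else 0) x"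
    unfolding trig_def by (rule sum.mono_neutral_cong_left; use assms in auto)+
  then show "trig F c x + trig G d x = trig (F \<union> G) ?e x"
    by (simp add: trig_def distrib_right sum.distrib)
qed (use assms in auto)

lemma trig_mult:
  assumes "finite F" "finite G"
  shows "\<exists>H e. finite H \<and> (\<forall>x. trig F c x * trig G d x = trig H e x)"
  using assms
proof (induction F)
  case empty
  then show ?case by (intro exI[of _ "{}"]) (auto simp: trig_def)
next
  case (insert j F)
  then obtain H e where H: "finite H" "\<And>x. trig F c x * trig G d x = trig H e x" by blast
  have "trig {j} c x * trig G d x = trig ((+) j ` G) (\<lambda>k. c j * d (k - j)) x" for x
    unfolding trig_def
    by (subst sum.reindex) (auto simp: sum_distrib_left algebra_simps cis_mult intro!: sum.cong)
  moreover obtain H' e' where "finite H'"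
    "\<And>x. trig ((+) j ` G) (\<lambda>k. c j * d (k - j)) x + trig H e x = trig H' e' x"
    using trig_add[of "(+) j ` G" H "\<lambda>k. c j * d (k - j)" e] insert.prems H(1) by blast
  moreover have "trig (insert j F) c x = trig {j} c x + trig F c x" for x
    using insert.hyps by (simp add: trig_def)
  ultimately show ?case using H(2)
    by (intro exI[of _ H'] exI[of _ e']) (simp add: distrib_right)
qed

text \<open>Real-linear forms of \<open>cis x\<close> are combinations of the frequencies 1 and -1,
  and sums and products stay trigonometric. In this way the Stone-Weierstrass theorem on the unit
  circle produces trigonometric polynomials.\<close>

lemma real_polynomial_trig:
  fixes g :: "complex \<Rightarrow> real"
  assumes "real_polynomial_function g"
  shows "\<exists>F c. finite F \<and> (\<forall>x. of_real (g (cis x)) = trig F c x)"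
  using assms
proof (induction g rule: real_polynomial_function.induct)
  case (linear f)
  then interpret bounded_linear f .
  have f: "f (cis x) = cos x * f 1 + sin x * f \<i>" for x
  proof -
    have "cis x = cos x *\<^sub>R 1 + sin x *\<^sub>R \<i>" by (auto simp: complex_eq_iff)
    then show ?thesis by (simp add: add scaleR)
  qed
  \<comment> \<open>Euler's formulas for sine and cosine; the factor \<open>of_int k\<close> is the
    sign of the frequency.\<close>
  have "of_real (f (cis x)) = trig {1, -1} (\<lambda>k. (f 1 - of_int k * \<i> * f \<i>) / 2) x" for x
    unfolding f by (simp add: trig_def complex_eq_iff field_simps)
  then show ?case by (intro exI[of _ "{1, -1}"] exI[of _ "\<lambda>k. (f 1 - of_int k * \<i> * f \<i>) / 2"]) simp
next
  case (const a)
  then show ?case by (intro exI[of _ "{0}"] exI[of _ "\<lambda>_. of_real a"]) (auto simp: trig_def)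
next
  case (add f g)
  then obtain F c G d where "finite F" "\<And>x. of_real (f (cis x)) = trig F c x"
    "finite G" "\<And>x. of_real (g (cis x)) = trig G d x" by blast
  then show ?case using trig_add[of F G c d] by simp
next
  case (mult f g)
  then obtain F c G d where "finite F" "\<And>x. of_real (f (cis x)) = trig F c x"
    "finite G" "\<And>x. of_real (g (cis x)) = trig G d x" by blast
  then show ?case using trig_mult[of F G c d] by simp
qed

text \<open>With equal end values the function descends to the unit circle, where its real and
  imaginary parts are approximated separately by polynomials.\<close>

lemma trig_dense_continuous:
  fixes \<phi> :: "real \<Rightarrow> complex"
  assumes cont: "continuous_on {0..2 * pi} \<phi>" and ends: "\<phi> 0 = \<phi> (2 * pi)" and e: "e > 0"
  shows "\<exists>F c. finite F \<and> (\<forall>x\<in>{0..2 * pi}. cmod (\<phi> x - trig F c x) < e)"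
proof -
  define p where "p = (\<lambda>s. \<phi> (2 * pi * s))"
  have "path p" unfolding path_def p_def
    by (rule continuous_on_compose2[OF cont]) (auto intro!: continuous_intros)
  moreover have "pathfinish p = pathstart p" using ends by (simp add: p_def pathfinish_def pathstart_def)
  \<comment> \<open>The constant homotopy of the loop is taken only for the continuity it implies:
    the function read through \<open>Arg2pi\<close> is continuous on the whole circle, including 1,
    where \<open>Arg2pi\<close> jumps.\<close>
  ultimately have "homotopic_loops UNIV p p" by (simp add: homotopic_loops_refl)
  from homotopic_loops_imp_homotopic_circlemaps[OF this]
  have h0: "continuous_on (sphere 0 1) (p \<circ> (\<lambda>z. Arg2pi z / (2 * pi)))"
    by (rule homotopic_with_imp_continuous[THEN conjunct1])
  define h where "h = p \<circ> (\<lambda>z. Arg2pi z / (2 * pi))"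
  have hc: "h (cis x) = \<phi> x" if "x \<in> {0..2 * pi}" for x
  proof (cases "x = 2 * pi")
    case True
    then show ?thesis using ends Arg2pi_of_real[of 1] by (simp add: h_def p_def)
  next
    case False
    then have "Arg2pi (cis x) = x"
      using that by (intro Arg2pi_unique[of 1]) (auto simp: cis_conv_exp)
    then show ?thesis by (simp add: h_def p_def)
  qed
  have cR: "continuous_on (sphere 0 1) (\<lambda>z. Re (h z))" and cI: "continuous_on (sphere 0 1) (\<lambda>z. Im (h z))"
    using h0 unfolding h_def by (auto intro!: continuous_intros)
  obtain gR where gR: "real_polynomial_function gR" "\<And>z. z \<in> sphere 0 1 \<Longrightarrow> \<bar>Re (h z) - gR z\<bar> < e / 2"
    using Stone_Weierstrass_real_polynomial_function[OF compact_sphere cR, of "e / 2"] e by auto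
  obtain gI where gI: "real_polynomial_function gI" "\<And>z. z \<in> sphere 0 1 \<Longrightarrow> \<bar>Im (h z) - gI z\<bar> < e / 2"
    using Stone_Weierstrass_real_polynomial_function[OF compact_sphere cI, of "e / 2"] e by auto
  obtain F c where F: "finite F" "\<And>x. of_real (gR (cis x)) = trig F c x"
    using real_polynomial_trig[OF gR(1)] by blast
  obtain G d where G: "finite G" "\<And>x. of_real (gI (cis x)) = trig G d x"
    using real_polynomial_trig[OF gI(1)] by blast
  have iG: "\<i> * trig G d x = trig G (\<lambda>k. \<i> * d k) x" for x
    by (simp add: trig_def sum_distrib_left mult.assoc)
  obtain H b where H: "finite H" "\<And>x. trig F c x + trig G (\<lambda>k. \<i> * d k) x = trig H b x"
    using trig_add[OF F(1) G(1), of c "\<lambda>k. \<i> * d k"] by blast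
  have "cmod (\<phi> x - trig H b x) < e" if x: "x \<in> {0..2 * pi}" for x
  proof -
    have eq: "\<phi> x - trig H b x = of_real (Re (h (cis x)) - gR (cis x)) + \<i> * of_real (Im (h (cis x)) - gI (cis x))"
      unfolding H(2)[symmetric] iG[symmetric] F(2)[symmetric] G(2)[symmetric] hc[OF x]
      by (simp add: complex_eq_iff)
    have "cmod (\<phi> x - trig H b x) \<le> \<bar>Re (h (cis x)) - gR (cis x)\<bar> + \<bar>Im (h (cis x)) - gI (cis x)\<bar>"
      unfolding eq by (rule order_trans[OF norm_triangle_ineq]) (simp only: norm_mult norm_of_real norm_ii mult_1 order_refl)
    then show ?thesis using gR(2)[of "cis x"] gI(2)[of "cis x"] by simp
  qed
  then show ?thesis using H(1) by blast
qed

lemma L2_dist_triangle: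
  assumes "sqint f" "sqint g" "sqint h"
  shows "(LINT x|CM. (cmod (f x - h x))\<^sup>2) \<le> 2 * (LINT x|CM. (cmod (f x - g x))\<^sup>2) + 2 * (LINT x|CM. (cmod (g x - h x))\<^sup>2)"
proof -
  have i: "integrable CM (\<lambda>x. (cmod (f x - h x))\<^sup>2)" "integrable CM (\<lambda>x. (cmod (f x - g x))\<^sup>2)"
    "integrable CM (\<lambda>x. (cmod (g x - h x))\<^sup>2)"
    using sqint_diff[OF assms(1,3)] sqint_diff[OF assms(1,2)] sqint_diff[OF assms(2,3)]
    by (simp_all add: sqint_def)
  have b: "(cmod (f x - h x))\<^sup>2 \<le> 2 * (cmod (f x - g x))\<^sup>2 + 2 * (cmod (g x - h x))\<^sup>2" for x
  proof -
    have "cmod (f x - h x) \<le> cmod (f x - g x) + cmod (g x - h x)"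
      using norm_triangle_ineq[of "f x - g x" "g x - h x"] by simp
    then have "(cmod (f x - h x))\<^sup>2 \<le> (cmod (f x - g x) + cmod (g x - h x))\<^sup>2" by (intro power_mono) auto
    then show ?thesis
      using sum_squares_bound[of "cmod (f x - g x)" "cmod (g x - h x)"] by (simp add: power2_sum)
  qed
  have "(LINT x|CM. (cmod (f x - h x))\<^sup>2) \<le> (LINT x|CM. 2 * (cmod (f x - g x))\<^sup>2 + 2 * (cmod (g x - h x))\<^sup>2)"
    by (rule integral_mono) (use i b in auto)
  then show ?thesis using i by simp
qed

text \<open>Measurability provides continuous functions that converge almost everywhere, but these
  carry no common bound and need not agree at 0 and 2 pi. Both defects are repaired without
  disturbing the limit, and dominated convergence gives an L2 approximation to which the continuous
  case applies.\<close>

lemma trig_dense_bounded: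
  assumes meas: "f \<in> borel_measurable CM" and B: "\<And>x. cmod (f x) \<le> B" and e: "e > 0"
  shows "\<exists>F c. finite F \<and> (LINT x|CM. (cmod (f x - trig F c x))\<^sup>2) < e"
proof -
  have B0: "B \<ge> 0" using B[of 0] norm_ge_zero order_trans by blast
  have "(\<lambda>x. indicator {0..<2*pi} x *\<^sub>R f x) \<in> borel_measurable lborel"
    using meas unfolding circle_measure_def by (subst (asm) borel_measurable_restrict_space_iff) auto
  then have "(\<lambda>x. indicator {0..<2*pi} x *\<^sub>R f x) \<in> borel_measurable lebesgue"
    by (simp add: measurable_completion)
  then have "(\<lambda>x. indicator {0..<2*pi} x *\<^sub>R f x) measurable_on UNIV"
    by (rule lebesgue_measurable_imp_measurable_on) simp
  then obtain N g where N: "negligible N" and gc: "\<And>n. continuous_on UNIV (g n)"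
    and gl: "\<And>x. x \<notin> N \<Longrightarrow> (\<lambda>n. g n x) \<longlonglongrightarrow> indicator {0..<2*pi} x *\<^sub>R f x"
    unfolding measurable_on_def by auto
  \<comment> \<open>Projection onto the ball of radius \<open>B\<close>: it fixes the values of
    \<open>f\<close> and supplies the bound for dominated convergence.\<close>
  define cl where "cl = closest_point (cball (0::complex) B)"
  have clc: "continuous_on UNIV cl" unfolding cl_def
    by (rule continuous_on_closest_point) (use B0 in auto)
  have clb: "cmod (cl z) \<le> B" for z
    using closest_point_in_set[of "cball (0::complex) B" z] B0 by (auto simp: cl_def)
  have clf: "cl (f x) = f x" for x
    unfolding cl_def by (rule closest_point_self) (use B in auto)
  \<comment> \<open>A trapezoidal cut-off that vanishes at 0 and 2 pi, so that the end values agree,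
    and tends to 1 in between.\<close>
  define \<eta> where "\<eta> = (\<lambda>n x. max 0 (min 1 (real n * min x (2 * pi - x))))"
  have \<eta>c: "continuous_on S (\<eta> n)" for S n unfolding \<eta>_def by (intro continuous_intros)
  have \<eta>b: "0 \<le> \<eta> n x" "\<eta> n x \<le> 1" for n x by (auto simp: \<eta>_def)
  have \<eta>l: "(\<lambda>n. \<eta> n x) \<longlonglongrightarrow> 1" if x: "0 < x" "x < 2 * pi" for x
  proof (rule tendsto_eventually)
    define m where "m = min x (2 * pi - x)"
    have "m > 0" using x by (simp add: m_def)
    then have "\<forall>\<^sub>F n in sequentially. real n * m \<ge> 1"
      by (intro eventually_sequentiallyI[of "nat \<lceil>1 / m\<rceil>"]) (simp add: field_simps nat_ceiling_le_eq)
    then show "\<forall>\<^sub>F n in sequentially. \<eta> n x = 1"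
      by eventually_elim (auto simp: \<eta>_def m_def)
  qed
  define \<phi> where "\<phi> = (\<lambda>n x. of_real (\<eta> n x) * cl (g n x))"
  have \<phi>c: "continuous_on UNIV (\<phi> n)" for n
    unfolding \<phi>_def
    by (intro continuous_intros \<eta>c continuous_on_compose2[OF clc gc]) auto
  have \<phi>b: "cmod (\<phi> n x) \<le> B" for n x
    using mult_mono[OF \<eta>b(2)[of n x] clb[of "g n x"]] \<eta>b(1)[of n x] by (simp add: \<phi>_def norm_mult)
  have \<phi>m: "\<phi> n \<in> borel_measurable CM" for n
    by (rule borel_measurable_CM[OF borel_measurable_continuous_onI[OF \<phi>c]])
  have sf: "sqint f" using meas B by (rule sqint_bounded)
  have s\<phi>: "sqint (\<phi> n)" for n using \<phi>m \<phi>b by (rule sqint_bounded)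
  have N': "AE x in lborel. x \<notin> N"
    using AE_not_in[of N lebesgue] N unfolding negligible_iff_null_sets by (simp add: AE_completion_iff)
  have AE: "AE x in CM. (\<lambda>n. \<phi> n x) \<longlonglongrightarrow> f x"
  proof -
    have "AE x in lborel. x \<in> {0..<2*pi} \<longrightarrow> (\<lambda>n. \<phi> n x) \<longlonglongrightarrow> f x"
      using N' AE_lborel_singleton[of 0]
    proof eventually_elim
      case (elim x)
      show ?case
      proof
        assume x: "x \<in> {0..<2*pi}"
        then have "(\<lambda>n. g n x) \<longlonglongrightarrow> f x" using gl[OF elim(1)] by simp
        then have "(\<lambda>n. cl (g n x)) \<longlonglongrightarrow> cl (f x)"
          using clc continuous_on_tendsto_compose[of UNIV cl "\<lambda>n. g n x" "f x" sequentially] by simp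
        then have "(\<lambda>n. of_real (\<eta> n x) * cl (g n x)) \<longlonglongrightarrow> of_real 1 * f x"
          using x elim(2) unfolding clf by (intro tendsto_mult tendsto_of_real \<eta>l) auto
        then show "(\<lambda>n. \<phi> n x) \<longlonglongrightarrow> f x" by (simp add: \<phi>_def)
      qed
    qed
    then show ?thesis unfolding circle_measure_def by (subst AE_restrict_space_iff) auto
  qed
  have "(\<lambda>n. LINT x|CM. (cmod (f x - \<phi> n x))\<^sup>2) \<longlonglongrightarrow> (LINT x|CM. 0)"
  proof (rule integral_dominated_convergence[where w = "\<lambda>_. (2 * B)\<^sup>2"])
    show "AE x in CM. (\<lambda>n. (cmod (f x - \<phi> n x))\<^sup>2) \<longlonglongrightarrow> 0"
      using AE
    proof eventually_elim
      case (elim x)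
      then have "(\<lambda>n. (cmod (f x - \<phi> n x))\<^sup>2) \<longlonglongrightarrow> (cmod (f x - f x))\<^sup>2"
        by (intro tendsto_intros)
      then show ?case by simp
    qed
    show "AE x in CM. norm ((cmod (f x - \<phi> n x))\<^sup>2) \<le> (2 * B)\<^sup>2" for n
    proof (rule AE_I2)
      fix x
      have "cmod (f x - \<phi> n x) \<le> 2 * B"
        using norm_triangle_ineq4[of "f x" "\<phi> n x"] B[of x] \<phi>b[of n x] by linarith
      then show "norm ((cmod (f x - \<phi> n x))\<^sup>2) \<le> (2 * B)\<^sup>2"
        unfolding real_norm_def abs_power2 by (rule power_mono) simp
    qed
    show "(\<lambda>x. (cmod (f x - \<phi> n x))\<^sup>2) \<in> borel_measurable CM" for n using meas \<phi>m[of n] by measurable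
  qed auto
  then have "(\<lambda>n. LINT x|CM. (cmod (f x - \<phi> n x))\<^sup>2) \<longlonglongrightarrow> 0" by simp
  from order_tendstoD(2)[OF this, of "e / 4"] e
  obtain n where n: "(LINT x|CM. (cmod (f x - \<phi> n x))\<^sup>2) < e / 4"
    by (auto simp: eventually_sequentially)
  \<comment> \<open>Chosen so that the uniform error contributes \<open>e / 8\<close> in the square
    norm; twice \<open>e / 4\<close> plus twice \<open>e / 8\<close> is below
    \<open>e\<close>.\<close>
  define d where "d = sqrt (e / (16 * pi))"
  have d: "d > 0" using e by (simp add: d_def)
  have "continuous_on {0..2*pi} (\<phi> n)" using \<phi>c continuous_on_subset by blast
  moreover have "\<phi> n 0 = \<phi> n (2 * pi)" by (simp add: \<phi>_def \<eta>_def)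
  ultimately obtain F c where F: "finite F" "\<And>x. x \<in> {0..2*pi} \<Longrightarrow> cmod (\<phi> n x - trig F c x) < d"
    using trig_dense_continuous[OF _ _ d, of "\<phi> n"] by blast
  have "(LINT x|CM. (cmod (\<phi> n x - trig F c x))\<^sup>2) \<le> (LINT x|CM. d\<^sup>2)"
  proof (rule integral_mono)
    show "integrable CM (\<lambda>x. (cmod (\<phi> n x - trig F c x))\<^sup>2)"
      using sqint_diff[OF s\<phi> sqint_trig] by (simp add: sqint_def)
    show "(cmod (\<phi> n x - trig F c x))\<^sup>2 \<le> d\<^sup>2" if "x \<in> space CM" for x
      using F(2)[of x] that by (intro power_mono) auto
  qed simp
  also have "\<dots> = 2 * pi * d\<^sup>2" by simp
  also have "\<dots> = e / 8" using e by (simp add: d_def field_simps)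
  finally have "(LINT x|CM. (cmod (f x - trig F c x))\<^sup>2) < e"
    using L2_dist_triangle[OF sf s\<phi>[of n] sqint_trig[of F c]] n e by linarith
  then show ?thesis using F(1) by blast
qed

lemma trig_dense:
  assumes f: "sqint f" and e: "e > 0"
  shows "\<exists>F c. finite F \<and> (LINT x|CM. (cmod (f x - trig F c x))\<^sup>2) < e"
proof -
  note [measurable] = sqint_measurable[OF f]
  define h where "h = (\<lambda>n x. if cmod (f x) \<le> real n then f x else 0)"
  have hm [measurable]: "h n \<in> borel_measurable CM" for n unfolding h_def by measurable
  have hb: "cmod (h n x) \<le> real n" for n x by (auto simp: h_def)
  have "(\<lambda>n. LINT x|CM. (cmod (f x - h n x))\<^sup>2) \<longlonglongrightarrow> (LINT x|CM. 0)"
  proof (rule integral_dominated_convergence[where w = "\<lambda>x. (cmod (f x))\<^sup>2"])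
    show "AE x in CM. (\<lambda>n. (cmod (f x - h n x))\<^sup>2) \<longlonglongrightarrow> 0"
    proof (rule AE_I2, rule tendsto_eventually)
      fix x
      obtain m where "cmod (f x) \<le> real m" using real_arch_simple by blast
      then show "\<forall>\<^sub>F n in sequentially. (cmod (f x - h n x))\<^sup>2 = 0"
        by (intro eventually_sequentiallyI[of m]) (auto simp: h_def)
    qed
    show "AE x in CM. norm ((cmod (f x - h n x))\<^sup>2) \<le> (cmod (f x))\<^sup>2" for n
      by (rule AE_I2) (auto simp: h_def)
  qed (use f in \<open>auto simp: sqint_def\<close>)
  then have "(\<lambda>n. LINT x|CM. (cmod (f x - h n x))\<^sup>2) \<longlonglongrightarrow> 0" by simp
  from order_tendstoD(2)[OF this, of "e / 4"] e
  obtain n where n: "(LINT x|CM. (cmod (f x - h n x))\<^sup>2) < e / 4"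
    by (auto simp: eventually_sequentially)
  obtain F c where F: "finite F" "(LINT x|CM. (cmod (h n x - trig F c x))\<^sup>2) < e / 4"
    using trig_dense_bounded[OF hm hb, of "e / 4" n] e by auto
  have "sqint (h n)" using hm hb by (rule sqint_bounded)
  from L2_dist_triangle[OF f this sqint_trig[of F c]]
  have "(LINT x|CM. (cmod (f x - trig F c x))\<^sup>2) < e" using F n by linarith
  then show ?thesis using F(1) by blast
qed

text \<open>A trigonometric polynomial close to \<open>f\<close> lives on a finite set of
  frequencies. On every window that contains them the Fourier partial sum is at least as close, by
  \<open>L2_dist_trig\<close>.\<close>

lemma fourier_partial_L2:
  assumes f: "sqint f"
  shows "(\<lambda>K. LINT x|CM. (cmod (f x - trig {- int K..int K} (fc f) x))\<^sup>2) \<longlonglongrightarrow> 0"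
proof (rule LIMSEQ_I)
  fix e :: real assume e: "e > 0"
  obtain F c where F: "finite F" "(LINT x|CM. (cmod (f x - trig F c x))\<^sup>2) < e"
    using trig_dense[OF f e] by blast
  obtain K0 where K0: "F \<subseteq> {- int K0..int K0}"
  proof -
    have "\<bar>k\<bar> \<le> Max (abs ` F)" if "k \<in> F" for k using F(1) that by simp
    then show ?thesis by (intro that[of "nat (Max (abs ` F))"]) force
  qed
  have "norm ((LINT x|CM. (cmod (f x - trig {- int K..int K} (fc f) x))\<^sup>2) - 0) < e" if K: "K \<ge> K0" for K
  proof -
    let ?G = "{- int K..int K}"
    let ?c = "\<lambda>k. if k \<in> F then c k else 0"
    have FG: "F \<subseteq> ?G" using K0 K by force
    have t: "trig F c x = trig ?G ?c x" for x
      unfolding trig_def by (rule sum.mono_neutral_cong_left) (use FG in auto)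
    have "(LINT x|CM. (cmod (f x - trig ?G (fc f) x))\<^sup>2) \<le> (LINT x|CM. (cmod (f x - trig ?G ?c x))\<^sup>2)"
      unfolding L2_dist_trig[OF f finite_atLeastAtMost_int] by (simp add: sum_nonneg)
    also have "\<dots> < e" using F(2) by (simp add: t)
    finally show ?thesis by simp
  qed
  then show "\<exists>no. \<forall>n\<ge>no. norm ((LINT x|CM. (cmod (f x - trig {- int n..int n} (fc f) x))\<^sup>2) - 0) < e"
    by blast
qed

section \<open>Products and absolutely convergent Fourier series\<close>

lemma fourier_coeff_bound:
  assumes f: "sqint f" and h: "sqint h"
  shows "cmod (fc (\<lambda>x. f x * h x) k) \<le> sqrt (LINT x|CM. (cmod (f x))\<^sup>2) * sqrt (LINT x|CM. (cmod (h x))\<^sup>2)"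
proof -
  have h': "sqint (\<lambda>x. h x * cis (- (of_int k * x)))"
    using h unfolding sqint_def by (auto simp: norm_mult)
  have "cmod (LINT x|CM. f x * (h x * cis (- (of_int k * x)))) \<le> sqrt (LINT x|CM. (cmod (f x))\<^sup>2) * sqrt (LINT x|CM. (cmod (h x))\<^sup>2)"
    using L2_Cauchy_Schwarz[OF f h'] by (simp add: norm_mult)
  moreover have "cmod z / (2 * pi) \<le> cmod z" for z
    using mult_left_mono[of 1 "2 * pi" "cmod z"] pi_gt3 by (simp add: field_simps)
  ultimately show ?thesis
    unfolding fourier_coeff_def by (simp add: norm_divide mult.assoc) (meson order_trans)
qed

lemma l2_shift:
  fixes w :: "int \<Rightarrow> real"
  assumes "integrable (count_space UNIV) (\<lambda>m. w m)"
  shows "integrable (count_space UNIV) (\<lambda>m. w (k - m))" "(LINT m|count_space UNIV. w (k - m)) = (LINT m|count_space UNIV. w m)"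
proof -
  have bij: "bij_betw (\<lambda>m::int. k - m) UNIV UNIV"
    by (rule bij_betw_byWitness[where f' = "\<lambda>m. k - m"]) auto
  show "integrable (count_space UNIV) (\<lambda>m. w (k - m))"
    using integrable_bij_count_space[OF bij, of w] assms by simp
  show "(LINT m|count_space UNIV. w (k - m)) = (LINT m|count_space UNIV. w m)"
    using integral_bij_count_space[OF bij, of w] by simp
qed

text \<open>For a partial sum in place of \<open>f\<close> this is a finite computation with shifted
  coefficients. The error is the Fourier coefficient of a product with one factor small in L2, which
  Cauchy-Schwarz controls.\<close>

lemma fourier_coeff_mult:
  assumes f: "sqint f" and h: "sqint h"
  shows "integrable (count_space UNIV) (\<lambda>m. fc f m * fc h (k - m))"
    and "fc (\<lambda>x. f x * h x) k = (LINT m|count_space UNIV. fc f m * fc h (k - m))"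
proof -
  show int: "integrable (count_space UNIV) (\<lambda>m. fc f m * fc h (k - m))"
  proof (rule Bochner_Integration.integrable_bound)
    show "integrable (count_space UNIV) (\<lambda>m. (cmod (fc f m))\<^sup>2 + (cmod (fc h (k - m)))\<^sup>2)"
      by (intro Bochner_Integration.integrable_add Bessel f l2_shift(1)[of "\<lambda>m. (cmod (fc h m))\<^sup>2"] h)
    have "cmod (fc f m) * cmod (fc h (k - m)) \<le> (cmod (fc f m))\<^sup>2 + (cmod (fc h (k - m)))\<^sup>2" for m
      using sum_squares_bound[of "cmod (fc f m)" "cmod (fc h (k - m))"]
        mult_nonneg_nonneg[OF norm_ge_zero norm_ge_zero, of "fc f m" "fc h (k - m)"] by linarith
    then show "AE m in count_space UNIV. norm (fc f m * fc h (k - m)) \<le> norm ((cmod (fc f m))\<^sup>2 + (cmod (fc h (k - m)))\<^sup>2)"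
      by (simp add: norm_mult)
  qed simp
  let ?S = "\<lambda>K. trig {- int K..int K} (fc f)"
  have d: "fc (\<lambda>x. f x * h x) k - (\<Sum>m\<in>{- int K..int K}. fc f m * fc h (k - m)) = fc (\<lambda>x. (f x - ?S K x) * h x) k" for K
  proof -
    have "fc (\<lambda>x. ?S K x * h x) k = (\<Sum>m\<in>{- int K..int K}. fc f m * fc h (k - m))"
    proof -
      have "fc (\<lambda>x. ?S K x * h x) k = fc (\<lambda>x. \<Sum>m\<in>{- int K..int K}. fc f m * (cis (of_int m * x) * h x)) k"
        by (rule arg_cong[of _ _ "\<lambda>g. fc g k"]) (auto simp: trig_def sum_distrib_right mult.assoc)
      also have "\<dots> = (\<Sum>m\<in>{- int K..int K}. fc (\<lambda>x. fc f m * (cis (of_int m * x) * h x)) k)"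
        by (rule fourier_coeff_sum, rule sqint_cmult) (use h in \<open>auto simp: sqint_def norm_mult\<close>)
      also have "\<dots> = (\<Sum>m\<in>{- int K..int K}. fc f m * fc h (k - m))"
      proof (rule sum.cong[OF refl])
        fix m
        have "(\<lambda>x. cis (of_int m * x) * h x * cis (- (of_int k * x))) = (\<lambda>x. h x * cis (- (of_int (k - m) * x)))"
        proof
          fix x
          have "cis (of_int m * x) * cis (- (of_int k * x)) = cis (- (of_int (k - m) * x))"
            by (simp add: cis_mult algebra_simps)
          then show "cis (of_int m * x) * h x * cis (- (of_int k * x)) = h x * cis (- (of_int (k - m) * x))"
            by (metis mult.assoc mult.commute)
        qed
        then have "fc (\<lambda>x. cis (of_int m * x) * h x) k = fc h (k - m)"
          unfolding fourier_coeff_def by simp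
        then show "fc (\<lambda>x. fc f m * (cis (of_int m * x) * h x)) k = fc f m * fc h (k - m)"
          by (simp add: fourier_coeff_cmult)
      qed
      finally show ?thesis .
    qed
    moreover have "fc (\<lambda>x. (f x - ?S K x) * h x) k = fc (\<lambda>x. f x * h x) k - fc (\<lambda>x. ?S K x * h x) k"
    proof -
      have "integrable CM (\<lambda>x. g x * h x * cis (- (of_int k * x)))" if "sqint g" for g
      proof -
        have "sqint (\<lambda>x. h x * cis (- (of_int k * x)))" using h unfolding sqint_def by (auto simp: norm_mult)
        from sqint_mult_integrable[OF that this] show ?thesis by (simp add: mult.assoc)
      qed
      then show ?thesis unfolding fourier_coeff_def
        by (simp add: left_diff_distrib f sqint_trig diff_divide_distrib)
    qed
    ultimately show ?thesis by simp
  qed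
  have "(\<lambda>K. fc (\<lambda>x. f x * h x) k - (\<Sum>m\<in>{- int K..int K}. fc f m * fc h (k - m))) \<longlonglongrightarrow> 0"
  proof (rule tendsto_0_le[where K = 1])
    show "(\<lambda>K. sqrt (LINT x|CM. (cmod (f x - ?S K x))\<^sup>2) * sqrt (LINT x|CM. (cmod (h x))\<^sup>2)) \<longlonglongrightarrow> 0"
      using tendsto_mult_left_zero[OF tendsto_real_sqrt[OF fourier_partial_L2[OF f], simplified], of "sqrt (LINT x|CM. (cmod (h x))\<^sup>2)"] by simp
    show "\<forall>\<^sub>F K in sequentially. norm (fc (\<lambda>x. f x * h x) k - (\<Sum>m\<in>{- int K..int K}. fc f m * fc h (k - m)))
        \<le> norm (sqrt (LINT x|CM. (cmod (f x - ?S K x))\<^sup>2) * sqrt (LINT x|CM. (cmod (h x))\<^sup>2)) * 1"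
      unfolding d by (rule always_eventually) (use fourier_coeff_bound[OF sqint_diff[OF f sqint_trig] h] in \<open>auto intro: order_trans[OF _ abs_ge_self]\<close>)
  qed
  then have "(\<lambda>K. \<Sum>m\<in>{- int K..int K}. fc f m * fc h (k - m)) \<longlonglongrightarrow> fc (\<lambda>x. f x * h x) k"
    using tendsto_diff[OF tendsto_const[of "fc (\<lambda>x. f x * h x) k"]] by fastforce
  then show "fc (\<lambda>x. f x * h x) k = (LINT m|count_space UNIV. fc f m * fc h (k - m))"
    using csum_lim[OF int] LIMSEQ_unique by blast
qed

lemma wiener_continuous:
  fixes c :: "int \<Rightarrow> complex"
  assumes "integrable (count_space UNIV) c"
  shows "continuous_on UNIV (\<lambda>x. LINT k|count_space UNIV. c k * cis (of_int k * x))"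
proof (rule continuous_at_imp_continuous_on, intro ballI)
  fix x
  show "isCont (\<lambda>x. LINT k|count_space UNIV. c k * cis (of_int k * x)) x"
    unfolding continuous_at_sequentially o_def
  proof (intro allI impI)
    fix X assume X: "X \<longlonglongrightarrow> x"
    show "(\<lambda>n. LINT k|count_space UNIV. c k * cis (of_int k * X n)) \<longlonglongrightarrow> (LINT k|count_space UNIV. c k * cis (of_int k * x))"
      by (rule integral_dominated_convergence[where w = "\<lambda>k. norm (c k)"])
        (use assms X in \<open>auto simp: norm_mult intro!: AE_I2 tendsto_intros\<close>)
  qed
qed

text \<open>The partial sums converge to \<open>f\<close> in L2 and to the series pointwise under a
  common bound, so the two limits agree almost everywhere. This supplies the continuous
  representative of an L2 class, whose supremum can be studied pointwise.\<close>

lemma wiener_reconstruct: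
  assumes f: "sqint f" and c: "integrable (count_space UNIV) (fc f)"
  shows "AE x in CM. f x = (LINT k|count_space UNIV. fc f k * cis (of_int k * x))"
proof -
  let ?g = "\<lambda>x. LINT k|count_space UNIV. fc f k * cis (of_int k * x)"
  let ?S = "\<lambda>K. trig {- int K..int K} (fc f)"
  note [measurable] = sqint_measurable[OF f]
  have gm [measurable]: "?g \<in> borel_measurable CM"
    by (rule borel_measurable_CM[OF borel_measurable_continuous_onI[OF wiener_continuous[OF c]]])
  have Sm [measurable]: "?S K \<in> borel_measurable CM" for K using sqint_trig[of "{- int K..int K}"] by (simp add: sqint_def)
  have int: "integrable (count_space UNIV) (\<lambda>k. fc f k * cis (of_int k * x))" for x
    by (rule Bochner_Integration.integrable_bound[OF c]) (auto simp: norm_mult)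
  let ?L = "LINT k|count_space UNIV. norm (fc f k)"
  have gb: "cmod (?g x) \<le> ?L" for x
    using integral_norm_bound[of "count_space UNIV" "\<lambda>k. fc f k * cis (of_int k * x)"] by (simp add: norm_mult)
  have Sb: "cmod (?S K x) \<le> ?L" for K x
  proof -
    have "cmod (?S K x) \<le> (\<Sum>k\<in>{- int K..int K}. norm (fc f k))"
      unfolding trig_def by (rule order_trans[OF norm_sum]) (simp add: norm_mult)
    also have "\<dots> \<le> ?L" by (rule cseq_lim_nn) (use c in auto)
    finally show ?thesis .
  qed
  have sg: "sqint ?g" by (rule sqint_bounded[OF gm gb])
  have "(\<lambda>K. LINT x|CM. (cmod (?S K x - ?g x))\<^sup>2) \<longlonglongrightarrow> (LINT x|CM. 0)"
  proof (rule integral_dominated_convergence[where w = "\<lambda>_. (2 * ?L)\<^sup>2"])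
    show "AE x in CM. (\<lambda>K. (cmod (?S K x - ?g x))\<^sup>2) \<longlonglongrightarrow> 0"
    proof (rule AE_I2)
      fix x
      have "(\<lambda>K. ?S K x) \<longlonglongrightarrow> ?g x" unfolding trig_def by (rule csum_lim[OF int])
      then have "(\<lambda>K. (cmod (?S K x - ?g x))\<^sup>2) \<longlonglongrightarrow> (cmod (?g x - ?g x))\<^sup>2" by (intro tendsto_intros)
      then show "(\<lambda>K. (cmod (?S K x - ?g x))\<^sup>2) \<longlonglongrightarrow> 0" by simp
    qed
    show "AE x in CM. norm ((cmod (?S K x - ?g x))\<^sup>2) \<le> (2 * ?L)\<^sup>2" for K
    proof (rule AE_I2)
      fix x
      have "cmod (?S K x - ?g x) \<le> 2 * ?L"
        using norm_triangle_ineq4[of "?S K x" "?g x"] Sb[of K x] gb[of x] by linarith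
      then show "norm ((cmod (?S K x - ?g x))\<^sup>2) \<le> (2 * ?L)\<^sup>2"
        unfolding real_norm_def abs_power2 by (rule power_mono) simp
    qed
  qed auto
  then have 1: "(\<lambda>K. LINT x|CM. (cmod (?S K x - ?g x))\<^sup>2) \<longlonglongrightarrow> 0" by simp
  have "(LINT x|CM. (cmod (f x - ?g x))\<^sup>2) \<le> 2 * 0 + 2 * 0"
    by (rule LIMSEQ_le_const[OF tendsto_add[OF tendsto_mult[OF tendsto_const fourier_partial_L2[OF f]]
        tendsto_mult[OF tendsto_const 1]]])
      (use L2_dist_triangle[OF f sqint_trig sg] in blast)
  then have "(LINT x|CM. (cmod (f x - ?g x))\<^sup>2) = 0"
    by (intro antisym Bochner_Integration.integral_nonneg) auto
  moreover have "integrable CM (\<lambda>x. (cmod (f x - ?g x))\<^sup>2)"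
    using sqint_diff[OF f sg] by (simp add: sqint_def)
  ultimately have "AE x in CM. (cmod (f x - ?g x))\<^sup>2 = 0"
    by (subst (asm) integral_nonneg_eq_0_iff_AE) auto
  then show ?thesis by simp
qed

lemma fourier_coeff_wiener:
  fixes c :: "int \<Rightarrow> complex"
  assumes c: "integrable (count_space UNIV) c"
  shows "fc (\<lambda>x. LINT k|count_space UNIV. c k * cis (of_int k * x)) j = c j"
proof -
  let ?g = "\<lambda>x. LINT k|count_space UNIV. c k * cis (of_int k * x)"
  let ?S = "\<lambda>K. trig {- int K..int K} c"
  have [measurable]: "?g \<in> borel_measurable CM"
    by (rule borel_measurable_CM[OF borel_measurable_continuous_onI[OF wiener_continuous[OF c]]])
  have [measurable]: "?S K \<in> borel_measurable CM" for K using sqint_trig[of "{- int K..int K}"] by (simp add: sqint_def)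
  have int: "integrable (count_space UNIV) (\<lambda>k. c k * cis (of_int k * x))" for x
    by (rule Bochner_Integration.integrable_bound[OF c]) (auto simp: norm_mult)
  let ?L = "LINT k|count_space UNIV. norm (c k)"
  have Sb: "cmod (?S K x) \<le> ?L" for K x
  proof -
    have "cmod (?S K x) \<le> (\<Sum>k\<in>{- int K..int K}. norm (c k))"
      unfolding trig_def by (rule order_trans[OF norm_sum]) (simp add: norm_mult)
    also have "\<dots> \<le> ?L" by (rule cseq_lim_nn) (use c in auto)
    finally show ?thesis .
  qed
  have "(\<lambda>K. LINT x|CM. ?S K x * cis (- (of_int j * x))) \<longlonglongrightarrow> (LINT x|CM. ?g x * cis (- (of_int j * x)))"
  proof (rule integral_dominated_convergence[where w = "\<lambda>_. ?L"])
    show "AE x in CM. (\<lambda>K. ?S K x * cis (- (of_int j * x))) \<longlonglongrightarrow> ?g x * cis (- (of_int j * x))"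
    proof (rule AE_I2)
      fix x
      have "(\<lambda>K. ?S K x) \<longlonglongrightarrow> ?g x" unfolding trig_def by (rule csum_lim[OF int])
      then show "(\<lambda>K. ?S K x * cis (- (of_int j * x))) \<longlonglongrightarrow> ?g x * cis (- (of_int j * x))" by (intro tendsto_intros)
    qed
  qed (use Sb in \<open>auto simp: norm_mult\<close>)
  then have "(\<lambda>K. fc (?S K) j) \<longlonglongrightarrow> fc ?g j"
    unfolding fourier_coeff_def by (intro tendsto_divide) auto
  moreover have "\<forall>\<^sub>F K in sequentially. fc (?S K) j = c j"
    by (rule eventually_sequentiallyI[of "nat \<bar>j\<bar>"]) (auto simp: fourier_coeff_trig)
  ultimately show ?thesis
    by (rule LIMSEQ_unique[OF _ tendsto_eventually])
qed

section \<open>A quadrilinear form with hyperbolic weights\<close>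

abbreviation (input) "CS \<equiv> count_space (UNIV :: int set)"

lemma nn_sum_swap:
  fixes f :: "int \<Rightarrow> int \<Rightarrow> ennreal"
  shows "(\<integral>\<^sup>+i. \<integral>\<^sup>+j. f i j \<partial>CS \<partial>CS) = (\<integral>\<^sup>+j. \<integral>\<^sup>+i. f i j \<partial>CS \<partial>CS)"
  by (rule nn_integral_count_space_nn_integral) auto

lemma nn_sum_shift:
  fixes f :: "int \<Rightarrow> ennreal"
  shows "(\<integral>\<^sup>+i. f (i + c) \<partial>CS) = (\<integral>\<^sup>+i. f i \<partial>CS)" "(\<integral>\<^sup>+i. f (c + i) \<partial>CS) = (\<integral>\<^sup>+i. f i \<partial>CS)"
    "(\<integral>\<^sup>+i. f (i - c) \<partial>CS) = (\<integral>\<^sup>+i. f i \<partial>CS)" "(\<integral>\<^sup>+i. f (c - i) \<partial>CS) = (\<integral>\<^sup>+i. f i \<partial>CS)"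
    "(\<integral>\<^sup>+i. f (- i) \<partial>CS) = (\<integral>\<^sup>+i. f i \<partial>CS)"
proof -
  have b: "bij_betw (\<lambda>i::int. i + c) UNIV UNIV" for c :: int
    by (rule bij_betw_byWitness[where f' = "\<lambda>i. i - c"]) auto
  have b': "bij_betw (\<lambda>i::int. c - i) UNIV UNIV" for c :: int
    by (rule bij_betw_byWitness[where f' = "\<lambda>i. c - i"]) auto
  note nn_integral_bij_count_space[OF b, of f c] nn_integral_bij_count_space[OF b, of f "- c"]
    nn_integral_bij_count_space[OF b', of f c] nn_integral_bij_count_space[OF b', of f 0]
  then show "(\<integral>\<^sup>+i. f (i + c) \<partial>CS) = (\<integral>\<^sup>+i. f i \<partial>CS)" "(\<integral>\<^sup>+i. f (c + i) \<partial>CS) = (\<integral>\<^sup>+i. f i \<partial>CS)"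
    "(\<integral>\<^sup>+i. f (i - c) \<partial>CS) = (\<integral>\<^sup>+i. f i \<partial>CS)" "(\<integral>\<^sup>+i. f (c - i) \<partial>CS) = (\<integral>\<^sup>+i. f i \<partial>CS)"
    "(\<integral>\<^sup>+i. f (- i) \<partial>CS) = (\<integral>\<^sup>+i. f i \<partial>CS)"
    by (simp_all add: add.commute)
qed

text \<open>The kernel is chosen such that \<open>kap p ^ 3 = 1 / |p|\<close> while \<open>kap p ^ 4\<close> is summable, which is what the
  Cauchy--Schwarz inequality for the form below needs.\<close>

definition kap :: "int \<Rightarrow> real" where "kap p = (if p = 0 then 0 else \<bar>real_of_int p\<bar> powr (- (1/3)))"

text \<open>Twice the value of the zeta function at 4/3.\<close>

definition hyp_const :: ennreal where "hyp_const = (\<integral>\<^sup>+p. ennreal (kap p ^ 4) \<partial>CS)"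

lemma kap_nonneg [simp]: "kap p \<ge> 0" by (simp add: kap_def)

lemma kap_cube: "kap p ^ 3 = 1 / \<bar>real_of_int p\<bar>"
proof (cases "p = 0")
  case False
  then show ?thesis
    by (simp add: kap_def powr_power powr_minus field_simps)
qed (simp add: kap_def)

lemma hyp_const_finite: "hyp_const < \<infinity>"
proof -
  have s: "summable (\<lambda>n. real n powr (- (4/3)))" using summable_real_powr_iff[of "- (4/3)"] by simp
  have "(\<Sum>m\<in>{- int K..int K}. norm (kap m ^ 4)) \<le> 2 * (\<Sum>n. real n powr (- (4/3)))" for K
  proof -
    have eq: "norm (kap m ^ 4) = real (nat \<bar>m\<bar>) powr (- (4/3))" for m
      by (cases "m = 0") (simp_all add: kap_def powr_power)
    have "(\<Sum>m\<in>{- int K..int K}. norm (kap m ^ 4)) \<le> (\<Sum>m\<in>int ` {..K} \<union> (\<lambda>n. - int n) ` {..K}. norm (kap m ^ 4))"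
    proof (rule sum_mono2)
      show "{- int K..int K} \<subseteq> int ` {..K} \<union> (\<lambda>n. - int n) ` {..K}"
      proof
        fix m assume m: "m \<in> {- int K..int K}"
        show "m \<in> int ` {..K} \<union> (\<lambda>n. - int n) ` {..K}"
        proof (cases "m \<ge> 0")
          case True
          then have "m = int (nat m)" "nat m \<le> K" using m by auto
          then show ?thesis by blast
        next
          case False
          then have "m = - int (nat (- m))" "nat (- m) \<le> K" using m by auto
          then show ?thesis by blast
        qed
      qed
    qed auto
    also have "\<dots> \<le> (\<Sum>m\<in>int ` {..K}. norm (kap m ^ 4)) + (\<Sum>m\<in>(\<lambda>n. - int n) ` {..K}. norm (kap m ^ 4))"
      by (subst sum_Un) (auto intro!: sum_nonneg)
    also have "\<dots> = 2 * (\<Sum>n\<in>{..K}. real n powr (- (4/3)))"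
      unfolding eq by (subst (1 2) sum.reindex) (auto simp: inj_on_def)
    also have "\<dots> \<le> 2 * (\<Sum>n. real n powr (- (4/3)))"
      using sum_le_suminf[OF s, of "{..K}"] by simp
    finally show ?thesis .
  qed
  from csum_integrable_bound(1)[OF this]
  show ?thesis unfolding hyp_const_def by (simp add: integrable_iff_bounded)
qed

text \<open>Values in \<open>ennreal\<close> make every rearrangement legitimate without a
  convergence check. Frequencies with \<open>p = 0\<close> or \<open>q = 0\<close> drop out because
  \<open>1 / 0 = 0\<close>.\<close>

definition Lam :: "(int \<Rightarrow> ennreal) \<Rightarrow> (int \<Rightarrow> ennreal) \<Rightarrow> (int \<Rightarrow> ennreal) \<Rightarrow> (int \<Rightarrow> ennreal) \<Rightarrow> ennreal" where
  "Lam w0 w1 w2 w3 = (\<integral>\<^sup>+k. \<integral>\<^sup>+p. \<integral>\<^sup>+q. ennreal (1 / (\<bar>of_int p\<bar> * \<bar>of_int q\<bar>)) * (w0 k * w1 (k - q) * w2 (k - p - q) * w3 (k - p)) \<partial>CS \<partial>CS \<partial>CS)"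

text \<open>Shift \<open>k\<close> by \<open>q\<close>, reflect \<open>q\<close>, and exchange the
  names of \<open>p\<close> and \<open>q\<close>; the weight is invariant under all three
  operations.\<close>

lemma Lam_rotate: "Lam w0 w1 w2 w3 = Lam w1 w2 w3 w0"
proof -
  have "Lam w0 w1 w2 w3 = (\<integral>\<^sup>+p. \<integral>\<^sup>+q. \<integral>\<^sup>+k. ennreal (1 / (\<bar>of_int p\<bar> * \<bar>of_int q\<bar>)) * (w0 k * w1 (k - q) * w2 (k - p - q) * w3 (k - p)) \<partial>CS \<partial>CS \<partial>CS)"
    unfolding Lam_def by (rule trans[OF nn_sum_swap], rule nn_integral_cong, rule nn_sum_swap)
  also have "\<dots> = (\<integral>\<^sup>+p. \<integral>\<^sup>+q. \<integral>\<^sup>+k. ennreal (1 / (\<bar>of_int p\<bar> * \<bar>of_int q\<bar>)) * (w0 (k + q) * w1 k * w2 (k - p) * w3 (k - p + q)) \<partial>CS \<partial>CS \<partial>CS)"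
  proof (rule nn_integral_cong, rule nn_integral_cong)
    fix p q :: int
    show "(\<integral>\<^sup>+k. ennreal (1 / (\<bar>of_int p\<bar> * \<bar>of_int q\<bar>)) * (w0 k * w1 (k - q) * w2 (k - p - q) * w3 (k - p)) \<partial>CS)
      = (\<integral>\<^sup>+k. ennreal (1 / (\<bar>of_int p\<bar> * \<bar>of_int q\<bar>)) * (w0 (k + q) * w1 k * w2 (k - p) * w3 (k - p + q)) \<partial>CS)"
      using nn_sum_shift(1)[of "\<lambda>k. ennreal (1 / (\<bar>of_int p\<bar> * \<bar>of_int q\<bar>)) * (w0 k * w1 (k - q) * w2 (k - p - q) * w3 (k - p))" q]
      by (simp add: algebra_simps)
  qed
  also have "\<dots> = (\<integral>\<^sup>+p. \<integral>\<^sup>+q. \<integral>\<^sup>+k. ennreal (1 / (\<bar>of_int p\<bar> * \<bar>of_int q\<bar>)) * (w0 (k - q) * w1 k * w2 (k - p) * w3 (k - p - q)) \<partial>CS \<partial>CS \<partial>CS)"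
  proof (rule nn_integral_cong)
    fix p :: int
    show "(\<integral>\<^sup>+q. \<integral>\<^sup>+k. ennreal (1 / (\<bar>of_int p\<bar> * \<bar>of_int q\<bar>)) * (w0 (k + q) * w1 k * w2 (k - p) * w3 (k - p + q)) \<partial>CS \<partial>CS)
     = (\<integral>\<^sup>+q. \<integral>\<^sup>+k. ennreal (1 / (\<bar>of_int p\<bar> * \<bar>of_int q\<bar>)) * (w0 (k - q) * w1 k * w2 (k - p) * w3 (k - p - q)) \<partial>CS \<partial>CS)"
      using nn_sum_shift(5)[of "\<lambda>q. \<integral>\<^sup>+k. ennreal (1 / (\<bar>of_int p\<bar> * \<bar>of_int q\<bar>)) * (w0 (k + q) * w1 k * w2 (k - p) * w3 (k - p + q)) \<partial>CS"]
      by simp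
  qed
  also have "\<dots> = (\<integral>\<^sup>+p. \<integral>\<^sup>+q. \<integral>\<^sup>+k. ennreal (1 / (\<bar>of_int q\<bar> * \<bar>of_int p\<bar>)) * (w1 k * w2 (k - p) * w3 (k - q - p) * w0 (k - q)) \<partial>CS \<partial>CS \<partial>CS)"
    by (intro nn_integral_cong) (simp add: mult_ac diff_diff_eq add.commute)
  also have "\<dots> = (\<integral>\<^sup>+q. \<integral>\<^sup>+p. \<integral>\<^sup>+k. ennreal (1 / (\<bar>of_int q\<bar> * \<bar>of_int p\<bar>)) * (w1 k * w2 (k - p) * w3 (k - q - p) * w0 (k - q)) \<partial>CS \<partial>CS \<partial>CS)"
    by (rule nn_sum_swap)
  also have "\<dots> = Lam w1 w2 w3 w0"
    unfolding Lam_def by (rule sym, rule trans[OF nn_sum_swap], rule nn_integral_cong, rule nn_sum_swap)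
  finally show ?thesis .
qed

lemma ennreal_power2_le_imp_le:
  fixes a b :: ennreal assumes "a\<^sup>2 \<le> b\<^sup>2" shows "a \<le> b"
  using assms by (cases a rule: ennreal_cases; cases b rule: ennreal_cases)
    (auto simp: ennreal_power power2_le_iff_abs_le top_unique)

text \<open>In the variables \<open>i = n + p\<close> and \<open>j = n + q\<close> the sum over
  \<open>n\<close> involves the kernel alone, and Cauchy-Schwarz bounds it by the sum of
  \<open>kap p ^ 4\<close>, uniformly in \<open>i\<close> and \<open>j\<close>.\<close>

lemma nn_shift_out:
  fixes x z :: "int \<Rightarrow> ennreal"
  shows "(\<integral>\<^sup>+n. \<integral>\<^sup>+p. \<integral>\<^sup>+q. x (n + p) * z (n + q) * (ennreal (kap p ^ 2) * ennreal (kap q ^ 2)) \<partial>CS \<partial>CS \<partial>CS)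
    \<le> hyp_const * (\<integral>\<^sup>+i. x i \<partial>CS) * (\<integral>\<^sup>+j. z j \<partial>CS)"
proof -
  have "(\<integral>\<^sup>+n. \<integral>\<^sup>+p. \<integral>\<^sup>+q. x (n + p) * z (n + q) * (ennreal (kap p ^ 2) * ennreal (kap q ^ 2)) \<partial>CS \<partial>CS \<partial>CS)
     = (\<integral>\<^sup>+n. \<integral>\<^sup>+i. \<integral>\<^sup>+j. x i * z j * (ennreal (kap (i - n) ^ 2) * ennreal (kap (j - n) ^ 2)) \<partial>CS \<partial>CS \<partial>CS)"
  proof (rule nn_integral_cong)
    fix n :: int
    have "(\<integral>\<^sup>+p. \<integral>\<^sup>+q. x (n + p) * z (n + q) * (ennreal (kap p ^ 2) * ennreal (kap q ^ 2)) \<partial>CS \<partial>CS)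
       = (\<integral>\<^sup>+p. \<integral>\<^sup>+j. x (n + p) * z j * (ennreal (kap p ^ 2) * ennreal (kap (j - n) ^ 2)) \<partial>CS \<partial>CS)"
      by (rule nn_integral_cong)
        (use nn_sum_shift(2)[of "\<lambda>j. x (n + p) * z j * (ennreal (kap p ^ 2) * ennreal (kap (j - n) ^ 2))" n for p] in simp)
    also have "\<dots> = (\<integral>\<^sup>+i. \<integral>\<^sup>+j. x i * z j * (ennreal (kap (i - n) ^ 2) * ennreal (kap (j - n) ^ 2)) \<partial>CS \<partial>CS)"
      using nn_sum_shift(2)[of "\<lambda>i. \<integral>\<^sup>+j. x i * z j * (ennreal (kap (i - n) ^ 2) * ennreal (kap (j - n) ^ 2)) \<partial>CS" n]
      by simp
    finally show "(\<integral>\<^sup>+p. \<integral>\<^sup>+q. x (n + p) * z (n + q) * (ennreal (kap p ^ 2) * ennreal (kap q ^ 2)) \<partial>CS \<partial>CS)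
       = (\<integral>\<^sup>+i. \<integral>\<^sup>+j. x i * z j * (ennreal (kap (i - n) ^ 2) * ennreal (kap (j - n) ^ 2)) \<partial>CS \<partial>CS)" .
  qed
  also have "\<dots> = (\<integral>\<^sup>+i. \<integral>\<^sup>+j. x i * z j * (\<integral>\<^sup>+n. ennreal (kap (i - n) ^ 2) * ennreal (kap (j - n) ^ 2) \<partial>CS) \<partial>CS \<partial>CS)"
    by (rule trans[OF nn_sum_swap], rule nn_integral_cong, rule trans[OF nn_sum_swap])
      (simp add: nn_integral_cmult)
  also have "\<dots> \<le> (\<integral>\<^sup>+i. \<integral>\<^sup>+j. x i * z j * hyp_const \<partial>CS \<partial>CS)"
  proof (intro nn_integral_mono mult_left_mono)
    fix i j :: int
    have "(\<integral>\<^sup>+n. ennreal (kap (i - n) ^ 2) * ennreal (kap (j - n) ^ 2) \<partial>CS)\<^sup>2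
       \<le> (\<integral>\<^sup>+n. (ennreal (kap (i - n) ^ 2))\<^sup>2 \<partial>CS) * (\<integral>\<^sup>+n. (ennreal (kap (j - n) ^ 2))\<^sup>2 \<partial>CS)"
      by (rule Cauchy_Schwarz_nn_integral) auto
    also have "\<dots> = hyp_const\<^sup>2"
      using nn_sum_shift(4)[of "\<lambda>p. ennreal (kap p ^ 4)"]
      by (simp add: hyp_const_def ennreal_power flip: power_mult) (simp add: power2_eq_square)
    finally show "(\<integral>\<^sup>+n. ennreal (kap (i - n) ^ 2) * ennreal (kap (j - n) ^ 2) \<partial>CS) \<le> hyp_const"
      by (rule ennreal_power2_le_imp_le)
  qed simp
  also have "\<dots> = hyp_const * (\<integral>\<^sup>+i. x i \<partial>CS) * (\<integral>\<^sup>+j. z j \<partial>CS)"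
    by (simp add: nn_integral_cmult nn_integral_multc mult_ac)
  finally show ?thesis .
qed

lemma nn_sum3:
  fixes f :: "int \<Rightarrow> int \<Rightarrow> int \<Rightarrow> ennreal"
  shows "(\<integral>\<^sup>+n. \<integral>\<^sup>+p. \<integral>\<^sup>+q. f n p q \<partial>CS \<partial>CS \<partial>CS)
    = (\<integral>\<^sup>+(n, p, q). f n p q \<partial>count_space UNIV)"
proof -
  have "(\<integral>\<^sup>+p. \<integral>\<^sup>+q. f n p q \<partial>CS \<partial>CS) = (\<integral>\<^sup>+r. (case r of (p, q) \<Rightarrow> f n p q) \<partial>count_space UNIV)" for n
    using nn_integral_fst_count_space[of "\<lambda>(p, q). f n p q"] by simp
  then show ?thesis
    using nn_integral_fst_count_space[of "\<lambda>(n, p, q). f n p q"] by simp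
qed

text \<open>The weight is split into \<open>kap p * kap q\<close> and its square. Cauchy-Schwarz
  puts the first part with \<open>w1\<close> and \<open>w3\<close>, where
  \<open>nn_shift_out\<close> applies, and the second with \<open>w2\<close>, where both kernel sums
  run freely. Each of the three resulting kernel sums is at most \<open>hyp_const\<close>.\<close>

lemma Lam_bound0:
  assumes "\<And>k. w0 k \<le> W"
  shows "(Lam w0 w1 w2 w3)\<^sup>2 \<le> hyp_const ^ 3 * W\<^sup>2 * (\<integral>\<^sup>+k. (w1 k)\<^sup>2 \<partial>CS) * (\<integral>\<^sup>+k. (w2 k)\<^sup>2 \<partial>CS) * (\<integral>\<^sup>+k. (w3 k)\<^sup>2 \<partial>CS)"
proof -
  \<comment> \<open>Here \<open>n\<close> stands for the vertex \<open>k - p - q\<close>, opposite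
    to \<open>k\<close>; the other two vertices are \<open>n + p\<close> and
    \<open>n + q\<close>.\<close>
  let ?F = "\<lambda>n p q. w1 (n + p) * w3 (n + q) * (ennreal (kap p) * ennreal (kap q))"
  let ?G = "\<lambda>n p q. w2 n * (ennreal (kap p ^ 2) * ennreal (kap q ^ 2))"
  have split: "ennreal (1 / (\<bar>of_int p\<bar> * \<bar>of_int q\<bar>)) = ennreal (kap p) * ennreal (kap q) * (ennreal (kap p ^ 2) * ennreal (kap q ^ 2))" for p q
  proof -
    have "1 / (\<bar>of_int p\<bar> * \<bar>of_int q\<bar>) = kap p * kap q * (kap p ^ 2 * kap q ^ 2)"
      using kap_cube[of p] kap_cube[of q] by (simp add: power2_eq_square power3_eq_cube) (metis (no_types, opaque_lifting) inverse_eq_divide mult.assoc mult.left_commute times_divide_times_eq mult_1)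
    then show ?thesis by (simp add: ennreal_mult)
  qed
  have "Lam w0 w1 w2 w3 \<le> (\<integral>\<^sup>+k. \<integral>\<^sup>+p. \<integral>\<^sup>+q. W * (?F (k - p - q) p q * ?G (k - p - q) p q) \<partial>CS \<partial>CS \<partial>CS)"
    unfolding Lam_def
  proof (intro nn_integral_mono)
    fix k p q
    have "ennreal (1 / (\<bar>of_int p\<bar> * \<bar>of_int q\<bar>)) * (w0 k * w1 (k - q) * w2 (k - p - q) * w3 (k - p))
      \<le> ennreal (1 / (\<bar>of_int p\<bar> * \<bar>of_int q\<bar>)) * (W * w1 (k - q) * w2 (k - p - q) * w3 (k - p))"
      by (intro mult_left_mono mult_right_mono assms) auto
    also have "\<dots> = W * (?F (k - p - q) p q * ?G (k - p - q) p q)"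
      unfolding split by (simp add: mult_ac)
    finally show "ennreal (1 / (\<bar>of_int p\<bar> * \<bar>of_int q\<bar>)) * (w0 k * w1 (k - q) * w2 (k - p - q) * w3 (k - p))
      \<le> W * (?F (k - p - q) p q * ?G (k - p - q) p q)" .
  qed
  also have "\<dots> = (\<integral>\<^sup>+p. \<integral>\<^sup>+q. \<integral>\<^sup>+k. W * (?F (k - p - q) p q * ?G (k - p - q) p q) \<partial>CS \<partial>CS \<partial>CS)"
    by (rule trans[OF nn_sum_swap], rule nn_integral_cong, rule nn_sum_swap)
  also have "\<dots> = (\<integral>\<^sup>+p. \<integral>\<^sup>+q. \<integral>\<^sup>+n. W * (?F n p q * ?G n p q) \<partial>CS \<partial>CS \<partial>CS)"
  proof (rule nn_integral_cong, rule nn_integral_cong)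
    fix p q
    show "(\<integral>\<^sup>+k. W * (?F (k - p - q) p q * ?G (k - p - q) p q) \<partial>CS) = (\<integral>\<^sup>+n. W * (?F n p q * ?G n p q) \<partial>CS)"
      using nn_sum_shift(3)[of "\<lambda>n. W * (?F n p q * ?G n p q)" "p + q"] by (simp only: diff_diff_eq)
  qed
  also have "\<dots> = (\<integral>\<^sup>+n. \<integral>\<^sup>+p. \<integral>\<^sup>+q. W * (?F n p q * ?G n p q) \<partial>CS \<partial>CS \<partial>CS)"
    by (rule sym, rule trans[OF nn_sum_swap], rule nn_integral_cong, rule nn_sum_swap)
  also have "\<dots> = W * (\<integral>\<^sup>+(n, p, q). ?F n p q * ?G n p q \<partial>count_space UNIV)"
    by (simp only: nn_sum3[symmetric]) (simp add: nn_integral_cmult)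
  finally have L: "Lam w0 w1 w2 w3 \<le> W * (\<integral>\<^sup>+(n, p, q). ?F n p q * ?G n p q \<partial>count_space UNIV)" .
  have "(\<integral>\<^sup>+(n, p, q). ?F n p q * ?G n p q \<partial>count_space UNIV)\<^sup>2
     \<le> (\<integral>\<^sup>+(n, p, q). (?F n p q)\<^sup>2 \<partial>count_space UNIV) * (\<integral>\<^sup>+(n, p, q). (?G n p q)\<^sup>2 \<partial>count_space UNIV)"
    using Cauchy_Schwarz_nn_integral[of "\<lambda>(n, p, q). ?F n p q" "count_space UNIV" "\<lambda>(n, p, q). ?G n p q"]
    by (simp add: case_prod_unfold)
  also have "(\<integral>\<^sup>+(n, p, q). (?F n p q)\<^sup>2 \<partial>count_space UNIV) \<le> hyp_const * (\<integral>\<^sup>+i. (w1 i)\<^sup>2 \<partial>CS) * (\<integral>\<^sup>+j. (w3 j)\<^sup>2 \<partial>CS)"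
    using nn_shift_out[of "\<lambda>i. (w1 i)\<^sup>2" "\<lambda>i. (w3 i)\<^sup>2"]
    by (simp only: nn_sum3[symmetric]) (simp add: power_mult_distrib ennreal_power)
  also have "(\<integral>\<^sup>+(n, p, q). (?G n p q)\<^sup>2 \<partial>count_space UNIV) = (\<integral>\<^sup>+n. (w2 n)\<^sup>2 \<partial>CS) * hyp_const * hyp_const"
    by (simp only: nn_sum3[symmetric])
       (simp add: power_mult_distrib ennreal_power hyp_const_def nn_integral_cmult nn_integral_multc mult.assoc flip: power_mult)
  finally have "(\<integral>\<^sup>+(n, p, q). ?F n p q * ?G n p q \<partial>count_space UNIV)\<^sup>2 \<le>
     hyp_const * (\<integral>\<^sup>+i. (w1 i)\<^sup>2 \<partial>CS) * (\<integral>\<^sup>+j. (w3 j)\<^sup>2 \<partial>CS) * ((\<integral>\<^sup>+n. (w2 n)\<^sup>2 \<partial>CS) * hyp_const * hyp_const)"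
    by (simp add: mult_right_mono)
  then have "W\<^sup>2 * (\<integral>\<^sup>+(n, p, q). ?F n p q * ?G n p q \<partial>count_space UNIV)\<^sup>2 \<le>
     W\<^sup>2 * (hyp_const * (\<integral>\<^sup>+i. (w1 i)\<^sup>2 \<partial>CS) * (\<integral>\<^sup>+j. (w3 j)\<^sup>2 \<partial>CS) * ((\<integral>\<^sup>+n. (w2 n)\<^sup>2 \<partial>CS) * hyp_const * hyp_const))"
    by (rule mult_left_mono) simp
  moreover have "(Lam w0 w1 w2 w3)\<^sup>2 \<le> W\<^sup>2 * (\<integral>\<^sup>+(n, p, q). ?F n p q * ?G n p q \<partial>count_space UNIV)\<^sup>2"
    using L by (simp add: power_mono flip: power_mult_distrib)
  ultimately show ?thesis by (simp add: mult_ac power3_eq_cube)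
qed

text \<open>The constant of the estimate after taking the square root, as a real number.\<close>

definition hyp_root :: real where "hyp_root = sqrt (enn2real hyp_const ^ 3)"

lemma hyp_root: "hyp_root \<ge> 0" "hyp_const ^ 3 = ennreal (hyp_root\<^sup>2)"
proof -
  obtain r where r: "hyp_const = ennreal r" "r \<ge> 0"
    using hyp_const_finite by (cases hyp_const rule: ennreal_cases) auto
  then show "hyp_root \<ge> 0" "hyp_const ^ 3 = ennreal (hyp_root\<^sup>2)"
    by (simp_all add: hyp_root_def r ennreal_power)
qed

text \<open>The form \<open>Lam\<close> is a sum over the vertices of parallelograms, so its arguments can be permuted
  cyclically and any one of the four may be the one measured in the supremum norm.\<close>

lemma Lam_le0:
  assumes "\<And>k. w0 k \<le> ennreal W" "(\<integral>\<^sup>+k. (w1 k)\<^sup>2 \<partial>CS) \<le> ennreal (x\<^sup>2)"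
    "(\<integral>\<^sup>+k. (w2 k)\<^sup>2 \<partial>CS) \<le> ennreal (y\<^sup>2)" "(\<integral>\<^sup>+k. (w3 k)\<^sup>2 \<partial>CS) \<le> ennreal (z\<^sup>2)"
    "W \<ge> 0" "x \<ge> 0" "y \<ge> 0" "z \<ge> 0"
  shows "Lam w0 w1 w2 w3 \<le> ennreal (hyp_root * W * x * y * z)"
proof (rule ennreal_power2_le_imp_le)
  have "(Lam w0 w1 w2 w3)\<^sup>2 \<le> hyp_const ^ 3 * (ennreal W)\<^sup>2 * (\<integral>\<^sup>+k. (w1 k)\<^sup>2 \<partial>CS) * (\<integral>\<^sup>+k. (w2 k)\<^sup>2 \<partial>CS) * (\<integral>\<^sup>+k. (w3 k)\<^sup>2 \<partial>CS)"
    by (rule Lam_bound0[OF assms(1)])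
  also have "\<dots> \<le> ennreal (hyp_root\<^sup>2) * (ennreal W)\<^sup>2 * ennreal (x\<^sup>2) * ennreal (y\<^sup>2) * ennreal (z\<^sup>2)"
    unfolding hyp_root(2) by (intro mult_mono assms order_refl) auto
  also have "\<dots> = (ennreal (hyp_root * W * x * y * z))\<^sup>2"
    using assms hyp_root(1) by (simp add: ennreal_power power_mult_distrib ennreal_mult)
  finally show "(Lam w0 w1 w2 w3)\<^sup>2 \<le> (ennreal (hyp_root * W * x * y * z))\<^sup>2" .
qed

lemma Lam_le1:
  assumes "\<And>k. w1 k \<le> ennreal W" "(\<integral>\<^sup>+k. (w2 k)\<^sup>2 \<partial>CS) \<le> ennreal (x\<^sup>2)"
    "(\<integral>\<^sup>+k. (w3 k)\<^sup>2 \<partial>CS) \<le> ennreal (y\<^sup>2)" "(\<integral>\<^sup>+k. (w0 k)\<^sup>2 \<partial>CS) \<le> ennreal (z\<^sup>2)"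
    "W \<ge> 0" "x \<ge> 0" "y \<ge> 0" "z \<ge> 0"
  shows "Lam w0 w1 w2 w3 \<le> ennreal (hyp_root * W * x * y * z)"
  unfolding Lam_rotate[of w0] by (rule Lam_le0[OF assms])

section \<open>Exchanging sums over the integers with integrals\<close>

lemma measurable_nn_sum [measurable]:
  fixes f :: "int \<Rightarrow> 'b \<Rightarrow> ennreal"
  assumes [measurable]: "\<And>q. f q \<in> borel_measurable N"
  shows "(\<lambda>s. \<integral>\<^sup>+q. f q s \<partial>CS) \<in> borel_measurable N"
proof -
  have "(\<lambda>x. f (snd x) (fst x)) \<in> borel_measurable (N \<Otimes>\<^sub>M CS)"
    by (rule measurable_compose_countable'[where f = "\<lambda>q x. f q (fst x)" and g = snd and I = UNIV]) auto
  then have m: "(\<lambda>(s, q). f q s) \<in> borel_measurable (N \<Otimes>\<^sub>M CS)" by (simp add: case_prod_beta')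
  interpret sigma_finite_measure "CS" by (rule sigma_finite_measure_count_space)
  from m show ?thesis by (rule borel_measurable_nn_integral)
qed

lemma measurable_csum [measurable]:
  fixes f :: "int \<Rightarrow> 'b \<Rightarrow> 'c::{banach, second_countable_topology}"
  assumes [measurable]: "\<And>q. f q \<in> borel_measurable N"
  shows "(\<lambda>s. LINT q|CS. f q s) \<in> borel_measurable N"
proof -
  have "(\<lambda>x. f (snd x) (fst x)) \<in> borel_measurable (N \<Otimes>\<^sub>M CS)"
    by (rule measurable_compose_countable'[where f = "\<lambda>q x. f q (fst x)" and g = snd and I = UNIV]) auto
  then have m: "(\<lambda>(s, q). f q s) \<in> borel_measurable (N \<Otimes>\<^sub>M CS)" by (simp add: case_prod_beta')
  interpret sigma_finite_measure "CS" by (rule sigma_finite_measure_count_space)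
  from m show ?thesis by (rule borel_measurable_lebesgue_integral)
qed

lemma integrable_csum_iff:
  fixes f :: "int \<Rightarrow> 'c::{banach, second_countable_topology}"
  shows "integrable CS f \<longleftrightarrow> (\<integral>\<^sup>+q. norm (f q) \<partial>CS) < \<infinity>"
  by (simp add: integrable_iff_bounded)

lemma csum_norm_le:
  fixes f :: "int \<Rightarrow> 'c::{banach, second_countable_topology}"
  shows "ennreal (norm (LINT q|CS. f q)) \<le> (\<integral>\<^sup>+q. norm (f q) \<partial>CS)"
  by (cases "integrable CS f") (auto intro: integral_norm_bound_ennreal simp: not_integrable_integral_eq)

text \<open>The sum of the norms, integrable by Tonelli, dominates all partial sums, so dominated
  convergence moves the integral through their limit.\<close>

lemma csum_integral_swap:
  fixes f :: "int \<Rightarrow> 'b \<Rightarrow> 'c::{banach, second_countable_topology}"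
  assumes m [measurable]: "\<And>q. f q \<in> borel_measurable N"
    and fin: "(\<integral>\<^sup>+q. \<integral>\<^sup>+s. norm (f q s) \<partial>N \<partial>CS) < \<infinity>"
  shows "integrable N (\<lambda>s. LINT q|CS. f q s)"
    and "AE s in N. integrable CS (\<lambda>q. f q s)"
    and "integrable CS (\<lambda>q. LINT s|N. f q s)"
    and "(LINT q|CS. LINT s|N. f q s) = (LINT s|N. LINT q|CS. f q s)"
proof -
  define w where "w = (\<lambda>s. \<integral>\<^sup>+q. norm (f q s) \<partial>CS)"
  have wm [measurable]: "w \<in> borel_measurable N" unfolding w_def by measurable
  have wi: "(\<integral>\<^sup>+s. w s \<partial>N) = (\<integral>\<^sup>+q. \<integral>\<^sup>+s. norm (f q s) \<partial>N \<partial>CS)"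
    unfolding w_def by (rule nn_integral_count_space_nn_integral) auto
  have wfin: "AE s in N. w s \<noteq> \<infinity>"
    by (rule nn_integral_PInf_AE) (use fin wi in auto)
  then show AEi: "AE s in N. integrable CS (\<lambda>q. f q s)"
    by eventually_elim (simp add: integrable_csum_iff w_def less_top[symmetric])
  have "integrable N (\<lambda>s. enn2real (w s))"
  proof (rule integrableI_bounded)
    have "(\<integral>\<^sup>+s. ennreal (norm (enn2real (w s))) \<partial>N) = (\<integral>\<^sup>+s. w s \<partial>N)"
      by (rule nn_integral_cong_AE) (use wfin in eventually_elim, auto simp: less_top)
    then show "(\<integral>\<^sup>+s. ennreal (norm (enn2real (w s))) \<partial>N) < \<infinity>" using wi fin by simp
  qed simp
  note W = this
  have bound: "AE s in N. norm (LINT q|CS. f q s) \<le> enn2real (w s)"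
    using wfin
  proof eventually_elim
    case (elim s)
    have "ennreal (norm (LINT q|CS. f q s)) \<le> w s" unfolding w_def by (rule csum_norm_le)
    then show ?case using elim by (metis enn2real_ennreal enn2real_mono infinity_ennreal_def norm_ge_zero top.not_eq_extremum)
  qed
  show int: "integrable N (\<lambda>s. LINT q|CS. f q s)"
    by (rule Bochner_Integration.integrable_bound[OF W]) (use bound in \<open>auto elim!: eventually_mono intro: order_trans[OF _ abs_ge_self]\<close>)
  have fi: "integrable N (f q)" for q
  proof (rule integrableI_bounded)
    have "(\<integral>\<^sup>+s. norm (f q s) \<partial>N) \<le> (\<integral>\<^sup>+s. w s \<partial>N)"
      unfolding w_def by (rule nn_integral_mono, rule nn_integral_ge_point[where p = "\<lambda>q. ennreal (norm (f q _))"]) simp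
    then show "(\<integral>\<^sup>+s. ennreal (norm (f q s)) \<partial>N) < \<infinity>" using wi fin by (simp add: order_le_less_trans)
  qed simp
  show ci: "integrable CS (\<lambda>q. LINT s|N. f q s)"
    unfolding integrable_csum_iff
    by (rule order_le_less_trans[OF nn_integral_mono fin]) (rule integral_norm_bound_ennreal[OF fi])
  have "(\<lambda>K. LINT s|N. (\<Sum>q\<in>{- int K..int K}. f q s)) \<longlonglongrightarrow> (LINT s|N. LINT q|CS. f q s)"
  proof (rule integral_dominated_convergence[OF _ _ W])
    show "AE s in N. (\<lambda>K. \<Sum>q\<in>{- int K..int K}. f q s) \<longlonglongrightarrow> (LINT q|CS. f q s)"
      using AEi by eventually_elim (rule csum_lim)
    show "AE s in N. norm (\<Sum>q\<in>{- int K..int K}. f q s) \<le> enn2real (w s)" for K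
      using wfin AEi
    proof eventually_elim
      case (elim s)
      have "norm (\<Sum>q\<in>{- int K..int K}. f q s) \<le> (\<Sum>q\<in>{- int K..int K}. norm (f q s))" by (rule norm_sum)
      also have "\<dots> \<le> (LINT q|CS. norm (f q s))"
        by (rule cseq_lim_nn) (use elim(2) in auto)
      also have "\<dots> = enn2real (w s)"
        unfolding w_def using elim(2) by (simp add: integral_eq_nn_integral)
      finally show ?case .
    qed
  qed auto
  moreover have "(LINT s|N. (\<Sum>q\<in>{- int K..int K}. f q s)) = (\<Sum>q\<in>{- int K..int K}. LINT s|N. f q s)" for K
    by (rule Bochner_Integration.integral_sum[OF fi])
  ultimately show "(LINT q|CS. LINT s|N. f q s) = (LINT s|N. LINT q|CS. f q s)"
    using csum_lim[OF ci] LIMSEQ_unique by simp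
qed

definition csum2 :: "(int \<Rightarrow> int \<Rightarrow> complex) \<Rightarrow> complex" where
  "csum2 f = (LINT p|CS. LINT q|CS. f p q)"

text \<open>Absolute summability over pairs. The cubic interactions of an L2 solution are known only
  as iterated sums, but after division by \<open>p * q\<close> they have this property.\<close>

definition csum2able :: "(int \<Rightarrow> int \<Rightarrow> complex) \<Rightarrow> bool" where
  "csum2able f \<longleftrightarrow> (\<integral>\<^sup>+p. \<integral>\<^sup>+q. norm (f p q) \<partial>CS \<partial>CS) < \<infinity>"

lemma csum2able_inner:
  assumes "csum2able f" shows "integrable CS (f p)" "integrable CS (\<lambda>p. LINT q|CS. f p q)"
proof -
  have "(\<integral>\<^sup>+q. norm (f p q) \<partial>CS) \<le> (\<integral>\<^sup>+p. \<integral>\<^sup>+q. norm (f p q) \<partial>CS \<partial>CS)"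
    by (rule nn_integral_ge_point[where p = "\<lambda>p. \<integral>\<^sup>+q. norm (f p q) \<partial>CS"]) simp
  then show "integrable CS (f p)" using assms by (simp add: integrable_csum_iff csum2able_def order_le_less_trans)
  have "(\<integral>\<^sup>+p. norm (LINT q|CS. f p q) \<partial>CS) \<le> (\<integral>\<^sup>+p. \<integral>\<^sup>+q. norm (f p q) \<partial>CS \<partial>CS)"
    by (rule nn_integral_mono, rule csum_norm_le)
  then show "integrable CS (\<lambda>p. LINT q|CS. f p q)"
    using assms by (simp add: integrable_csum_iff csum2able_def order_le_less_trans)
qed

lemma csum2_norm_le: "ennreal (norm (csum2 f)) \<le> (\<integral>\<^sup>+p. \<integral>\<^sup>+q. norm (f p q) \<partial>CS \<partial>CS)"
  unfolding csum2_def by (rule order_trans[OF csum_norm_le], rule nn_integral_mono, rule csum_norm_le)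

lemma csum2_diff:
  assumes "csum2able f" "csum2able g"
  shows "csum2able (\<lambda>p q. f p q - g p q)" "csum2 (\<lambda>p q. f p q - g p q) = csum2 f - csum2 g"
proof -
  show "csum2 (\<lambda>p q. f p q - g p q) = csum2 f - csum2 g"
    unfolding csum2_def by (simp add: csum2able_inner assms)
  have "(\<integral>\<^sup>+p. \<integral>\<^sup>+q. norm (f p q - g p q) \<partial>CS \<partial>CS) \<le> (\<integral>\<^sup>+p. \<integral>\<^sup>+q. ennreal (norm (f p q)) + ennreal (norm (g p q)) \<partial>CS \<partial>CS)"
    by (intro nn_integral_mono) (simp add: norm_triangle_ineq4 flip: ennreal_plus)
  also have "\<dots> = (\<integral>\<^sup>+p. \<integral>\<^sup>+q. norm (f p q) \<partial>CS \<partial>CS) + (\<integral>\<^sup>+p. \<integral>\<^sup>+q. norm (g p q) \<partial>CS \<partial>CS)"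
    by (simp add: nn_integral_add)
  finally show "csum2able (\<lambda>p q. f p q - g p q)"
    using assms unfolding csum2able_def by (simp add: order_le_less_trans)
qed

lemma csum2_integral_swap:
  fixes f :: "int \<Rightarrow> int \<Rightarrow> 'b \<Rightarrow> complex"
  assumes m [measurable]: "\<And>p q. f p q \<in> borel_measurable N"
    and fin: "(\<integral>\<^sup>+s. \<integral>\<^sup>+p. \<integral>\<^sup>+q. norm (f p q s) \<partial>CS \<partial>CS \<partial>N) < \<infinity>"
  shows "integrable N (\<lambda>s. csum2 (\<lambda>p q. f p q s))"
    and "csum2able (\<lambda>p q. LINT s|N. f p q s)"
    and "csum2 (\<lambda>p q. LINT s|N. f p q s) = (LINT s|N. csum2 (\<lambda>p q. f p q s))"
proof -
  have eq1: "(\<integral>\<^sup>+s. \<integral>\<^sup>+p. \<integral>\<^sup>+q. norm (f p q s) \<partial>CS \<partial>CS \<partial>N) = (\<integral>\<^sup>+p. \<integral>\<^sup>+s. \<integral>\<^sup>+q. norm (f p q s) \<partial>CS \<partial>N \<partial>CS)"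
    by (rule nn_integral_count_space_nn_integral) auto
  also have "\<dots> = (\<integral>\<^sup>+p. \<integral>\<^sup>+q. \<integral>\<^sup>+s. norm (f p q s) \<partial>N \<partial>CS \<partial>CS)"
    by (rule nn_integral_cong, rule nn_integral_count_space_nn_integral) auto
  finally have eq2: "(\<integral>\<^sup>+s. \<integral>\<^sup>+p. \<integral>\<^sup>+q. norm (f p q s) \<partial>CS \<partial>CS \<partial>N) = (\<integral>\<^sup>+p. \<integral>\<^sup>+q. \<integral>\<^sup>+s. norm (f p q s) \<partial>N \<partial>CS \<partial>CS)" .
  have inner: "(\<integral>\<^sup>+q. \<integral>\<^sup>+s. norm (f p q s) \<partial>N \<partial>CS) < \<infinity>" for p
    by (rule order_le_less_trans[OF nn_integral_ge_point[where p = "\<lambda>p. \<integral>\<^sup>+q. \<integral>\<^sup>+s. norm (f p q s) \<partial>N \<partial>CS"] fin[unfolded eq2]]) simp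
  note sw = csum_integral_swap[OF m inner]
  have outer: "(\<integral>\<^sup>+p. \<integral>\<^sup>+s. norm (LINT q|CS. f p q s) \<partial>N \<partial>CS) < \<infinity>"
    using fin unfolding eq1
    by (rule order_le_less_trans[rotated]) (intro nn_integral_mono csum_norm_le)
  have mo: "(\<lambda>s. LINT q|CS. f p q s) \<in> borel_measurable N" for p by measurable
  note sw2 = csum_integral_swap[OF mo outer]
  show "integrable N (\<lambda>s. csum2 (\<lambda>p q. f p q s))" unfolding csum2_def by (rule sw2(1))
  show "csum2 (\<lambda>p q. LINT s|N. f p q s) = (LINT s|N. csum2 (\<lambda>p q. f p q s))"
    unfolding csum2_def by (simp only: sw(4) sw2(4))
  have fi: "integrable N (f p q)" for p q
  proof (rule integrableI_bounded)
    have "(\<integral>\<^sup>+s. norm (f p q s) \<partial>N) \<le> (\<integral>\<^sup>+q. \<integral>\<^sup>+s. norm (f p q s) \<partial>N \<partial>CS)"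
      by (rule nn_integral_ge_point[where p = "\<lambda>q. \<integral>\<^sup>+s. norm (f p q s) \<partial>N"]) simp
    then show "(\<integral>\<^sup>+s. norm (f p q s) \<partial>N) < \<infinity>" using inner[of p] by (simp add: order_le_less_trans)
  qed simp
  show "csum2able (\<lambda>p q. LINT s|N. f p q s)"
    unfolding csum2able_def using fin unfolding eq2
    by (rule order_le_less_trans[rotated]) (intro nn_integral_mono integral_norm_bound_ennreal fi)
qed

section \<open>Absolutely continuous functions\<close>

lemma set_lebesgue_integral_split:
  fixes f :: "real \<Rightarrow> complex"
  assumes "set_integrable lborel {a..b} f" "a \<le> r" "r \<le> t" "t \<le> b"
  shows "(LINT s:{a..t}|lborel. f s) = (LINT s:{a..r}|lborel. f s) + (LINT s:{r..t}|lborel. f s)"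
proof -
  have i: "set_integrable lborel {a..r} f" "set_integrable lborel {r<..t} f"
    by (rule set_integrable_subset[OF assms(1)]; use assms in auto)+
  have "(LINT s:{a..r} \<union> {r<..t}|lborel. f s) = (LINT s:{a..r}|lborel. f s) + (LINT s:{r<..t}|lborel. f s)"
    by (rule set_integral_Un) (use i in auto)
  moreover have "{a..r} \<union> {r<..t} = {a..t}" using assms by auto
  moreover have "(LINT s:{r<..t}|lborel. f s) = (LINT s:{r..t}|lborel. f s)"
    unfolding set_lebesgue_integral_def
  proof (rule integral_cong_AE)
    show "AE x in lborel. indicator {r<..t} x *\<^sub>R f x = indicator {r..t} x *\<^sub>R f x"
      using AE_lborel_singleton[of r] by eventually_elim (auto simp: indicator_def)
    have "set_integrable lborel {r..t} f"
      by (rule set_integrable_subset[OF assms(1)]) (use assms in auto)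
    then show "(\<lambda>x. indicator {r<..t} x *\<^sub>R f x) \<in> borel_measurable lborel"
      "(\<lambda>x. indicator {r..t} x *\<^sub>R f x) \<in> borel_measurable lborel"
      using i(2) unfolding set_integrable_def by (auto dest: borel_measurable_integrable)
  qed
  ultimately show ?thesis by simp
qed

text \<open>The double integral of the product of the two densities is split along the diagonal.\<close>

lemma AC_product:
  fixes f g f' g' :: "real \<Rightarrow> complex"
  assumes ab: "a \<le> b" and f': "set_integrable lborel {a..b} f'" and g': "set_integrable lborel {a..b} g'"
    and f: "\<And>t. t \<in> {a..b} \<Longrightarrow> f t = f a + (LINT s:{a..t}|lborel. f' s)"
    and g: "\<And>t. t \<in> {a..b} \<Longrightarrow> g t = g a + (LINT s:{a..t}|lborel. g' s)"
  shows "set_integrable lborel {a..b} (\<lambda>s. f' s * g s + f s * g' s)"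
    and "f b * g b = f a * g a + (LINT s:{a..b}|lborel. f' s * g s + f s * g' s)"
proof -
  define F where "F = (\<lambda>s. indicator {a..b} s *\<^sub>R f' s)"
  define G where "G = (\<lambda>s. indicator {a..b} s *\<^sub>R g' s)"
  have Fi [simp]: "integrable lborel F" and Gi [simp]: "integrable lborel G"
    using f' g' by (auto simp: F_def G_def set_integrable_def)
  have [measurable]: "F \<in> borel_measurable borel" "G \<in> borel_measurable borel"
    using borel_measurable_integrable[OF Fi] borel_measurable_integrable[OF Gi] by auto
  have fF: "f s = f a + (LINT r|lborel. (if r \<le> s then F r else 0))" if "s \<in> {a..b}" for s
    unfolding f[OF that] set_lebesgue_integral_def F_def
    by (rule arg_cong[of _ _ "\<lambda>z. f a + z"], rule Bochner_Integration.integral_cong) (use that in \<open>auto simp: indicator_def\<close>)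
  have gG: "g s = g a + (LINT r|lborel. (if r \<le> s then G r else 0))" if "s \<in> {a..b}" for s
    unfolding g[OF that] set_lebesgue_integral_def G_def
    by (rule arg_cong[of _ _ "\<lambda>z. g a + z"], rule Bochner_Integration.integral_cong) (use that in \<open>auto simp: indicator_def\<close>)
  have FG: "integrable (lborel \<Otimes>\<^sub>M lborel) (\<lambda>(s, r). F s * G r)"
  proof (rule lborel_pair.Fubini_integrable)
    show "integrable lborel (\<lambda>x. LINT y|lborel. norm (case (x, y) of (s, r) \<Rightarrow> F s * G r))"
      by (simp add: norm_mult)
  qed (auto intro!: AE_I2)
  have J1: "integrable (lborel \<Otimes>\<^sub>M lborel) (\<lambda>(s, r). F s * (if r \<le> s then G r else 0))"
    by (rule Bochner_Integration.integrable_bound[OF FG]) (auto simp: norm_mult)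
  have J2: "integrable (lborel \<Otimes>\<^sub>M lborel) (\<lambda>(s, r). F s * (if s \<le> r then G r else 0))"
    by (rule Bochner_Integration.integrable_bound[OF FG]) (auto simp: norm_mult)
  \<comment> \<open>The two triangles on either side of the diagonal, each integrated over the
    variable that makes it a density on the line.\<close>
  define I1 where "I1 = (\<lambda>s. LINT r|lborel. F s * (if r \<le> s then G r else 0))"
  define I2 where "I2 = (\<lambda>r. LINT s|lborel. F s * (if s \<le> r then G r else 0))"
  have I1i: "integrable lborel I1" unfolding I1_def using lborel_pair.integrable_fst'[OF J1] by (simp only: case_prod_conv)
  have I2i: "integrable lborel I2" unfolding I2_def by (rule lborel_pair.integrable_snd[OF J2])
  have pt1: "indicator {a..b} s *\<^sub>R (f' s * g s) = g a * F s + I1 s" for s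
  proof (cases "s \<in> {a..b}")
    case True
    have "I1 s = F s * (LINT r|lborel. (if r \<le> s then G r else 0))" unfolding I1_def by (rule integral_mult_right_zero)
    then show ?thesis using True gG[OF True] by (simp add: F_def distrib_left)
  next
    case False
    then have "F s = 0" by (simp add: F_def)
    then show ?thesis using False by (simp add: I1_def)
  qed
  have pt2: "indicator {a..b} s *\<^sub>R (f s * g' s) = f a * G s + I2 s" for s
  proof (cases "s \<in> {a..b}")
    case True
    have "I2 s = (LINT r|lborel. (if r \<le> s then F r else 0) * G s)"
      unfolding I2_def by (rule Bochner_Integration.integral_cong) auto
    also have "\<dots> = (LINT r|lborel. (if r \<le> s then F r else 0)) * G s" by (rule integral_mult_left_zero)
    finally show ?thesis using True fF[OF True] by (simp add: G_def distrib_right)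
  next
    case False
    then have "G s = 0" by (simp add: G_def)
    then show ?thesis using False by (simp add: I2_def cong: if_cong)
  qed
  have pt: "indicator {a..b} s *\<^sub>R (f' s * g s + f s * g' s) = g a * F s + I1 s + (f a * G s + I2 s)" for s
    by (simp only: scaleR_add_right pt1 pt2)
  show "set_integrable lborel {a..b} (\<lambda>s. f' s * g s + f s * g' s)"
    unfolding set_integrable_def pt using I1i I2i by simp
  have "(LINT s|lborel. I2 s) = (LINT s|lborel. LINT r|lborel. F s * (if s \<le> r then G r else 0))"
    unfolding I2_def by (rule lborel_pair.Fubini_integral[OF J2])
  moreover have "(LINT s|lborel. I1 s) = (LINT s|lborel. LINT r|lborel. F s * (if r \<le> s then G r else 0))"
    unfolding I1_def ..
  moreover have "(LINT s|lborel. LINT r|lborel. F s * (if r \<le> s then G r else 0))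
     + (LINT s|lborel. LINT r|lborel. F s * (if s \<le> r then G r else 0)) = (LINT s|lborel. F s * (LINT r|lborel. G r))"
  proof -
    have Gs: "integrable lborel (\<lambda>r. if r \<le> s then G r else 0)" "integrable lborel (\<lambda>r. if s \<le> r then G r else 0)" for s
      by (rule Bochner_Integration.integrable_bound[OF Gi]; auto)+
    have "(LINT r|lborel. (if r \<le> s then G r else 0)) + (LINT r|lborel. (if s \<le> r then G r else 0)) = (LINT r|lborel. G r)" for s
    proof -
      have "(LINT r|lborel. (if r \<le> s then G r else 0)) + (LINT r|lborel. (if s \<le> r then G r else 0))
        = (LINT r|lborel. (if r \<le> s then G r else 0) + (if s \<le> r then G r else 0))"
        using Gs by simp
      also have "\<dots> = (LINT r|lborel. G r)"
      proof (rule integral_cong_AE)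
        show "AE r in lborel. (if r \<le> s then G r else 0) + (if s \<le> r then G r else 0) = G r"
          using AE_lborel_singleton[of s] by eventually_elim auto
      qed auto
      finally show ?thesis .
    qed
    then have "(LINT r|lborel. F s * (if r \<le> s then G r else 0)) + (LINT r|lborel. F s * (if s \<le> r then G r else 0)) = F s * (LINT r|lborel. G r)" for s
      by (simp only: integral_mult_right_zero distrib_left[symmetric])
    moreover have "integrable lborel (\<lambda>s. LINT r|lborel. F s * (if r \<le> s then G r else 0))"
      "integrable lborel (\<lambda>s. LINT r|lborel. F s * (if s \<le> r then G r else 0))"
      using lborel_pair.integrable_fst'[OF J1] lborel_pair.integrable_fst'[OF J2] by (simp_all only: case_prod_conv)
    ultimately show ?thesis by (subst Bochner_Integration.integral_add[symmetric]) auto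
  qed
  ultimately have dbl: "(LINT s|lborel. I1 s) + (LINT s|lborel. I2 s) = (LINT s|lborel. F s) * (LINT s|lborel. G s)"
    by simp
  have "(LINT s:{a..b}|lborel. f' s * g s + f s * g' s) = g a * (LINT s|lborel. F s) + f a * (LINT s|lborel. G s) + (LINT s|lborel. F s) * (LINT s|lborel. G s)"
    unfolding set_lebesgue_integral_def pt using I1i I2i dbl by simp
  moreover have "f b = f a + (LINT s|lborel. F s)" "g b = g a + (LINT s|lborel. G s)"
    using f[of b] g[of b] ab by (auto simp: set_lebesgue_integral_def F_def G_def)
  ultimately show "f b * g b = f a * g a + (LINT s:{a..b}|lborel. f' s * g s + f s * g' s)"
    by (simp add: algebra_simps)
qed

lemma AC_product':
  fixes f g f' g' :: "real \<Rightarrow> complex"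
  assumes f': "set_integrable lborel {a..b} f'" and g': "set_integrable lborel {a..b} g'"
    and f: "\<And>t. t \<in> {a..b} \<Longrightarrow> f t = f a + (LINT s:{a..t}|lborel. f' s)"
    and g: "\<And>t. t \<in> {a..b} \<Longrightarrow> g t = g a + (LINT s:{a..t}|lborel. g' s)"
    and t: "t \<in> {a..b}"
  shows "f t * g t = f a * g a + (LINT s:{a..t}|lborel. f' s * g s + f s * g' s)"
proof (rule AC_product(2))
  show "set_integrable lborel {a..t} f'" by (rule set_integrable_subset[OF f']) (use t in auto)
  show "set_integrable lborel {a..t} g'" by (rule set_integrable_subset[OF g']) (use t in auto)
  show "a \<le> t" using t by simp
  show "f s = f a + (LINT s:{a..s}|lborel. f' s)" if "s \<in> {a..t}" for s by (rule f) (use that t in auto)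
  show "g s = g a + (LINT s:{a..s}|lborel. g' s)" if "s \<in> {a..t}" for s by (rule g) (use that t in auto)
qed

text \<open>Absolute continuity with the density as part of the data. The cubic term that drives the
  modes is merely integrable in time, so the calculus is done with densities instead of pointwise
  derivatives.\<close>

definition AC_on :: "real \<Rightarrow> real \<Rightarrow> (real \<Rightarrow> complex) \<Rightarrow> (real \<Rightarrow> complex) \<Rightarrow> bool" where
  "AC_on a b f f' \<longleftrightarrow> set_integrable lborel {a..b} f' \<and>
     (\<forall>t\<in>{a..b}. f t = f a + (LINT s:{a..t}|lborel. f' s))"

lemma AC_on_int: "AC_on a b f f' \<Longrightarrow> set_integrable lborel {a..b} f'"
  unfolding AC_on_def by (rule conjunct1)

lemma AC_on_eq: "AC_on a b f f' \<Longrightarrow> t \<in> {a..b} \<Longrightarrow> f t = f a + (LINT s:{a..t}|lborel. f' s)"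
  unfolding AC_on_def by (drule conjunct2) (rule bspec)

lemma AC_onI:
  "set_integrable lborel {a..b} f' \<Longrightarrow> (\<And>t. t \<in> {a..b} \<Longrightarrow> f t = f a + (LINT s:{a..t}|lborel. f' s)) \<Longrightarrow> AC_on a b f f'"
  unfolding AC_on_def by (rule conjI) (assumption, rule ballI)

lemma AC_on_mult:
  assumes "AC_on a b f f'" "AC_on a b g g'" "a \<le> b"
  shows "AC_on a b (\<lambda>s. f s * g s) (\<lambda>s. f' s * g s + f s * g' s)"
proof (rule AC_onI)
  show "set_integrable lborel {a..b} (\<lambda>s. f' s * g s + f s * g' s)"
    by (rule AC_product(1)[OF assms(3) AC_on_int[OF assms(1)] AC_on_int[OF assms(2)]])
      (rule AC_on_eq[OF assms(1)], assumption, rule AC_on_eq[OF assms(2)])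
  show "f t * g t = f a * g a + (LINT s:{a..t}|lborel. f' s * g s + f s * g' s)" if "t \<in> {a..b}" for t
    by (rule AC_product'[OF AC_on_int[OF assms(1)] AC_on_int[OF assms(2)] _ _ that])
      (rule AC_on_eq[OF assms(1)], assumption, rule AC_on_eq[OF assms(2)])
qed

lemma AC_on_cnj:
  assumes "AC_on a b f f'" shows "AC_on a b (\<lambda>s. cnj (f s)) (\<lambda>s. cnj (f' s))"
proof -
  have e: "indicator A s *\<^sub>R cnj (f' s) = cnj (indicator A s *\<^sub>R f' s)" for A s by (simp add: indicator_def)
  show ?thesis
  proof (rule AC_onI)
    show "set_integrable lborel {a..b} (\<lambda>s. cnj (f' s))"
      unfolding set_integrable_def e
      by (rule integrable_cnj) (use AC_on_int[OF assms] in \<open>simp add: set_integrable_def\<close>)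
    fix t assume t: "t \<in> {a..b}"
    show "cnj (f t) = cnj (f a) + (LINT s:{a..t}|lborel. cnj (f' s))"
      unfolding set_lebesgue_integral_def e Bochner_Integration.integral_cnj
      by (subst AC_on_eq[OF assms t]) (simp only: complex_cnj_add set_lebesgue_integral_def)
  qed
qed

lemma AC_on_subinterval:
  assumes "AC_on a b f f'" "a \<le> r" "r \<le> t" "t \<le> b"
  shows "AC_on r t f f'"
proof (rule AC_onI)
  show "set_integrable lborel {r..t} f'"
    by (rule set_integrable_subset[OF AC_on_int[OF assms(1)]]) (use assms in auto)
  show "f s = f r + (LINT s:{r..s}|lborel. f' s)" if s: "s \<in> {r..t}" for s
  proof -
    have "f s = f a + (LINT s:{a..s}|lborel. f' s)" "f r = f a + (LINT s:{a..r}|lborel. f' s)"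
      by (rule AC_on_eq[OF assms(1)]; use assms s in auto)+
    moreover have "(LINT s:{a..s}|lborel. f' s) = (LINT s:{a..r}|lborel. f' s) + (LINT s:{r..s}|lborel. f' s)"
      by (rule set_lebesgue_integral_split[OF AC_on_int[OF assms(1)]]) (use assms s in auto)
    ultimately show ?thesis by simp
  qed
qed

lemma AC_on_C1:
  assumes "\<And>t. t \<in> {a..b} \<Longrightarrow> (f has_vector_derivative f' t) (at t within {a..b})" "continuous_on {a..b} f'"
  shows "AC_on a b f f'"
proof (rule AC_onI)
  show "set_integrable lborel {a..b} f'"
    by (rule borel_integrable_atLeastAtMost'[OF assms(2)])
  fix t assume t: "t \<in> {a..b}"
  have "(LINT s:{a..t}|lborel. f' s) = f t - f a"
    unfolding set_lebesgue_integral_def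
  proof (rule integral_FTC_atLeastAtMost)
    show "(f has_vector_derivative f' x) (at x within {a..t})" if "a \<le> x" "x \<le> t" for x
      by (rule has_vector_derivative_within_subset[OF assms(1)]) (use that t in auto)
    show "continuous_on {a..t} f'" by (rule continuous_on_subset[OF assms(2)]) (use t in auto)
  qed (use t in auto)
  then show "f t = f a + (LINT s:{a..t}|lborel. f' s)" by simp
qed

lemma AC_on_continuous:
  assumes "AC_on a b f f'" shows "continuous_on {a..b} f"
proof -
  have "f' integrable_on {a..b}"
    by (rule set_borel_integral_eq_integral(1)[OF AC_on_int[OF assms]])
  then have c: "continuous_on {a..b} (\<lambda>t. f a + integral {a..t} f')"
    by (intro continuous_intros indefinite_integral_continuous_1)
  show ?thesis
  proof (rule continuous_on_eq[OF c])
    fix t assume t: "t \<in> {a..b}"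
    have "set_integrable lborel {a..t} f'"
      by (rule set_integrable_subset[OF AC_on_int[OF assms]]) (use t in auto)
    from set_borel_integral_eq_integral(2)[OF this]
    show "f a + integral {a..t} f' = f t" using AC_on_eq[OF assms t] by simp
  qed
qed

section \<open>Time intervals as finite measure spaces\<close>

abbreviation (input) "IM r t \<equiv> restrict_space lborel {r..t::real}"

lemma set_integral_IM:
  fixes f :: "real \<Rightarrow> 'b::{banach, second_countable_topology}"
  shows "(LINT s:{r..t}|lborel. f s) = (LINT s|IM r t. f s)"
    and "set_integrable lborel {r..t} f \<longleftrightarrow> integrable (IM r t) f"
  by (simp_all add: set_lebesgue_integral_def set_integrable_def integral_restrict_space integrable_restrict_space)

lemma finite_measure_IM: "finite_measure (IM r t)"
  by (rule finite_measureI) (simp add: emeasure_restrict_space space_restrict_space emeasure_lborel_Icc_eq)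

lemma space_IM [simp]: "space (IM r t) = {r..t}" by (simp add: space_restrict_space)

lemma AE_IM: "(AE s in IM r t. P s) \<longleftrightarrow> (AE s in lborel. s \<in> {r..t} \<longrightarrow> P s)"
  by (rule AE_restrict_space_iff) simp

lemma continuous_on_measurable_IM:
  fixes f :: "real \<Rightarrow> 'b::topological_space"
  assumes "continuous_on {r..t} f" shows "f \<in> borel_measurable (IM r t)"
proof -
  have "f \<in> borel_measurable (restrict_space borel {r..t})"
    by (rule borel_measurable_continuous_on_restrict[OF assms])
  moreover have "sets (restrict_space borel {r..t}) = sets (IM r t)" by (simp add: sets_restrict_space)
  ultimately show ?thesis using measurable_cong_sets by blast
qed

section \<open>The normal form of a cubic mode system\<close>

text \<open>The form \<open>Lam\<close> with its first vertex fixed at \<open>k\<close>.\<close>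

definition Lam3 :: "int \<Rightarrow> (int \<Rightarrow> ennreal) \<Rightarrow> (int \<Rightarrow> ennreal) \<Rightarrow> (int \<Rightarrow> ennreal) \<Rightarrow> ennreal" where
  "Lam3 k w1 w2 w3 = (\<integral>\<^sup>+p. \<integral>\<^sup>+q. ennreal (1 / (\<bar>of_int p\<bar> * \<bar>of_int q\<bar>)) * (w1 (k - q) * w2 (k - p - q) * w3 (k - p)) \<partial>CS \<partial>CS)"

lemma Lam_Lam3: "Lam w0 w1 w2 w3 = (\<integral>\<^sup>+k. w0 k * Lam3 k w1 w2 w3 \<partial>CS)"
  unfolding Lam_def Lam3_def by (simp add: mult_ac flip: nn_integral_cmult)

text \<open>Fixing a vertex is testing with a unit sequence, whose supremum and square sum are both
  1. Bounds of \<open>Lam\<close> thus become bounds for each single mode.\<close>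

lemma Lam_delta: "Lam (\<lambda>j. if j = k then 1 else 0) w1 w2 w3 = Lam3 k w1 w2 w3"
proof -
  have "(\<integral>\<^sup>+j. (if j = k then 1 else 0) * Lam3 j w1 w2 w3 \<partial>CS) = (\<integral>\<^sup>+j. Lam3 k w1 w2 w3 * indicator {k} j \<partial>CS)"
    by (rule nn_integral_cong) auto
  then show ?thesis unfolding Lam_Lam3 by simp
qed

lemma delta_l2: "(\<integral>\<^sup>+j. (if j = (k::int) then 1 else 0 :: ennreal)\<^sup>2 \<partial>CS) \<le> ennreal (1\<^sup>2)"
proof -
  have "(\<integral>\<^sup>+j. (if j = (k::int) then 1 else 0 :: ennreal)\<^sup>2 \<partial>CS) = (\<integral>\<^sup>+j. indicator {k} j \<partial>CS)"
    by (rule nn_integral_cong) auto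
  then show ?thesis by simp
qed

lemma l2_product_sum:
  fixes x y :: "int \<Rightarrow> ennreal"
  assumes "(\<integral>\<^sup>+k. (x k)\<^sup>2 \<partial>CS) \<le> ennreal (\<alpha>\<^sup>2)" "(\<integral>\<^sup>+k. (y k)\<^sup>2 \<partial>CS) \<le> ennreal (\<beta>\<^sup>2)" "\<alpha> \<ge> 0" "\<beta> \<ge> 0"
  shows "(\<integral>\<^sup>+k. x k * y k \<partial>CS) \<le> ennreal (\<alpha> * \<beta>)"
proof (rule ennreal_power2_le_imp_le)
  have "(\<integral>\<^sup>+k. x k * y k \<partial>CS)\<^sup>2 \<le> (\<integral>\<^sup>+k. (x k)\<^sup>2 \<partial>CS) * (\<integral>\<^sup>+k. (y k)\<^sup>2 \<partial>CS)"
    by (rule Cauchy_Schwarz_nn_integral) auto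
  also have "\<dots> \<le> ennreal (\<alpha>\<^sup>2) * ennreal (\<beta>\<^sup>2)" by (intro mult_mono assms) auto
  also have "\<dots> = (ennreal (\<alpha> * \<beta>))\<^sup>2" using assms by (simp add: ennreal_power power_mult_distrib ennreal_mult)
  finally show "(\<integral>\<^sup>+k. x k * y k \<partial>CS)\<^sup>2 \<le> (ennreal (\<alpha> * \<beta>))\<^sup>2" .
qed

lemma csum_delta:
  fixes x :: "'c::{banach, second_countable_topology}"
  shows "(LINT q|CS. (if q = j then x else 0)) = x" "integrable CS (\<lambda>q. if q = j then x else 0)"
proof -
  have e: "(if q = j then x else 0) = indicator {j} q *\<^sub>R x" for q by auto
  show "(LINT q|CS. (if q = j then x else 0)) = x" "integrable CS (\<lambda>q. if q = j then x else 0)"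
    unfolding e using csum_finite[of "{j}" "\<lambda>_. x"] by auto
qed

text \<open>What an L2 solution provides, in terms of its modes. \<open>a k\<close> is the mode with
  the free evolution removed, \<eta> the coupling and \<open>n k\<close> the cubic term; the phase
  2pq is k^2 - (k-q)^2 + (k-p-q)^2 - (k-p)^2. \<open>V p\<close> majorises the p-th Fourier
  coefficient of |u|^2, and its l2 bound \<open>W\<close> is only integrable in time, so bounds that
  contain the cubic term hold at almost every time.\<close>

locale cubic_modes =
  fixes \<eta> :: real and a n :: "int \<Rightarrow> real \<Rightarrow> complex" and V :: "int \<Rightarrow> real \<Rightarrow> real" and W :: "real \<Rightarrow> real" and T \<mu> :: real
  assumes T: "T \<ge> 0" and eta: "\<eta> \<ge> 0" and mu: "\<mu> \<ge> 0"
    and n_int: "\<And>k. set_integrable lborel {0..T} (n k)"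
    and AC: "\<And>k. AC_on 0 T (a k) (\<lambda>s. - (\<i> * of_real \<eta>) * n k s)"
    and mass: "\<And>s. s \<in> {0..T} \<Longrightarrow> (\<integral>\<^sup>+k. (ennreal (cmod (a k s)))\<^sup>2 \<partial>CS) \<le> ennreal (\<mu>\<^sup>2)"
    and W_int: "set_integrable lborel {0..T} W" and W_nonneg: "\<And>s. W s \<ge> 0" and V_nonneg: "\<And>p s. V p s \<ge> 0"
    and good: "AE s in IM 0 T. (\<integral>\<^sup>+p. (ennreal (V p s))\<^sup>2 \<partial>CS) \<le> ennreal ((W s)\<^sup>2) \<and>
      (\<forall>k. n k s = (LINT p|CS. (LINT q|CS. cis (2 * of_int p * of_int q * s) * a (k - q) s * cnj (a (k - p - q) s)) * a (k - p) s)) \<and>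
      (\<forall>p k. cmod (LINT q|CS. cis (2 * of_int p * of_int q * s) * a (k - q) s * cnj (a (k - p - q) s)) \<le> V p s)"
begin

definition good_time :: "real \<Rightarrow> bool" where
  "good_time s \<longleftrightarrow> s \<in> {0..T} \<and> (\<integral>\<^sup>+p. (ennreal (V p s))\<^sup>2 \<partial>CS) \<le> ennreal ((W s)\<^sup>2) \<and>
      (\<forall>k. n k s = (LINT p|CS. (LINT q|CS. cis (2 * of_int p * of_int q * s) * a (k - q) s * cnj (a (k - p - q) s)) * a (k - p) s)) \<and>
      (\<forall>p k. cmod (LINT q|CS. cis (2 * of_int p * of_int q * s) * a (k - q) s * cnj (a (k - p - q) s)) \<le> V p s)"

lemma AE_good: "0 \<le> r \<Longrightarrow> t \<le> T \<Longrightarrow> AE s in IM r t. good_time s"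
  using good unfolding AE_IM good_time_def by (auto elim!: eventually_mono)

abbreviation (input) "A s k \<equiv> ennreal (cmod (a k s))"
abbreviation (input) "N s k \<equiv> ennreal (cmod (n k s))"

lemma A_le: assumes "s \<in> {0..T}" shows "cmod (a k s) \<le> \<mu>"
proof -
  have "(A s k)\<^sup>2 \<le> (\<integral>\<^sup>+k. (A s k)\<^sup>2 \<partial>CS)" by (rule nn_integral_ge_point) simp
  also have "\<dots> \<le> ennreal (\<mu>\<^sup>2)" by (rule mass[OF assms])
  finally show ?thesis using mu by (simp add: ennreal_power power2_le_iff_abs_le)
qed

lemma mass_shift:
  assumes "s \<in> {0..T}"
  shows "(\<integral>\<^sup>+q. (A s (k - q))\<^sup>2 \<partial>CS) \<le> ennreal (\<mu>\<^sup>2)"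
  using mass[OF assms] nn_sum_shift(4)[of "\<lambda>q. (A s q)\<^sup>2" k] by simp

lemma pair_sum:
  assumes "s \<in> {0..T}"
  shows "(\<integral>\<^sup>+q. A s (k - q) * A s (j - q) \<partial>CS) \<le> ennreal (\<mu> * \<mu>)"
  by (rule l2_product_sum[OF mass_shift[OF assms] mass_shift[OF assms] mu mu])

text \<open>The inner sum is bounded by \<open>V p s\<close> uniformly in \<open>k\<close>, which
  leaves a convolution of \<open>V\<close> with the modes. Both the supremum bound of the cubic term
  and its dual estimate start from here.\<close>

lemma N_le_conv:
  assumes "good_time s"
  shows "N s k \<le> (\<integral>\<^sup>+p. ennreal (V p s) * A s (k - p) \<partial>CS)"
proof -
  have "N s k \<le> (\<integral>\<^sup>+p. norm ((LINT q|CS. cis (2 * of_int p * of_int q * s) * a (k - q) s * cnj (a (k - p - q) s)) * a (k - p) s) \<partial>CS)"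
    using assms csum_norm_le[of "\<lambda>p. (LINT q|CS. cis (2 * of_int p * of_int q * s) * a (k - q) s * cnj (a (k - p - q) s)) * a (k - p) s"]
    by (simp add: good_time_def)
  also have "\<dots> \<le> (\<integral>\<^sup>+p. ennreal (V p s) * A s (k - p) \<partial>CS)"
    by (rule nn_integral_mono) (use assms V_nonneg in \<open>auto simp: good_time_def norm_mult ennreal_mult intro!: mult_right_mono\<close>)
  finally show ?thesis .
qed

lemma N_le:
  assumes "good_time s"
  shows "cmod (n k s) \<le> W s * \<mu>"
proof -
  have s: "s \<in> {0..T}" using assms by (simp add: good_time_def)
  have "N s k \<le> (\<integral>\<^sup>+p. ennreal (V p s) * A s (k - p) \<partial>CS)" by (rule N_le_conv[OF assms])
  also have "\<dots> \<le> ennreal (W s * \<mu>)"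
    by (rule l2_product_sum[OF _ mass_shift[OF s] W_nonneg mu]) (use assms in \<open>simp add: good_time_def\<close>)
  finally show ?thesis using W_nonneg mu by simp
qed

section \<open>Boundary terms and quintic terms\<close>

definition cubic_term :: "int \<Rightarrow> int \<Rightarrow> int \<Rightarrow> real \<Rightarrow> complex" where
  "cubic_term k p q s = a (k - q) s * cnj (a (k - p - q) s) * a (k - p) s"

definition cubic_term_deriv :: "int \<Rightarrow> int \<Rightarrow> int \<Rightarrow> real \<Rightarrow> complex" where
  "cubic_term_deriv k p q s = (- (\<i> * of_real \<eta>) * n (k - q) s * cnj (a (k - p - q) s) + a (k - q) s * cnj (- (\<i> * of_real \<eta>) * n (k - p - q) s)) * a (k - p) s
     + a (k - q) s * cnj (a (k - p - q) s) * (- (\<i> * of_real \<eta>) * n (k - p) s)"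

text \<open>The resonant phases \<open>p * q = 0\<close> are removed by the convention \<open>x / 0 = 0\<close>.\<close>

definition ph :: "int \<Rightarrow> int \<Rightarrow> real \<Rightarrow> complex" where
  "ph p q s = cis (2 * of_int p * of_int q * s) / (2 * \<i> * of_int p * of_int q)"

definition tri :: "int \<Rightarrow> int \<Rightarrow> int \<Rightarrow> real \<Rightarrow> complex" where
  "tri k p q s = cis (2 * of_int p * of_int q * s) * cubic_term k p q s"

text \<open>\<open>Bk\<close> is the boundary term of the differentiation by parts.
  \<open>Qk\<close> is the term in which the derivative falls on the modes; it is quintic because
  the derivative of a mode is cubic.\<close>

definition Bk :: "int \<Rightarrow> real \<Rightarrow> complex" where "Bk k s = csum2 (\<lambda>p q. ph p q s * cubic_term k p q s)"
definition Qk :: "int \<Rightarrow> real \<Rightarrow> complex" where "Qk k s = csum2 (\<lambda>p q. ph p q s * cubic_term_deriv k p q s)"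
definition ms :: "real \<Rightarrow> real" where "ms s = (LINT q|CS. (cmod (a q s))\<^sup>2)"

lemma cubic_term_AC: "AC_on 0 T (cubic_term k p q) (cubic_term_deriv k p q)"
  using AC_on_mult[OF AC_on_mult[OF AC AC_on_cnj[OF AC] T] AC T, of "k - q" "k - p - q" "k - p"]
  unfolding cubic_term_def[abs_def] cubic_term_deriv_def[abs_def] by simp

lemma ph_AC:
  assumes "p \<noteq> 0" "q \<noteq> 0"
  shows "AC_on r t (ph p q) (\<lambda>s. cis (2 * of_int p * of_int q * s))"
proof (rule AC_on_C1)
  show "(ph p q has_vector_derivative cis (2 * of_int p * of_int q * s)) (at s within {r..t})" for s
  proof -
    have d: "((\<lambda>z. exp (\<i> * (2 * of_int p * of_int q * z)) / (2 * \<i> * of_int p * of_int q)) has_field_derivative exp (\<i> * (2 * of_int p * of_int q * of_real s)))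
        (at (of_real s) within of_real ` {r..t})"
      using assms by (auto intro!: derivative_eq_intros simp: complex_eq_iff field_simps)
    show ?thesis
      using field_vector_diff_chain_within[OF has_vector_derivative_of_real[OF DERIV_ident] d]
      by (simp add: o_def cis_conv_exp ph_def[abs_def])
  qed
  show "continuous_on {r..t} (\<lambda>s. cis (2 * of_int p * of_int q * s))" by (intro continuous_intros)
qed

text \<open>Since \<open>ph\<close> is a primitive of the oscillating phase, this is the product
  rule for \<open>ph\<close> times the cubic product. The gain is the factor
  \<open>1 / (p * q)\<close> in \<open>ph\<close>.\<close>

lemma oscillatory_by_parts:
  assumes pq: "p \<noteq> 0" "q \<noteq> 0" and r: "0 \<le> r" "r \<le> t" "t \<le> T"
  shows "integrable (IM r t) (\<lambda>s. ph p q s * cubic_term_deriv k p q s)"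
    and "(LINT s|IM r t. tri k p q s) = ph p q t * cubic_term k p q t - ph p q r * cubic_term k p q r - (LINT s|IM r t. ph p q s * cubic_term_deriv k p q s)"
proof -
  have 1: "AC_on r t (cubic_term k p q) (cubic_term_deriv k p q)" by (rule AC_on_subinterval[OF cubic_term_AC r])
  have ct: "continuous_on {r..t} (tri k p q)"
    unfolding tri_def[abs_def] by (intro continuous_intros AC_on_continuous[OF 1])
  have it: "set_integrable lborel {r..t} (tri k p q)" by (rule borel_integrable_atLeastAtMost'[OF ct])
  note 2 = AC_on_mult[OF ph_AC[OF pq] 1 r(2)]
  have sum: "set_integrable lborel {r..t} (\<lambda>s. tri k p q s + ph p q s * cubic_term_deriv k p q s)"
    using AC_on_int[OF 2] by (simp add: tri_def)
  have "set_integrable lborel {r..t} (\<lambda>s. (tri k p q s + ph p q s * cubic_term_deriv k p q s) - tri k p q s)"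
    by (rule set_integral_diff(1)[OF sum it])
  then have id: "set_integrable lborel {r..t} (\<lambda>s. ph p q s * cubic_term_deriv k p q s)" by simp
  then show "integrable (IM r t) (\<lambda>s. ph p q s * cubic_term_deriv k p q s)" by (simp only: set_integral_IM)
  have "ph p q t * cubic_term k p q t = ph p q r * cubic_term k p q r + (LINT s:{r..t}|lborel. tri k p q s + ph p q s * cubic_term_deriv k p q s)"
    using AC_on_eq[OF 2, of t] r by (simp add: tri_def)
  also have "(LINT s:{r..t}|lborel. tri k p q s + ph p q s * cubic_term_deriv k p q s) = (LINT s|IM r t. tri k p q s) + (LINT s|IM r t. ph p q s * cubic_term_deriv k p q s)"
    using set_integral_add(2)[OF it id] by (simp only: set_integral_IM)
  finally show "(LINT s|IM r t. tri k p q s) = ph p q t * cubic_term k p q t - ph p q r * cubic_term k p q r - (LINT s|IM r t. ph p q s * cubic_term_deriv k p q s)"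
    by simp
qed

lemma norm_ph: "ennreal (cmod (ph p q s)) = ennreal (1/2) * ennreal (1 / (\<bar>of_int p\<bar> * \<bar>of_int q\<bar>))"
  by (subst ennreal_mult[symmetric]) (simp_all add: ph_def norm_divide norm_mult)

lemma ph_cubic_term_sum:
  "(\<integral>\<^sup>+p. \<integral>\<^sup>+q. norm (ph p q s * cubic_term k p q s) \<partial>CS \<partial>CS) = ennreal (1/2) * Lam3 k (A s) (A s) (A s)"
  unfolding Lam3_def
  by (simp add: norm_mult ennreal_mult norm_ph cubic_term_def nn_integral_cmult mult.assoc flip: nn_integral_cmult)

text \<open>The derivative falls on each of the three factors in turn, which replaces one
  \<open>A\<close> by \<eta> times \<open>N\<close>; the factor 1/2 comes from the denominator of
  \<open>ph\<close>.\<close>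

lemma ph_cubic_term_deriv_sum:
  "(\<integral>\<^sup>+p. \<integral>\<^sup>+q. norm (ph p q s * cubic_term_deriv k p q s) \<partial>CS \<partial>CS)
   \<le> ennreal (\<eta> / 2) * (Lam3 k (N s) (A s) (A s) + Lam3 k (A s) (N s) (A s) + Lam3 k (A s) (A s) (N s))"
proof -
  have d: "ennreal (cmod (cubic_term_deriv k p q s)) \<le> ennreal \<eta> * (N s (k - q) * A s (k - p - q) * A s (k - p)
     + A s (k - q) * N s (k - p - q) * A s (k - p) + A s (k - q) * A s (k - p - q) * N s (k - p))" for p q
  proof -
    have "cmod (cubic_term_deriv k p q s) \<le> (cmod (- (\<i> * of_real \<eta>) * n (k - q) s * cnj (a (k - p - q) s)) + cmod (a (k - q) s * cnj (- (\<i> * of_real \<eta>) * n (k - p - q) s))) * cmod (a (k - p) s)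
     + cmod (a (k - q) s * cnj (a (k - p - q) s) * (- (\<i> * of_real \<eta>) * n (k - p) s))"
      unfolding cubic_term_deriv_def
      by (rule order_trans[OF norm_triangle_ineq], rule add_right_mono, subst norm_mult)
         (rule mult_right_mono[OF norm_triangle_ineq], simp)
    also have "\<dots> = \<eta> * (cmod (n (k - q) s) * cmod (a (k - p - q) s) * cmod (a (k - p) s)
     + cmod (a (k - q) s) * cmod (n (k - p - q) s) * cmod (a (k - p) s) + cmod (a (k - q) s) * cmod (a (k - p - q) s) * cmod (n (k - p) s))"
      using eta by (simp add: norm_mult algebra_simps)
    finally have "ennreal (cmod (cubic_term_deriv k p q s)) \<le> ennreal \<dots>" by (rule ennreal_leI)
    then show ?thesis using eta by (simp add: ennreal_mult ennreal_plus)
  qed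
  have "(\<integral>\<^sup>+p. \<integral>\<^sup>+q. norm (ph p q s * cubic_term_deriv k p q s) \<partial>CS \<partial>CS) \<le>
    (\<integral>\<^sup>+p. \<integral>\<^sup>+q. (ennreal (1/2) * ennreal (1 / (\<bar>of_int p\<bar> * \<bar>of_int q\<bar>))) * (ennreal \<eta> * (N s (k - q) * A s (k - p - q) * A s (k - p)
     + A s (k - q) * N s (k - p - q) * A s (k - p) + A s (k - q) * A s (k - p - q) * N s (k - p))) \<partial>CS \<partial>CS)"
    unfolding norm_mult ennreal_mult[OF norm_ge_zero norm_ge_zero] norm_ph
    by (intro nn_integral_mono mult_left_mono d) simp
  also have "\<dots> = (\<integral>\<^sup>+p. \<integral>\<^sup>+q. ennreal (\<eta> / 2) * (ennreal (1 / (\<bar>of_int p\<bar> * \<bar>of_int q\<bar>)) * (N s (k - q) * A s (k - p - q) * A s (k - p))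
     + ennreal (1 / (\<bar>of_int p\<bar> * \<bar>of_int q\<bar>)) * (A s (k - q) * N s (k - p - q) * A s (k - p)) + ennreal (1 / (\<bar>of_int p\<bar> * \<bar>of_int q\<bar>)) * (A s (k - q) * A s (k - p - q) * N s (k - p))) \<partial>CS \<partial>CS)"
  proof (intro nn_integral_cong)
    fix p q
    have h: "ennreal (\<eta> / 2) = ennreal (1/2) * ennreal \<eta>" using eta by (subst ennreal_mult[symmetric]) auto
    show "(ennreal (1/2) * ennreal (1 / (\<bar>of_int p\<bar> * \<bar>of_int q\<bar>))) * (ennreal \<eta> * (N s (k - q) * A s (k - p - q) * A s (k - p)
     + A s (k - q) * N s (k - p - q) * A s (k - p) + A s (k - q) * A s (k - p - q) * N s (k - p)))
     = ennreal (\<eta> / 2) * (ennreal (1 / (\<bar>of_int p\<bar> * \<bar>of_int q\<bar>)) * (N s (k - q) * A s (k - p - q) * A s (k - p))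
     + ennreal (1 / (\<bar>of_int p\<bar> * \<bar>of_int q\<bar>)) * (A s (k - q) * N s (k - p - q) * A s (k - p)) + ennreal (1 / (\<bar>of_int p\<bar> * \<bar>of_int q\<bar>)) * (A s (k - q) * A s (k - p - q) * N s (k - p)))"
      unfolding h by (simp only: distrib_left mult_ac)
  qed
  also have "\<dots> = ennreal (\<eta> / 2) * (Lam3 k (N s) (A s) (A s) + Lam3 k (A s) (N s) (A s) + Lam3 k (A s) (A s) (N s))"
    unfolding Lam3_def by (simp add: nn_integral_cmult nn_integral_add)
  finally show ?thesis .
qed

lemma Lam_AAA_le:
  assumes s: "s \<in> {0..T}" and c: "\<And>k. c k \<le> 1"
  shows "Lam c (A s) (A s) (A s) \<le> ennreal (hyp_root * \<mu> ^ 3)"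
  using Lam_le0[of c 1 "A s" \<mu> "A s" \<mu> "A s" \<mu>] c mass[OF s] mu
  by (simp add: power3_eq_cube mult.assoc)

text \<open>Of the cubic term only the supremum bound \<open>W s * \<mu>\<close> is at hand, so
  wherever \<open>N\<close> stands it has to take the supremum slot of \<open>Lam\<close>. The unit
  sequence that fixes \<open>k\<close> then serves as one of the three square-summable arguments,
  with norm 1.\<close>

lemma Lam3_N_le:
  assumes s: "good_time s"
  shows "Lam3 k (N s) (A s) (A s) + Lam3 k (A s) (N s) (A s) + Lam3 k (A s) (A s) (N s) \<le> ennreal (3 * (hyp_root * W s * \<mu> ^ 3))"
proof -
  let ?d = "\<lambda>j. if j = k then 1 else 0 :: ennreal"
  have sT: "s \<in> {0..T}" using s by (simp add: good_time_def)
  have Nb: "N s j \<le> ennreal (W s * \<mu>)" for j using N_le[OF s, of j] by (rule ennreal_leI)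
  have m: "(\<integral>\<^sup>+k. (A s k)\<^sup>2 \<partial>CS) \<le> ennreal (\<mu>\<^sup>2)" by (rule mass[OF sT])
  note nn = mult_nonneg_nonneg[OF W_nonneg mu, of s]
  have "Lam3 k (N s) (A s) (A s) \<le> ennreal (hyp_root * W s * \<mu> ^ 3)"
    using Lam_le1[of "N s" "W s * \<mu>" "A s" \<mu> "A s" \<mu> ?d 1, OF Nb m m delta_l2 nn mu mu]
    by (simp add: Lam_delta power3_eq_cube mult.assoc)
  moreover have "Lam3 k (A s) (N s) (A s) \<le> ennreal (hyp_root * W s * \<mu> ^ 3)"
    using Lam_le1[of "N s" "W s * \<mu>" "A s" \<mu> ?d 1 "A s" \<mu>, OF Nb m delta_l2 m nn mu _ mu]
    by (simp add: Lam_rotate[symmetric, of "A s" "N s" "A s" ?d] Lam_rotate[of ?d, symmetric] Lam_delta power3_eq_cube mult.assoc)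
  moreover have "Lam3 k (A s) (A s) (N s) \<le> ennreal (hyp_root * W s * \<mu> ^ 3)"
    using Lam_le1[of "N s" "W s * \<mu>" ?d 1 "A s" \<mu> "A s" \<mu>, OF Nb delta_l2 m m nn _ mu mu]
    by (simp add: Lam_rotate[of ?d "A s" "A s" "N s"] Lam_rotate[of "A s" "A s" "N s" ?d] Lam_delta[symmetric] power3_eq_cube mult.assoc)
  ultimately have "Lam3 k (N s) (A s) (A s) + Lam3 k (A s) (N s) (A s) + Lam3 k (A s) (A s) (N s)
     \<le> ennreal (hyp_root * W s * \<mu> ^ 3) + ennreal (hyp_root * W s * \<mu> ^ 3) + ennreal (hyp_root * W s * \<mu> ^ 3)"
    by (intro add_mono)
  also have "\<dots> = ennreal (3 * (hyp_root * W s * \<mu> ^ 3))"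
    using hyp_root(1) W_nonneg[of s] mu by (subst ennreal_plus[symmetric], simp, simp)+ simp
  finally show ?thesis .
qed

lemma a_meas: "0 \<le> r \<Longrightarrow> t \<le> T \<Longrightarrow> a k \<in> borel_measurable (IM r t)"
  by (rule continuous_on_measurable_IM, rule continuous_on_subset[OF AC_on_continuous[OF AC]]) auto

lemma n_integrable: "0 \<le> r \<Longrightarrow> t \<le> T \<Longrightarrow> integrable (IM r t) (n k)"
  by (subst set_integral_IM(2)[symmetric], rule set_integrable_subset[OF n_int]) auto

lemma n_meas: "0 \<le> r \<Longrightarrow> t \<le> T \<Longrightarrow> n k \<in> borel_measurable (IM r t)"
  using n_integrable by (rule borel_measurable_integrable)

lemma W_integrable: "0 \<le> r \<Longrightarrow> t \<le> T \<Longrightarrow> integrable (IM r t) W"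
  by (subst set_integral_IM(2)[symmetric], rule set_integrable_subset[OF W_int]) auto

lemma cis_meas_IM: "(\<lambda>s. cis (c * s)) \<in> borel_measurable (IM r t)"
  by (rule continuous_on_measurable_IM) (intro continuous_intros)

lemma ph_meas: "ph p q \<in> borel_measurable (IM r t)"
  unfolding ph_def[abs_def] by (intro borel_measurable_divide cis_meas_IM) auto

lemma cubic_term_meas: "0 \<le> r \<Longrightarrow> t \<le> T \<Longrightarrow> cubic_term k p q \<in> borel_measurable (IM r t)"
  by (rule continuous_on_measurable_IM, rule continuous_on_subset[OF AC_on_continuous[OF cubic_term_AC]]) auto

lemma cubic_term_deriv_meas: assumes "0 \<le> r" "t \<le> T" shows "cubic_term_deriv k p q \<in> borel_measurable (IM r t)"
  by (rule borel_measurable_integrable, subst set_integral_IM(2)[symmetric],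
      rule set_integrable_subset[OF AC_on_int[OF cubic_term_AC]]) (use assms in auto)

lemma tri_meas: "0 \<le> r \<Longrightarrow> t \<le> T \<Longrightarrow> tri k p q \<in> borel_measurable (IM r t)"
  unfolding tri_def[abs_def] by (intro borel_measurable_times cis_meas_IM cubic_term_meas)

lemma nn_integral_IM_const: "(\<integral>\<^sup>+s. ennreal c \<partial>IM r t) < \<infinity>"
  by (simp add: emeasure_restrict_space ennreal_mult_less_top emeasure_lborel_Icc_eq)

lemma nn_integral_IM_bounded:
  assumes "\<And>s. s \<in> {r..t} \<Longrightarrow> f s \<le> ennreal c"
  shows "(\<integral>\<^sup>+s. f s \<partial>IM r t) < \<infinity>"
proof -
  have "(\<integral>\<^sup>+s. f s \<partial>IM r t) \<le> (\<integral>\<^sup>+s. ennreal c \<partial>IM r t)"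
    by (rule nn_integral_mono) (use assms in simp)
  then show ?thesis using nn_integral_IM_const by (rule order_le_less_trans)
qed

lemma tri_sum:
  assumes s: "s \<in> {0..T}"
  shows "(\<integral>\<^sup>+q. norm (tri k p q s) \<partial>CS) \<le> ennreal (\<mu> * \<mu> * \<mu>)"
proof -
  have "(\<integral>\<^sup>+q. norm (tri k p q s) \<partial>CS) = (\<integral>\<^sup>+q. A s (k - q) * A s (k - p - q) \<partial>CS) * A s (k - p)"
    by (simp add: tri_def cubic_term_def norm_mult ennreal_mult nn_integral_multc)
  also have "\<dots> \<le> ennreal (\<mu> * \<mu>) * ennreal \<mu>"
    by (intro mult_mono pair_sum[OF s] ennreal_leI A_le[OF s]) auto
  also have "\<dots> = ennreal (\<mu> * \<mu> * \<mu>)" using mu by (simp add: ennreal_mult)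
  finally show ?thesis .
qed

text \<open>For an L2 solution this is, up to a phase, the p-th Fourier coefficient of |u|^2 times a
  mode. The sum over \<open>q\<close> converges absolutely for fixed \<open>p\<close>; the sum over
  \<open>p\<close> is taken afterwards.\<close>

definition Sp :: "int \<Rightarrow> int \<Rightarrow> real \<Rightarrow> complex" where "Sp k p s = (LINT q|CS. tri k p q s)"

lemma Sp_eq: "Sp k p s = (LINT q|CS. cis (2 * of_int p * of_int q * s) * a (k - q) s * cnj (a (k - p - q) s)) * a (k - p) s"
  unfolding Sp_def by (subst integral_mult_left_zero[symmetric]) (simp add: tri_def cubic_term_def mult.assoc)

lemma Sp_norm:
  assumes s: "good_time s"
  shows "(\<integral>\<^sup>+p. norm (Sp k p s) \<partial>CS) \<le> ennreal (W s * \<mu>)"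
proof -
  have sT: "s \<in> {0..T}" using s by (simp add: good_time_def)
  have "(\<integral>\<^sup>+p. norm (Sp k p s) \<partial>CS) \<le> (\<integral>\<^sup>+p. ennreal (V p s) * A s (k - p) \<partial>CS)"
    unfolding Sp_eq
    by (rule nn_integral_mono) (use s V_nonneg in \<open>auto simp: good_time_def norm_mult ennreal_mult intro!: mult_right_mono\<close>)
  also have "\<dots> \<le> ennreal (W s * \<mu>)"
    by (rule l2_product_sum[OF _ mass_shift[OF sT] W_nonneg mu]) (use s in \<open>simp add: good_time_def\<close>)
  finally show ?thesis .
qed

section \<open>The resonant coefficient\<close>

lemma sqsum_integrable:
  assumes "s \<in> {0..T}"
  shows "integrable CS (\<lambda>q. (cmod (a q s))\<^sup>2)"
proof -
  have "(\<integral>\<^sup>+q. norm ((cmod (a q s))\<^sup>2) \<partial>CS) < \<infinity>"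
    using mass[OF assms] by (simp add: ennreal_power order_le_less_trans)
  then show ?thesis by (simp add: integrable_csum_iff)
qed

lemma ms_bounds:
  assumes "s \<in> {0..T}" shows "0 \<le> ms s" "ms s \<le> \<mu>\<^sup>2"
proof -
  show "0 \<le> ms s" unfolding ms_def by (rule Bochner_Integration.integral_nonneg) simp
  have "ennreal (ms s) = (\<integral>\<^sup>+q. ennreal ((cmod (a q s))\<^sup>2) \<partial>CS)"
    unfolding ms_def using sqsum_integrable[OF assms] by (simp add: nn_integral_eq_integral)
  also have "\<dots> \<le> ennreal (\<mu>\<^sup>2)" using mass[OF assms] by (simp add: ennreal_power)
  finally show "ms s \<le> \<mu>\<^sup>2" by simp
qed

lemma ms_meas: assumes "0 \<le> r" "t \<le> T" shows "ms \<in> borel_measurable (IM r t)"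
proof -
  have [measurable]: "a q \<in> borel_measurable (IM r t)" for q by (rule a_meas[OF assms])
  show ?thesis unfolding ms_def[abs_def] by measurable
qed

text \<open>The resonant lines \<open>p = 0\<close> and \<open>q = 0\<close> each contribute the
  mass, and their common point, counted twice, is subtracted once.\<close>

definition rho :: "int \<Rightarrow> real \<Rightarrow> real" where "rho k s = 2 * ms s - (cmod (a k s))\<^sup>2"

lemma rho_meas: assumes "0 \<le> r" "t \<le> T" shows "rho k \<in> borel_measurable (IM r t)"
proof -
  have [measurable]: "a q \<in> borel_measurable (IM r t)" "ms \<in> borel_measurable (IM r t)" for q
    by (rule a_meas[OF assms] ms_meas[OF assms])+
  show ?thesis unfolding rho_def[abs_def] by measurable
qed

lemma rho_le: assumes "s \<in> {0..T}" shows "\<bar>rho k s\<bar> \<le> 2 * \<mu>\<^sup>2"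
proof -
  have "(cmod (a k s))\<^sup>2 \<le> \<mu>\<^sup>2" using A_le[OF assms] by (simp add: power_mono)
  moreover have "(cmod (a k s))\<^sup>2 \<le> ms s"
    using cseq_lim_nn[OF sqsum_integrable[OF assms], of "{k}"] by (simp add: ms_def)
  ultimately show ?thesis using ms_bounds[OF assms] zero_le_power2[of "cmod (a k s)"]
    unfolding rho_def abs_le_iff by linarith
qed

lemma integrable_IM_bounded:
  fixes f :: "real \<Rightarrow> complex"
  assumes "f \<in> borel_measurable (IM r t)" "\<And>s. s \<in> {r..t} \<Longrightarrow> cmod (f s) \<le> C"
  shows "integrable (IM r t) f"
proof -
  interpret finite_measure "IM r t" by (rule finite_measure_IM)
  show ?thesis by (rule integrable_const_bound[where B = C]) (use assms in \<open>auto intro!: AE_I2\<close>)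
qed

lemma rho_a_integrable:
  assumes "0 \<le> r" "t \<le> T" shows "integrable (IM r t) (\<lambda>s. of_real (rho k s) * a k s)"
proof (rule integrable_IM_bounded)
  have [measurable]: "a q \<in> borel_measurable (IM r t)" "rho k \<in> borel_measurable (IM r t)" for q
    by (rule a_meas[OF assms] rho_meas[OF assms])+
  show "(\<lambda>s. of_real (rho k s) * a k s) \<in> borel_measurable (IM r t)" by measurable
  show "cmod (of_real (rho k s) * a k s) \<le> 2 * \<mu>\<^sup>2 * \<mu>" if "s \<in> {r..t}" for s
    unfolding norm_mult norm_of_real by (intro mult_mono rho_le A_le) (use that assms in auto)
qed

text \<open>At almost every time the bound \<open>Lam3_N_le\<close> holds, and it depends on time
  only through \<open>W\<close>, which is integrable.\<close>

lemma cubic_term_deriv_time_sum: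
  assumes r: "0 \<le> r" "t \<le> T"
  shows "(\<integral>\<^sup>+s. \<integral>\<^sup>+p. \<integral>\<^sup>+q. norm (ph p q s * cubic_term_deriv k p q s) \<partial>CS \<partial>CS \<partial>IM r t) < \<infinity>"
proof -
  have "(\<integral>\<^sup>+s. \<integral>\<^sup>+p. \<integral>\<^sup>+q. norm (ph p q s * cubic_term_deriv k p q s) \<partial>CS \<partial>CS \<partial>IM r t)
     \<le> (\<integral>\<^sup>+s. ennreal (\<eta> / 2 * (3 * (hyp_root * W s * \<mu> ^ 3))) \<partial>IM r t)"
  proof (rule nn_integral_mono_AE)
    show "AE s in IM r t. (\<integral>\<^sup>+p. \<integral>\<^sup>+q. norm (ph p q s * cubic_term_deriv k p q s) \<partial>CS \<partial>CS) \<le> ennreal (\<eta> / 2 * (3 * (hyp_root * W s * \<mu> ^ 3)))"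
      using AE_good[OF r]
    proof eventually_elim
      case (elim s)
      have "(\<integral>\<^sup>+p. \<integral>\<^sup>+q. norm (ph p q s * cubic_term_deriv k p q s) \<partial>CS \<partial>CS) \<le> ennreal (\<eta> / 2) * ennreal (3 * (hyp_root * W s * \<mu> ^ 3))"
        by (rule order_trans[OF ph_cubic_term_deriv_sum mult_left_mono[OF Lam3_N_le[OF elim]]]) simp
      also have "\<dots> = ennreal (\<eta> / 2 * (3 * (hyp_root * W s * \<mu> ^ 3)))"
        using eta hyp_root(1) W_nonneg[of s] mu by (subst ennreal_mult) auto
      finally show ?case .
    qed
  qed
  also have "\<dots> < \<infinity>"
  proof -
    have "integrable (IM r t) (\<lambda>s. \<eta> / 2 * (3 * (hyp_root * W s * \<mu> ^ 3)))"
      using W_integrable[OF r] by simp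
    then show ?thesis
      using eta hyp_root(1) W_nonneg mu by (subst nn_integral_eq_integral) auto
  qed
  finally show ?thesis .
qed

lemma ph_cubic_term_csum2able:
  assumes "s \<in> {0..T}" shows "csum2able (\<lambda>p q. ph p q s * cubic_term k p q s)"
proof -
  have "Lam3 k (A s) (A s) (A s) \<le> ennreal (hyp_root * \<mu> ^ 3)"
    using Lam_AAA_le[OF assms, of "\<lambda>j. if j = k then 1 else 0"] by (simp add: Lam_delta)
  then have "Lam3 k (A s) (A s) (A s) < \<infinity>" by (rule order_le_less_trans) simp
  then show ?thesis
    unfolding csum2able_def ph_cubic_term_sum infinity_ennreal_def ennreal_mult_less_top
    using ennreal_less_top[of "1/2"] by blast
qed

lemma Qk_integrable:
  assumes "0 \<le> r" "t \<le> T" shows "integrable (IM r t) (Qk k)"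
  unfolding Qk_def[abs_def]
  by (rule csum2_integral_swap(1)[OF _ cubic_term_deriv_time_sum[OF assms]])
     (intro borel_measurable_times ph_meas cubic_term_deriv_meas[OF assms])

text \<open>Differentiation by parts of the non-resonant interactions.\<close>

lemma normal_form:
  assumes r: "0 \<le> r" "r \<le> t" "t \<le> T"
  shows "(LINT s|IM r t. n k s) = (LINT s|IM r t. of_real (rho k s) * a k s) + (Bk k t - Bk k r) - (LINT s|IM r t. Qk k s)"
proof -
  have sT: "s \<in> {0..T}" if "s \<in> {r..t}" for s using that r by auto
  have rT: "0 \<le> r" "t \<le> T" using r by auto
  have [measurable]: "a q \<in> borel_measurable (IM r t)" "ms \<in> borel_measurable (IM r t)" for q
    by (rule a_meas[OF rT] ms_meas[OF rT])+
  have tm: "tri k p q \<in> borel_measurable (IM r t)" for p q by (rule tri_meas[OF rT])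
  define \<beta> where "\<beta> = (\<lambda>p q. ph p q t * cubic_term k p q t - ph p q r * cubic_term k p q r - (LINT s|IM r t. ph p q s * cubic_term_deriv k p q s))"
  have b1: "csum2able (\<lambda>p q. ph p q t * cubic_term k p q t)" "csum2able (\<lambda>p q. ph p q r * cubic_term k p q r)"
    by (rule ph_cubic_term_csum2able; use r in auto)+
  have mD: "(\<lambda>s. ph p q s * cubic_term_deriv k p q s) \<in> borel_measurable (IM r t)" for p q
    by (intro borel_measurable_times ph_meas cubic_term_deriv_meas[OF rT])
  note sw = csum2_integral_swap[OF mD cubic_term_deriv_time_sum[OF rT]]
  note b2 = csum2_diff[OF b1]
  note b3 = csum2_diff[OF b2(1) sw(2)]
  have \<beta>sum: "csum2able \<beta>" unfolding \<beta>_def by (rule b3(1))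
  have \<beta>val: "csum2 \<beta> = Bk k t - Bk k r - (LINT s|IM r t. Qk k s)"
    unfolding \<beta>_def b3(2) b2(2) sw(3) Bk_def Qk_def ..
  \<comment> \<open>On the resonant lines all three parts of \<open>\<beta>\<close> vanish, as
    \<open>ph\<close> divides by zero there.\<close>
  have \<beta>0: "\<beta> p q = 0" if "p = 0 \<or> q = 0" for p q using that by (auto simp: \<beta>_def ph_def)
  have Spm: "Sp k p \<in> borel_measurable (IM r t)" for p
    unfolding Sp_def[abs_def] by (rule measurable_csum[OF tm])
  have "(\<integral>\<^sup>+p. \<integral>\<^sup>+s. norm (Sp k p s) \<partial>IM r t \<partial>CS) = (\<integral>\<^sup>+s. \<integral>\<^sup>+p. norm (Sp k p s) \<partial>CS \<partial>IM r t)"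
    by (rule nn_integral_count_space_nn_integral[symmetric]) (use Spm in auto)
  also have "\<dots> \<le> (\<integral>\<^sup>+s. ennreal (W s * \<mu>) \<partial>IM r t)"
    by (rule nn_integral_mono_AE) (use AE_good[OF rT] in eventually_elim, rule Sp_norm)
  also have "\<dots> < \<infinity>"
  proof -
    have "integrable (IM r t) (\<lambda>s. W s * \<mu>)" using W_integrable[OF rT] by simp
    then show ?thesis using W_nonneg mu by (subst nn_integral_eq_integral) auto
  qed
  finally have fin1: "(\<integral>\<^sup>+p. \<integral>\<^sup>+s. norm (Sp k p s) \<partial>IM r t \<partial>CS) < \<infinity>" .
  \<comment> \<open>Sum and integral are exchanged in two stages, matching the two stages of
    convergence: the sum over \<open>p\<close> is dominated through \<open>V\<close> and
    \<open>W\<close>, the sum over \<open>q\<close> for fixed \<open>p\<close> through the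
    mass.\<close>
  note s1 = csum_integral_swap[OF Spm fin1]
  have e1: "(LINT s|IM r t. n k s) = (LINT p|CS. LINT s|IM r t. Sp k p s)"
    unfolding s1(4)
  proof (rule integral_cong_AE)
    show "AE s in IM r t. n k s = (LINT p|CS. Sp k p s)"
      using AE_good[OF rT] by eventually_elim (simp add: good_time_def Sp_eq)
    show "n k \<in> borel_measurable (IM r t)" by (rule n_meas[OF rT])
    show "(\<lambda>s. LINT p|CS. Sp k p s) \<in> borel_measurable (IM r t)" by (rule measurable_csum[OF Spm])
  qed
  have fin2: "(\<integral>\<^sup>+q. \<integral>\<^sup>+s. norm (tri k p q s) \<partial>IM r t \<partial>CS) < \<infinity>" for p
  proof -
    have "(\<integral>\<^sup>+q. \<integral>\<^sup>+s. norm (tri k p q s) \<partial>IM r t \<partial>CS) = (\<integral>\<^sup>+s. \<integral>\<^sup>+q. norm (tri k p q s) \<partial>CS \<partial>IM r t)"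
      by (rule nn_integral_count_space_nn_integral[symmetric]) (use tm in auto)
    also have "\<dots> < \<infinity>" by (rule nn_integral_IM_bounded[OF tri_sum[OF sT]])
    finally show ?thesis .
  qed
  note s2 = csum_integral_swap[OF tm fin2]
  have e2: "(LINT s|IM r t. Sp k p s) = (LINT q|CS. LINT s|IM r t. tri k p q s)" for p
    unfolding Sp_def s2(4) ..
  \<comment> \<open>The contribution of the line \<open>q = 0\<close> at the given
    \<open>p\<close>.\<close>
  define \<gamma> where "\<gamma> = (\<lambda>p. LINT s|IM r t. of_real ((cmod (a (k - p) s))\<^sup>2) * a k s)"
  have tri0: "tri k p 0 s = of_real ((cmod (a (k - p) s))\<^sup>2) * a k s" for p s
    by (simp only: complex_norm_square) (simp add: tri_def cubic_term_def mult_ac)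
  have e3: "(LINT s|IM r t. Sp k p s) = \<gamma> p + (LINT q|CS. \<beta> p q)" if p: "p \<noteq> 0" for p
  proof -
    have "(LINT s|IM r t. tri k p q s) = (if q = 0 then \<gamma> p else 0) + \<beta> p q" for q
      using oscillatory_by_parts(2)[OF p _ r, of q k] \<beta>0[of p 0]
      by (cases "q = 0") (auto simp: tri0 \<gamma>_def \<beta>_def)
    then show ?thesis unfolding e2
      using csum2able_inner(1)[OF \<beta>sum, of p] by (simp add: csum_delta)
  qed
  have e0: "(LINT s|IM r t. Sp k 0 s) = (LINT s|IM r t. of_real (ms s) * a k s)"
  proof (rule Bochner_Integration.integral_cong)
    fix s assume "s \<in> space (IM r t)"
    have "Sp k 0 s = (LINT q|CS. of_real ((cmod (a (k - q) s))\<^sup>2)) * a k s"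
      unfolding Sp_eq by (simp only: complex_norm_square) (simp add: mult.assoc)
    also have "(LINT q|CS. complex_of_real ((cmod (a (k - q) s))\<^sup>2)) = (LINT q|CS. complex_of_real ((cmod (a q s))\<^sup>2))"
    proof -
      have "bij_betw (\<lambda>m::int. k - m) UNIV UNIV"
        by (rule bij_betw_byWitness[where f' = "\<lambda>m. k - m"]) auto
      from integral_bij_count_space[OF this, of "\<lambda>q. complex_of_real ((cmod (a q s))\<^sup>2)"] show ?thesis by simp
    qed
    finally show "Sp k 0 s = of_real (ms s) * a k s" by (simp add: ms_def del: of_real_power)
  qed simp
  have g1: "(\<lambda>s. of_real ((cmod (a (k - p) s))\<^sup>2) * a k s) \<in> borel_measurable (IM r t)" for p by measurable
  have g2: "(\<integral>\<^sup>+p. \<integral>\<^sup>+s. norm (of_real ((cmod (a (k - p) s))\<^sup>2) * a k s) \<partial>IM r t \<partial>CS) < \<infinity>"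
  proof -
    have "(\<integral>\<^sup>+p. \<integral>\<^sup>+s. norm (of_real ((cmod (a (k - p) s))\<^sup>2) * a k s) \<partial>IM r t \<partial>CS) = (\<integral>\<^sup>+s. \<integral>\<^sup>+p. norm (of_real ((cmod (a (k - p) s))\<^sup>2) * a k s) \<partial>CS \<partial>IM r t)"
      by (rule nn_integral_count_space_nn_integral[symmetric]) auto
    also have "\<dots> < \<infinity>"
    proof (rule nn_integral_IM_bounded)
      fix s assume s: "s \<in> {r..t}"
      have "(\<integral>\<^sup>+p. norm (of_real ((cmod (a (k - p) s))\<^sup>2) * a k s) \<partial>CS) = (\<integral>\<^sup>+p. (A s (k - p))\<^sup>2 \<partial>CS) * A s k"
        by (simp add: norm_mult norm_power ennreal_mult nn_integral_multc ennreal_power)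
      also have "\<dots> \<le> ennreal (\<mu>\<^sup>2) * ennreal \<mu>"
        by (intro mult_mono mass_shift sT[OF s] ennreal_leI A_le) auto
      also have "\<dots> = ennreal (\<mu>\<^sup>2 * \<mu>)" using mu by (simp add: ennreal_mult)
      finally show "(\<integral>\<^sup>+p. norm (of_real ((cmod (a (k - p) s))\<^sup>2) * a k s) \<partial>CS) \<le> ennreal (\<mu>\<^sup>2 * \<mu>)" .
    qed
    finally show ?thesis .
  qed
  note s3 = csum_integral_swap[OF g1 g2]
  have msa: "integrable (IM r t) (\<lambda>s. of_real (ms s) * a k s)"
    by (rule integrable_IM_bounded[where C = "\<mu>\<^sup>2 * \<mu>"])
       (use ms_bounds sT A_le in \<open>auto simp: norm_mult intro!: mult_mono\<close>)
  have kka: "integrable (IM r t) (\<lambda>s. of_real ((cmod (a k s))\<^sup>2) * a k s)"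
    by (rule integrable_IM_bounded[where C = "\<mu>\<^sup>2 * \<mu>"])
       (use sT A_le in \<open>auto simp: norm_mult norm_power intro!: mult_mono power_mono\<close>)
  have \<gamma>sum: "(LINT p|CS. \<gamma> p) = (LINT s|IM r t. of_real (ms s) * a k s)"
    unfolding \<gamma>_def s3(4)
  proof (rule Bochner_Integration.integral_cong)
    fix s assume "s \<in> space (IM r t)"
    have "bij_betw (\<lambda>m::int. k - m) UNIV UNIV"
      by (rule bij_betw_byWitness[where f' = "\<lambda>m. k - m"]) auto
    from integral_bij_count_space[OF this, of "\<lambda>q. complex_of_real ((cmod (a q s))\<^sup>2)"]
    have "(LINT q|CS. complex_of_real ((cmod (a (k - q) s))\<^sup>2)) = of_real (ms s)" by (simp add: ms_def del: of_real_power)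
    then show "(LINT p|CS. of_real ((cmod (a (k - p) s))\<^sup>2) * a k s) = of_real (ms s) * a k s"
      by (simp del: of_real_power)
  qed simp
  \<comment> \<open>The line \<open>p = 0\<close> without its point \<open>q = 0\<close>, which
    \<open>\<gamma> 0\<close> already counts. This gives the next identity the same form for every
    \<open>p\<close>.\<close>
  define x0 where "x0 = (LINT s|IM r t. of_real (ms s) * a k s) - (LINT s|IM r t. of_real ((cmod (a k s))\<^sup>2) * a k s)"
  have all: "(LINT s|IM r t. Sp k p s) = ((if p = 0 then x0 else 0) + \<gamma> p) + (LINT q|CS. \<beta> p q)" for p
    by (cases "p = 0") (auto simp: e0 e3 x0_def \<gamma>_def \<beta>0)
  have "(LINT s|IM r t. n k s) = x0 + (LINT p|CS. \<gamma> p) + csum2 \<beta>"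
    unfolding e1 all csum2_def using csum2able_inner(2)[OF \<beta>sum] s3(3)
    by (simp add: csum_delta \<gamma>_def)
  also have "x0 + (LINT p|CS. \<gamma> p) = (LINT s|IM r t. of_real (rho k s) * a k s)"
  proof -
    have "(LINT s|IM r t. of_real (rho k s) * a k s) = (LINT s|IM r t. 2 * (of_real (ms s) * a k s) - of_real ((cmod (a k s))\<^sup>2) * a k s)"
      by (rule Bochner_Integration.integral_cong) (auto simp: rho_def algebra_simps)
    also have "\<dots> = 2 * (LINT s|IM r t. of_real (ms s) * a k s) - (LINT s|IM r t. of_real ((cmod (a k s))\<^sup>2) * a k s)"
      using msa kka by (simp del: of_real_power)
    finally show ?thesis unfolding \<gamma>sum x0_def by simp
  qed
  finally show ?thesis unfolding \<beta>val by (simp add: algebra_simps)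
qed

lemma a_increment:
  assumes r: "0 \<le> r" "r \<le> t" "t \<le> T"
  shows "a k t - a k r = - (\<i> * of_real \<eta>) * (LINT s|IM r t. n k s)"
proof -
  have "a k t = a k r + (LINT s:{r..t}|lborel. - (\<i> * of_real \<eta>) * n k s)"
    by (rule AC_on_eq[OF AC_on_subinterval[OF AC r]]) (use r in auto)
  then show ?thesis by (simp only: set_integral_IM integral_mult_right_zero) simp
qed

end

section \<open>Propagation of summability\<close>

text \<open>Testing against such a sequence gives a finite value for modes that are merely square
  summable, so an estimate can be fed back into itself. As \<open>K\<close> grows, the tests include
  the indicators of all finite windows and detect the l1 norm.\<close>

definition admissible :: "real \<Rightarrow> (int \<Rightarrow> ennreal) \<Rightarrow> bool" where
  "admissible K c \<longleftrightarrow> (\<forall>k. c k \<le> 1) \<and> (\<integral>\<^sup>+k. (c k)\<^sup>2 \<partial>CS) \<le> ennreal (K\<^sup>2)"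

text \<open>The test sequence is the truncation of \<open>C\<close> itself to a finite window; its
  square sum is finite and can be divided out.\<close>

lemma l2_from_testing:
  fixes C :: "int \<Rightarrow> ennreal"
  assumes D: "D \<ge> 0" and fin: "\<And>j. C j < \<infinity>"
    and test: "\<And>w x. x \<ge> 0 \<Longrightarrow> (\<integral>\<^sup>+j. (w j)\<^sup>2 \<partial>CS) \<le> ennreal (x\<^sup>2) \<Longrightarrow> (\<integral>\<^sup>+j. w j * C j \<partial>CS) \<le> ennreal (D * x)"
  shows "(\<integral>\<^sup>+j. (C j)\<^sup>2 \<partial>CS) \<le> ennreal (D\<^sup>2)"
proof -
  define g where "g = (\<lambda>j. enn2real (C j))"
  have C: "C j = ennreal (g j)" for j using fin[of j] by (simp add: g_def)
  have g0: "g j \<ge> 0" for j by (simp add: g_def)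
  have "(\<Sum>j\<in>{- int K..int K}. norm ((g j)\<^sup>2)) \<le> D\<^sup>2" for K
  proof -
    define X where "X = (\<Sum>j\<in>{- int K..int K}. (g j)\<^sup>2)"
    define x where "x = sqrt X"
    have X0: "X \<ge> 0" unfolding X_def by (intro sum_nonneg) auto
    have x: "x \<ge> 0" "x\<^sup>2 = X" using X0 by (auto simp: x_def)
    let ?w = "\<lambda>j. C j * indicator {- int K..int K} j"
    have e1: "(\<integral>\<^sup>+j. ennreal ((g j)\<^sup>2) * indicator {- int K..int K} j \<partial>CS) = ennreal X"
      unfolding X_def by (simp flip: nn_integral_count_space_indicator) (simp add: nn_integral_count_space_finite)
    have "(\<integral>\<^sup>+j. (?w j)\<^sup>2 \<partial>CS) = (\<integral>\<^sup>+j. ennreal ((g j)\<^sup>2) * indicator {- int K..int K} j \<partial>CS)"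
      by (rule nn_integral_cong) (auto simp: C ennreal_power g0 indicator_def)
    then have "(\<integral>\<^sup>+j. (?w j)\<^sup>2 \<partial>CS) \<le> ennreal (x\<^sup>2)" by (simp add: e1 x)
    from test[OF x(1) this]
    have "(\<integral>\<^sup>+j. ?w j * C j \<partial>CS) \<le> ennreal (D * x)" .
    moreover have "(\<integral>\<^sup>+j. ?w j * C j \<partial>CS) = (\<integral>\<^sup>+j. ennreal ((g j)\<^sup>2) * indicator {- int K..int K} j \<partial>CS)"
      by (rule nn_integral_cong) (auto simp: C g0 indicator_def power2_eq_square ennreal_mult)
    ultimately have "ennreal X \<le> ennreal (D * x)" by (simp only: e1)
    then have "x * x \<le> D * x" using x D by (simp add: power2_eq_square)
    then have "x \<le> D" using x(1) D by (cases "x = 0") auto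
    then have "x\<^sup>2 \<le> D\<^sup>2" using x(1) by (intro power_mono) auto
    then show ?thesis using x by (simp add: X_def)
  qed
  note b = csum_integrable_bound[OF this]
  have "(\<integral>\<^sup>+j. (C j)\<^sup>2 \<partial>CS) = (\<integral>\<^sup>+j. ennreal ((g j)\<^sup>2) \<partial>CS)"
    by (rule nn_integral_cong) (simp add: C ennreal_power g0)
  also have "\<dots> = ennreal (LINT j|CS. (g j)\<^sup>2)"
    by (rule nn_integral_eq_integral[OF b(1)]) simp
  also have "\<dots> \<le> ennreal (D\<^sup>2)" using b(2) by (intro ennreal_leI) simp
  finally show ?thesis .
qed

text \<open>Moving the convolution with \<open>v\<close> to the test side replaces \<open>c\<close>
  by a sequence \<open>C\<close>. The two hypotheses on \<open>c\<close> bound \<open>C\<close> by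
  \<open>E * W\<close> in supremum and by \<open>E * W * K\<close> in l2, so
  \<open>C / (E * W)\<close> is again admissible at the same level \<open>K\<close>. Preserving the
  level is what allows the estimate to be iterated.\<close>

lemma conv_dual:
  fixes c :: "int \<Rightarrow> ennreal"
  assumes t2: "\<And>w x. x \<ge> 0 \<Longrightarrow> (\<integral>\<^sup>+j. (w j)\<^sup>2 \<partial>CS) \<le> ennreal (x\<^sup>2) \<Longrightarrow> (\<integral>\<^sup>+j. w j * c j \<partial>CS) \<le> ennreal (E * x)"
    and tinf: "\<And>w x. x \<ge> 0 \<Longrightarrow> (\<And>j. w j \<le> ennreal x) \<Longrightarrow> (\<integral>\<^sup>+j. w j * c j \<partial>CS) \<le> ennreal (E * K * x)"
    and E: "E \<ge> 0" and K: "K \<ge> 0" and W: "W \<ge> 0" and S: "S \<ge> 0"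
    and V: "(\<integral>\<^sup>+p. (v p)\<^sup>2 \<partial>CS) \<le> ennreal (W\<^sup>2)"
    and A: "\<And>d. admissible K d \<Longrightarrow> (\<integral>\<^sup>+j. d j * A j \<partial>CS) \<le> ennreal S"
    and N: "\<And>n. N n \<le> (\<integral>\<^sup>+p. v p * A (n - p) \<partial>CS)"
  shows "(\<integral>\<^sup>+n. N n * c n \<partial>CS) \<le> ennreal (E * W * S)"
proof -
  define C where "C = (\<lambda>j. \<integral>\<^sup>+n. v (n - j) * c n \<partial>CS)"
  have "(\<integral>\<^sup>+n. N n * c n \<partial>CS) \<le> (\<integral>\<^sup>+n. (\<integral>\<^sup>+j. v (n - j) * A j \<partial>CS) * c n \<partial>CS)"
  proof (intro nn_integral_mono mult_right_mono)
    fix n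
    show "N n \<le> (\<integral>\<^sup>+j. v (n - j) * A j \<partial>CS)"
      using N[of n] nn_sum_shift(4)[of "\<lambda>p. v p * A (n - p)" n] by simp
  qed simp
  also have "\<dots> = (\<integral>\<^sup>+n. \<integral>\<^sup>+j. A j * (v (n - j) * c n) \<partial>CS \<partial>CS)"
    by (simp add: mult_ac flip: nn_integral_multc nn_integral_cmult)
  also have "\<dots> = (\<integral>\<^sup>+j. \<integral>\<^sup>+n. A j * (v (n - j) * c n) \<partial>CS \<partial>CS)" by (rule nn_sum_swap)
  also have "\<dots> = (\<integral>\<^sup>+j. C j * A j \<partial>CS)"
    unfolding C_def by (simp add: nn_integral_cmult mult.commute)
  finally have 1: "(\<integral>\<^sup>+n. N n * c n \<partial>CS) \<le> (\<integral>\<^sup>+j. C j * A j \<partial>CS)" .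
  have vs: "(\<integral>\<^sup>+n. (v (n - j))\<^sup>2 \<partial>CS) \<le> ennreal (W\<^sup>2)" "(\<integral>\<^sup>+n. (v (j - n))\<^sup>2 \<partial>CS) \<le> ennreal (W\<^sup>2)" for j
    using V nn_sum_shift(3)[of "\<lambda>p. (v p)\<^sup>2" j] nn_sum_shift(4)[of "\<lambda>p. (v p)\<^sup>2" j] by simp_all
  have Cb: "C j \<le> ennreal (E * W)" for j unfolding C_def by (rule t2[OF W vs(1)])
  have C2: "(\<integral>\<^sup>+j. (C j)\<^sup>2 \<partial>CS) \<le> ennreal ((E * W * K)\<^sup>2)"
  proof (rule l2_from_testing)
    fix w :: "int \<Rightarrow> ennreal" and x :: real
    assume x: "x \<ge> 0" and w: "(\<integral>\<^sup>+j. (w j)\<^sup>2 \<partial>CS) \<le> ennreal (x\<^sup>2)"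
    have "(\<integral>\<^sup>+j. w j * C j \<partial>CS) = (\<integral>\<^sup>+j. \<integral>\<^sup>+n. w j * (v (n - j) * c n) \<partial>CS \<partial>CS)"
      unfolding C_def by (simp add: nn_integral_cmult)
    also have "\<dots> = (\<integral>\<^sup>+n. \<integral>\<^sup>+j. w j * (v (n - j) * c n) \<partial>CS \<partial>CS)" by (rule nn_sum_swap)
    also have "\<dots> = (\<integral>\<^sup>+n. (\<integral>\<^sup>+j. w j * v (n - j) \<partial>CS) * c n \<partial>CS)"
      by (simp add: mult.assoc flip: nn_integral_multc)
    also have "\<dots> \<le> ennreal (E * K * (x * W))"
      by (rule tinf) (use x W w vs in \<open>auto intro!: l2_product_sum\<close>)
    finally show "(\<integral>\<^sup>+j. w j * C j \<partial>CS) \<le> ennreal (E * W * K * x)" by (simp add: mult_ac)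
  qed (use E W K in \<open>auto intro: le_less_trans[OF Cb]\<close>)
  show ?thesis
  proof (cases "E * W = 0")
    case True
    have "C j \<le> ennreal 0" for j using Cb[of j] unfolding True .
    then have "C j = 0" for j by simp
    then show ?thesis using 1 True by simp
  next
    case False
    then have EW: "E * W > 0" using E W by (metis mult_nonneg_nonneg less_eq_real_def)
    define d where "d = (\<lambda>j. ennreal (1 / (E * W)) * C j)"
    have dC: "C j = ennreal (E * W) * d j" for j
      unfolding d_def mult.assoc[symmetric] using EW by (subst ennreal_mult[symmetric]) auto
    have "d j \<le> 1" for j
    proof -
      have "d j \<le> ennreal (1 / (E * W)) * ennreal (E * W)" unfolding d_def by (rule mult_left_mono[OF Cb]) simp
      also have "\<dots> = 1" using EW by (subst ennreal_mult[symmetric]) auto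
      finally show ?thesis .
    qed
    moreover have "(\<integral>\<^sup>+j. (d j)\<^sup>2 \<partial>CS) \<le> ennreal (K\<^sup>2)"
    proof -
      have "(\<integral>\<^sup>+j. (d j)\<^sup>2 \<partial>CS) = (ennreal (1 / (E * W)))\<^sup>2 * (\<integral>\<^sup>+j. (C j)\<^sup>2 \<partial>CS)"
        unfolding d_def power_mult_distrib by (rule nn_integral_cmult) simp
      also have "\<dots> \<le> (ennreal (1 / (E * W)))\<^sup>2 * ennreal ((E * W * K)\<^sup>2)" by (rule mult_left_mono[OF C2]) simp
      also have "\<dots> = ennreal ((1 / (E * W))\<^sup>2 * (E * W * K)\<^sup>2)"
        using EW by (subst ennreal_power, simp) (rule ennreal_mult[symmetric]; simp)
      also have "(1 / (E * W))\<^sup>2 * (E * W * K)\<^sup>2 = K\<^sup>2" using False by (simp add: power_mult_distrib power_divide)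
      finally show ?thesis .
    qed
    ultimately have "admissible K d" by (simp add: admissible_def)
    have "(\<integral>\<^sup>+j. C j * A j \<partial>CS) = ennreal (E * W) * (\<integral>\<^sup>+j. d j * A j \<partial>CS)"
      unfolding dC mult.assoc by (rule nn_integral_cmult) simp
    also have "\<dots> \<le> ennreal (E * W) * ennreal S" by (rule mult_left_mono[OF A[OF \<open>admissible K d\<close>]]) simp
    also have "\<dots> = ennreal (E * W * S)" using EW S by (simp add: ennreal_mult)
    finally show ?thesis using 1 by (rule order_trans[rotated])
  qed
qed

section \<open>Growth of the tested sums on short time blocks\<close>

context cubic_modes
begin

definition tested_le :: "real \<Rightarrow> real \<Rightarrow> real \<Rightarrow> bool" where
  "tested_le K s b \<longleftrightarrow> (\<forall>c. admissible K c \<longrightarrow> (\<integral>\<^sup>+k. c k * A s k \<partial>CS) \<le> ennreal b)"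

lemma tested_le_trivial: "s \<in> {0..T} \<Longrightarrow> K \<ge> 0 \<Longrightarrow> tested_le K s (K * \<mu>)"
  unfolding tested_le_def admissible_def by (intro allI impI l2_product_sum mass mu) auto

text \<open>For each position of \<open>N\<close> the remaining three arguments form a functional to
  which \<open>conv_dual\<close> applies. Against square-summable sequences the test sequence
  \<open>c\<close> takes the supremum slot with bound 1; against bounded ones it takes an l2 slot
  with norm \<open>K\<close>.\<close>

lemma Lam3_N_dual:
  assumes s: "good_time s" and K: "K \<ge> 0" and S: "S \<ge> 0" and c: "admissible K c" and J: "tested_le K s S"
  shows "(\<integral>\<^sup>+k. c k * (Lam3 k (N s) (A s) (A s) + Lam3 k (A s) (N s) (A s) + Lam3 k (A s) (A s) (N s)) \<partial>CS)
    \<le> ennreal (3 * (hyp_root * \<mu>\<^sup>2 * W s * S))"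
proof -
  have sT: "s \<in> {0..T}" using s by (simp add: good_time_def)
  have m: "(\<integral>\<^sup>+k. (A s k)\<^sup>2 \<partial>CS) \<le> ennreal (\<mu>\<^sup>2)" by (rule mass[OF sT])
  have c1: "c k \<le> ennreal 1" for k using c by (simp add: admissible_def)
  have c2: "(\<integral>\<^sup>+k. (c k)\<^sup>2 \<partial>CS) \<le> ennreal (K\<^sup>2)" using c by (simp add: admissible_def)
  have gen: "(\<integral>\<^sup>+n. N s n * d n \<partial>CS) \<le> ennreal (hyp_root * \<mu>\<^sup>2 * W s * S)"
    if "\<And>w x. x \<ge> 0 \<Longrightarrow> (\<integral>\<^sup>+j. (w j)\<^sup>2 \<partial>CS) \<le> ennreal (x\<^sup>2) \<Longrightarrow> (\<integral>\<^sup>+j. w j * d j \<partial>CS) \<le> ennreal (hyp_root * \<mu>\<^sup>2 * x)"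
      "\<And>w x. x \<ge> 0 \<Longrightarrow> (\<And>j. w j \<le> ennreal x) \<Longrightarrow> (\<integral>\<^sup>+j. w j * d j \<partial>CS) \<le> ennreal (hyp_root * \<mu>\<^sup>2 * K * x)" for d
    using that(1)
  proof (rule conv_dual)
    show "(\<integral>\<^sup>+j. w j * d j \<partial>CS) \<le> ennreal (hyp_root * \<mu>\<^sup>2 * K * x)" if "x \<ge> 0" "\<And>j. w j \<le> ennreal x" for w x
      by (rule \<open>\<And>w x. x \<ge> 0 \<Longrightarrow> (\<And>j. w j \<le> ennreal x) \<Longrightarrow> (\<integral>\<^sup>+j. w j * d j \<partial>CS) \<le> ennreal (hyp_root * \<mu>\<^sup>2 * K * x)\<close>[OF that])
    show "hyp_root * \<mu>\<^sup>2 \<ge> 0" using hyp_root(1) by simp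
    show "(\<integral>\<^sup>+p. (ennreal (V p s))\<^sup>2 \<partial>CS) \<le> ennreal ((W s)\<^sup>2)" using s by (simp add: good_time_def)
    show "(\<integral>\<^sup>+j. d' j * A s j \<partial>CS) \<le> ennreal S" if "admissible K d'" for d' using J that by (simp add: tested_le_def)
    show "N s n \<le> (\<integral>\<^sup>+p. ennreal (V p s) * A s (n - p) \<partial>CS)" for n by (rule N_le_conv[OF s])
  qed (use K S W_nonneg in auto)
  have "Lam c (N s) (A s) (A s) \<le> ennreal (hyp_root * \<mu>\<^sup>2 * W s * S)"
    unfolding Lam_rotate[of c "N s"] Lam_Lam3[of "N s"]
  proof (rule gen)
    show "(\<integral>\<^sup>+j. w j * Lam3 j (A s) (A s) c \<partial>CS) \<le> ennreal (hyp_root * \<mu>\<^sup>2 * x)"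
      if "x \<ge> 0" "(\<integral>\<^sup>+j. (w j)\<^sup>2 \<partial>CS) \<le> ennreal (x\<^sup>2)" for w x
      using Lam_le0[of c 1 w x "A s" \<mu> "A s" \<mu>, OF c1 that(2) m m _ that(1) mu mu]
      by (simp add: Lam_rotate[of c w] Lam_Lam3[of w] power2_eq_square mult_ac)
    show "(\<integral>\<^sup>+j. w j * Lam3 j (A s) (A s) c \<partial>CS) \<le> ennreal (hyp_root * \<mu>\<^sup>2 * K * x)"
      if "x \<ge> 0" "\<And>j. w j \<le> ennreal x" for w x
      using Lam_le0[of w x "A s" \<mu> "A s" \<mu> c K, OF that(2) m m c2 that(1) mu mu K]
      by (simp add: Lam_Lam3[of w] power2_eq_square mult_ac)
  qed
  moreover have "Lam c (A s) (N s) (A s) \<le> ennreal (hyp_root * \<mu>\<^sup>2 * W s * S)"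
    unfolding Lam_rotate[of c "A s" "N s"] Lam_rotate[of "A s" "N s" "A s" c] Lam_Lam3[of "N s"]
  proof (rule gen)
    show "(\<integral>\<^sup>+j. w j * Lam3 j (A s) c (A s) \<partial>CS) \<le> ennreal (hyp_root * \<mu>\<^sup>2 * x)"
      if "x \<ge> 0" "(\<integral>\<^sup>+j. (w j)\<^sup>2 \<partial>CS) \<le> ennreal (x\<^sup>2)" for w x
      using Lam_le0[of c 1 "A s" \<mu> w x "A s" \<mu>, OF c1 m that(2) m _ mu that(1) mu]
      by (simp add: Lam_rotate[of c "A s" w] Lam_rotate[of "A s" w "A s" c] Lam_Lam3[of w] power2_eq_square mult_ac)
    show "(\<integral>\<^sup>+j. w j * Lam3 j (A s) c (A s) \<partial>CS) \<le> ennreal (hyp_root * \<mu>\<^sup>2 * K * x)"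
      if "x \<ge> 0" "\<And>j. w j \<le> ennreal x" for w x
      using Lam_le0[of w x "A s" \<mu> c K "A s" \<mu>, OF that(2) m c2 m that(1) mu K mu]
      by (simp add: Lam_Lam3[of w] power2_eq_square mult_ac)
  qed
  moreover have "Lam c (A s) (A s) (N s) \<le> ennreal (hyp_root * \<mu>\<^sup>2 * W s * S)"
    unfolding Lam_rotate[of c "A s" "A s" "N s"] Lam_rotate[of "A s" "A s" "N s" c] Lam_rotate[of "A s" "N s" c "A s"] Lam_Lam3[of "N s"]
  proof (rule gen)
    show "(\<integral>\<^sup>+j. w j * Lam3 j c (A s) (A s) \<partial>CS) \<le> ennreal (hyp_root * \<mu>\<^sup>2 * x)"
      if "x \<ge> 0" "(\<integral>\<^sup>+j. (w j)\<^sup>2 \<partial>CS) \<le> ennreal (x\<^sup>2)" for w x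
      using Lam_le1[of c 1 "A s" \<mu> "A s" \<mu> w x, OF c1 m m that(2) _ mu mu that(1)]
      by (simp add: Lam_Lam3[of w] power2_eq_square mult_ac)
    show "(\<integral>\<^sup>+j. w j * Lam3 j c (A s) (A s) \<partial>CS) \<le> ennreal (hyp_root * \<mu>\<^sup>2 * K * x)"
      if "x \<ge> 0" "\<And>j. w j \<le> ennreal x" for w x
      using Lam_le0[of w x c K "A s" \<mu> "A s" \<mu>, OF that(2) c2 m m that(1) K mu mu]
      by (simp add: Lam_Lam3[of w] power2_eq_square mult_ac)
  qed
  ultimately have "Lam c (N s) (A s) (A s) + Lam c (A s) (N s) (A s) + Lam c (A s) (A s) (N s)
      \<le> ennreal (hyp_root * \<mu>\<^sup>2 * W s * S) + ennreal (hyp_root * \<mu>\<^sup>2 * W s * S) + ennreal (hyp_root * \<mu>\<^sup>2 * W s * S)"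
    by (intro add_mono)
  also have "\<dots> = ennreal (3 * (hyp_root * \<mu>\<^sup>2 * W s * S))"
    using hyp_root(1) W_nonneg[of s] S by (subst ennreal_plus[symmetric], simp, simp)+ simp
  finally show ?thesis unfolding Lam_Lam3 by (simp add: distrib_left nn_integral_add)
qed

text \<open>The rate at which tested sums can grow: the resonant rotation, with coefficient at most
  2 \<mu>^2 in modulus, and the quintic term. Because of \<open>W\<close> it is integrable in time
  but need not be bounded.\<close>

definition tested_rate :: "real \<Rightarrow> real" where "tested_rate s = 2 * \<eta> * \<mu>\<^sup>2 + \<eta> * (\<eta> / 2 * (3 * (hyp_root * \<mu>\<^sup>2 * W s)))"

lemma tested_rate_nonneg: "tested_rate s \<ge> 0"
  unfolding tested_rate_def using eta mu hyp_root(1) W_nonneg[of s] by (intro add_nonneg_nonneg mult_nonneg_nonneg) auto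

lemma tested_rate_integrable: assumes "0 \<le> r" "t \<le> T" shows "integrable (IM r t) tested_rate"
proof -
  interpret finite_measure "IM r t" by (rule finite_measure_IM)
  show ?thesis unfolding tested_rate_def[abs_def] using W_integrable[OF assms] by auto
qed

text \<open>The normal form on the interval, in absolute values and tested with \<open>c\<close>.
  The two boundary terms, each carrying a factor 1/2, are controlled by the mass alone; only the
  time integral sees the current bound \<open>S\<close>.\<close>

lemma tested_le_step:
  assumes r: "0 \<le> r" "r \<le> t" "t \<le> T" and K: "K \<ge> 0" and S: "S \<ge> 0" and b: "b \<ge> 0"
    and JS: "\<And>s. s \<in> {r..t} \<Longrightarrow> tested_le K s S" and Jr: "tested_le K r b"
  shows "tested_le K t (b + \<eta> * (hyp_root * \<mu> ^ 3) + S * (LINT s|IM r t. tested_rate s))"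
  unfolding tested_le_def
proof (intro allI impI)
  fix c assume c: "admissible K c"
  have rT: "0 \<le> r" "t \<le> T" "r \<in> {0..T}" "t \<in> {0..T}" and sT: "s \<in> {0..T}" if "s \<in> {r..t}" for s
    using r that by auto
  have rT: "0 \<le> r" "t \<le> T" "r \<in> {0..T}" "t \<in> {0..T}" using r by auto
  have sT: "s \<in> {0..T}" if "s \<in> {r..t}" for s using r that by auto
  have [measurable]: "a q \<in> borel_measurable (IM r t)" "n q \<in> borel_measurable (IM r t)" for q
    by (rule a_meas[OF rT(1,2)] n_meas[OF rT(1,2)])+
  let ?L = "\<lambda>k s. Lam3 k (N s) (A s) (A s) + Lam3 k (A s) (N s) (A s) + Lam3 k (A s) (A s) (N s)"
  let ?B = "\<lambda>k s. ennreal (1/2) * Lam3 k (A s) (A s) (A s)"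
  define f where "f = (\<lambda>k s. ennreal (2 * \<eta> * \<mu>\<^sup>2) * A s k + ennreal \<eta> * (ennreal (\<eta> / 2) * ?L k s))"
  have Lm [measurable]: "(\<lambda>s. ?L k s) \<in> borel_measurable (IM r t)" for k
    unfolding Lam3_def by measurable
  have fm [measurable]: "f k \<in> borel_measurable (IM r t)" for k unfolding f_def by measurable
  have pt: "A t k \<le> A r k + (\<integral>\<^sup>+s. f k s \<partial>IM r t) + ennreal \<eta> * (?B k t + ?B k r)" for k
  proof -
    let ?R = "LINT s|IM r t. of_real (rho k s) * a k s"
    let ?Q = "LINT s|IM r t. Qk k s"
    have "a k t = a k r - \<i> * of_real \<eta> * (?R + (Bk k t - Bk k r) - ?Q)"
      using a_increment[OF r, of k] normal_form[OF r, of k] by (simp add: algebra_simps)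
    then have "cmod (a k t) \<le> cmod (a k r) + \<eta> * cmod (?R + (Bk k t - Bk k r) - ?Q)"
      using norm_triangle_ineq4[of "a k r" "\<i> * of_real \<eta> * (?R + (Bk k t - Bk k r) - ?Q)"] eta
      by (simp add: norm_mult)
    also have "\<dots> \<le> cmod (a k r) + \<eta> * (cmod ?R + (cmod (Bk k t) + cmod (Bk k r)) + cmod ?Q)"
    proof -
      have "cmod (?R + (Bk k t - Bk k r) - ?Q) \<le> cmod ?R + (cmod (Bk k t) + cmod (Bk k r)) + cmod ?Q"
        by (rule order_trans[OF norm_triangle_ineq4], rule add_right_mono, rule order_trans[OF norm_triangle_ineq],
            rule add_left_mono, rule norm_triangle_ineq4)
      then show ?thesis using eta by (simp add: mult_left_mono)
    qed
    finally have "A t k \<le> A r k + ennreal \<eta> * (ennreal (cmod ?R) + (ennreal (cmod (Bk k t)) + ennreal (cmod (Bk k r))) + ennreal (cmod ?Q))"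
      using eta by (simp flip: ennreal_plus ennreal_mult)
    also have "\<dots> \<le> A r k + ennreal \<eta> * ((\<integral>\<^sup>+s. ennreal (2 * \<mu>\<^sup>2) * A s k \<partial>IM r t) + (?B k t + ?B k r) + (\<integral>\<^sup>+s. ennreal (\<eta> / 2) * ?L k s \<partial>IM r t))"
    proof (intro add_left_mono mult_left_mono add_mono)
      have "ennreal (cmod ?R) \<le> (\<integral>\<^sup>+s. norm (of_real (rho k s) * a k s) \<partial>IM r t)"
        by (rule integral_norm_bound_ennreal[OF rho_a_integrable[OF rT(1,2)]])
      also have "\<dots> \<le> (\<integral>\<^sup>+s. ennreal (2 * \<mu>\<^sup>2) * A s k \<partial>IM r t)"
      proof (rule nn_integral_mono)
        fix s assume "s \<in> space (IM r t)"
        then have "\<bar>rho k s\<bar> \<le> 2 * \<mu>\<^sup>2" using rho_le[OF sT] by simp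
        then show "ennreal (norm (of_real (rho k s) * a k s)) \<le> ennreal (2 * \<mu>\<^sup>2) * A s k"
          by (simp add: norm_mult mult_right_mono flip: ennreal_mult)
      qed
      finally show "ennreal (cmod ?R) \<le> (\<integral>\<^sup>+s. ennreal (2 * \<mu>\<^sup>2) * A s k \<partial>IM r t)" .
      show "ennreal (cmod (Bk k t)) \<le> ?B k t" "ennreal (cmod (Bk k r)) \<le> ?B k r"
        unfolding Bk_def ph_cubic_term_sum[symmetric] by (rule csum2_norm_le)+
      have "ennreal (cmod ?Q) \<le> (\<integral>\<^sup>+s. norm (Qk k s) \<partial>IM r t)"
        by (rule integral_norm_bound_ennreal[OF Qk_integrable[OF rT(1,2)]])
      also have "\<dots> \<le> (\<integral>\<^sup>+s. ennreal (\<eta> / 2) * ?L k s \<partial>IM r t)"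
        unfolding Qk_def by (rule nn_integral_mono, rule order_trans[OF csum2_norm_le ph_cubic_term_deriv_sum])
      finally show "ennreal (cmod ?Q) \<le> (\<integral>\<^sup>+s. ennreal (\<eta> / 2) * ?L k s \<partial>IM r t)" .
    qed auto
    also have "\<dots> = A r k + (ennreal \<eta> * (\<integral>\<^sup>+s. ennreal (2 * \<mu>\<^sup>2) * A s k \<partial>IM r t) + ennreal \<eta> * (\<integral>\<^sup>+s. ennreal (\<eta> / 2) * ?L k s \<partial>IM r t)) + ennreal \<eta> * (?B k t + ?B k r)"
      by (simp only: distrib_left add_ac)
    also have "ennreal \<eta> * (\<integral>\<^sup>+s. ennreal (2 * \<mu>\<^sup>2) * A s k \<partial>IM r t) + ennreal \<eta> * (\<integral>\<^sup>+s. ennreal (\<eta> / 2) * ?L k s \<partial>IM r t) = (\<integral>\<^sup>+s. f k s \<partial>IM r t)"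
    proof -
      have e: "ennreal \<eta> * (ennreal (2 * \<mu>\<^sup>2) * x) = ennreal (2 * \<eta> * \<mu>\<^sup>2) * x" for x
        unfolding mult.assoc[symmetric] using eta by (subst ennreal_mult[symmetric]) (auto simp: mult_ac)
      have m1: "(\<lambda>s. ennreal (2 * \<mu>\<^sup>2) * A s k) \<in> borel_measurable (IM r t)" "(\<lambda>s. ennreal (\<eta> / 2) * ?L k s) \<in> borel_measurable (IM r t)"
        by measurable
      have m2: "(\<lambda>s. ennreal (2 * \<eta> * \<mu>\<^sup>2) * A s k) \<in> borel_measurable (IM r t)" "(\<lambda>s. ennreal \<eta> * (ennreal (\<eta> / 2) * ?L k s)) \<in> borel_measurable (IM r t)"
        by measurable
      show ?thesis
        unfolding nn_integral_cmult[OF m1(1), symmetric] nn_integral_cmult[OF m1(2), symmetric] e f_def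
        by (rule nn_integral_add[OF m2, symmetric])
    qed
    finally show ?thesis .
  qed
  have "(\<integral>\<^sup>+k. c k * A t k \<partial>CS) \<le> (\<integral>\<^sup>+k. c k * A r k + (\<integral>\<^sup>+s. c k * f k s \<partial>IM r t) + ennreal (\<eta> / 2) * (c k * Lam3 k (A t) (A t) (A t) + c k * Lam3 k (A r) (A r) (A r)) \<partial>CS)"
  proof (rule nn_integral_mono)
    fix k
    have "c k * A t k \<le> c k * (A r k + (\<integral>\<^sup>+s. f k s \<partial>IM r t) + ennreal \<eta> * (?B k t + ?B k r))"
      by (rule mult_left_mono[OF pt]) simp
    also have "\<dots> = c k * A r k + c k * (\<integral>\<^sup>+s. f k s \<partial>IM r t) + (ennreal \<eta> * ennreal (1/2)) * (c k * Lam3 k (A t) (A t) (A t) + c k * Lam3 k (A r) (A r) (A r))"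
      by (simp only: distrib_left mult_ac)
    also have "ennreal \<eta> * ennreal (1/2) = ennreal (\<eta> / 2)" using eta by (subst ennreal_mult[symmetric]) auto
    also have "c k * (\<integral>\<^sup>+s. f k s \<partial>IM r t) = (\<integral>\<^sup>+s. c k * f k s \<partial>IM r t)" by (rule nn_integral_cmult[symmetric]) simp
    finally show "c k * A t k \<le> c k * A r k + (\<integral>\<^sup>+s. c k * f k s \<partial>IM r t) + ennreal (\<eta> / 2) * (c k * Lam3 k (A t) (A t) (A t) + c k * Lam3 k (A r) (A r) (A r))" .
  qed
  also have "\<dots> = (\<integral>\<^sup>+k. c k * A r k \<partial>CS) + (\<integral>\<^sup>+k. \<integral>\<^sup>+s. c k * f k s \<partial>IM r t \<partial>CS) + ennreal (\<eta> / 2) * (Lam c (A t) (A t) (A t) + Lam c (A r) (A r) (A r))"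
    unfolding Lam_Lam3 by (simp add: nn_integral_add nn_integral_cmult)
  also have "\<dots> \<le> ennreal b + ennreal (S * (LINT s|IM r t. tested_rate s)) + ennreal (\<eta> / 2) * (ennreal (hyp_root * \<mu> ^ 3) + ennreal (hyp_root * \<mu> ^ 3))"
  proof (intro add_mono mult_left_mono)
    show "(\<integral>\<^sup>+k. c k * A r k \<partial>CS) \<le> ennreal b" using Jr c by (simp add: tested_le_def)
    show "Lam c (A t) (A t) (A t) \<le> ennreal (hyp_root * \<mu> ^ 3)" "Lam c (A r) (A r) (A r) \<le> ennreal (hyp_root * \<mu> ^ 3)"
      using c rT by (auto intro!: Lam_AAA_le simp: admissible_def)
    have "(\<integral>\<^sup>+k. \<integral>\<^sup>+s. c k * f k s \<partial>IM r t \<partial>CS) = (\<integral>\<^sup>+s. \<integral>\<^sup>+k. c k * f k s \<partial>CS \<partial>IM r t)"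
      by (rule nn_integral_count_space_nn_integral[symmetric]) auto
    also have "\<dots> \<le> (\<integral>\<^sup>+s. ennreal (S * tested_rate s) \<partial>IM r t)"
    proof (rule nn_integral_mono_AE)
      show "AE s in IM r t. (\<integral>\<^sup>+k. c k * f k s \<partial>CS) \<le> ennreal (S * tested_rate s)"
        using AE_good[OF rT(1,2)] AE_space
      proof eventually_elim
        case (elim s)
        then have J: "tested_le K s S" using JS by simp
        have "(\<integral>\<^sup>+k. c k * f k s \<partial>CS) = ennreal (2 * \<eta> * \<mu>\<^sup>2) * (\<integral>\<^sup>+k. c k * A s k \<partial>CS) + ennreal \<eta> * (ennreal (\<eta> / 2) * (\<integral>\<^sup>+k. c k * ?L k s \<partial>CS))"
        proof -
          have "(\<integral>\<^sup>+k. c k * f k s \<partial>CS) = (\<integral>\<^sup>+k. ennreal (2 * \<eta> * \<mu>\<^sup>2) * (c k * A s k) + ennreal \<eta> * (ennreal (\<eta> / 2) * (c k * ?L k s)) \<partial>CS)"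
            unfolding f_def by (rule nn_integral_cong) (simp only: distrib_left mult_ac)
          then show ?thesis by (simp only: nn_integral_add nn_integral_cmult borel_measurable_count_space)
        qed
        also have "\<dots> \<le> ennreal (2 * \<eta> * \<mu>\<^sup>2) * ennreal S + ennreal \<eta> * (ennreal (\<eta> / 2) * ennreal (3 * (hyp_root * \<mu>\<^sup>2 * W s * S)))"
          using J c by (intro add_mono mult_left_mono Lam3_N_dual[OF elim(1) K S c J]) (auto simp: tested_le_def)
        also have "\<dots> = ennreal (2 * \<eta> * \<mu>\<^sup>2 * S + \<eta> * (\<eta> / 2 * (3 * (hyp_root * \<mu>\<^sup>2 * W s * S))))"
          using eta S hyp_root(1) W_nonneg[of s] by (simp add: ennreal_plus ennreal_mult[symmetric] del: ennreal_plus flip: ennreal_plus)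
        also have "2 * \<eta> * \<mu>\<^sup>2 * S + \<eta> * (\<eta> / 2 * (3 * (hyp_root * \<mu>\<^sup>2 * W s * S))) = S * tested_rate s"
          by (simp add: tested_rate_def algebra_simps)
        finally show ?case .
      qed
    qed
    also have "\<dots> = ennreal (LINT s|IM r t. S * tested_rate s)"
      by (rule nn_integral_eq_integral) (use tested_rate_integrable[OF rT(1,2)] tested_rate_nonneg S in auto)
    finally show "(\<integral>\<^sup>+k. \<integral>\<^sup>+s. c k * f k s \<partial>IM r t \<partial>CS) \<le> ennreal (S * (LINT s|IM r t. tested_rate s))" by simp
  qed auto
  also have "\<dots> = ennreal (b + S * (LINT s|IM r t. tested_rate s) + \<eta> / 2 * (hyp_root * \<mu> ^ 3 + hyp_root * \<mu> ^ 3))"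
    using b S eta hyp_root(1) mu Bochner_Integration.integral_nonneg[of "IM r t" tested_rate] tested_rate_nonneg
    by (simp add: ennreal_mult[symmetric] del: ennreal_plus flip: ennreal_plus)
  also have "b + S * (LINT s|IM r t. tested_rate s) + \<eta> / 2 * (hyp_root * \<mu> ^ 3 + hyp_root * \<mu> ^ 3) = b + \<eta> * (hyp_root * \<mu> ^ 3) + S * (LINT s|IM r t. tested_rate s)"
    by (simp add: algebra_simps)
  finally show "(\<integral>\<^sup>+k. c k * A t k \<partial>CS) \<le> ennreal (b + \<eta> * (hyp_root * \<mu> ^ 3) + S * (LINT s|IM r t. tested_rate s))" .
qed

text \<open>The primitive of an integrable rate is uniformly continuous. The length of the blocks
  has to come from this, as \<open>W\<close> carries no pointwise bound.\<close>

lemma tested_rate_blocks: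
  "\<exists>\<delta>>0. \<forall>r t. 0 \<le> r \<longrightarrow> r \<le> t \<longrightarrow> t \<le> T \<longrightarrow> t - r \<le> \<delta> \<longrightarrow> (LINT s|IM r t. tested_rate s) \<le> 1/2"
proof -
  define G where "G = (\<lambda>t. LINT s:{0..t}|lborel. complex_of_real (tested_rate s))"
  have si: "set_integrable lborel {0..T} (\<lambda>s. complex_of_real (tested_rate s))"
    unfolding set_integral_IM(2) using tested_rate_integrable[of 0 T] T by simp
  have G: "AC_on 0 T G (\<lambda>s. complex_of_real (tested_rate s))"
  proof (rule AC_onI[OF si])
    have "G 0 = 0" unfolding G_def set_lebesgue_integral_def
      by (rule integral_eq_zero_AE) (use AE_lborel_singleton[of 0] in eventually_elim, simp)
    then show "G t = G 0 + (LINT s:{0..t}|lborel. complex_of_real (tested_rate s))" for t by (simp add: G_def)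
  qed
  have "uniformly_continuous_on {0..T} G"
    by (rule compact_uniformly_continuous[OF AC_on_continuous[OF G]]) simp
  then obtain d where d: "d > 0" "\<And>x x'. x \<in> {0..T} \<Longrightarrow> x' \<in> {0..T} \<Longrightarrow> dist x' x < d \<Longrightarrow> dist (G x') (G x) < 1/2"
    unfolding uniformly_continuous_on_def by (metis half_gt_zero zero_less_one)
  have "(LINT s|IM r t. tested_rate s) \<le> 1/2" if "0 \<le> r" "r \<le> t" "t \<le> T" "t - r \<le> d / 2" for r t
  proof -
    have "G t = G r + (LINT s:{r..t}|lborel. complex_of_real (tested_rate s))"
      by (rule AC_on_eq[OF AC_on_subinterval[OF G]]) (use that in auto)
    also have "(LINT s:{r..t}|lborel. complex_of_real (tested_rate s)) = of_real (LINT s|IM r t. tested_rate s)"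
      by (simp only: set_integral_IM integral_complex_of_real)
    finally have "G t - G r = of_real (LINT s|IM r t. tested_rate s)" by simp
    moreover have "dist (G t) (G r) < 1/2" by (rule d(2)) (use that d(1) in \<open>auto simp: dist_real_def\<close>)
    ultimately have "\<bar>LINT s|IM r t. tested_rate s\<bar> < 1/2" by (simp add: dist_norm)
    then show ?thesis by simp
  qed
  with d(1) show ?thesis by (intro exI[of _ "d / 2"]) auto
qed

text \<open>One pass turns a bound \<open>S\<close> into \<open>D + S / 2\<close>, where
  \<open>D\<close> is the initial bound plus the boundary terms. Starting from the trivial bound
  \<open>K * \<mu>\<close>, the iteration converges to \<open>2 * D\<close>, from which
  \<open>K\<close> has disappeared.\<close>

lemma tested_le_block:
  assumes r: "0 \<le> r" "r \<le> T" and K: "K \<ge> 0" and b: "b \<ge> 0" and Jr: "tested_le K r b"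
    and blk: "\<And>s. s \<in> {r..r'} \<Longrightarrow> (LINT s'|IM r s. tested_rate s') \<le> 1/2" and r': "r' \<le> T" and s: "s \<in> {r..r'}"
  shows "tested_le K s (2 * (b + \<eta> * (hyp_root * \<mu> ^ 3)))"
proof -
  let ?D = "b + \<eta> * (hyp_root * \<mu> ^ 3)"
  have D: "?D \<ge> 0" using b eta hyp_root(1) mu by simp
  have "\<forall>s\<in>{r..r'}. tested_le K s (2 * ?D + K * \<mu> / 2 ^ m)" for m :: nat
  proof (induction m)
    case 0
    show ?case
    proof
      fix s assume s: "s \<in> {r..r'}"
      have "tested_le K s (K * \<mu>)" by (rule tested_le_trivial) (use s r r' K in auto)
      moreover have "ennreal (K * \<mu>) \<le> ennreal (2 * ?D + K * \<mu> / 2 ^ 0)" using D by (intro ennreal_leI) simp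
      ultimately show "tested_le K s (2 * ?D + K * \<mu> / 2 ^ 0)" unfolding tested_le_def by (meson order_trans)
    qed
  next
    case (Suc m)
    show ?case
    proof
      fix s assume s: "s \<in> {r..r'}"
      let ?S = "2 * ?D + K * \<mu> / 2 ^ m"
      have S: "?S \<ge> 0" using D K mu by simp
      have J: "tested_le K s (b + \<eta> * (hyp_root * \<mu> ^ 3) + ?S * (LINT s'|IM r s. tested_rate s'))"
        by (rule tested_le_step) (use Suc r r' s K S b Jr in auto)
      have "?S * (LINT s'|IM r s. tested_rate s') \<le> ?S * (1/2)" by (rule mult_left_mono[OF blk[OF s] S])
      then have "ennreal (b + \<eta> * (hyp_root * \<mu> ^ 3) + ?S * (LINT s'|IM r s. tested_rate s')) \<le> ennreal (2 * ?D + K * \<mu> / 2 ^ Suc m)"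
        by (intro ennreal_leI) (simp add: field_simps)
      then show "tested_le K s (2 * ?D + K * \<mu> / 2 ^ Suc m)" using J unfolding tested_le_def by (meson order_trans)
    qed
  qed
  then have J: "tested_le K s (2 * ?D + K * \<mu> / 2 ^ m)" for m :: nat using s by blast
  show ?thesis unfolding tested_le_def
  proof (intro allI impI)
    fix c assume c: "admissible K c"
    have "(\<lambda>m. 2 * ?D + K * \<mu> / 2 ^ m) \<longlonglongrightarrow> 2 * ?D + 0"
      by (intro tendsto_add tendsto_const) (use LIMSEQ_divide_realpow_zero[of 2 "K * \<mu>"] in simp)
    then have "(\<lambda>m. ennreal (2 * ?D + K * \<mu> / 2 ^ m)) \<longlonglongrightarrow> ennreal (2 * ?D)"
      by (intro tendsto_ennrealI) simp
    then show "(\<integral>\<^sup>+k. c k * A s k \<partial>CS) \<le> ennreal (2 * ?D)"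
      by (rule LIMSEQ_le_const) (use J c in \<open>auto simp: tested_le_def\<close>)
  qed
qed

text \<open>The increments of the tested sums are bounded uniformly in the test level \<open>K\<close>, because the normal form
  smooths the non-resonant part and the resonant part is diagonal; then \<open>K\<close> tends to infinity.\<close>

lemma l1_propagation:
  assumes Y: "(\<integral>\<^sup>+k. A 0 k \<partial>CS) \<le> ennreal Y" "Y \<ge> 0"
  shows "\<exists>L\<ge>0. \<forall>s\<in>{0..T}. (\<integral>\<^sup>+k. A s k \<partial>CS) \<le> ennreal L"
proof -
  obtain \<delta> where \<delta>: "\<delta> > 0" "\<And>r t. 0 \<le> r \<Longrightarrow> r \<le> t \<Longrightarrow> t \<le> T \<Longrightarrow> t - r \<le> \<delta> \<Longrightarrow> (LINT s|IM r t. tested_rate s) \<le> 1/2"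
    using tested_rate_blocks by blast
  \<comment> \<open>The bound is chosen before \<open>K\<close>: uniformity in the level is the
    point of the induction over blocks.\<close>
  have "\<exists>b\<ge>0. \<forall>K\<ge>0. \<forall>s\<in>{0..min T (real m * \<delta>)}. tested_le K s b" for m :: nat
  proof (induction m)
    case 0
    have "tested_le K 0 Y" for K
      unfolding tested_le_def
    proof (intro allI impI)
      fix c assume c: "admissible K c"
      have "(\<integral>\<^sup>+k. c k * A 0 k \<partial>CS) \<le> (\<integral>\<^sup>+k. 1 * A 0 k \<partial>CS)"
        by (intro nn_integral_mono mult_right_mono) (use c in \<open>auto simp: admissible_def\<close>)
      then show "(\<integral>\<^sup>+k. c k * A 0 k \<partial>CS) \<le> ennreal Y" using Y(1) by simp
    qed
    then show ?case using Y(2) T by auto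
  next
    case (Suc m)
    then obtain b where b: "b \<ge> 0" "\<And>K s. K \<ge> 0 \<Longrightarrow> s \<in> {0..min T (real m * \<delta>)} \<Longrightarrow> tested_le K s b" by blast
    let ?b = "2 * (b + \<eta> * (hyp_root * \<mu> ^ 3))"
    have b0: "?b \<ge> 0" "b \<le> ?b" using b(1) eta hyp_root(1) mu by auto
    have "tested_le K s ?b" if K: "K \<ge> 0" and s: "s \<in> {0..min T (real (Suc m) * \<delta>)}" for K s
    proof (cases "s \<le> min T (real m * \<delta>)")
      case True
      then have "tested_le K s b" using b(2)[OF K] s by simp
      then show ?thesis using ennreal_leI[OF b0(2)] unfolding tested_le_def by (meson order_trans)
    next
      case False
      let ?r = "real m * \<delta>"
      have r: "0 \<le> ?r" "?r \<le> T" using False s \<delta>(1) by auto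
      show ?thesis
      proof (rule tested_le_block[OF r K b(1)])
        show "tested_le K ?r b" using b(2)[OF K, of ?r] r by simp
        show "(LINT s'|IM ?r s''. tested_rate s') \<le> 1/2" if "s'' \<in> {?r..s}" for s''
          by (rule \<delta>(2)) (use that r s in \<open>auto simp: algebra_simps\<close>)
        show "s \<le> T" "s \<in> {?r..s}" using s False by auto
      qed
    qed
    then show ?case using b0(1) by blast
  qed
  moreover obtain m :: nat where "T \<le> real m * \<delta>"
    using reals_Archimedean3[OF \<delta>(1)] less_imp_le by blast
  ultimately obtain b where b: "b \<ge> 0" "\<And>K s. K \<ge> 0 \<Longrightarrow> s \<in> {0..T} \<Longrightarrow> tested_le K s b" by (metis min.absorb1)
  have "(\<integral>\<^sup>+k. A s k \<partial>CS) \<le> ennreal b" if s: "s \<in> {0..T}" for s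
  proof -
    have "(\<Sum>k\<in>{- int K..int K}. norm (a k s)) \<le> b" for K
    proof -
      \<comment> \<open>The indicator of a window is admissible at the level given by the root of
        its size; testing with it gives a partial sum of the l1 norm.\<close>
      let ?c = "indicator {- int K..int K} :: int \<Rightarrow> ennreal"
      have "(\<integral>\<^sup>+k. (?c k)\<^sup>2 \<partial>CS) = (\<integral>\<^sup>+k. ?c k \<partial>CS)" by (rule nn_integral_cong) (simp add: indicator_def)
      also have "\<dots> = ennreal ((sqrt (real (card {- int K..int K})))\<^sup>2)"
        by (simp add: ennreal_of_nat_eq_real_of_nat)
      finally have "admissible (sqrt (real (card {- int K..int K}))) ?c"
        unfolding admissible_def by (auto simp: indicator_def)
      then have "(\<integral>\<^sup>+k. ?c k * A s k \<partial>CS) \<le> ennreal b"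
        using b(2)[OF _ s, of "sqrt (real (card {- int K..int K}))"] by (simp add: tested_le_def)
      moreover have "(\<integral>\<^sup>+k. ?c k * A s k \<partial>CS) = ennreal (\<Sum>k\<in>{- int K..int K}. norm (a k s))"
        by (simp add: mult.commute[of "indicator _ _"] flip: nn_integral_count_space_indicator)
           (simp add: nn_integral_count_space_finite)
      ultimately show ?thesis using b(1) by simp
    qed
    note i = csum_integrable_bound[OF this]
    have "(\<integral>\<^sup>+k. A s k \<partial>CS) = ennreal (LINT k|CS. norm (a k s))"
      using i(1) by (subst nn_integral_eq_integral) auto
    then show ?thesis using i(2) by (simp add: ennreal_leI)
  qed
  then show ?thesis using b(1) by blast
qed

end

section \<open>Approximation by the resonant flow\<close>

text \<open>\<open>Lam3\<close> without the weight: once the modes are summable, plain convolution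
  estimates suffice.\<close>

definition T3 :: "int \<Rightarrow> (int \<Rightarrow> ennreal) \<Rightarrow> (int \<Rightarrow> ennreal) \<Rightarrow> (int \<Rightarrow> ennreal) \<Rightarrow> ennreal" where
  "T3 k w1 w2 w3 = (\<integral>\<^sup>+p. \<integral>\<^sup>+q. w1 (k - q) * w2 (k - p - q) * w3 (k - p) \<partial>CS \<partial>CS)"

text \<open>The map from \<open>(k, p, q)\<close> to the three frequencies
  \<open>(k - q, k - p - q, k - p)\<close> is a bijection, so the triple sum factorises.\<close>

lemma T3_sum: "(\<integral>\<^sup>+k. T3 k w1 w2 w3 \<partial>CS) = (\<integral>\<^sup>+k. w1 k \<partial>CS) * (\<integral>\<^sup>+k. w2 k \<partial>CS) * (\<integral>\<^sup>+k. w3 k \<partial>CS)"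
proof -
  have "(\<integral>\<^sup>+k. T3 k w1 w2 w3 \<partial>CS) = (\<integral>\<^sup>+k. \<integral>\<^sup>+p. \<integral>\<^sup>+j. w1 j * w2 (j - p) * w3 (k - p) \<partial>CS \<partial>CS \<partial>CS)"
    unfolding T3_def
  proof (rule nn_integral_cong, rule nn_integral_cong)
    fix k p
    have e: "k - p - q = k - q - p" for q :: int by simp
    show "(\<integral>\<^sup>+q. w1 (k - q) * w2 (k - p - q) * w3 (k - p) \<partial>CS) = (\<integral>\<^sup>+j. w1 j * w2 (j - p) * w3 (k - p) \<partial>CS)"
      unfolding e by (rule nn_sum_shift(4)[of "\<lambda>j. w1 j * w2 (j - p) * w3 (k - p)" k])
  qed
  also have "\<dots> = (\<integral>\<^sup>+p. \<integral>\<^sup>+k. \<integral>\<^sup>+j. w1 j * w2 (j - p) * w3 (k - p) \<partial>CS \<partial>CS \<partial>CS)" by (rule nn_sum_swap)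
  also have "\<dots> = (\<integral>\<^sup>+p. (\<integral>\<^sup>+j. w1 j * w2 (j - p) \<partial>CS) * (\<integral>\<^sup>+k. w3 k \<partial>CS) \<partial>CS)"
    by (simp add: nn_integral_multc nn_integral_cmult nn_sum_shift)
  also have "\<dots> = (\<integral>\<^sup>+p. \<integral>\<^sup>+j. w1 j * w2 (j - p) \<partial>CS \<partial>CS) * (\<integral>\<^sup>+k. w3 k \<partial>CS)" by (rule nn_integral_multc) simp
  also have "(\<integral>\<^sup>+p. \<integral>\<^sup>+j. w1 j * w2 (j - p) \<partial>CS \<partial>CS) = (\<integral>\<^sup>+j. \<integral>\<^sup>+p. w1 j * w2 (j - p) \<partial>CS \<partial>CS)" by (rule nn_sum_swap)
  also have "\<dots> = (\<integral>\<^sup>+k. w1 k \<partial>CS) * (\<integral>\<^sup>+k. w2 k \<partial>CS)"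
    by (simp add: nn_integral_multc nn_integral_cmult nn_sum_shift)
  finally show ?thesis .
qed

lemma Lam3_le_T3: "Lam3 k w1 w2 w3 \<le> T3 k w1 w2 w3"
  unfolding Lam3_def T3_def
proof (rule nn_integral_mono, rule nn_integral_mono)
  fix p q :: int
  have "1 / (\<bar>of_int p\<bar> * \<bar>of_int q\<bar>) \<le> (1::real)"
  proof (cases "p = 0 \<or> q = 0")
    case False
    then have "1 \<le> \<bar>p\<bar> * \<bar>q\<bar>" using mult_mono[of 1 "\<bar>p\<bar>" 1 "\<bar>q\<bar>"] by auto
    then have "1 \<le> \<bar>real_of_int p\<bar> * \<bar>real_of_int q\<bar>" by (metis of_int_1_le_iff of_int_abs of_int_mult)
    then show ?thesis by (simp add: divide_le_eq_1)
  qed auto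
  then have "ennreal (1 / (\<bar>of_int p\<bar> * \<bar>of_int q\<bar>)) \<le> 1" by simp
  from mult_right_mono[OF this]
  show "ennreal (1 / (\<bar>of_int p\<bar> * \<bar>of_int q\<bar>)) * (w1 (k - q) * w2 (k - p - q) * w3 (k - p)) \<le> w1 (k - q) * w2 (k - p - q) * w3 (k - p)"
    by simp
qed

section \<open>Estimates in the Wiener norm\<close>

context cubic_modes
begin

abbreviation (input) "Y s \<equiv> (\<integral>\<^sup>+k. A s k \<partial>CS)"

lemma N_sum:
  assumes s: "good_time s" and L: "Y s \<le> ennreal L" "L \<ge> 0"
  shows "(\<integral>\<^sup>+k. N s k \<partial>CS) \<le> ennreal (L ^ 3)"
proof -
  have "N s k \<le> T3 k (A s) (A s) (A s)" for k
  proof -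
    have "n k s = csum2 (\<lambda>p q. tri k p q s)"
      using s Sp_eq[of k _ s] by (simp add: good_time_def csum2_def Sp_def)
    then have "N s k \<le> (\<integral>\<^sup>+p. \<integral>\<^sup>+q. norm (tri k p q s) \<partial>CS \<partial>CS)" using csum2_norm_le by simp
    then show ?thesis by (simp add: T3_def tri_def cubic_term_def norm_mult ennreal_mult)
  qed
  then have "(\<integral>\<^sup>+k. N s k \<partial>CS) \<le> (\<integral>\<^sup>+k. T3 k (A s) (A s) (A s) \<partial>CS)" by (intro nn_integral_mono) auto
  also have "\<dots> \<le> ennreal L * ennreal L * ennreal L" unfolding T3_sum by (intro mult_mono L) auto
  also have "\<dots> = ennreal (L ^ 3)" using L by (simp add: ennreal_mult power3_eq_cube)
  finally show ?thesis .
qed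

lemma Bk_sum:
  assumes L: "Y s \<le> ennreal L" "L \<ge> 0"
  shows "(\<integral>\<^sup>+k. norm (Bk k s) \<partial>CS) \<le> ennreal (L ^ 3 / 2)"
proof -
  have "(\<integral>\<^sup>+k. norm (Bk k s) \<partial>CS) \<le> (\<integral>\<^sup>+k. ennreal (1/2) * T3 k (A s) (A s) (A s) \<partial>CS)"
    unfolding Bk_def
    by (rule nn_integral_mono, rule order_trans[OF csum2_norm_le], unfold ph_cubic_term_sum, rule mult_left_mono[OF Lam3_le_T3]) simp
  also have "\<dots> = ennreal (1/2) * (\<integral>\<^sup>+k. T3 k (A s) (A s) (A s) \<partial>CS)" by (rule nn_integral_cmult) simp
  also have "\<dots> \<le> ennreal (1/2) * (ennreal L * ennreal L * ennreal L)" unfolding T3_sum by (intro mult_mono L) auto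
  also have "\<dots> = ennreal (1/2 * (L * L * L))" using L by (simp only: ennreal_mult[symmetric] mult_nonneg_nonneg)
  finally show ?thesis by (simp add: power3_eq_cube)
qed

text \<open>The cubic term has l1 norm at most \<open>L ^ 3\<close> and occurs once in each of three
  products with two modes, which gives three times \<open>L ^ 5\<close>; the factor \<eta> / 2 comes
  from the derivative and the phase.\<close>

lemma Qk_sum:
  assumes s: "good_time s" and L: "Y s \<le> ennreal L" "L \<ge> 0"
  shows "(\<integral>\<^sup>+k. norm (Qk k s) \<partial>CS) \<le> ennreal (3 * \<eta> / 2 * L ^ 5)"
proof -
  note Ns = N_sum[OF s L]
  have "(\<integral>\<^sup>+k. norm (Qk k s) \<partial>CS) \<le> (\<integral>\<^sup>+k. ennreal (\<eta> / 2) * (T3 k (N s) (A s) (A s) + T3 k (A s) (N s) (A s) + T3 k (A s) (A s) (N s)) \<partial>CS)"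
    unfolding Qk_def
    by (rule nn_integral_mono, rule order_trans[OF csum2_norm_le], rule order_trans[OF ph_cubic_term_deriv_sum], intro mult_left_mono add_mono Lam3_le_T3) simp
  also have "\<dots> = ennreal (\<eta> / 2) * ((\<integral>\<^sup>+k. T3 k (N s) (A s) (A s) \<partial>CS) + (\<integral>\<^sup>+k. T3 k (A s) (N s) (A s) \<partial>CS) + (\<integral>\<^sup>+k. T3 k (A s) (A s) (N s) \<partial>CS))"
    by (simp add: nn_integral_cmult nn_integral_add)
  also have "\<dots> \<le> ennreal (\<eta> / 2) * (ennreal (L ^ 3) * ennreal L * ennreal L + ennreal L * ennreal (L ^ 3) * ennreal L + ennreal L * ennreal L * ennreal (L ^ 3))"
    unfolding T3_sum by (intro mult_left_mono add_mono mult_mono L Ns) auto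
  also have "\<dots> = ennreal (\<eta> / 2 * (L ^ 3 * L * L + L * L ^ 3 * L + L * L * L ^ 3))"
    using L(2) eta by (simp add: ennreal_mult[symmetric] del: ennreal_plus flip: ennreal_plus)
  also have "\<eta> / 2 * (L ^ 3 * L * L + L * L ^ 3 * L + L * L * L ^ 3) = 3 * \<eta> / 2 * L ^ 5" by (simp add: eval_nat_numeral)
  finally show ?thesis .
qed

lemma A_le_L: assumes "Y s \<le> ennreal L" "L \<ge> 0" shows "cmod (a k s) \<le> L"
proof -
  have "A s k \<le> Y s" by (rule nn_integral_ge_point) simp
  then have "A s k \<le> ennreal L" using assms(1) by (rule order_trans)
  then show ?thesis using assms(2) by simp
qed

lemma ms_le_L: assumes s: "s \<in> {0..T}" and L: "Y s \<le> ennreal L" "L \<ge> 0" shows "ms s \<le> L\<^sup>2"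
proof -
  have "ennreal (ms s) = (\<integral>\<^sup>+q. ennreal ((cmod (a q s))\<^sup>2) \<partial>CS)"
    unfolding ms_def using sqsum_integrable[OF s] by (simp add: nn_integral_eq_integral)
  also have "\<dots> \<le> (\<integral>\<^sup>+q. ennreal L * A s q \<partial>CS)"
    by (rule nn_integral_mono) (use A_le_L[OF L] L(2) in \<open>auto simp: power2_eq_square simp flip: ennreal_mult intro!: ennreal_leI mult_right_mono\<close>)
  also have "\<dots> = ennreal L * Y s" by (rule nn_integral_cmult) simp
  also have "\<dots> \<le> ennreal L * ennreal L" by (rule mult_left_mono[OF L(1)]) simp
  also have "\<dots> = ennreal (L\<^sup>2)" using L(2) by (simp add: ennreal_mult power2_eq_square)
  finally show ?thesis by simp
qed

lemma rho_le_L: assumes s: "s \<in> {0..T}" and L: "Y s \<le> ennreal L" "L \<ge> 0" shows "\<bar>rho k s\<bar> \<le> 2 * L\<^sup>2"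
proof -
  have "(cmod (a k s))\<^sup>2 \<le> ms s"
    using cseq_lim_nn[OF sqsum_integrable[OF s], of "{k}"] by (simp add: ms_def)
  then show ?thesis using ms_le_L[OF assms] zero_le_power2[of "cmod (a k s)"] ms_bounds(1)[OF s]
    unfolding rho_def abs_le_iff by linarith
qed

text \<open>The boundary term is absorbed into the mode. What remains in the equation is the
  resonant rotation of \<open>bb\<close> itself and a remainder quadratic in \<eta>.\<close>

definition bb :: "int \<Rightarrow> real \<Rightarrow> complex" where "bb k s = a k s + \<i> * of_real \<eta> * Bk k s"
text \<open>Besides the quintic term it contains what arises when \<open>rho * a\<close> is
  rewritten as a multiple of \<open>bb\<close>.\<close>

definition rk :: "int \<Rightarrow> real \<Rightarrow> complex" where "rk k s = \<i> * of_real \<eta> * Qk k s - of_real (\<eta>\<^sup>2 * rho k s) * Bk k s"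

lemma bb_AC: "AC_on 0 T (bb k) (\<lambda>s. - (\<i> * of_real (\<eta> * rho k s)) * bb k s + rk k s)"
proof -
  have e: "- (\<i> * of_real (\<eta> * rho k s)) * bb k s + rk k s = - (\<i> * of_real \<eta>) * (of_real (rho k s) * a k s - Qk k s)" for s
    by (simp add: bb_def rk_def algebra_simps power2_eq_square)
  show ?thesis unfolding e
  proof (rule AC_onI)
    have i: "integrable (IM 0 t) (\<lambda>s. of_real (rho k s) * a k s - Qk k s)" if "t \<le> T" for t
      using rho_a_integrable[OF order_refl that] Qk_integrable[OF order_refl that] by (rule Bochner_Integration.integrable_diff)
    show "set_integrable lborel {0..T} (\<lambda>s. - (\<i> * of_real \<eta>) * (of_real (rho k s) * a k s - Qk k s))"
      unfolding set_integral_IM by (rule integrable_mult_right[OF i]) simp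
    fix t assume t: "t \<in> {0..T}"
    have "bb k t = bb k 0 + - (\<i> * of_real \<eta>) * ((LINT s|IM 0 t. of_real (rho k s) * a k s) - (LINT s|IM 0 t. Qk k s))"
      using a_increment[of 0 t k] normal_form[of 0 t k] t by (simp add: bb_def algebra_simps)
    also have "(LINT s|IM 0 t. of_real (rho k s) * a k s) - (LINT s|IM 0 t. Qk k s) = (LINT s|IM 0 t. of_real (rho k s) * a k s - Qk k s)"
      using rho_a_integrable[of 0 t k] Qk_integrable[of 0 t k] t by simp
    finally show "bb k t = bb k 0 + (LINT s:{0..t}|lborel. - (\<i> * of_real \<eta>) * (of_real (rho k s) * a k s - Qk k s))"
      unfolding set_integral_IM integral_mult_right_zero .
  qed
qed

lemma Bk_meas: assumes "0 \<le> r" "t \<le> T" shows "Bk k \<in> borel_measurable (IM r t)"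
proof -
  have [measurable]: "(\<lambda>s. ph p q s * cubic_term k p q s) \<in> borel_measurable (IM r t)" for p q
    by (intro borel_measurable_times ph_meas cubic_term_meas[OF assms])
  show ?thesis unfolding Bk_def[abs_def] csum2_def by measurable
qed

lemma rk_meas: assumes "0 \<le> r" "t \<le> T" shows "rk k \<in> borel_measurable (IM r t)"
proof -
  have [measurable]: "Qk k \<in> borel_measurable (IM r t)" "rho k \<in> borel_measurable (IM r t)" "Bk k \<in> borel_measurable (IM r t)"
    using Qk_integrable[OF assms, of k] rho_meas[OF assms] Bk_meas[OF assms] by auto
  show ?thesis unfolding rk_def[abs_def] by measurable
qed

lemma rk_sum:
  assumes s: "good_time s" and L: "Y s \<le> ennreal L" "L \<ge> 0"
  shows "(\<integral>\<^sup>+k. norm (rk k s) \<partial>CS) \<le> ennreal (3 * \<eta>\<^sup>2 * L ^ 5)"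
proof -
  have sT: "s \<in> {0..T}" using s by (simp add: good_time_def)
  have "(\<integral>\<^sup>+k. norm (rk k s) \<partial>CS) \<le> (\<integral>\<^sup>+k. ennreal \<eta> * norm (Qk k s) + ennreal (\<eta>\<^sup>2 * (2 * L\<^sup>2)) * norm (Bk k s) \<partial>CS)"
  proof (rule nn_integral_mono)
    fix k
    have "norm (rk k s) \<le> \<eta> * norm (Qk k s) + \<eta>\<^sup>2 * \<bar>rho k s\<bar> * norm (Bk k s)"
      unfolding rk_def using norm_triangle_ineq4[of "\<i> * of_real \<eta> * Qk k s" "of_real (\<eta>\<^sup>2 * rho k s) * Bk k s"] eta
      by (simp add: norm_mult norm_power abs_mult)
    also have "\<dots> \<le> \<eta> * norm (Qk k s) + \<eta>\<^sup>2 * (2 * L\<^sup>2) * norm (Bk k s)"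
      by (intro add_left_mono mult_right_mono mult_left_mono rho_le_L[OF sT L]) auto
    finally show "ennreal (norm (rk k s)) \<le> ennreal \<eta> * norm (Qk k s) + ennreal (\<eta>\<^sup>2 * (2 * L\<^sup>2)) * norm (Bk k s)"
      using eta by (simp flip: ennreal_plus ennreal_mult)
  qed
  also have "\<dots> = ennreal \<eta> * (\<integral>\<^sup>+k. norm (Qk k s) \<partial>CS) + ennreal (\<eta>\<^sup>2 * (2 * L\<^sup>2)) * (\<integral>\<^sup>+k. norm (Bk k s) \<partial>CS)"
    by (simp add: nn_integral_add nn_integral_cmult)
  also have "\<dots> \<le> ennreal \<eta> * ennreal (3 * \<eta> / 2 * L ^ 5) + ennreal (\<eta>\<^sup>2 * (2 * L\<^sup>2)) * ennreal (L ^ 3 / 2)"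
    by (intro add_mono mult_left_mono Qk_sum[OF s L] Bk_sum[OF L]) auto
  also have "\<dots> = ennreal (\<eta> * (3 * \<eta> / 2 * L ^ 5) + \<eta>\<^sup>2 * (2 * L\<^sup>2) * (L ^ 3 / 2))"
    using eta L(2) by (simp add: ennreal_mult[symmetric] del: ennreal_plus flip: ennreal_plus)
  also have "\<dots> \<le> ennreal (3 * \<eta>\<^sup>2 * L ^ 5)"
  proof (rule ennreal_leI)
    \<comment> \<open>The coefficient is 3/2 from the quintic term plus 1 from the product of
      \<open>rho\<close> and \<open>Bk\<close>; it is rounded up to 3.\<close>
    have e: "\<eta> * (3 * \<eta> / 2 * L ^ 5) + \<eta>\<^sup>2 * (2 * L\<^sup>2) * (L ^ 3 / 2) = 5 / 2 * (\<eta>\<^sup>2 * L ^ 5)" by (simp add: eval_nat_numeral field_simps)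
    have "0 \<le> \<eta>\<^sup>2 * L ^ 5" using L(2) by simp
    then show "\<eta> * (3 * \<eta> / 2 * L ^ 5) + \<eta>\<^sup>2 * (2 * L\<^sup>2) * (L ^ 3 / 2) \<le> 3 * \<eta>\<^sup>2 * L ^ 5" unfolding e by simp
  qed
  finally show ?thesis .
qed

end

text \<open>The time \<open>t\<close> may be shorter than \<open>T\<close>, so that the estimates
  can be used up to the first time at which the Wiener norm reaches \<open>L\<close>. The condition
  on \<eta> L^2 keeps \<open>bb\<close> within \<open>L / 2\<close> of \<open>a\<close> in that
  norm.\<close>

locale cubic_modes_bounded = cubic_modes +
  fixes t L :: real
  assumes t: "0 \<le> t" "t \<le> T" and L: "L \<ge> 0" and kappa: "\<eta> * L\<^sup>2 \<le> 1"
    and YL: "\<And>s. s \<in> {0..t} \<Longrightarrow> (\<integral>\<^sup>+k. ennreal (cmod (a k s)) \<partial>CS) \<le> ennreal L"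
begin

lemma sT: "s \<in> {0..t} \<Longrightarrow> s \<in> {0..T}" using t by auto

lemma ab_sum: assumes "s \<in> {0..t}" shows "(\<integral>\<^sup>+k. cmod (a k s - bb k s) \<partial>CS) \<le> ennreal (\<eta> * L ^ 3 / 2)"
proof -
  have "(\<integral>\<^sup>+k. cmod (a k s - bb k s) \<partial>CS) = ennreal \<eta> * (\<integral>\<^sup>+k. norm (Bk k s) \<partial>CS)"
    using eta by (simp add: bb_def norm_mult ennreal_mult nn_integral_cmult)
  also have "\<dots> \<le> ennreal \<eta> * ennreal (L ^ 3 / 2)" by (rule mult_left_mono[OF Bk_sum[OF YL[OF assms] L]]) simp
  also have "\<dots> = ennreal (\<eta> * L ^ 3 / 2)" using eta L by (subst ennreal_mult[symmetric]) auto
  finally show ?thesis .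
qed

lemma kL: "\<eta> * L ^ 3 / 2 \<le> L / 2"
  using mult_right_mono[OF kappa L] by (simp add: eval_nat_numeral)

lemma bb_sum: assumes "s \<in> {0..t}" shows "(\<integral>\<^sup>+k. cmod (bb k s) \<partial>CS) \<le> ennreal (3 / 2 * L)"
proof -
  have "(\<integral>\<^sup>+k. cmod (bb k s) \<partial>CS) \<le> (\<integral>\<^sup>+k. A s k + cmod (a k s - bb k s) \<partial>CS)"
  proof (rule nn_integral_mono)
    fix k
    have "cmod (bb k s) \<le> cmod (a k s) + cmod (a k s - bb k s)"
      using norm_triangle_ineq4[of "a k s" "a k s - bb k s"] by simp
    then show "ennreal (cmod (bb k s)) \<le> A s k + ennreal (cmod (a k s - bb k s))" by (simp flip: ennreal_plus)
  qed
  also have "\<dots> = Y s + (\<integral>\<^sup>+k. cmod (a k s - bb k s) \<partial>CS)" by (rule nn_integral_add) auto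
  also have "\<dots> \<le> ennreal L + ennreal (L / 2)"
    by (rule add_mono[OF YL[OF assms] order_trans[OF ab_sum[OF assms] ennreal_leI[OF kL]]])
  also have "\<dots> = ennreal (3 / 2 * L)" using L by (subst ennreal_plus[symmetric]) auto
  finally show ?thesis .
qed

lemma bb_le: assumes "s \<in> {0..t}" shows "cmod (bb k s) \<le> 3 / 2 * L"
proof -
  have "ennreal (cmod (bb k s)) \<le> (\<integral>\<^sup>+k. cmod (bb k s) \<partial>CS)" by (rule nn_integral_ge_point) simp
  also have "\<dots> \<le> ennreal (3 / 2 * L)" by (rule bb_sum[OF assms])
  finally show ?thesis using L by (simp add: ennreal_le_iff)
qed

lemma rk_time_sum:
  assumes "s \<in> {0..t}"
  shows "(\<integral>\<^sup>+k. \<integral>\<^sup>+s'. norm (rk k s') \<partial>IM 0 s \<partial>CS) \<le> ennreal (3 * \<eta>\<^sup>2 * L ^ 5 * s)"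
proof -
  have s: "0 \<le> s" "s \<le> T" using assms t by auto
  have [measurable]: "rk k \<in> borel_measurable (IM 0 s)" for k by (rule rk_meas) (use s in auto)
  have "(\<integral>\<^sup>+k. \<integral>\<^sup>+s'. norm (rk k s') \<partial>IM 0 s \<partial>CS) = (\<integral>\<^sup>+s'. \<integral>\<^sup>+k. norm (rk k s') \<partial>CS \<partial>IM 0 s)"
    by (rule nn_integral_count_space_nn_integral[symmetric]) auto
  also have "\<dots> \<le> (\<integral>\<^sup>+s'. ennreal (3 * \<eta>\<^sup>2 * L ^ 5) \<partial>IM 0 s)"
  proof (rule nn_integral_mono_AE)
    show "AE s' in IM 0 s. (\<integral>\<^sup>+k. norm (rk k s') \<partial>CS) \<le> ennreal (3 * \<eta>\<^sup>2 * L ^ 5)"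
      using AE_good[OF order_refl s(2)] AE_space
      by eventually_elim (rule rk_sum[OF _ YL L], use assms in auto)
  qed
  also have "\<dots> = ennreal (3 * \<eta>\<^sup>2 * L ^ 5 * s)"
    using s L by (simp add: emeasure_restrict_space space_restrict_space ennreal_mult)
  finally show ?thesis .
qed

text \<open>The rotation is purely imaginary and cancels in the derivative of the squared modulus.
  Only \<open>rk\<close> remains, paired with twice \<open>bb\<close>, hence the factor
  \<open>3 * L\<close>.\<close>

lemma bb_square_sum:
  assumes "s \<in> {0..t}"
  shows "(\<integral>\<^sup>+k. \<bar>(cmod (bb k s))\<^sup>2 - (cmod (bb k 0))\<^sup>2\<bar> \<partial>CS) \<le> ennreal (9 * \<eta>\<^sup>2 * L ^ 6 * s)"
proof -
  have s: "0 \<le> s" "s \<le> T" "0 \<in> {0..s}" "s \<in> {0..s}" using assms t by auto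
  have pt: "ennreal \<bar>(cmod (bb k s))\<^sup>2 - (cmod (bb k 0))\<^sup>2\<bar> \<le> ennreal (3 * L) * (\<integral>\<^sup>+s'. norm (rk k s') \<partial>IM 0 s)" for k
  proof -
    define d where "d = (\<lambda>s. (- (\<i> * of_real (\<eta> * rho k s)) * bb k s + rk k s) * cnj (bb k s) + bb k s * cnj (- (\<i> * of_real (\<eta> * rho k s)) * bb k s + rk k s))"
    have AC2: "AC_on 0 T (\<lambda>s. bb k s * cnj (bb k s)) d"
      unfolding d_def by (rule AC_on_mult[OF bb_AC AC_on_cnj[OF bb_AC] T])
    have d: "d s' = rk k s' * cnj (bb k s') + bb k s' * cnj (rk k s')" for s'
      by (simp add: d_def algebra_simps)
    have di: "integrable (IM 0 s) d"
      using AC_on_int[OF AC_on_subinterval[OF AC2 order_refl s(1,2)]] by (simp only: set_integral_IM)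
    have "bb k s * cnj (bb k s) = bb k 0 * cnj (bb k 0) + (LINT s':{0..s}|lborel. d s')"
      by (rule AC_on_eq[OF AC2]) (use s in auto)
    then have "of_real ((cmod (bb k s))\<^sup>2 - (cmod (bb k 0))\<^sup>2) = (LINT s'|IM 0 s. d s')"
      unfolding of_real_diff complex_norm_square set_integral_IM by simp
    then have "\<bar>(cmod (bb k s))\<^sup>2 - (cmod (bb k 0))\<^sup>2\<bar> = cmod (LINT s'|IM 0 s. d s')" by (metis norm_of_real)
    then have "ennreal \<bar>(cmod (bb k s))\<^sup>2 - (cmod (bb k 0))\<^sup>2\<bar> \<le> (\<integral>\<^sup>+s'. norm (d s') \<partial>IM 0 s)"
      using integral_norm_bound_ennreal[OF di] by simp
    also have "\<dots> \<le> (\<integral>\<^sup>+s'. ennreal (3 * L) * norm (rk k s') \<partial>IM 0 s)"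
    proof (rule nn_integral_mono)
      fix s' assume "s' \<in> space (IM 0 s)"
      then have s': "s' \<in> {0..t}" using assms by auto
      have "norm (d s') \<le> 2 * (norm (rk k s') * cmod (bb k s'))"
        unfolding d by (rule order_trans[OF norm_triangle_ineq]) (simp add: norm_mult)
      also have "\<dots> \<le> 2 * (norm (rk k s') * (3 / 2 * L))"
        by (intro mult_left_mono bb_le[OF s']) auto
      finally show "ennreal (norm (d s')) \<le> ennreal (3 * L) * ennreal (norm (rk k s'))"
        using L by (simp add: mult_ac flip: ennreal_mult)
    qed
    also have "\<dots> = ennreal (3 * L) * (\<integral>\<^sup>+s'. norm (rk k s') \<partial>IM 0 s)"
    proof (rule nn_integral_cmult)
      have "rk k \<in> borel_measurable (IM 0 s)" by (rule rk_meas) (use s in auto)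
      then show "(\<lambda>s'. ennreal (norm (rk k s'))) \<in> borel_measurable (IM 0 s)" by measurable
    qed
    finally show ?thesis .
  qed
  have "(\<integral>\<^sup>+k. \<bar>(cmod (bb k s))\<^sup>2 - (cmod (bb k 0))\<^sup>2\<bar> \<partial>CS) \<le> ennreal (3 * L) * (\<integral>\<^sup>+k. \<integral>\<^sup>+s'. norm (rk k s') \<partial>IM 0 s \<partial>CS)"
    by (subst nn_integral_cmult[symmetric], simp) (rule nn_integral_mono, rule pt)
  also have "\<dots> \<le> ennreal (3 * L) * ennreal (3 * \<eta>\<^sup>2 * L ^ 5 * s)" by (rule mult_left_mono[OF rk_time_sum[OF assms]]) simp
  also have "\<dots> = ennreal (3 * L * (3 * \<eta>\<^sup>2 * L ^ 5 * s))"
    by (rule ennreal_mult[symmetric]) (use L s in auto)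
  also have "3 * L * (3 * \<eta>\<^sup>2 * L ^ 5 * s) = 9 * \<eta>\<^sup>2 * L ^ 6 * s" by (simp add: eval_nat_numeral)
  finally show ?thesis .
qed

text \<open>The two moduli add up to at most 5/2 times \<open>L\<close>, and \<open>ab_sum\<close>
  bounds their difference.\<close>

lemma ab_square_sum:
  assumes "s \<in> {0..t}"
  shows "(\<integral>\<^sup>+k. \<bar>(cmod (a k s))\<^sup>2 - (cmod (bb k s))\<^sup>2\<bar> \<partial>CS) \<le> ennreal (5 / 4 * \<eta> * L ^ 4)"
proof -
  have "(\<integral>\<^sup>+k. \<bar>(cmod (a k s))\<^sup>2 - (cmod (bb k s))\<^sup>2\<bar> \<partial>CS) \<le> (\<integral>\<^sup>+k. ennreal (5 / 2 * L) * cmod (a k s - bb k s) \<partial>CS)"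
  proof (rule nn_integral_mono)
    fix k
    have "\<bar>(cmod (a k s))\<^sup>2 - (cmod (bb k s))\<^sup>2\<bar> = \<bar>cmod (a k s) - cmod (bb k s)\<bar> * (cmod (a k s) + cmod (bb k s))"
      by (simp add: square_diff_square_factored power2_eq_square abs_mult)
    also have "\<dots> \<le> cmod (a k s - bb k s) * (L + 3 / 2 * L)"
      by (intro mult_mono norm_triangle_ineq3 add_mono A_le_L[OF YL[OF assms] L] bb_le[OF assms]) auto
    finally show "ennreal \<bar>(cmod (a k s))\<^sup>2 - (cmod (bb k s))\<^sup>2\<bar> \<le> ennreal (5 / 2 * L) * ennreal (cmod (a k s - bb k s))"
      using L by (simp add: mult_ac flip: ennreal_mult)
  qed
  also have "\<dots> = ennreal (5 / 2 * L) * (\<integral>\<^sup>+k. cmod (a k s - bb k s) \<partial>CS)" by (rule nn_integral_cmult) simp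
  also have "\<dots> \<le> ennreal (5 / 2 * L) * ennreal (\<eta> * L ^ 3 / 2)" by (rule mult_left_mono[OF ab_sum[OF assms]]) simp
  also have "\<dots> = ennreal (5 / 4 * \<eta> * L ^ 4)"
    using L eta by (subst ennreal_mult[symmetric]) (auto simp: eval_nat_numeral mult_ac)
  finally show ?thesis .
qed

lemma a_square_sum:
  assumes "s \<in> {0..t}"
  shows "(\<integral>\<^sup>+k. \<bar>(cmod (a k s))\<^sup>2 - (cmod (a k 0))\<^sup>2\<bar> \<partial>CS) \<le> ennreal (3 * \<eta> * L ^ 4 + 9 * \<eta>\<^sup>2 * L ^ 6 * t)"
proof -
  have 0: "0 \<in> {0..t}" using t by auto
  have "(\<integral>\<^sup>+k. \<bar>(cmod (a k s))\<^sup>2 - (cmod (a k 0))\<^sup>2\<bar> \<partial>CS) \<le>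
    (\<integral>\<^sup>+k. ennreal \<bar>(cmod (a k s))\<^sup>2 - (cmod (bb k s))\<^sup>2\<bar> + (ennreal \<bar>(cmod (bb k s))\<^sup>2 - (cmod (bb k 0))\<^sup>2\<bar> + ennreal \<bar>(cmod (a k 0))\<^sup>2 - (cmod (bb k 0))\<^sup>2\<bar>) \<partial>CS)"
    by (rule nn_integral_mono) (simp flip: ennreal_plus)
  also have "\<dots> = (\<integral>\<^sup>+k. \<bar>(cmod (a k s))\<^sup>2 - (cmod (bb k s))\<^sup>2\<bar> \<partial>CS) + ((\<integral>\<^sup>+k. \<bar>(cmod (bb k s))\<^sup>2 - (cmod (bb k 0))\<^sup>2\<bar> \<partial>CS) + (\<integral>\<^sup>+k. \<bar>(cmod (a k 0))\<^sup>2 - (cmod (bb k 0))\<^sup>2\<bar> \<partial>CS))"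
    by (simp add: nn_integral_add del: ennreal_plus)
  also have "\<dots> \<le> ennreal (5 / 4 * \<eta> * L ^ 4) + (ennreal (9 * \<eta>\<^sup>2 * L ^ 6 * s) + ennreal (5 / 4 * \<eta> * L ^ 4))"
    by (intro add_mono ab_square_sum bb_square_sum assms 0)
  also have "\<dots> = ennreal (5 / 4 * \<eta> * L ^ 4 + (9 * \<eta>\<^sup>2 * L ^ 6 * s + 5 / 4 * \<eta> * L ^ 4))"
    using eta L assms by (simp flip: ennreal_plus)
  also have "\<dots> \<le> ennreal (3 * \<eta> * L ^ 4 + 9 * \<eta>\<^sup>2 * L ^ 6 * t)"
  proof (rule ennreal_leI)
    have "9 * \<eta>\<^sup>2 * L ^ 6 * s \<le> 9 * \<eta>\<^sup>2 * L ^ 6 * t" using assms L by (intro mult_left_mono) auto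
    moreover have "0 \<le> \<eta> * L ^ 4" using eta L by simp
    ultimately show "5 / 4 * \<eta> * L ^ 4 + (9 * \<eta>\<^sup>2 * L ^ 6 * s + 5 / 4 * \<eta> * L ^ 4) \<le> 3 * \<eta> * L ^ 4 + 9 * \<eta>\<^sup>2 * L ^ 6 * t" by simp
  qed
  finally show ?thesis .
qed

text \<open>Three times the bound of \<open>a_square_sum\<close>: \<open>rho\<close> contains the
  mass twice and the squared modulus of the mode once.\<close>

definition \<Delta> :: real where "\<Delta> = 9 * \<eta> * L ^ 4 + 27 * \<eta>\<^sup>2 * L ^ 6 * t"

lemma rho_diff:
  assumes "s \<in> {0..t}" shows "\<bar>rho k s - rho k 0\<bar> \<le> \<Delta>"
proof -
  have 0: "0 \<in> {0..t}" using t by auto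
  let ?D = "3 * \<eta> * L ^ 4 + 9 * \<eta>\<^sup>2 * L ^ 6 * t"
  have D0: "?D \<ge> 0" using eta L t by simp
  have "\<bar>ms s - ms 0\<bar> \<le> ?D"
  proof -
    have i: "integrable CS (\<lambda>k. (cmod (a k s))\<^sup>2 - (cmod (a k 0))\<^sup>2)"
      using sqsum_integrable[OF sT[OF assms]] sqsum_integrable[OF sT[OF 0]] by simp
    have "ms s - ms 0 = (LINT k|CS. (cmod (a k s))\<^sup>2 - (cmod (a k 0))\<^sup>2)"
      unfolding ms_def using sqsum_integrable[OF sT[OF assms]] sqsum_integrable[OF sT[OF 0]] by simp
    then have "ennreal \<bar>ms s - ms 0\<bar> \<le> (\<integral>\<^sup>+k. \<bar>(cmod (a k s))\<^sup>2 - (cmod (a k 0))\<^sup>2\<bar> \<partial>CS)"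
      using integral_norm_bound_ennreal[OF i] by simp
    also have "\<dots> \<le> ennreal ?D" by (rule a_square_sum[OF assms])
    finally show ?thesis using D0 by (simp add: ennreal_le_iff)
  qed
  moreover have "\<bar>(cmod (a k s))\<^sup>2 - (cmod (a k 0))\<^sup>2\<bar> \<le> ?D"
  proof -
    have "ennreal \<bar>(cmod (a k s))\<^sup>2 - (cmod (a k 0))\<^sup>2\<bar> \<le> (\<integral>\<^sup>+k. \<bar>(cmod (a k s))\<^sup>2 - (cmod (a k 0))\<^sup>2\<bar> \<partial>CS)"
      by (rule nn_integral_ge_point) simp
    also have "\<dots> \<le> ennreal ?D" by (rule a_square_sum[OF assms])
    finally show ?thesis using D0 by (simp add: ennreal_le_iff)
  qed
  ultimately show ?thesis unfolding rho_def \<Delta>_def by linarith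
qed

text \<open>With the integrating factor \<open>cis (\<eta> * rho k 0 * s)\<close> the rotation
  frozen at time 0 cancels from the derivative of \<open>bb k\<close>, leaving the change of
  \<open>rho\<close> since then and the remainder \<open>rk\<close>. Both ends are afterwards
  converted from \<open>bb\<close> back to \<open>a\<close>.\<close>

lemma resonant_approximation:
  "(\<integral>\<^sup>+k. cmod (a k t - cis (- (\<eta> * rho k 0 * t)) * a k 0) \<partial>CS)
    \<le> ennreal (\<eta> * L ^ 3 + \<eta> * \<Delta> * (3 / 2 * L) * t + 3 * \<eta>\<^sup>2 * L ^ 5 * t)"
proof -
  have tt: "t \<in> {0..t}" "0 \<in> {0..t}" using t by auto
  have D0: "\<Delta> \<ge> 0" using eta L t by (simp add: \<Delta>_def)
  have [measurable]: "rk k \<in> borel_measurable (IM 0 t)" "bb k \<in> borel_measurable (IM 0 t)" for k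
    using rk_meas[OF order_refl t(2)] continuous_on_measurable_IM[OF AC_on_continuous[OF AC_on_subinterval[OF bb_AC order_refl t]]] by auto
  have pt: "ennreal (cmod (bb k t - cis (- (\<eta> * rho k 0 * t)) * bb k 0)) \<le> ennreal (\<eta> * \<Delta>) * (\<integral>\<^sup>+s. cmod (bb k s) \<partial>IM 0 t) + (\<integral>\<^sup>+s. norm (rk k s) \<partial>IM 0 t)" for k
  proof -
    define x where "x = \<eta> * rho k 0"
    have e: "AC_on 0 T (\<lambda>s. cis (x * s)) (\<lambda>s. \<i> * of_real x * cis (x * s))"
    proof (rule AC_on_C1)
      show "((\<lambda>s. cis (x * s)) has_vector_derivative \<i> * of_real x * cis (x * s)) (at s within {0..T})" for s
      proof -
        have d: "((\<lambda>z. exp (\<i> * (of_real x * z))) has_field_derivative \<i> * of_real x * exp (\<i> * (of_real x * of_real s)))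
            (at (of_real s) within of_real ` {0..T})"
          by (auto intro!: derivative_eq_intros)
        show ?thesis
          using field_vector_diff_chain_within[OF has_vector_derivative_of_real[OF DERIV_ident] d]
          by (simp add: o_def cis_conv_exp)
      qed
      show "continuous_on {0..T} (\<lambda>s. \<i> * of_real x * cis (x * s))" by (intro continuous_intros)
    qed
    define d where "d = (\<lambda>s. \<i> * of_real x * cis (x * s) * bb k s + cis (x * s) * (- (\<i> * of_real (\<eta> * rho k s)) * bb k s + rk k s))"
    have AC2: "AC_on 0 T (\<lambda>s. cis (x * s) * bb k s) d"
      unfolding d_def by (rule AC_on_mult[OF e bb_AC T])
    have d: "d s = cis (x * s) * (\<i> * of_real (\<eta> * (rho k 0 - rho k s)) * bb k s + rk k s)" for s
      by (simp add: d_def x_def algebra_simps)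
    have di: "integrable (IM 0 t) d"
      using AC_on_int[OF AC_on_subinterval[OF AC2 order_refl t]] by (simp only: set_integral_IM)
    have "cis (x * t) * bb k t = cis (x * 0) * bb k 0 + (LINT s:{0..t}|lborel. d s)"
      by (rule AC_on_eq[OF AC2]) (use t in auto)
    then have "cis (x * t) * (bb k t - cis (- (x * t)) * bb k 0) = (LINT s|IM 0 t. d s)"
      unfolding set_integral_IM by (simp add: right_diff_distrib cis_mult flip: mult.assoc)
    then have "cmod (bb k t - cis (- (x * t)) * bb k 0) = cmod (LINT s|IM 0 t. d s)"
      by (metis mult_1 norm_cis norm_mult)
    then have "ennreal (cmod (bb k t - cis (- (x * t)) * bb k 0)) \<le> (\<integral>\<^sup>+s. norm (d s) \<partial>IM 0 t)"
      using integral_norm_bound_ennreal[OF di] by simp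
    also have "\<dots> \<le> (\<integral>\<^sup>+s. ennreal (\<eta> * \<Delta>) * cmod (bb k s) + norm (rk k s) \<partial>IM 0 t)"
    proof (rule nn_integral_mono)
      fix s assume "s \<in> space (IM 0 t)"
      then have s: "s \<in> {0..t}" by simp
      have "norm (d s) \<le> cmod (\<i> * of_real (\<eta> * (rho k 0 - rho k s)) * bb k s) + norm (rk k s)"
        unfolding d norm_mult[of "cis _"] norm_cis mult_1 by (rule norm_triangle_ineq)
      also have "cmod (\<i> * of_real (\<eta> * (rho k 0 - rho k s)) * bb k s) = \<eta> * \<bar>rho k s - rho k 0\<bar> * cmod (bb k s)"
        using eta by (simp only: norm_mult norm_of_real abs_mult norm_ii) (simp add: abs_minus_commute)
      also have "\<dots> \<le> \<eta> * \<Delta> * cmod (bb k s)"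
        by (intro mult_right_mono mult_left_mono rho_diff[OF s] eta) simp
      finally show "ennreal (norm (d s)) \<le> ennreal (\<eta> * \<Delta>) * ennreal (cmod (bb k s)) + ennreal (norm (rk k s))"
        using eta D0 by (simp flip: ennreal_mult ennreal_plus)
    qed
    also have "\<dots> = ennreal (\<eta> * \<Delta>) * (\<integral>\<^sup>+s. cmod (bb k s) \<partial>IM 0 t) + (\<integral>\<^sup>+s. norm (rk k s) \<partial>IM 0 t)"
      by (simp add: nn_integral_add nn_integral_cmult)
    finally show ?thesis by (simp add: x_def)
  qed
  have "(\<integral>\<^sup>+k. cmod (a k t - cis (- (\<eta> * rho k 0 * t)) * a k 0) \<partial>CS) \<le>
    (\<integral>\<^sup>+k. (ennreal (cmod (a k t - bb k t)) + ennreal (cmod (a k 0 - bb k 0))) + ennreal (cmod (bb k t - cis (- (\<eta> * rho k 0 * t)) * bb k 0)) \<partial>CS)"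
  proof (rule nn_integral_mono)
    fix k
    let ?c = "cis (- (\<eta> * rho k 0 * t))"
    have "a k t - ?c * a k 0 = (a k t - bb k t) - ?c * (a k 0 - bb k 0) + (bb k t - ?c * bb k 0)" by (simp add: algebra_simps)
    then have "cmod (a k t - ?c * a k 0) \<le> cmod (a k t - bb k t) + cmod (?c * (a k 0 - bb k 0)) + cmod (bb k t - ?c * bb k 0)"
      by (simp only: order_trans[OF norm_triangle_ineq add_right_mono[OF norm_triangle_ineq4]])
    then have "cmod (a k t - ?c * a k 0) \<le> cmod (a k t - bb k t) + cmod (a k 0 - bb k 0) + cmod (bb k t - ?c * bb k 0)"
      by (simp only: norm_mult norm_cis mult_1)
    then show "ennreal (cmod (a k t - ?c * a k 0)) \<le> ennreal (cmod (a k t - bb k t)) + ennreal (cmod (a k 0 - bb k 0)) + ennreal (cmod (bb k t - ?c * bb k 0))"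
      by (simp flip: ennreal_plus)
  qed
  also have "\<dots> = ((\<integral>\<^sup>+k. cmod (a k t - bb k t) \<partial>CS) + (\<integral>\<^sup>+k. cmod (a k 0 - bb k 0) \<partial>CS)) + (\<integral>\<^sup>+k. cmod (bb k t - cis (- (\<eta> * rho k 0 * t)) * bb k 0) \<partial>CS)"
    by (simp add: nn_integral_add)
  also have "\<dots> \<le> (ennreal (\<eta> * L ^ 3 / 2) + ennreal (\<eta> * L ^ 3 / 2)) + (ennreal (\<eta> * \<Delta>) * ennreal (3 / 2 * L * t) + ennreal (3 * \<eta>\<^sup>2 * L ^ 5 * t))"
  proof (intro add_mono ab_sum tt)
    have "(\<integral>\<^sup>+k. cmod (bb k t - cis (- (\<eta> * rho k 0 * t)) * bb k 0) \<partial>CS) \<le>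
      (\<integral>\<^sup>+k. ennreal (\<eta> * \<Delta>) * (\<integral>\<^sup>+s. cmod (bb k s) \<partial>IM 0 t) + (\<integral>\<^sup>+s. norm (rk k s) \<partial>IM 0 t) \<partial>CS)"
      by (rule nn_integral_mono) (rule pt)
    also have "\<dots> = ennreal (\<eta> * \<Delta>) * (\<integral>\<^sup>+k. \<integral>\<^sup>+s. cmod (bb k s) \<partial>IM 0 t \<partial>CS) + (\<integral>\<^sup>+k. \<integral>\<^sup>+s. norm (rk k s) \<partial>IM 0 t \<partial>CS)"
      by (simp add: nn_integral_add nn_integral_cmult)
    also have "(\<integral>\<^sup>+k. \<integral>\<^sup>+s. cmod (bb k s) \<partial>IM 0 t \<partial>CS) = (\<integral>\<^sup>+s. \<integral>\<^sup>+k. cmod (bb k s) \<partial>CS \<partial>IM 0 t)"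
      by (rule nn_integral_count_space_nn_integral[symmetric]) auto
    also have "ennreal (\<eta> * \<Delta>) * (\<integral>\<^sup>+s. \<integral>\<^sup>+k. cmod (bb k s) \<partial>CS \<partial>IM 0 t) + (\<integral>\<^sup>+k. \<integral>\<^sup>+s. norm (rk k s) \<partial>IM 0 t \<partial>CS)
      \<le> ennreal (\<eta> * \<Delta>) * (\<integral>\<^sup>+s. ennreal (3 / 2 * L) \<partial>IM 0 t) + ennreal (3 * \<eta>\<^sup>2 * L ^ 5 * t)"
      by (intro add_mono mult_left_mono rk_time_sum tt nn_integral_mono bb_sum) auto
    also have "(\<integral>\<^sup>+s. ennreal (3 / 2 * L) \<partial>IM 0 t) = ennreal (3 / 2 * L * t)"
      using t L by (simp add: emeasure_restrict_space space_restrict_space flip: ennreal_mult)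
    finally show "(\<integral>\<^sup>+k. cmod (bb k t - cis (- (\<eta> * rho k 0 * t)) * bb k 0) \<partial>CS) \<le> ennreal (\<eta> * \<Delta>) * ennreal (3 / 2 * L * t) + ennreal (3 * \<eta>\<^sup>2 * L ^ 5 * t)" .
  qed
  also have "\<dots> = ennreal ((\<eta> * L ^ 3 / 2 + \<eta> * L ^ 3 / 2) + (\<eta> * \<Delta> * (3 / 2 * L * t) + 3 * \<eta>\<^sup>2 * L ^ 5 * t))"
    using eta L t D0 by (simp add: ennreal_mult[symmetric] del: ennreal_plus flip: ennreal_plus)
  also have "(\<eta> * L ^ 3 / 2 + \<eta> * L ^ 3 / 2) + (\<eta> * \<Delta> * (3 / 2 * L * t) + 3 * \<eta>\<^sup>2 * L ^ 5 * t) = \<eta> * L ^ 3 + \<eta> * \<Delta> * (3 / 2 * L) * t + 3 * \<eta>\<^sup>2 * L ^ 5 * t"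
    by simp
  finally show ?thesis .
qed

text \<open>Relative to \<open>L\<close> the error depends only on \<kappa> and \<kappa> t. The
  exact coefficients 33/2 and 81/2 are rounded up.\<close>

lemma resonant_approximation':
  defines "\<kappa> \<equiv> \<eta> * L\<^sup>2"
  shows "(\<integral>\<^sup>+k. cmod (a k t - cis (- (\<eta> * rho k 0 * t)) * a k 0) \<partial>CS)
    \<le> ennreal (L * (\<kappa> * (1 + 17 * (\<kappa> * t) + 41 * (\<kappa> * t)\<^sup>2)))"
proof (rule order_trans[OF resonant_approximation ennreal_leI])
  have k: "\<kappa> \<ge> 0" "\<kappa> * t \<ge> 0" using eta t by (auto simp: \<kappa>_def)
  have "\<eta> * L ^ 3 + \<eta> * \<Delta> * (3 / 2 * L) * t + 3 * \<eta>\<^sup>2 * L ^ 5 * t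
     = L * (\<kappa> * (1 + 33 / 2 * (\<kappa> * t) + 81 / 2 * (\<kappa> * t)\<^sup>2))"
    by (simp add: \<Delta>_def \<kappa>_def eval_nat_numeral algebra_simps)
  also have "\<dots> \<le> L * (\<kappa> * (1 + 17 * (\<kappa> * t) + 41 * (\<kappa> * t)\<^sup>2))"
    using k by (intro mult_left_mono add_mono mult_right_mono L) auto
  finally show "\<eta> * L ^ 3 + \<eta> * \<Delta> * (3 / 2 * L) * t + 3 * \<eta>\<^sup>2 * L ^ 5 * t \<le> L * (\<kappa> * (1 + 17 * (\<kappa> * t) + 41 * (\<kappa> * t)\<^sup>2))" .
qed

end

text \<open>Relative error of the resonant flow in the Wiener norm. For \<kappa> of order \<epsilon>
  and t at most of order |log \<epsilon>| / \<epsilon> it is at most of order \<epsilon> |log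
  \<epsilon>|^2.\<close>

definition drift :: "real \<Rightarrow> real \<Rightarrow> real" where
  "drift \<kappa> t = \<kappa> * (1 + 17 * (\<kappa> * t) + 41 * (\<kappa> * t)\<^sup>2)"

lemma drift_mono: "0 \<le> \<kappa> \<Longrightarrow> 0 \<le> s \<Longrightarrow> s \<le> t \<Longrightarrow> drift \<kappa> s \<le> drift \<kappa> t"
  unfolding drift_def by (intro mult_left_mono add_mono power_mono) auto

section \<open>Bootstrap to long times\<close>

context cubic_modes
begin

text \<open>A crude Lipschitz bound from the equation itself, without use of the phases. It serves
  for the continuity of the Wiener norm and for the time stepping.\<close>

lemma increment_sum:
  assumes r: "0 \<le> r" "r \<le> t" "t \<le> T" and L: "\<And>s. s \<in> {r..t} \<Longrightarrow> Y s \<le> ennreal L" "L \<ge> 0"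
  shows "(\<integral>\<^sup>+k. cmod (a k t - a k r) \<partial>CS) \<le> ennreal (\<eta> * L ^ 3 * (t - r))"
proof -
  have rT: "0 \<le> r" "t \<le> T" using r by auto
  have [measurable]: "n k \<in> borel_measurable (IM r t)" for k by (rule n_meas[OF rT])
  have "(\<integral>\<^sup>+k. cmod (a k t - a k r) \<partial>CS) \<le> (\<integral>\<^sup>+k. ennreal \<eta> * (\<integral>\<^sup>+s. N s k \<partial>IM r t) \<partial>CS)"
  proof (rule nn_integral_mono)
    fix k
    have "ennreal (cmod (a k t - a k r)) = ennreal \<eta> * ennreal (cmod (LINT s|IM r t. n k s))"
      unfolding a_increment[OF r] using eta by (simp add: norm_mult ennreal_mult)
    also have "\<dots> \<le> ennreal \<eta> * (\<integral>\<^sup>+s. N s k \<partial>IM r t)"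
      by (rule mult_left_mono[OF integral_norm_bound_ennreal[OF n_integrable[OF rT]]]) simp
    finally show "ennreal (cmod (a k t - a k r)) \<le> ennreal \<eta> * (\<integral>\<^sup>+s. N s k \<partial>IM r t)" .
  qed
  also have "\<dots> = ennreal \<eta> * (\<integral>\<^sup>+k. \<integral>\<^sup>+s. N s k \<partial>IM r t \<partial>CS)" by (rule nn_integral_cmult) simp
  also have "(\<integral>\<^sup>+k. \<integral>\<^sup>+s. N s k \<partial>IM r t \<partial>CS) = (\<integral>\<^sup>+s. \<integral>\<^sup>+k. N s k \<partial>CS \<partial>IM r t)"
    by (rule nn_integral_count_space_nn_integral[symmetric]) auto
  also have "ennreal \<eta> * \<dots> \<le> ennreal \<eta> * (\<integral>\<^sup>+s. ennreal (L ^ 3) \<partial>IM r t)"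
  proof (intro mult_left_mono nn_integral_mono_AE)
    show "AE s in IM r t. (\<integral>\<^sup>+k. N s k \<partial>CS) \<le> ennreal (L ^ 3)"
      using AE_good[OF rT] AE_space by eventually_elim (rule N_sum[OF _ L], auto)
  qed simp
  also have "\<dots> = ennreal (\<eta> * L ^ 3 * (t - r))"
    using r L(2) eta by (simp add: emeasure_restrict_space space_restrict_space mult.assoc flip: ennreal_mult)
  finally show ?thesis .
qed

lemma Y_triangle: "Y s \<le> Y r + (\<integral>\<^sup>+k. cmod (a k s - a k r) \<partial>CS)"
proof -
  have "Y s \<le> (\<integral>\<^sup>+k. A r k + ennreal (cmod (a k s - a k r)) \<partial>CS)"
    by (rule nn_integral_mono) (simp add: norm_triangle_sub flip: ennreal_plus)
  then show ?thesis by (simp add: nn_integral_add)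
qed

text \<open>Bootstrap. Up to the first time at which the Wiener norm reaches \<open>L\<close> the
  resonant approximation holds. As the resonant flow preserves all moduli, the norm there is at most
  \<open>L / 2\<close> plus \<open>L\<close> times a drift below 1/2, which contradicts reaching
  \<open>L\<close>.\<close>

lemma long_time_approximation:
  assumes Y0: "Y 0 \<le> ennreal (L / 2)" and L: "L > 0" and \<kappa>: "\<eta> * L\<^sup>2 \<le> 1" and small: "drift (\<eta> * L\<^sup>2) T < 1/2"
  shows "(\<integral>\<^sup>+k. cmod (a k T - cis (- (\<eta> * rho k 0 * T)) * a k 0) \<partial>CS) \<le> ennreal (L * drift (\<eta> * L\<^sup>2) T)"
    and "\<forall>s\<in>{0..T}. Y s \<le> ennreal L"
proof -
  \<comment> \<open>A bound without control of its size; it only makes the Wiener norm finite and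
    Lipschitz in time.\<close>
  obtain M where M: "M \<ge> 0" "\<And>s. s \<in> {0..T} \<Longrightarrow> Y s \<le> ennreal M"
    using l1_propagation[OF Y0] L by auto
  define y where "y = (\<lambda>s. enn2real (Y s))"
  have y: "Y s = ennreal (y s)" "y s \<ge> 0" if "s \<in> {0..T}" for s
  proof -
    have "Y s < top" using M(2)[OF that] by (rule order_le_less_trans) simp
    then show "Y s = ennreal (y s)" by (simp add: y_def)
  qed (simp add: y_def)
  define C where "C = \<eta> * M ^ 3"
  have C: "C \<ge> 0" using eta M by (simp add: C_def)
  have lip1: "y t \<le> y r + C * (t - r)" "y r \<le> y t + C * (t - r)" if "0 \<le> r" "r \<le> t" "t \<le> T" for r t
  proof -
    have r: "r \<in> {0..T}" "t \<in> {0..T}" using that by auto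
    have i: "(\<integral>\<^sup>+k. cmod (a k t - a k r) \<partial>CS) \<le> ennreal (C * (t - r))"
      unfolding C_def by (rule increment_sum[OF that M(2) M(1)]) (use that in auto)
    have "Y t \<le> Y r + ennreal (C * (t - r))" by (rule order_trans[OF Y_triangle add_left_mono[OF i]])
    then show "y t \<le> y r + C * (t - r)" using y r C that by (simp flip: ennreal_plus)
    have "(\<integral>\<^sup>+k. cmod (a k r - a k t) \<partial>CS) \<le> ennreal (C * (t - r))" using i by (simp add: norm_minus_commute)
    then have "Y r \<le> Y t + ennreal (C * (t - r))" by (rule order_trans[OF Y_triangle add_left_mono])
    then show "y r \<le> y t + C * (t - r)" using y r C that by (simp flip: ennreal_plus)
  qed
  have lip: "\<bar>y t - y r\<bar> \<le> C * \<bar>t - r\<bar>" if "t \<in> {0..T}" "r \<in> {0..T}" for t r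
    using lip1[of r t] lip1[of t r] that by (cases "r \<le> t") (auto simp: abs_if)
  have cont: "continuous_on {0..T} y"
  proof (rule continuous_on_eq[of _ "\<lambda>s. y s"])
    have "C-lipschitz_on {0..T} y"
      by (rule lipschitz_onI) (use lip C in \<open>auto simp: dist_real_def\<close>)
    then show "continuous_on {0..T} (\<lambda>s. y s)" by (rule lipschitz_on_continuous_on)
  qed simp
  have below: "y s < L" if s: "s \<in> {0..T}" for s
  proof (rule ccontr)
    assume "\<not> y s < L"
    define S where "S = {s \<in> {0..T}. L \<le> y s}"
    have S: "s \<in> S" using s \<open>\<not> y s < L\<close> by (simp add: S_def)
    have "closed ({0..T} \<inter> y -` {L..})"
      by (rule continuous_closed_preimage[OF cont closed_atLeastAtMost closed_atLeast])
    moreover have "{0..T} \<inter> y -` {L..} = S" by (auto simp: S_def)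
    ultimately have "closed S" by simp
    define s0 where "s0 = Inf S"
    have bdd: "bdd_below S" by (rule bdd_belowI[of _ 0]) (auto simp: S_def)
    have s0: "s0 \<in> S" unfolding s0_def by (rule closed_contains_Inf) (use S bdd \<open>closed S\<close> in auto)
    have s0T: "s0 \<in> {0..T}" "L \<le> y s0" using s0 by (auto simp: S_def)
    have less: "y s < L" if "s \<in> {0..T}" "s < s0" for s
    proof (rule ccontr)
      assume "\<not> y s < L"
      then have "s \<in> S" using that by (simp add: S_def)
      then have "s0 \<le> s" unfolding s0_def by (rule cInf_lower[OF _ bdd])
      then show False using that by simp
    qed
    have 0: "0 \<in> {0..T}" using T by simp
    have "y 0 \<le> L / 2" using Y0 y[OF 0] L by simp
    then have s0pos: "s0 > 0" using s0T L by (cases "s0 = 0") auto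
    \<comment> \<open>The bound \<open>L\<close> has to hold at \<open>s0\<close> itself, the end of
      the interval on which the approximation is applied.\<close>
    have ys0: "y s0 \<le> L"
    proof (rule field_le_epsilon)
      fix e :: real assume e: "e > 0"
      \<comment> \<open>The denominator is \<open>C + 1\<close> because \<open>C\<close> may be
        0.\<close>
      define s where "s = max 0 (s0 - e / (C + 1))"
      have ss: "s \<in> {0..T}" "s < s0" "s0 - s \<le> e / (C + 1)"
      proof -
        have "0 < e / (C + 1)" using e C by simp
        then show "s \<in> {0..T}" "s < s0" "s0 - s \<le> e / (C + 1)" using s0pos s0T by (auto simp: s_def)
      qed
      have "y s0 \<le> y s + C * (s0 - s)" by (rule lip1(1)) (use ss s0T in auto)
      also have "C * (s0 - s) \<le> (C + 1) * (e / (C + 1))" using ss C e by (intro mult_mono) auto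
      also have "\<dots> = e" using C by simp
      finally show "y s0 \<le> L + e" using less[OF ss(1,2)] by simp
    qed
    interpret bd: cubic_modes_bounded \<eta> a n V W T \<mu> s0 L
    proof (unfold_locales)
      show "Y s \<le> ennreal L" if "s \<in> {0..s0}" for s
      proof -
        have sT: "s \<in> {0..T}" using that s0T by auto
        have "y s \<le> L" using less[OF sT] ys0 that by (cases "s = s0") auto
        then show ?thesis unfolding y(1)[OF sT] by (rule ennreal_leI)
      qed
    qed (use s0T L \<kappa> in auto)
    have "Y s0 \<le> (\<integral>\<^sup>+k. A 0 k + ennreal (cmod (a k s0 - cis (- (\<eta> * rho k 0 * s0)) * a k 0)) \<partial>CS)"
    proof (rule nn_integral_mono)
      fix k
      have "cmod (a k s0) \<le> cmod (cis (- (\<eta> * rho k 0 * s0)) * a k 0) + cmod (a k s0 - cis (- (\<eta> * rho k 0 * s0)) * a k 0)"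
        by (rule norm_triangle_sub)
      then show "A s0 k \<le> A 0 k + ennreal (cmod (a k s0 - cis (- (\<eta> * rho k 0 * s0)) * a k 0))"
        by (simp add: norm_mult flip: ennreal_plus)
    qed
    also have "\<dots> = Y 0 + (\<integral>\<^sup>+k. cmod (a k s0 - cis (- (\<eta> * rho k 0 * s0)) * a k 0) \<partial>CS)" by (rule nn_integral_add) auto
    also have "\<dots> \<le> ennreal (L / 2) + ennreal (L * drift (\<eta> * L\<^sup>2) s0)"
      unfolding drift_def by (rule add_mono[OF Y0 bd.resonant_approximation'])
    also have "\<dots> \<le> ennreal (L / 2) + ennreal (L * drift (\<eta> * L\<^sup>2) T)"
      by (intro add_left_mono ennreal_leI mult_left_mono drift_mono) (use s0T L eta in auto)
    also have "\<dots> = ennreal (L / 2 + L * drift (\<eta> * L\<^sup>2) T)"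
      using L eta T by (subst ennreal_plus) (auto simp: drift_def)
    finally have "ennreal (y s0) \<le> ennreal (L / 2 + L * drift (\<eta> * L\<^sup>2) T)" unfolding y(1)[OF s0T(1)] .
    moreover have "0 \<le> L / 2 + L * drift (\<eta> * L\<^sup>2) T" using L eta T by (simp add: drift_def)
    ultimately have "y s0 \<le> L / 2 + L * drift (\<eta> * L\<^sup>2) T" using ennreal_le_iff by blast
    also have "\<dots> < L / 2 + L * (1/2)" using L small by (intro add_strict_left_mono mult_strict_left_mono) auto
    finally show False using s0T(2) by simp
  qed
  show YL: "\<forall>s\<in>{0..T}. Y s \<le> ennreal L"
  proof
    fix s assume s: "s \<in> {0..T}"
    show "Y s \<le> ennreal L" unfolding y(1)[OF s] by (rule ennreal_leI[OF less_imp_le[OF below[OF s]]])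
  qed
  interpret bd: cubic_modes_bounded \<eta> a n V W T \<mu> T L
    by unfold_locales (use YL L \<kappa> T in auto)
  show "(\<integral>\<^sup>+k. cmod (a k T - cis (- (\<eta> * rho k 0 * T)) * a k 0) \<partial>CS) \<le> ennreal (L * drift (\<eta> * L\<^sup>2) T)"
    unfolding drift_def by (rule bd.resonant_approximation')
qed

end

section \<open>The modes of a solution\<close>

lemma cubic_modes_subinterval:
  assumes "cubic_modes \<eta> a n V W T' \<mu>" "0 \<le> T" "T \<le> T'"
  shows "cubic_modes \<eta> a n V W T \<mu>"
proof -
  interpret m: cubic_modes \<eta> a n V W T' \<mu> by fact
  show ?thesis
  proof
    show "set_integrable lborel {0..T} (n k)" for k
      by (rule set_integrable_subset[OF m.n_int]) (use assms in auto)
    show "set_integrable lborel {0..T} W"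
      by (rule set_integrable_subset[OF m.W_int]) (use assms in auto)
    show "AC_on 0 T (a k) (\<lambda>s. - (\<i> * of_real \<eta>) * n k s)" for k
      by (rule AC_on_subinterval[OF m.AC]) (use assms in auto)
    show "(\<integral>\<^sup>+k. (ennreal (cmod (a k s)))\<^sup>2 \<partial>CS) \<le> ennreal (\<mu>\<^sup>2)" if "s \<in> {0..T}" for s
      by (rule m.mass) (use assms that in auto)
    show "AE s in IM 0 T. (\<integral>\<^sup>+p. (ennreal (V p s))\<^sup>2 \<partial>CS) \<le> ennreal ((W s)\<^sup>2) \<and>
      (\<forall>k. n k s = (LINT p|CS. (LINT q|CS. cis (2 * of_int p * of_int q * s) * a (k - q) s * cnj (a (k - p - q) s)) * a (k - p) s)) \<and>
      (\<forall>p k. cmod (LINT q|CS. cis (2 * of_int p * of_int q * s) * a (k - q) s * cnj (a (k - p - q) s)) \<le> V p s)"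
      using m.AE_good[OF order_refl assms(3)] by eventually_elim (simp add: m.good_time_def)
  qed (use assms m.eta m.mu m.W_nonneg m.V_nonneg in auto)
qed

text \<open>The interaction picture: the free evolution is factored out of the Fourier coefficients.\<close>

definition umode :: "(real \<Rightarrow> real \<Rightarrow> complex) \<Rightarrow> int \<Rightarrow> real \<Rightarrow> complex" where
  "umode u k s = cis ((of_int k)\<^sup>2 * s) * fourier_coeff (u s) k"

definition nmode :: "(real \<Rightarrow> real \<Rightarrow> complex) \<Rightarrow> int \<Rightarrow> real \<Rightarrow> complex" where
  "nmode u k s = cis ((of_int k)\<^sup>2 * s) * fourier_coeff (\<lambda>x. of_real ((cmod (u s x))\<^sup>2) * u s x) k"

definition I4 :: "(real \<Rightarrow> real \<Rightarrow> complex) \<Rightarrow> real \<Rightarrow> real" where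
  "I4 u s = (LINT x|circle_measure. (cmod (u s x)) ^ 4)"

lemma sigma_finite_IM: "sigma_finite_measure (IM r t)"
  by (rule finite_measure.axioms(1)[OF finite_measure_IM])

lemma pair_IM_CM: "pair_sigma_finite (IM 0 T) CM"
  by (intro pair_sigma_finite.intro sigma_finite_IM CM.sigma_finite_measure)

lemma sqint_of_solution: "L2_solution_class u \<Longrightarrow> s \<ge> 0 \<Longrightarrow> sqint (u s)"
  unfolding L2_solution_class_def in_L2_def sqint_def by simp

lemma solution_measurable:
  assumes "L2_solution_class u"
  shows "(\<lambda>(s, x). u s x) \<in> borel_measurable (IM 0 T \<Otimes>\<^sub>M CM)"
proof -
  have id: "(\<lambda>s. s) \<in> measurable (IM 0 T) (restrict_space lborel {0..})"
    by (rule measurable_restrict_space2) (auto intro: measurable_restrict_space1)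
  have "(\<lambda>z. (fst z, snd z)) \<in> measurable (IM 0 T \<Otimes>\<^sub>M CM) (restrict_space lborel {0..} \<Otimes>\<^sub>M CM)"
    by (rule measurable_Pair[OF measurable_compose[OF measurable_fst id] measurable_snd])
  from measurable_compose[OF this] assms
  show ?thesis unfolding L2_solution_class_def by (auto simp: case_prod_beta')
qed

lemma I4_facts:
  assumes u: "L2_solution_class u" and T: "T > 0"
  shows "integrable (IM 0 T) (I4 u)" and "AE s in IM 0 T. integrable CM (\<lambda>x. (cmod (u s x)) ^ 4)"
proof -
  interpret pair_sigma_finite "IM 0 T" CM by (rule pair_IM_CM)
  have i: "integrable (IM 0 T \<Otimes>\<^sub>M CM) (\<lambda>(t, x). (cmod (u t x)) ^ 4)"
    using u T unfolding L2_solution_class_def by blast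
  show "integrable (IM 0 T) (I4 u)"
    unfolding I4_def[abs_def] using integrable_fst'[OF i] by simp
  show "AE s in IM 0 T. integrable CM (\<lambda>x. (cmod (u s x)) ^ 4)"
    using AE_integrable_fst'[OF i] by simp
qed

lemma I4_nonneg: "I4 u s \<ge> 0"
  unfolding I4_def by (rule Bochner_Integration.integral_nonneg) simp

lemma square_sqint:
  assumes "sqint f" "integrable CM (\<lambda>x. (cmod (f x)) ^ 4)"
  shows "sqint (\<lambda>x. of_real ((cmod (f x))\<^sup>2))"
proof -
  note [measurable] = sqint_measurable[OF assms(1)]
  show ?thesis unfolding sqint_def
  proof
    show "integrable CM (\<lambda>x. (cmod (of_real ((cmod (f x))\<^sup>2)))\<^sup>2)"
      using assms(2) by (simp add: norm_power flip: power_mult)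
  qed measurable
qed

text \<open>The elementary bound r^3 \<le> 1 + r^4 reduces the cubic term to the fourth power, which
  is integrable in space and time.\<close>

lemma nmode_integrable:
  assumes u: "L2_solution_class u" and T: "T > 0"
  shows "integrable (IM 0 T) (nmode u k)"
proof -
  interpret pair_sigma_finite "IM 0 T" CM by (rule pair_IM_CM)
  interpret F: finite_measure "IM 0 T" by (rule finite_measure_IM)
  note [measurable] = solution_measurable[OF u, of T]
  have c: "(\<lambda>z. cis (- (of_int k * snd z))) \<in> borel_measurable (IM 0 T \<Otimes>\<^sub>M CM)"
    by (rule measurable_compose[OF measurable_snd cis_neg_measurable_CM])
  have "(\<lambda>z. of_real ((cmod (u (fst z) (snd z)))\<^sup>2) * u (fst z) (snd z) * cis (- (of_int k * snd z))) \<in> borel_measurable (IM 0 T \<Otimes>\<^sub>M CM)"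
    using solution_measurable[OF u, of T] c by (auto simp: case_prod_beta' intro!: borel_measurable_times borel_measurable_of_real borel_measurable_power borel_measurable_norm)
  then have "(\<lambda>s. LINT x|CM. of_real ((cmod (u s x))\<^sup>2) * u s x * cis (- (of_int k * x))) \<in> borel_measurable (IM 0 T)"
    by (intro CM.borel_measurable_lebesgue_integral) (simp add: case_prod_beta')
  note m0 = this
  have c1: "(\<lambda>s. cis ((of_int k)\<^sup>2 * s)) \<in> borel_measurable (IM 0 T)"
    by (rule continuous_on_measurable_IM) (intro continuous_intros)
  have m: "nmode u k \<in> borel_measurable (IM 0 T)"
    unfolding nmode_def[abs_def] fourier_coeff_def
    by (rule borel_measurable_times[OF c1 borel_measurable_divide[OF m0 borel_measurable_const]])
  have b: "AE s in IM 0 T. cmod (nmode u k s) \<le> I4 u s / (2 * pi) + 1"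
    using I4_facts(2)[OF u T] AE_space
  proof eventually_elim
    case (elim s)
    then have s: "s \<ge> 0" by simp
    note [measurable] = sqint_measurable[OF sqint_of_solution[OF u s]]
    have "cmod (LINT x|CM. of_real ((cmod (u s x))\<^sup>2) * u s x * cis (- (of_int k * x))) \<le> (LINT x|CM. 1 + (cmod (u s x)) ^ 4)"
    proof (rule order_trans[OF integral_norm_bound], rule integral_mono')
      show "integrable CM (\<lambda>x. 1 + (cmod (u s x)) ^ 4)" using elim(1) by simp
      show "norm (of_real ((cmod (u s x))\<^sup>2) * u s x * cis (- (of_int k * x))) \<le> 1 + (cmod (u s x)) ^ 4" for x
      proof -
        have "r ^ 3 \<le> 1 + r ^ 4" if "r \<ge> 0" for r :: real
        proof (cases "r \<le> 1")
          case True
          then have "r ^ 3 \<le> 1" using that by (simp add: power_le_one)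
          then show ?thesis using that by (simp add: add_increasing2)
        next
          case False
          then have "r ^ 3 * 1 \<le> r ^ 3 * r" by (intro mult_left_mono) auto
          then show ?thesis by (simp add: eval_nat_numeral)
        qed
        from this[of "cmod (u s x)"] show ?thesis by (simp add: norm_mult norm_power eval_nat_numeral)
      qed
    qed auto
    also have "\<dots> = 2 * pi + I4 u s" using elim(1) by (simp add: I4_def)
    finally have "cmod (LINT x|CM. of_real ((cmod (u s x))\<^sup>2) * u s x * cis (- (of_int k * x))) / (2 * pi) \<le> (2 * pi + I4 u s) / (2 * pi)"
      by (rule divide_right_mono) simp
    then show ?case by (simp add: nmode_def fourier_coeff_def norm_mult norm_divide add_divide_distrib)
  qed
  show ?thesis
  proof (rule Bochner_Integration.integrable_bound[OF _ m])
    show "integrable (IM 0 T) (\<lambda>s. I4 u s / (2 * pi) + 1)" using I4_facts(1)[OF u T] by simp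
    show "AE s in IM 0 T. norm (nmode u k s) \<le> norm (I4 u s / (2 * pi) + 1)"
      using b by eventually_elim (use I4_nonneg in simp)
  qed
qed

text \<open>Continuity in time with values in L2 bounds the mass near each time, and bisection joins
  the local bounds.\<close>

lemma solution_L2_bounded:
  assumes u: "L2_solution_class u" and T: "T \<ge> 0"
  shows "\<exists>B\<ge>0. \<forall>s\<in>{0..T}. (LINT x|CM. (cmod (u s x))\<^sup>2) \<le> B"
proof -
  let ?m = "\<lambda>s. LINT x|CM. (cmod (u s x))\<^sup>2"
  define P where "P = (\<lambda>a b. \<exists>B\<ge>0. \<forall>s\<in>{a..b}. s \<ge> 0 \<longrightarrow> ?m s \<le> B)"
  have "P 0 T"
  proof (rule Bolzano[OF T])
    fix a b c :: real assume "P a b" "P b c" "a \<le> b" "b \<le> c"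
    then obtain B C where "B \<ge> 0" "\<forall>s\<in>{a..b}. s \<ge> 0 \<longrightarrow> ?m s \<le> B" "C \<ge> 0" "\<forall>s\<in>{b..c}. s \<ge> 0 \<longrightarrow> ?m s \<le> C"
      unfolding P_def by blast
    then show "P a c" unfolding P_def
    proof (intro exI[of _ "max B C"] conjI ballI impI)
      fix s assume "s \<in> {a..c}" "s \<ge> 0"
      then show "?m s \<le> max B C"
        using \<open>\<forall>s\<in>{a..b}. s \<ge> 0 \<longrightarrow> ?m s \<le> B\<close> \<open>\<forall>s\<in>{b..c}. s \<ge> 0 \<longrightarrow> ?m s \<le> C\<close>
        by (cases "s \<le> b") (auto intro: max.coboundedI1 max.coboundedI2)
    qed (use \<open>B \<ge> 0\<close> in auto)
  next
    fix x :: real assume x: "0 \<le> x" "x \<le> T"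
    have "((\<lambda>s. LINT y|CM. (cmod (u s y - u x y))\<^sup>2) \<longlongrightarrow> 0) (at x within {0..})"
      using u x unfolding L2_solution_class_def by blast
    then have "\<forall>\<^sub>F s in at x within {0..}. (LINT y|CM. (cmod (u s y - u x y))\<^sup>2) < 1"
      by (rule order_tendstoD(2)) simp
    then obtain d where d: "d > 0" "\<And>s. s \<ge> 0 \<Longrightarrow> s \<noteq> x \<Longrightarrow> dist s x < d \<Longrightarrow> (LINT y|CM. (cmod (u s y - u x y))\<^sup>2) < 1"
      unfolding eventually_at by (metis atLeast_iff)
    have "?m s \<le> 2 + 2 * ?m x" if s: "s \<ge> 0" "dist s x < d" for s
    proof -
      have "(LINT y|CM. (cmod (u s y - u x y))\<^sup>2) \<le> 1" using d(2)[of s] s by (cases "s = x") auto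
      moreover have "?m s \<le> 2 * (LINT y|CM. (cmod (u s y - u x y))\<^sup>2) + 2 * ?m x"
        using L2_dist_triangle[OF sqint_of_solution[OF u s(1)] sqint_of_solution[OF u x(1)] sqint_const[of 0]] by simp
      ultimately show ?thesis by linarith
    qed
    then have "P a b" if "a \<le> x" "x \<le> b" "b - a < d" for a b
      unfolding P_def using that
      by (intro exI[of _ "2 + 2 * ?m x"]) (auto simp: dist_real_def intro!: add_nonneg_nonneg mult_nonneg_nonneg Bochner_Integration.integral_nonneg)
    then show "\<exists>d>0. \<forall>a b. a \<le> x \<and> x \<le> b \<and> b - a < d \<longrightarrow> P a b" using d(1) by blast
  qed
  then show ?thesis unfolding P_def by auto
qed

text \<open>Multiplying Duhamel's formula by the inverse free propagator of the mode cancels it from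
  the datum and, under the integral, turns its value at t - s into the phase contained in
  \<open>nmode\<close>.\<close>

lemma nls_mode_AC:
  assumes sol: "nls_solution \<epsilon> u0 u" and T: "T > 0"
  shows "AC_on 0 T (umode u k) (\<lambda>s. - (\<i> * of_real (\<epsilon>\<^sup>2)) * nmode u k s)" "umode u k 0 = fourier_coeff u0 k"
proof -
  have u: "L2_solution_class u" using sol by (simp add: nls_solution_def)
  have eq: "umode u k t = fourier_coeff u0 k + (LINT s:{0..t}|lborel. - (\<i> * of_real (\<epsilon>\<^sup>2)) * nmode u k s)" if t: "t \<ge> 0" for t
  proof -
    let ?c = "\<lambda>s. cis ((of_int k)\<^sup>2 * s)"
    let ?F = "\<lambda>s. fourier_coeff (\<lambda>x. of_real ((cmod (u s x))\<^sup>2) * u s x) k"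
    have "fourier_coeff (u t) k = cis (- ((of_int k)\<^sup>2 * t)) * fourier_coeff u0 k
        - \<i> * of_real (\<epsilon>\<^sup>2) * (LINT s|IM 0 t. cis (- ((of_int k)\<^sup>2 * (t - s))) * ?F s)"
      using sol t unfolding nls_solution_def by blast
    then have "umode u k t = ?c t * (cis (- ((of_int k)\<^sup>2 * t)) * fourier_coeff u0 k
        - \<i> * of_real (\<epsilon>\<^sup>2) * (LINT s|IM 0 t. cis (- ((of_int k)\<^sup>2 * (t - s))) * ?F s))"
      by (simp only: umode_def)
    also have "\<dots> = (?c t * cis (- ((of_int k)\<^sup>2 * t))) * fourier_coeff u0 k
        - \<i> * of_real (\<epsilon>\<^sup>2) * (?c t * (LINT s|IM 0 t. cis (- ((of_int k)\<^sup>2 * (t - s))) * ?F s))"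
      by (simp only: right_diff_distrib mult_ac)
    also have "?c t * cis (- ((of_int k)\<^sup>2 * t)) = 1" by (simp add: cis_mult)
    also have "?c t * (LINT s|IM 0 t. cis (- ((of_int k)\<^sup>2 * (t - s))) * ?F s) = (LINT s|IM 0 t. nmode u k s)"
    proof -
      have "?c t * (LINT s|IM 0 t. cis (- ((of_int k)\<^sup>2 * (t - s))) * ?F s) = (LINT s|IM 0 t. ?c t * (cis (- ((of_int k)\<^sup>2 * (t - s))) * ?F s))"
        by simp
      also have "\<dots> = (LINT s|IM 0 t. nmode u k s)"
      proof -
        have "?c t * cis (- ((of_int k)\<^sup>2 * (t - s))) = ?c s" for s
          by (simp add: cis_mult right_diff_distrib)
        then show ?thesis by (simp only: nmode_def mult.assoc[symmetric])
      qed
      finally show ?thesis .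
    qed
    finally show ?thesis unfolding set_integral_IM integral_mult_right_zero by simp
  qed
  have z: "(LINT s:{0..0}|lborel. f s) = 0" for f :: "real \<Rightarrow> complex"
    unfolding set_lebesgue_integral_def
    by (rule integral_eq_zero_AE) (use AE_lborel_singleton[of 0] in eventually_elim, simp)
  show e0: "umode u k 0 = fourier_coeff u0 k" using eq[of 0] unfolding z by simp
  show "AC_on 0 T (umode u k) (\<lambda>s. - (\<i> * of_real (\<epsilon>\<^sup>2)) * nmode u k s)"
  proof (rule AC_onI)
    show "set_integrable lborel {0..T} (\<lambda>s. - (\<i> * of_real (\<epsilon>\<^sup>2)) * nmode u k s)"
      unfolding set_integral_IM by (rule integrable_mult_right[OF nmode_integrable[OF u T]])
  qed (use eq e0 in auto)
qed

text \<open>The inner sum is the p-th Fourier coefficient of |f|^2 times a phase with frequency k^2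
  - (k-p)^2, so its modulus is the same for every \<open>k\<close>. The phase is exactly what is
  missing between the coefficient \<open>k - p\<close> of \<open>f\<close>, turned into a mode, and
  the mode \<open>k\<close> of the cubic term.\<close>

lemma solution_product_structure:
  assumes f: "sqint f" and i4: "integrable CM (\<lambda>x. (cmod (f x)) ^ 4)"
  defines "b \<equiv> (\<lambda>k s. cis ((of_int k)\<^sup>2 * s) * fourier_coeff f k)"
  shows "cmod (LINT q|CS. cis (2 * of_int p * of_int q * s) * b (k - q) s * cnj (b (k - p - q) s)) = cmod (fourier_coeff (\<lambda>x. of_real ((cmod (f x))\<^sup>2)) p)" (is ?thesis1)
    and "cis ((of_int k)\<^sup>2 * s) * fourier_coeff (\<lambda>x. of_real ((cmod (f x))\<^sup>2) * f x) k =
      (LINT p|CS. (LINT q|CS. cis (2 * of_int p * of_int q * s) * b (k - q) s * cnj (b (k - p - q) s)) * b (k - p) s)" (is ?thesis2)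
proof -
  let ?S = "\<lambda>x. of_real ((cmod (f x))\<^sup>2) :: complex"
  have S: "sqint ?S" by (rule square_sqint[OF f i4])
  have V: "fourier_coeff ?S p = (LINT q|CS. fourier_coeff f (k - q) * cnj (fourier_coeff f (k - p - q)))" for p k
  proof -
    have "fourier_coeff ?S p = fourier_coeff (\<lambda>x. f x * cnj (f x)) p" by (simp add: complex_norm_square del: of_real_power)
    also have "\<dots> = (LINT m|CS. fourier_coeff f m * fourier_coeff (\<lambda>x. cnj (f x)) (p - m))"
      by (rule fourier_coeff_mult(2)[OF f sqint_cnj[OF f]])
    also have "\<dots> = (LINT m|CS. fourier_coeff f m * cnj (fourier_coeff f (m - p)))"
      by (simp add: fourier_coeff_cnj)
    also have "\<dots> = (LINT q|CS. fourier_coeff f (k - q) * cnj (fourier_coeff f (k - q - p)))"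
    proof -
      have "bij_betw (\<lambda>m::int. k - m) UNIV UNIV" by (rule bij_betw_byWitness[where f' = "\<lambda>m. k - m"]) auto
      from integral_bij_count_space[OF this, of "\<lambda>m. fourier_coeff f m * cnj (fourier_coeff f (m - p))"] show ?thesis by simp
    qed
    finally show ?thesis by (simp add: diff_right_commute add.commute diff_diff_eq)
  qed
  have inner: "(LINT q|CS. cis (2 * of_int p * of_int q * s) * b (k - q) s * cnj (b (k - p - q) s))
      = cis (((of_int k)\<^sup>2 - (of_int (k - p))\<^sup>2) * s) * fourier_coeff ?S p" for p k
  proof -
    have "cis (2 * of_int p * of_int q * s) * b (k - q) s * cnj (b (k - p - q) s)
      = cis (((of_int k)\<^sup>2 - (of_int (k - p))\<^sup>2) * s) * (fourier_coeff f (k - q) * cnj (fourier_coeff f (k - p - q)))" for q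
    proof -
      have "cis (2 * of_int p * of_int q * s) * cis ((of_int (k - q))\<^sup>2 * s) * cis (- ((of_int (k - p - q))\<^sup>2 * s))
        = cis (((of_int k)\<^sup>2 - (of_int (k - p))\<^sup>2) * s)"
        unfolding cis_mult by (rule arg_cong[of _ _ cis]) (simp add: algebra_simps power2_eq_square)
      then show ?thesis unfolding b_def by (simp add: cis_cnj mult_ac)
    qed
    then show ?thesis unfolding V[of p k] by simp
  qed
  show ?thesis1 unfolding inner by (simp add: norm_mult)
  have "cis ((of_int k)\<^sup>2 * s) * fourier_coeff (\<lambda>x. ?S x * f x) k = (LINT p|CS. cis ((of_int k)\<^sup>2 * s) * (fourier_coeff ?S p * fourier_coeff f (k - p)))"
    unfolding fourier_coeff_mult(2)[OF S f] by simp
  also have "\<dots> = (LINT p|CS. cis (((of_int k)\<^sup>2 - (of_int (k - p))\<^sup>2) * s) * fourier_coeff ?S p * b (k - p) s)"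
  proof (rule Bochner_Integration.integral_cong[OF refl])
    fix p
    have e: "cis ((of_int k)\<^sup>2 * s) = cis (((of_int k)\<^sup>2 - (of_int (k - p))\<^sup>2) * s) * cis ((of_int (k - p))\<^sup>2 * s)"
      unfolding cis_mult by (rule arg_cong[of _ _ cis]) (simp add: algebra_simps)
    show "cis ((of_int k)\<^sup>2 * s) * (fourier_coeff ?S p * fourier_coeff f (k - p)) = cis (((of_int k)\<^sup>2 - (of_int (k - p))\<^sup>2) * s) * fourier_coeff ?S p * b (k - p) s"
      unfolding b_def e by (simp only: mult_ac)
  qed
  finally show ?thesis2 unfolding inner .
qed

lemma nls_cubic_modes:
  assumes sol: "nls_solution \<epsilon> u0 u" and T: "T \<ge> 0"
  shows "\<exists>V W \<mu>. cubic_modes (\<epsilon>\<^sup>2) (umode u) (nmode u) V W T \<mu>"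
proof -
  have u: "L2_solution_class u" using sol by (simp add: nls_solution_def)
  \<comment> \<open>The solution class gives integrability on intervals of positive length; working
    up to \<open>T + 1\<close> and restricting includes \<open>T = 0\<close>.\<close>
  define T' where "T' = T + 1"
  have T': "T' > 0" using T by (simp add: T'_def)
  obtain B where B: "B \<ge> 0" "\<And>s. s \<in> {0..T'} \<Longrightarrow> (LINT x|CM. (cmod (u s x))\<^sup>2) \<le> B"
    using solution_L2_bounded[OF u, of T'] T' by auto
  define V where "V = (\<lambda>p s. cmod (fourier_coeff (\<lambda>x. of_real ((cmod (u s x))\<^sup>2)) p))"
  \<comment> \<open>Bessel's inequality bounds the square sum of \<open>V\<close> by z = I4 / (2
    pi), and z \<le> (z + 1)^2. This \<open>W\<close> is affine in \<open>I4\<close>, hence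
    integrable in time.\<close>
  define W where "W = (\<lambda>s. I4 u s / (2 * pi) + 1)"
  define \<mu> where "\<mu> = sqrt (B / (2 * pi))"
  interpret F: finite_measure "IM 0 T'" by (rule finite_measure_IM)
  have "cubic_modes (\<epsilon>\<^sup>2) (umode u) (nmode u) V W T' \<mu>"
  proof
    show "set_integrable lborel {0..T'} (nmode u k)" for k
      unfolding set_integral_IM by (rule nmode_integrable[OF u T'])
    show "AC_on 0 T' (umode u k) (\<lambda>s. - (\<i> * of_real (\<epsilon>\<^sup>2)) * nmode u k s)" for k
      by (rule nls_mode_AC(1)[OF sol T'])
    show "(\<integral>\<^sup>+k. (ennreal (cmod (umode u k s)))\<^sup>2 \<partial>CS) \<le> ennreal (\<mu>\<^sup>2)" if s: "s \<in> {0..T'}" for s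
    proof -
      have sq: "sqint (u s)" by (rule sqint_of_solution[OF u]) (use s in simp)
      have "(\<integral>\<^sup>+k. (ennreal (cmod (umode u k s)))\<^sup>2 \<partial>CS) = (\<integral>\<^sup>+k. ennreal ((cmod (fourier_coeff (u s) k))\<^sup>2) \<partial>CS)"
        by (simp add: umode_def norm_mult ennreal_power)
      also have "\<dots> = ennreal (LINT k|CS. (cmod (fourier_coeff (u s) k))\<^sup>2)"
        by (rule nn_integral_eq_integral[OF Bessel(1)[OF sq]]) simp
      also have "\<dots> \<le> ennreal (B / (2 * pi))"
        by (rule ennreal_leI, rule order_trans[OF Bessel(2)[OF sq]], rule divide_right_mono[OF B(2)[OF s]]) simp
      also have "\<dots> = ennreal (\<mu>\<^sup>2)" using B(1) by (simp add: \<mu>_def)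
      finally show ?thesis .
    qed
    show "set_integrable lborel {0..T'} W" unfolding set_integral_IM W_def using I4_facts(1)[OF u T'] by simp
    show "W s \<ge> 0" for s unfolding W_def using I4_nonneg[of u s] by simp
    show "AE s in IM 0 T'. (\<integral>\<^sup>+p. (ennreal (V p s))\<^sup>2 \<partial>CS) \<le> ennreal ((W s)\<^sup>2) \<and>
      (\<forall>k. nmode u k s = (LINT p|CS. (LINT q|CS. cis (2 * of_int p * of_int q * s) * umode u (k - q) s * cnj (umode u (k - p - q) s)) * umode u (k - p) s)) \<and>
      (\<forall>p k. cmod (LINT q|CS. cis (2 * of_int p * of_int q * s) * umode u (k - q) s * cnj (umode u (k - p - q) s)) \<le> V p s)"
      using I4_facts(2)[OF u T'] AE_space
    proof eventually_elim
      case (elim s)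
      then have sq: "sqint (u s)" by (intro sqint_of_solution[OF u]) simp
      note S = square_sqint[OF sq elim(1)]
      note str = solution_product_structure[OF sq elim(1)]
      have "(\<integral>\<^sup>+p. (ennreal (V p s))\<^sup>2 \<partial>CS) = (\<integral>\<^sup>+p. ennreal ((V p s)\<^sup>2) \<partial>CS)"
        by (simp add: ennreal_power V_def)
      also have "\<dots> = ennreal (LINT p|CS. (V p s)\<^sup>2)"
        unfolding V_def by (rule nn_integral_eq_integral[OF Bessel(1)[OF S]]) simp
      also have "\<dots> \<le> ennreal ((W s)\<^sup>2)"
      proof (rule ennreal_leI)
        have "(LINT p|CS. (V p s)\<^sup>2) \<le> I4 u s / (2 * pi)"
          unfolding V_def using Bessel(2)[OF S] by (simp add: I4_def norm_power flip: power_mult)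
        also have "\<dots> \<le> (I4 u s / (2 * pi) + 1)\<^sup>2"
        proof -
          have "z \<le> (z + 1)\<^sup>2" if "z \<ge> 0" for z :: real
            using that zero_le_power2[of z] unfolding power2_sum by simp
          then show ?thesis using I4_nonneg[of u s] by simp
        qed
        finally show "(LINT p|CS. (V p s)\<^sup>2) \<le> (W s)\<^sup>2" by (simp add: W_def)
      qed
      finally show ?case using str unfolding V_def umode_def nmode_def by simp
    qed
  qed (use T' B in \<open>auto simp: \<mu>_def V_def\<close>)
  then have "cubic_modes (\<epsilon>\<^sup>2) (umode u) (nmode u) V W T \<mu>"
    by (rule cubic_modes_subinterval) (use T in \<open>auto simp: T'_def\<close>)
  then show ?thesis by blast
qed

section \<open>Measurability of the modes\<close>

text \<open>An explicit time stepping scheme, used only for measurability: the modes at a given time are limits of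
  functions that are computed from the initial modes by countable sums.\<close>

definition estep :: "real \<Rightarrow> real \<Rightarrow> real \<Rightarrow> (int \<Rightarrow> complex) \<Rightarrow> int \<Rightarrow> complex" where
  "estep \<eta> r t v k = v k - \<i> * of_real \<eta> * csum2 (\<lambda>p q. (LINT s|IM r t. cis (2 * of_int p * of_int q * s)) * (v (k - q) * cnj (v (k - p - q)) * v (k - p)))"

fun euler :: "real \<Rightarrow> real \<Rightarrow> (int \<Rightarrow> complex) \<Rightarrow> nat \<Rightarrow> int \<Rightarrow> complex" where
  "euler \<eta> h d 0 = d"
| "euler \<eta> h d (Suc j) = estep \<eta> (real j * h) (real (Suc j) * h) (euler \<eta> h d j)"

context cubic_modes
begin

lemma trilinear_difference:
  fixes x y z x' y' z' :: complex
  shows "cmod (x * cnj y * z - x' * cnj y' * z') \<le> cmod (x - x') * cmod y * cmod z + cmod x' * cmod (y - y') * cmod z + cmod x' * cmod y' * cmod (z - z')"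
proof -
  have "x * cnj y * z - x' * cnj y' * z' = (x - x') * cnj y * z + x' * cnj (y - y') * z + x' * cnj y' * (z - z')"
    by (simp add: algebra_simps)
  then have "cmod (x * cnj y * z - x' * cnj y' * z') \<le> cmod ((x - x') * cnj y * z) + cmod (x' * cnj (y - y') * z) + cmod (x' * cnj y' * (z - z'))"
    by (simp only: order_trans[OF norm_triangle_ineq add_right_mono[OF norm_triangle_ineq]])
  then show ?thesis by (simp only: norm_mult complex_mod_cnj)
qed

text \<open>Freezing the modes at \<open>v\<close> over the step costs their motion, at most \<eta>
  L^3 times the step length, plus the initial error \<open>e\<close>. The three positions of the
  difference give the factor 3, and \<open>L + 1\<close> bounds the Wiener norm of \<open>v\<close>
  because \<open>e \<le> 1\<close>.\<close>

lemma estep_error: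
  assumes r: "0 \<le> r" "r \<le> t" "t \<le> T"
    and L: "\<And>s. s \<in> {r..t} \<Longrightarrow> Y s \<le> ennreal L" "L \<ge> 0"
    and e: "(\<integral>\<^sup>+k. cmod (a k r - v k) \<partial>CS) \<le> ennreal e" "0 \<le> e" "e \<le> 1"
  shows "(\<integral>\<^sup>+k. cmod (a k t - estep \<eta> r t v k) \<partial>CS)
    \<le> ennreal ((1 + 3 * \<eta> * (L + 1)\<^sup>2 * (t - r)) * e + 3 * \<eta>\<^sup>2 * (L + 1)\<^sup>2 * L ^ 3 * (t - r)\<^sup>2)"
proof -
  have rT: "0 \<le> r" "t \<le> T" using r by auto
  define R where "R = L + 1"
  have R: "R \<ge> 0" "L \<le> R" using L(2) by (auto simp: R_def)
  let ?v = "\<lambda>k. ennreal (cmod (v k))"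
  have vR: "(\<integral>\<^sup>+k. ?v k \<partial>CS) \<le> ennreal R"
  proof -
    have "(\<integral>\<^sup>+k. ?v k \<partial>CS) \<le> (\<integral>\<^sup>+k. A r k + ennreal (cmod (a k r - v k)) \<partial>CS)"
    proof (rule nn_integral_mono)
      fix k show "?v k \<le> A r k + ennreal (cmod (a k r - v k))"
        using norm_triangle_sub[of "v k" "a k r"] by (simp add: norm_minus_commute flip: ennreal_plus)
    qed
    also have "\<dots> = Y r + (\<integral>\<^sup>+k. cmod (a k r - v k) \<partial>CS)" by (rule nn_integral_add) auto
    also have "\<dots> \<le> ennreal L + ennreal 1"
      by (intro add_mono L(1) order_trans[OF e(1)] ennreal_leI e(3)) (use r in auto)
    finally show ?thesis using L(2) by (simp add: R_def)
  qed
  have YR: "Y s \<le> ennreal R" if "s \<in> {r..t}" for s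
    by (rule order_trans[OF L(1)[OF that] ennreal_leI[OF R(2)]])
  define E where "E = \<eta> * L ^ 3 * (t - r) + e"
  have E0: "E \<ge> 0" using eta L(2) r e by (simp add: E_def)
  let ?x = "\<lambda>s k. ennreal (cmod (a k s - v k))"
  have xE: "(\<integral>\<^sup>+k. ?x s k \<partial>CS) \<le> ennreal E" if s: "s \<in> {r..t}" for s
  proof -
    have "(\<integral>\<^sup>+k. ?x s k \<partial>CS) \<le> (\<integral>\<^sup>+k. ennreal (cmod (a k s - a k r)) + ennreal (cmod (a k r - v k)) \<partial>CS)"
    proof (rule nn_integral_mono)
      fix k show "?x s k \<le> ennreal (cmod (a k s - a k r)) + ennreal (cmod (a k r - v k))"
        using norm_triangle_ineq[of "a k s - a k r" "a k r - v k"] by (simp flip: ennreal_plus)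
    qed
    also have "\<dots> = (\<integral>\<^sup>+k. cmod (a k s - a k r) \<partial>CS) + (\<integral>\<^sup>+k. cmod (a k r - v k) \<partial>CS)" by (rule nn_integral_add) auto
    also have "\<dots> \<le> ennreal (\<eta> * L ^ 3 * (s - r)) + ennreal e"
      by (intro add_mono e(1) increment_sum) (use s r L in auto)
    also have "\<dots> = ennreal (\<eta> * L ^ 3 * (s - r) + e)" using eta L s e by (subst ennreal_plus) auto
    also have "\<dots> \<le> ennreal E"
      unfolding E_def by (intro ennreal_leI add_right_mono mult_left_mono) (use s eta L in auto)
    finally show ?thesis .
  qed
  let ?vvv = "\<lambda>k p q. v (k - q) * cnj (v (k - p - q)) * v (k - p)"
  let ?c = "\<lambda>p q s. cis (2 * of_int p * of_int q * s)"
  have diff_sum: "(\<integral>\<^sup>+k. \<integral>\<^sup>+p. \<integral>\<^sup>+q. norm (tri k p q s - ?c p q s * ?vvv k p q) \<partial>CS \<partial>CS \<partial>CS) \<le> ennreal (3 * R\<^sup>2 * E)" if s: "s \<in> {r..t}" for s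
  proof -
    have "(\<integral>\<^sup>+k. \<integral>\<^sup>+p. \<integral>\<^sup>+q. norm (tri k p q s - ?c p q s * ?vvv k p q) \<partial>CS \<partial>CS \<partial>CS)
      \<le> (\<integral>\<^sup>+k. T3 k (?x s) (A s) (A s) + T3 k ?v (?x s) (A s) + T3 k ?v ?v (?x s) \<partial>CS)"
    proof (rule nn_integral_mono)
      fix k
      have "(\<integral>\<^sup>+p. \<integral>\<^sup>+q. norm (tri k p q s - ?c p q s * ?vvv k p q) \<partial>CS \<partial>CS)
       \<le> (\<integral>\<^sup>+p. \<integral>\<^sup>+q. ?x s (k - q) * A s (k - p - q) * A s (k - p) + ?v (k - q) * ?x s (k - p - q) * A s (k - p) + ?v (k - q) * ?v (k - p - q) * ?x s (k - p) \<partial>CS \<partial>CS)"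
      proof (rule nn_integral_mono, rule nn_integral_mono)
        fix p q
        have "norm (tri k p q s - ?c p q s * ?vvv k p q) = norm (cubic_term k p q s - ?vvv k p q)"
          unfolding tri_def right_diff_distrib[symmetric] norm_mult norm_cis by simp
        then have "norm (tri k p q s - ?c p q s * ?vvv k p q) \<le> cmod (a (k - q) s - v (k - q)) * cmod (a (k - p - q) s) * cmod (a (k - p) s)
          + cmod (v (k - q)) * cmod (a (k - p - q) s - v (k - p - q)) * cmod (a (k - p) s) + cmod (v (k - q)) * cmod (v (k - p - q)) * cmod (a (k - p) s - v (k - p))"
          unfolding cubic_term_def by (simp only: trilinear_difference)
        then have "ennreal (norm (tri k p q s - ?c p q s * ?vvv k p q)) \<le> ennreal (cmod (a (k - q) s - v (k - q)) * cmod (a (k - p - q) s) * cmod (a (k - p) s)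
          + cmod (v (k - q)) * cmod (a (k - p - q) s - v (k - p - q)) * cmod (a (k - p) s) + cmod (v (k - q)) * cmod (v (k - p - q)) * cmod (a (k - p) s - v (k - p)))"
          by (rule ennreal_leI)
        then show "ennreal (norm (tri k p q s - ?c p q s * ?vvv k p q)) \<le> ?x s (k - q) * A s (k - p - q) * A s (k - p) + ?v (k - q) * ?x s (k - p - q) * A s (k - p) + ?v (k - q) * ?v (k - p - q) * ?x s (k - p)"
          by (simp add: ennreal_plus ennreal_mult)
      qed
      also have "\<dots> = T3 k (?x s) (A s) (A s) + T3 k ?v (?x s) (A s) + T3 k ?v ?v (?x s)"
        unfolding T3_def by (simp add: nn_integral_add)
      finally show "(\<integral>\<^sup>+p. \<integral>\<^sup>+q. norm (tri k p q s - ?c p q s * ?vvv k p q) \<partial>CS \<partial>CS) \<le> T3 k (?x s) (A s) (A s) + T3 k ?v (?x s) (A s) + T3 k ?v ?v (?x s)" .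
    qed
    also have "\<dots> = (\<integral>\<^sup>+k. T3 k (?x s) (A s) (A s) \<partial>CS) + (\<integral>\<^sup>+k. T3 k ?v (?x s) (A s) \<partial>CS) + (\<integral>\<^sup>+k. T3 k ?v ?v (?x s) \<partial>CS)"
      by (simp add: nn_integral_add)
    also have "\<dots> \<le> ennreal E * ennreal R * ennreal R + ennreal R * ennreal E * ennreal R + ennreal R * ennreal R * ennreal E"
      unfolding T3_sum by (intro add_mono mult_mono xE YR vR s) auto
    also have "\<dots> = ennreal (E * R * R + R * E * R + R * R * E)"
      using E0 R by (simp add: ennreal_mult[symmetric] del: ennreal_plus flip: ennreal_plus)
    also have "E * R * R + R * E * R + R * R * E = 3 * R\<^sup>2 * E" by (simp add: power2_eq_square)
    finally show ?thesis .
  qed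
  have tm: "tri k p q \<in> borel_measurable (IM r t)" for k p q by (rule tri_meas[OF rT])
  have cm: "(\<lambda>s. ?c p q s * ?vvv k p q) \<in> borel_measurable (IM r t)" for k p q
    by (rule borel_measurable_times[OF cis_meas_IM borel_measurable_const])
  have dm: "(\<lambda>s. tri k p q s - ?c p q s * ?vvv k p q) \<in> borel_measurable (IM r t)" for k p q
    by (rule borel_measurable_diff[OF tm cm])
  have fin_a: "(\<integral>\<^sup>+s. \<integral>\<^sup>+p. \<integral>\<^sup>+q. norm (tri k p q s) \<partial>CS \<partial>CS \<partial>IM r t) < \<infinity>" for k
  proof (rule nn_integral_IM_bounded)
    fix s assume s: "s \<in> {r..t}"
    have "(\<integral>\<^sup>+p. \<integral>\<^sup>+q. norm (tri k p q s) \<partial>CS \<partial>CS) = T3 k (A s) (A s) (A s)"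
      by (simp add: T3_def tri_def cubic_term_def norm_mult ennreal_mult)
    also have "\<dots> \<le> (\<integral>\<^sup>+k. T3 k (A s) (A s) (A s) \<partial>CS)" by (rule nn_integral_ge_point) simp
    also have "\<dots> \<le> ennreal R * ennreal R * ennreal R" unfolding T3_sum by (intro mult_mono YR s) auto
    also have "\<dots> = ennreal (R * R * R)" using R by (simp add: ennreal_mult)
    finally show "(\<integral>\<^sup>+p. \<integral>\<^sup>+q. norm (tri k p q s) \<partial>CS \<partial>CS) \<le> ennreal (R * R * R)" .
  qed
  have fin_v: "(\<integral>\<^sup>+s. \<integral>\<^sup>+p. \<integral>\<^sup>+q. norm (?c p q s * ?vvv k p q) \<partial>CS \<partial>CS \<partial>IM r t) < \<infinity>" for k
  proof (rule nn_integral_IM_bounded)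
    fix s
    have "(\<integral>\<^sup>+p. \<integral>\<^sup>+q. norm (?c p q s * ?vvv k p q) \<partial>CS \<partial>CS) = T3 k ?v ?v ?v"
      by (simp add: T3_def norm_mult ennreal_mult)
    also have "\<dots> \<le> (\<integral>\<^sup>+k. T3 k ?v ?v ?v \<partial>CS)" by (rule nn_integral_ge_point) simp
    also have "\<dots> \<le> ennreal R * ennreal R * ennreal R" unfolding T3_sum by (intro mult_mono vR) auto
    also have "\<dots> = ennreal (R * R * R)" using R by (simp add: ennreal_mult)
    finally show "(\<integral>\<^sup>+p. \<integral>\<^sup>+q. norm (?c p q s * ?vvv k p q) \<partial>CS \<partial>CS) \<le> ennreal (R * R * R)" .
  qed
  have pt: "a k t - estep \<eta> r t v k = (a k r - v k) - \<i> * of_real \<eta> * (LINT s|IM r t. csum2 (\<lambda>p q. tri k p q s - ?c p q s * ?vvv k p q))" for k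
  proof -
    note sa = csum2_integral_swap[OF tm fin_a, of k]
    note sv = csum2_integral_swap[OF cm fin_v, of k]
    have n: "(LINT s|IM r t. n k s) = (LINT s|IM r t. csum2 (\<lambda>p q. tri k p q s))"
    proof (rule integral_cong_AE)
      show "AE s in IM r t. n k s = csum2 (\<lambda>p q. tri k p q s)"
        using AE_good[OF rT] by eventually_elim (simp add: good_time_def Sp_eq[symmetric] csum2_def Sp_def)
      show "n k \<in> borel_measurable (IM r t)" by (rule n_meas[OF rT])
      show "(\<lambda>s. csum2 (\<lambda>p q. tri k p q s)) \<in> borel_measurable (IM r t)" using sa(1) by auto
    qed
    have AEi: "AE s in IM r t. csum2 (\<lambda>p q. tri k p q s - ?c p q s * ?vvv k p q) = csum2 (\<lambda>p q. tri k p q s) - csum2 (\<lambda>p q. ?c p q s * ?vvv k p q)"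
    proof -
      have "AE s in IM r t. (\<integral>\<^sup>+p. \<integral>\<^sup>+q. norm (tri k p q s) \<partial>CS \<partial>CS) \<noteq> \<infinity>" "AE s in IM r t. (\<integral>\<^sup>+p. \<integral>\<^sup>+q. norm (?c p q s * ?vvv k p q) \<partial>CS \<partial>CS) \<noteq> \<infinity>"
        by (rule nn_integral_PInf_AE; use fin_a[of k] fin_v[of k] tm cm in \<open>auto intro!: measurable_nn_sum\<close>)+
      then show ?thesis
        by eventually_elim (rule csum2_diff(2), auto simp: csum2able_def less_top)
    qed
    have "(LINT s|IM r t. csum2 (\<lambda>p q. tri k p q s - ?c p q s * ?vvv k p q)) = (LINT s|IM r t. csum2 (\<lambda>p q. tri k p q s) - csum2 (\<lambda>p q. ?c p q s * ?vvv k p q))"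
      by (rule integral_cong_AE[OF _ _ AEi]) (use sa(1) sv(1) dm in \<open>auto simp: csum2_def intro!: measurable_csum\<close>)
    also have "\<dots> = (LINT s|IM r t. n k s) - (LINT s|IM r t. csum2 (\<lambda>p q. ?c p q s * ?vvv k p q))"
      unfolding n by (rule Bochner_Integration.integral_diff[OF sa(1) sv(1)])
    also have "(LINT s|IM r t. csum2 (\<lambda>p q. ?c p q s * ?vvv k p q)) = csum2 (\<lambda>p q. (LINT s|IM r t. ?c p q s) * ?vvv k p q)"
      unfolding sv(3)[symmetric] by (rule arg_cong[of _ _ csum2]) simp
    finally have "(LINT s|IM r t. csum2 (\<lambda>p q. tri k p q s - ?c p q s * ?vvv k p q)) = (LINT s|IM r t. n k s) - csum2 (\<lambda>p q. (LINT s|IM r t. ?c p q s) * ?vvv k p q)" .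
    note I = this
    have at: "a k t = a k r - \<i> * of_real \<eta> * (LINT s|IM r t. n k s)" using a_increment[OF r, of k] by (simp add: algebra_simps)
    show ?thesis unfolding estep_def I at right_diff_distrib by simp
  qed
  have mq: "(\<lambda>s. \<integral>\<^sup>+p. \<integral>\<^sup>+q. norm (tri k p q s - ?c p q s * ?vvv k p q) \<partial>CS \<partial>CS) \<in> borel_measurable (IM r t)" for k
    using dm by (auto intro!: measurable_nn_sum)
  have "(\<integral>\<^sup>+k. cmod (a k t - estep \<eta> r t v k) \<partial>CS) \<le> (\<integral>\<^sup>+k. ennreal (cmod (a k r - v k)) + ennreal \<eta> * (\<integral>\<^sup>+s. \<integral>\<^sup>+p. \<integral>\<^sup>+q. norm (tri k p q s - ?c p q s * ?vvv k p q) \<partial>CS \<partial>CS \<partial>IM r t) \<partial>CS)"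
  proof (rule nn_integral_mono)
    fix k
    let ?I = "LINT s|IM r t. csum2 (\<lambda>p q. tri k p q s - ?c p q s * ?vvv k p q)"
    have "cmod (a k t - estep \<eta> r t v k) \<le> cmod (a k r - v k) + \<eta> * cmod ?I"
      unfolding pt using norm_triangle_ineq4[of "a k r - v k" "\<i> * of_real \<eta> * ?I"] eta by (simp add: norm_mult)
    then have "ennreal (cmod (a k t - estep \<eta> r t v k)) \<le> ennreal (cmod (a k r - v k)) + ennreal \<eta> * ennreal (cmod ?I)"
      using eta by (simp flip: ennreal_plus ennreal_mult)
    also have "ennreal (cmod ?I) \<le> (\<integral>\<^sup>+s. \<integral>\<^sup>+p. \<integral>\<^sup>+q. norm (tri k p q s - ?c p q s * ?vvv k p q) \<partial>CS \<partial>CS \<partial>IM r t)"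
    proof (cases "integrable (IM r t) (\<lambda>s. csum2 (\<lambda>p q. tri k p q s - ?c p q s * ?vvv k p q))")
      case True
      show ?thesis by (rule order_trans[OF integral_norm_bound_ennreal[OF True] nn_integral_mono[OF csum2_norm_le]])
    qed (simp add: not_integrable_integral_eq)
    finally show "ennreal (cmod (a k t - estep \<eta> r t v k)) \<le> ennreal (cmod (a k r - v k)) + ennreal \<eta> * (\<integral>\<^sup>+s. \<integral>\<^sup>+p. \<integral>\<^sup>+q. norm (tri k p q s - ?c p q s * ?vvv k p q) \<partial>CS \<partial>CS \<partial>IM r t)"
      by (simp add: add_left_mono mult_left_mono)
  qed
  also have "\<dots> = (\<integral>\<^sup>+k. cmod (a k r - v k) \<partial>CS) + ennreal \<eta> * (\<integral>\<^sup>+k. \<integral>\<^sup>+s. \<integral>\<^sup>+p. \<integral>\<^sup>+q. norm (tri k p q s - ?c p q s * ?vvv k p q) \<partial>CS \<partial>CS \<partial>IM r t \<partial>CS)"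
    by (simp add: nn_integral_add nn_integral_cmult)
  also have "(\<integral>\<^sup>+k. \<integral>\<^sup>+s. \<integral>\<^sup>+p. \<integral>\<^sup>+q. norm (tri k p q s - ?c p q s * ?vvv k p q) \<partial>CS \<partial>CS \<partial>IM r t \<partial>CS)
     = (\<integral>\<^sup>+s. \<integral>\<^sup>+k. \<integral>\<^sup>+p. \<integral>\<^sup>+q. norm (tri k p q s - ?c p q s * ?vvv k p q) \<partial>CS \<partial>CS \<partial>CS \<partial>IM r t)"
    by (rule nn_integral_count_space_nn_integral[symmetric]) (use mq in auto)
  also have "(\<integral>\<^sup>+k. cmod (a k r - v k) \<partial>CS) + ennreal \<eta> * \<dots> \<le> ennreal e + ennreal \<eta> * (\<integral>\<^sup>+s. ennreal (3 * R\<^sup>2 * E) \<partial>IM r t)"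
    by (intro add_mono mult_left_mono e(1) nn_integral_mono diff_sum) auto
  also have "\<dots> = ennreal (e + \<eta> * (3 * R\<^sup>2 * E * (t - r)))"
    using r e eta E0 by (simp add: emeasure_restrict_space space_restrict_space flip: ennreal_mult ennreal_plus)
  also have "e + \<eta> * (3 * R\<^sup>2 * E * (t - r)) = (1 + 3 * \<eta> * R\<^sup>2 * (t - r)) * e + 3 * \<eta>\<^sup>2 * R\<^sup>2 * L ^ 3 * (t - r)\<^sup>2"
    by (simp add: E_def algebra_simps power2_eq_square)
  finally show ?thesis by (simp add: R_def)
qed

text \<open>Discrete Gronwall: after \<open>j\<close> steps of length \<open>h\<close> the error is
  at most D h^2 j (1 + C h)^j. The norm in which this holds dominates every single mode.\<close>

lemma euler_limit:
  assumes "Y 0 < \<infinity>"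
  shows "(\<lambda>n. euler \<eta> (T / real n) (\<lambda>k. a k 0) n k) \<longlonglongrightarrow> a k T"
proof -
  obtain y where y: "Y 0 = ennreal y" "y \<ge> 0" using assms by (cases "Y 0" rule: ennreal_cases) auto
  obtain L where L: "L \<ge> 0" "\<And>s. s \<in> {0..T} \<Longrightarrow> Y s \<le> ennreal L"
    using l1_propagation[of y] y by auto
  define C where "C = 3 * \<eta> * (L + 1)\<^sup>2"
  define D where "D = 3 * \<eta>\<^sup>2 * (L + 1)\<^sup>2 * L ^ 3"
  have C: "C \<ge> 0" "D \<ge> 0" using eta L(1) by (auto simp: C_def D_def)
  \<comment> \<open>Bounds the accumulated error after at most \<open>n\<close> steps; it has to be
    at most 1 before \<open>estep_error\<close> applies to all of them.\<close>
  define B where "B = (\<lambda>n::nat. D * (T / real n) * T * exp (C * T))"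
  have Bl: "B \<longlonglongrightarrow> 0"
    unfolding B_def by real_asymp
  have err: "ennreal (cmod (a k T - euler \<eta> (T / real n) (\<lambda>k. a k 0) n k)) \<le> ennreal (B n)" if n: "n > 0" and Bn: "B n \<le> 1" for n
  proof -
    define h where "h = T / real n"
    have h: "h \<ge> 0" "real n * h = T" using T n by (auto simp: h_def)
    have bnd: "D * h\<^sup>2 * real j * (1 + C * h) ^ j \<le> B n" if j: "j \<le> n" for j
    proof -
      have "(1 + C * h) ^ j \<le> (1 + C * h) ^ n" using C h j by (intro power_increasing) auto
      also have "\<dots> \<le> exp (C * h) ^ n" using C h by (intro power_mono) auto
      also have "\<dots> = exp (C * T)" using h(2) by (simp add: mult_ac flip: exp_of_nat_mult)
      finally have "(1 + C * h) ^ j \<le> exp (C * T)" .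
      moreover have "D * h\<^sup>2 * real j \<le> D * h\<^sup>2 * real n" using C j by (intro mult_left_mono) auto
      moreover have "D * h\<^sup>2 * real n = D * h * T" using h(2)[symmetric] by (simp add: power2_eq_square)
      ultimately have x: "(1 + C * h) ^ j \<le> exp (C * T)" "D * h\<^sup>2 * real j \<le> D * h * T" by simp_all
      have "D * h\<^sup>2 * real j * (1 + C * h) ^ j \<le> D * h * T * exp (C * T)"
        by (rule mult_mono[OF x(2,1)]) (use C h T in auto)
      then show ?thesis unfolding B_def h_def[symmetric] .
    qed
    have "(\<integral>\<^sup>+k. cmod (a k (real j * h) - euler \<eta> h (\<lambda>k. a k 0) j k) \<partial>CS) \<le> ennreal (D * h\<^sup>2 * real j * (1 + C * h) ^ j)" if "j \<le> n" for j
      using that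
    proof (induction j)
      case (Suc j)
      let ?e = "D * h\<^sup>2 * real j * (1 + C * h) ^ j"
      have jn: "real (Suc j) * h \<le> T" using mult_right_mono[of "real (Suc j)" "real n" h] Suc.prems h by simp
      have e0: "0 \<le> ?e" using C h by simp
      have "(\<integral>\<^sup>+k. cmod (a k (real (Suc j) * h) - estep \<eta> (real j * h) (real (Suc j) * h) (euler \<eta> h (\<lambda>k. a k 0) j) k) \<partial>CS)
        \<le> ennreal ((1 + 3 * \<eta> * (L + 1)\<^sup>2 * (real (Suc j) * h - real j * h)) * ?e + 3 * \<eta>\<^sup>2 * (L + 1)\<^sup>2 * L ^ 3 * (real (Suc j) * h - real j * h)\<^sup>2)"
      proof (rule estep_error)
        show "real j * h \<le> real (Suc j) * h" using h by (simp add: distrib_right)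
        show "Y s \<le> ennreal L" if "s \<in> {real j * h..real (Suc j) * h}" for s
          by (rule L(2)) (use that jn h order_trans[OF mult_nonneg_nonneg[of "real j" h]] in auto)
        show "?e \<le> 1" using bnd[of j] Suc.prems Bn by simp
      qed (use Suc jn h L e0 in auto)
      also have "real (Suc j) * h - real j * h = h" by (simp add: algebra_simps)
      also have "(1 + 3 * \<eta> * (L + 1)\<^sup>2 * h) * ?e + 3 * \<eta>\<^sup>2 * (L + 1)\<^sup>2 * L ^ 3 * h\<^sup>2 \<le> D * h\<^sup>2 * real (Suc j) * (1 + C * h) ^ Suc j"
      proof -
        have "1 \<le> (1 + C * h) ^ Suc j" using C h by (intro one_le_power) auto
        then have "D * h\<^sup>2 * 1 \<le> D * h\<^sup>2 * (1 + C * h) ^ Suc j" using C by (intro mult_left_mono) auto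
        then show ?thesis unfolding C_def[symmetric] D_def[symmetric] by (simp add: algebra_simps)
      qed
      finally show ?case by (simp add: ennreal_leI)
    qed simp
    from this[of n]
    have "(\<integral>\<^sup>+k. cmod (a k T - euler \<eta> h (\<lambda>k. a k 0) n k) \<partial>CS) \<le> ennreal (D * h\<^sup>2 * real n * (1 + C * h) ^ n)" by (simp add: h(2))
    also have "\<dots> \<le> ennreal (B n)" by (rule ennreal_leI[OF bnd]) simp
    finally have "(\<integral>\<^sup>+k. cmod (a k T - euler \<eta> h (\<lambda>k. a k 0) n k) \<partial>CS) \<le> ennreal (B n)" .
    then show ?thesis unfolding h_def[symmetric]
      by (rule order_trans[rotated]) (rule nn_integral_ge_point[where p = "\<lambda>k. ennreal (cmod (a k T - euler \<eta> h (\<lambda>k. a k 0) n k))"], simp)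
  qed
  have B0: "B n \<ge> 0" for n using C T by (simp add: B_def)
  have "\<forall>\<^sub>F n in sequentially. norm (euler \<eta> (T / real n) (\<lambda>k. a k 0) n k - a k T) \<le> B n"
    using order_tendstoD(2)[OF Bl zero_less_one] eventually_gt_at_top[of 0]
  proof eventually_elim
    case (elim n)
    have "ennreal (cmod (a k T - euler \<eta> (T / real n) (\<lambda>k. a k 0) n k)) \<le> ennreal (B n)"
      by (rule err) (use elim in auto)
    then show ?case using B0[of n] by (simp add: norm_minus_commute)
  qed
  then have "(\<lambda>n. euler \<eta> (T / real n) (\<lambda>k. a k 0) n k - a k T) \<longlonglongrightarrow> 0"
    by (rule Lim_null_comparison[OF _ Bl])
  then show ?thesis by (rule LIM_zero_cancel)
qed

end

lemma borel_measurable_cnj [measurable (raw)]: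
  "f \<in> borel_measurable M \<Longrightarrow> (\<lambda>x. cnj (f x)) \<in> borel_measurable M"
  by (rule borel_measurable_continuous_on[where f = cnj]) (intro continuous_intros)

lemma euler_measurable:
  fixes d :: "int \<Rightarrow> 'b \<Rightarrow> complex"
  assumes [measurable]: "\<And>k. d k \<in> borel_measurable M"
  shows "(\<lambda>w. euler \<eta> h (\<lambda>k. d k w) j k) \<in> borel_measurable M"
proof (induction j arbitrary: k)
  case (Suc j)
  note [measurable] = Suc
  show ?case unfolding euler.simps estep_def csum2_def by measurable
qed simp

section \<open>Standard complex Gaussian variables\<close>

text \<open>Variance 1/2 in each unit direction, so that the squared modulus has mean 1. The pair
  \<open>(0, 0)\<close> is left out because a normal density needs a positive deviation.\<close>

definition std_cgauss :: "'a measure \<Rightarrow> ('a \<Rightarrow> complex) \<Rightarrow> bool" where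
  "std_cgauss M X \<longleftrightarrow> X \<in> borel_measurable M \<and>
     (\<forall>a b. (a, b) \<noteq> (0, 0) \<longrightarrow> distributed M lborel (\<lambda>\<omega>. a * Re (X \<omega>) + b * Im (X \<omega>)) (normal_density 0 (sqrt ((a\<^sup>2 + b\<^sup>2) / 2))))"

lemma std_cgauss_measurable: "std_cgauss M X \<Longrightarrow> X \<in> borel_measurable M"
  by (simp add: std_cgauss_def)

lemma Re_Im_measurable:
  fixes X :: "'a \<Rightarrow> complex"
  assumes [measurable]: "X \<in> borel_measurable M"
  shows "(\<lambda>\<omega>. Re (X \<omega>)) \<in> borel_measurable M" "(\<lambda>\<omega>. Im (X \<omega>)) \<in> borel_measurable M"
  using assms borel_measurable_complex_iff by blast+

text \<open>Integrability is drawn from Gaussianity, as the value of an integral does not show it: a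
  function that is not integrable has integral 0 by convention. A constant with mean 0 has second
  moment 0, so a positive \<open>v\<close> excludes the degenerate case.\<close>

lemma (in prob_space) gaussian_rv_square_integrable:
  assumes "gaussian_rv M Y"
  shows "integrable M Y" "integrable M (\<lambda>\<omega>. (Y \<omega>)\<^sup>2)"
    and "expectation (\<lambda>\<omega>. (Y \<omega>)\<^sup>2) = v \<Longrightarrow> expectation Y = 0 \<Longrightarrow> v > 0 \<Longrightarrow> distributed M lborel Y (normal_density 0 (sqrt v))"
proof -
  have Ym [measurable]: "Y \<in> borel_measurable M" using assms by (simp add: gaussian_rv_def)
  obtain \<mu> \<sigma> where ms: "(\<sigma> > 0 \<and> distributed M lborel Y (normal_density \<mu> \<sigma>)) \<or> (AE \<omega> in M. Y \<omega> = \<mu>)"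
    using assms unfolding gaussian_rv_def by blast
  have "integrable M Y \<and> integrable M (\<lambda>\<omega>. (Y \<omega>)\<^sup>2) \<and>
    (expectation (\<lambda>\<omega>. (Y \<omega>)\<^sup>2) = v \<longrightarrow> expectation Y = 0 \<longrightarrow> v > 0 \<longrightarrow> distributed M lborel Y (normal_density 0 (sqrt v)))"
    using ms
  proof
    assume "\<sigma> > 0 \<and> distributed M lborel Y (normal_density \<mu> \<sigma>)"
    then have s: "\<sigma> > 0" and D: "distributed M lborel Y (normal_density \<mu> \<sigma>)" by auto
    have i1: "integrable M Y"
      using distributed_integrable_var[OF D] integrable_normal_moment_nz_1[OF s] by simp
    have i2: "integrable M (\<lambda>\<omega>. (Y \<omega> - \<mu>)\<^sup>2)"
      using distributed_integrable[OF D, of "\<lambda>x. (x - \<mu>)\<^sup>2"] integrable_normal_moment[OF s, of \<mu> 2] by simp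
    have "integrable M (\<lambda>\<omega>. (Y \<omega> - \<mu>)\<^sup>2 + 2 * \<mu> * Y \<omega> - \<mu>\<^sup>2)" using i1 i2 by simp
    moreover have "(Y \<omega> - \<mu>)\<^sup>2 + 2 * \<mu> * Y \<omega> - \<mu>\<^sup>2 = (Y \<omega>)\<^sup>2" for \<omega> by (simp add: power2_diff)
    ultimately have i3: "integrable M (\<lambda>\<omega>. (Y \<omega>)\<^sup>2)" by simp
    have ex: "expectation Y = \<mu>" by (rule normal_distributed_expectation[OF s D])
    have var: "variance Y = \<sigma>\<^sup>2" by (rule normal_distributed_variance[OF s D])
    show ?thesis
    proof (intro conjI i1 i3 impI)
      assume "expectation (\<lambda>\<omega>. (Y \<omega>)\<^sup>2) = v" "expectation Y = 0" "v > 0"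
      then have "\<mu> = 0" "\<sigma>\<^sup>2 = v" using ex var by auto
      then have "\<sigma> = sqrt v" using s by (simp add: real_sqrt_unique)
      then show "distributed M lborel Y (normal_density 0 (sqrt v))" using D \<open>\<mu> = 0\<close> by simp
    qed
  next
    assume AE: "AE \<omega> in M. Y \<omega> = \<mu>"
    have i: "integrable M Y"
      by (rule integrable_cong_AE_imp[of M "\<lambda>_. \<mu>"]) (use AE in \<open>auto elim!: eventually_mono\<close>)
    have i2: "integrable M (\<lambda>\<omega>. (Y \<omega>)\<^sup>2)"
      by (rule integrable_cong_AE_imp[of M "\<lambda>_. \<mu>\<^sup>2"]) (use AE in \<open>auto elim!: eventually_mono\<close>)
    have "expectation Y = (LINT \<omega>|M. \<mu>)" "expectation (\<lambda>\<omega>. (Y \<omega>)\<^sup>2) = (LINT \<omega>|M. \<mu>\<^sup>2)"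
      by (rule integral_cong_AE; use AE in \<open>auto elim!: eventually_mono\<close>)+
    then have "expectation Y = \<mu>" "expectation (\<lambda>\<omega>. (Y \<omega>)\<^sup>2) = \<mu>\<^sup>2" by (simp_all add: prob_space)
    then show ?thesis using i i2 by auto
  qed
  then show "integrable M Y" "integrable M (\<lambda>\<omega>. (Y \<omega>)\<^sup>2)"
    "expectation (\<lambda>\<omega>. (Y \<omega>)\<^sup>2) = v \<Longrightarrow> expectation Y = 0 \<Longrightarrow> v > 0 \<Longrightarrow> distributed M lborel Y (normal_density 0 (sqrt v))"
    by auto
qed

text \<open>The mean of X^2 has real part E (Re X)^2 - E (Im X)^2 and imaginary part 2 E (Re X)(Im
  X). Its vanishing and E |X|^2 = 1 make the two parts uncorrelated with variance 1/2, which fixes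
  the variance of every linear form.\<close>

lemma (in prob_space) std_cgaussI:
  assumes X: "complex_gaussian_rv M X" and "(LINT \<omega>|M. X \<omega>) = 0" "(LINT \<omega>|M. X \<omega> * X \<omega>) = 0" "(LINT \<omega>|M. X \<omega> * cnj (X \<omega>)) = 1"
  shows "std_cgauss M X"
proof -
  have gab: "gaussian_rv M (\<lambda>\<omega>. a * Re (X \<omega>) + b * Im (X \<omega>))" for a b using X by (simp add: complex_gaussian_rv_def)
  have gR: "gaussian_rv M (\<lambda>\<omega>. Re (X \<omega>))" using gab[of 1 0] by simp
  have gI: "gaussian_rv M (\<lambda>\<omega>. Im (X \<omega>))" using gab[of 0 1] by simp
  have m: "(\<lambda>\<omega>. Re (X \<omega>)) \<in> borel_measurable M" "(\<lambda>\<omega>. Im (X \<omega>)) \<in> borel_measurable M"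
    using gR gI by (auto simp: gaussian_rv_def)
  then have Xm [measurable]: "X \<in> borel_measurable M" using borel_measurable_complex_iff by blast
  note [measurable] = m
  note R = gaussian_rv_square_integrable(1,2)[OF gR] and I = gaussian_rv_square_integrable(1,2)[OF gI]
  have RI: "integrable M (\<lambda>\<omega>. Re (X \<omega>) * Im (X \<omega>))"
  proof (rule Bochner_Integration.integrable_bound)
    show "integrable M (\<lambda>\<omega>. (Re (X \<omega>))\<^sup>2 + (Im (X \<omega>))\<^sup>2)" using R I by simp
    have "norm (x * y) \<le> norm (x\<^sup>2 + y\<^sup>2)" for x y :: real
    proof -
      have "2 * (\<bar>x\<bar> * \<bar>y\<bar>) \<le> x\<^sup>2 + y\<^sup>2" using sum_squares_bound[of "\<bar>x\<bar>" "\<bar>y\<bar>"] by simp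
      moreover have "0 \<le> \<bar>x\<bar> * \<bar>y\<bar>" by simp
      ultimately show ?thesis unfolding real_norm_def abs_mult by linarith
    qed
    then show "AE \<omega> in M. norm (Re (X \<omega>) * Im (X \<omega>)) \<le> norm ((Re (X \<omega>))\<^sup>2 + (Im (X \<omega>))\<^sup>2)" by simp
  qed measurable
  have cint: "integrable M (\<lambda>\<omega>. Complex (f \<omega>) (g \<omega>))" "(LINT \<omega>|M. Complex (f \<omega>) (g \<omega>)) = Complex (expectation f) (expectation g)"
    if "integrable M f" "integrable M g" for f g
  proof -
    have e: "Complex (f \<omega>) (g \<omega>) = of_real (f \<omega>) + \<i> * of_real (g \<omega>)" for \<omega> by (simp add: Complex_eq)
    show "integrable M (\<lambda>\<omega>. Complex (f \<omega>) (g \<omega>))" unfolding e using that by simp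
    show "(LINT \<omega>|M. Complex (f \<omega>) (g \<omega>)) = Complex (expectation f) (expectation g)" unfolding e using that by (simp add: Complex_eq)
  qed
  have X1: "X \<omega> = Complex (Re (X \<omega>)) (Im (X \<omega>))" for \<omega> by simp
  have E1: "expectation (\<lambda>\<omega>. Re (X \<omega>)) = 0" "expectation (\<lambda>\<omega>. Im (X \<omega>)) = 0"
    using cint(2)[OF R(1) I(1)] assms(2) by (simp_all add: complex_eq_iff)
  have X2: "X \<omega> * X \<omega> = Complex ((Re (X \<omega>))\<^sup>2 - (Im (X \<omega>))\<^sup>2) (2 * (Re (X \<omega>) * Im (X \<omega>)))" for \<omega>
    by (simp add: complex_eq_iff power2_eq_square)
  have "(LINT \<omega>|M. X \<omega> * X \<omega>) = Complex (expectation (\<lambda>\<omega>. (Re (X \<omega>))\<^sup>2 - (Im (X \<omega>))\<^sup>2)) (expectation (\<lambda>\<omega>. 2 * (Re (X \<omega>) * Im (X \<omega>))))"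
    unfolding X2 by (rule cint(2)) (use R I RI in auto)
  then have E2: "expectation (\<lambda>\<omega>. (Re (X \<omega>))\<^sup>2) = expectation (\<lambda>\<omega>. (Im (X \<omega>))\<^sup>2)" "expectation (\<lambda>\<omega>. Re (X \<omega>) * Im (X \<omega>)) = 0"
    using assms(3) R I RI by (auto simp: complex_eq_iff)
  have X3: "X \<omega> * cnj (X \<omega>) = Complex ((Re (X \<omega>))\<^sup>2 + (Im (X \<omega>))\<^sup>2) 0" for \<omega>
    by (simp add: complex_eq_iff power2_eq_square)
  have "(LINT \<omega>|M. X \<omega> * cnj (X \<omega>)) = Complex (expectation (\<lambda>\<omega>. (Re (X \<omega>))\<^sup>2 + (Im (X \<omega>))\<^sup>2)) (expectation (\<lambda>\<omega>. 0))"
    unfolding X3 by (rule cint(2)) (use R I in auto)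
  then have "expectation (\<lambda>\<omega>. (Re (X \<omega>))\<^sup>2) + expectation (\<lambda>\<omega>. (Im (X \<omega>))\<^sup>2) = 1"
    using assms(4) R I by (auto simp: complex_eq_iff)
  with E2(1) have E3: "expectation (\<lambda>\<omega>. (Re (X \<omega>))\<^sup>2) = 1/2" "expectation (\<lambda>\<omega>. (Im (X \<omega>))\<^sup>2) = 1/2" by auto
  show ?thesis unfolding std_cgauss_def
  proof (intro conjI Xm allI impI)
    fix a b :: real assume ab: "(a, b) \<noteq> (0, 0)"
    have "expectation (\<lambda>\<omega>. (a * Re (X \<omega>) + b * Im (X \<omega>))\<^sup>2) = expectation (\<lambda>\<omega>. a\<^sup>2 * (Re (X \<omega>))\<^sup>2 + b\<^sup>2 * (Im (X \<omega>))\<^sup>2 + 2 * a * b * (Re (X \<omega>) * Im (X \<omega>)))"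
      by (rule Bochner_Integration.integral_cong) (auto simp: power2_eq_square algebra_simps)
    also have "\<dots> = (a\<^sup>2 + b\<^sup>2) / 2" using R I RI by (simp add: E2(2) E3 add_divide_distrib)
    finally have "expectation (\<lambda>\<omega>. (a * Re (X \<omega>) + b * Im (X \<omega>))\<^sup>2) = (a\<^sup>2 + b\<^sup>2) / 2" .
    moreover have "expectation (\<lambda>\<omega>. a * Re (X \<omega>) + b * Im (X \<omega>)) = 0" using R I E1 by simp
    moreover have "(a\<^sup>2 + b\<^sup>2) / 2 > 0" using ab by (auto simp: sum_power2_gt_zero_iff)
    ultimately show "distributed M lborel (\<lambda>\<omega>. a * Re (X \<omega>) + b * Im (X \<omega>)) (normal_density 0 (sqrt ((a\<^sup>2 + b\<^sup>2) / 2)))"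
      by (rule gaussian_rv_square_integrable(3)[OF gab])
  qed
qed

section \<open>Characteristic functions and independence of the two parts\<close>

lemma (in prob_space) normal_char:
  assumes D: "distributed M lborel Y (normal_density 0 \<sigma>)" and s: "\<sigma> > 0"
  shows "(LINT \<omega>|M. iexp (Y \<omega>)) = of_real (exp (- \<sigma>\<^sup>2 / 2))"
proof -
  have Z: "distributed M lborel (\<lambda>\<omega>. Y \<omega> / \<sigma>) std_normal_density"
    using normal_standard_normal_convert[OF s, of Y 0] D by simp
  have Ym [measurable]: "Y \<in> borel_measurable M" using distributed_measurable[OF D] by simp
  have "char std_normal_distribution \<sigma> = (LINT x|distr M lborel (\<lambda>\<omega>. Y \<omega> / \<sigma>). iexp (\<sigma> * x))"
    unfolding char_def using distributed_distr_eq_density[OF Z] by simp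
  also have "\<dots> = (LINT \<omega>|M. iexp (\<sigma> * (Y \<omega> / \<sigma>)))"
    by (rule integral_distr) auto
  also have "\<dots> = (LINT \<omega>|M. iexp (Y \<omega>))" using s by simp
  finally show ?thesis unfolding char_std_normal_distribution by simp
qed

lemma (in prob_space) cgauss_char:
  assumes "std_cgauss M X"
  shows "(LINT \<omega>|M. iexp (a * Re (X \<omega>) + b * Im (X \<omega>))) = of_real (exp (- (a\<^sup>2 + b\<^sup>2) / 4))"
proof (cases "(a, b) = (0, 0)")
  case True
  then show ?thesis by (simp add: prob_space)
next
  case False
  then have p: "(a\<^sup>2 + b\<^sup>2) / 2 > 0" by (auto simp: sum_power2_gt_zero_iff)
  have "distributed M lborel (\<lambda>\<omega>. a * Re (X \<omega>) + b * Im (X \<omega>)) (normal_density 0 (sqrt ((a\<^sup>2 + b\<^sup>2) / 2)))"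
    using assms False unfolding std_cgauss_def by blast
  from normal_char[OF this]
  have "(LINT \<omega>|M. iexp (a * Re (X \<omega>) + b * Im (X \<omega>))) = of_real (exp (- (sqrt ((a\<^sup>2 + b\<^sup>2) / 2))\<^sup>2 / 2))"
    using p by simp
  moreover have "- (sqrt ((a\<^sup>2 + b\<^sup>2) / 2))\<^sup>2 / 2 = - (a\<^sup>2 + b\<^sup>2) / 4"
    unfolding real_sqrt_pow2[OF less_imp_le[OF p]] by (simp add: field_simps)
  ultimately show ?thesis by (simp only:)
qed

text \<open>The weight \<open>w\<close> turns \<open>M\<close> into another probability measure
  under which \<open>Y\<close> has the same characteristic function, hence the same law. The
  conclusion is this equality of laws read on one event.\<close>

lemma (in prob_space) weighted_Levy_uniqueness:
  fixes w Y :: "'a \<Rightarrow> real"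
  assumes [measurable]: "Y \<in> borel_measurable M" "w \<in> borel_measurable M"
    and w: "\<And>\<omega>. 0 \<le> w \<omega>" "\<And>\<omega>. w \<omega> \<le> C" "expectation w = 1"
    and ch: "\<And>t. (LINT \<omega>|M. w \<omega> *\<^sub>R iexp (t * Y \<omega>)) = (LINT \<omega>|M. iexp (t * Y \<omega>))"
    and A [measurable]: "A \<in> sets borel"
  shows "expectation (\<lambda>\<omega>. w \<omega> * indicator A (Y \<omega>)) = prob {\<omega> \<in> space M. Y \<omega> \<in> A}"
proof -
  have wi: "integrable M w" by (rule integrable_const_bound[where B = C]) (use w in auto)
  let ?N = "density M (\<lambda>\<omega>. ennreal (w \<omega>))"
  interpret N: prob_space ?N
  proof
    have "emeasure ?N (space ?N) = (\<integral>\<^sup>+\<omega>. ennreal (w \<omega>) \<partial>M)"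
      by (simp add: emeasure_density cong: nn_integral_cong)
    also have "\<dots> = 1" using wi w by (simp add: nn_integral_eq_integral)
    finally show "emeasure ?N (space ?N) = 1" .
  qed
  have YN [measurable]: "Y \<in> borel_measurable ?N" by simp
  have "distr ?N borel Y = distr M borel Y"
  proof (rule Levy_uniqueness)
    show "real_distribution (distr ?N borel Y)"
      by (intro real_distribution.intro N.prob_space_distr real_distribution_axioms.intro) auto
    show "real_distribution (distr M borel Y)"
      by (intro real_distribution.intro prob_space_distr real_distribution_axioms.intro) auto
    show "char (distr ?N borel Y) = char (distr M borel Y)"
    proof
      fix t
      have "char (distr ?N borel Y) t = (LINT \<omega>|?N. iexp (t * Y \<omega>))"
        unfolding char_def by (rule integral_distr) auto
      also have "\<dots> = (LINT \<omega>|M. w \<omega> *\<^sub>R iexp (t * Y \<omega>))"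
        by (rule integral_density) (use w in auto)
      also have "\<dots> = (LINT \<omega>|M. iexp (t * Y \<omega>))" by (rule ch)
      also have "\<dots> = char (distr M borel Y) t"
        unfolding char_def by (rule integral_distr[symmetric]) auto
      finally show "char (distr ?N borel Y) t = char (distr M borel Y) t" .
    qed
  qed
  then have "emeasure (distr ?N borel Y) A = emeasure (distr M borel Y) A" by simp
  then have e: "emeasure ?N (Y -` A \<inter> space M) = emeasure M (Y -` A \<inter> space M)"
    by (simp add: emeasure_distr)
  have "emeasure ?N (Y -` A \<inter> space M) = (\<integral>\<^sup>+\<omega>. ennreal (w \<omega>) * indicator (Y -` A \<inter> space M) \<omega> \<partial>M)"
    by (rule emeasure_density) auto
  also have "\<dots> = (\<integral>\<^sup>+\<omega>. ennreal (w \<omega> * indicator A (Y \<omega>)) \<partial>M)"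
    by (rule nn_integral_cong) (auto simp: indicator_def)
  also have "\<dots> = ennreal (expectation (\<lambda>\<omega>. w \<omega> * indicator A (Y \<omega>)))"
  proof (rule nn_integral_eq_integral)
    show "integrable M (\<lambda>\<omega>. w \<omega> * indicator A (Y \<omega>))"
      by (rule integrable_const_bound[where B = C]) (use w in \<open>auto simp: indicator_def intro: order_trans[OF w(1) w(2)]\<close>)
  qed (use w in auto)
  finally have "ennreal (expectation (\<lambda>\<omega>. w \<omega> * indicator A (Y \<omega>))) = ennreal (prob (Y -` A \<inter> space M))"
    using e by (simp add: emeasure_eq_measure)
  moreover have "expectation (\<lambda>\<omega>. w \<omega> * indicator A (Y \<omega>)) \<ge> 0"
    by (rule Bochner_Integration.integral_nonneg) (use w in auto)
  ultimately have "expectation (\<lambda>\<omega>. w \<omega> * indicator A (Y \<omega>)) = prob (Y -` A \<inter> space M)" by simp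
  moreover have "Y -` A \<inter> space M = {\<omega> \<in> space M. Y \<omega> \<in> A}" by auto
  ultimately show ?thesis by simp
qed

text \<open>Levy's theorem for the real part with, up to normalisation, the weights
  \<open>1 + cos (b Im X) / 2\<close> and \<open>1 + sin (b Im X) / 2\<close> determines the characteristic function of the
  imaginary part on every event of the real part.\<close>

lemma (in prob_space) cgauss_indep:
  assumes X: "std_cgauss M X" and A [measurable]: "A \<in> sets borel" and B [measurable]: "B \<in> sets borel"
  shows "prob {\<omega> \<in> space M. Re (X \<omega>) \<in> A \<and> Im (X \<omega>) \<in> B} = prob {\<omega> \<in> space M. Re (X \<omega>) \<in> A} * prob {\<omega> \<in> space M. Im (X \<omega>) \<in> B}"
proof -
  have [measurable]: "X \<in> borel_measurable M" by (rule std_cgauss_measurable[OF X])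
  have [measurable]: "(\<lambda>\<omega>. Re (X \<omega>)) \<in> borel_measurable M" "(\<lambda>\<omega>. Im (X \<omega>)) \<in> borel_measurable M"
    by (rule Re_Im_measurable; measurable)+
  let ?R = "\<lambda>\<omega>. Re (X \<omega>)" and ?I = "\<lambda>\<omega>. Im (X \<omega>)"
  define \<phi> where "\<phi> = (\<lambda>a b::real. exp (- (a\<^sup>2 + b\<^sup>2) / 4))"
  have ch: "(LINT \<omega>|M. iexp (a * ?R \<omega> + b * ?I \<omega>)) = of_real (\<phi> a b)" for a b
    unfolding \<phi>_def by (rule cgauss_char[OF X])
  have ie: "integrable M (\<lambda>\<omega>. iexp (a * ?R \<omega> + b * ?I \<omega>))" for a b
    by (rule integrable_const_bound[where B = 1]) auto
  have cosw: "(LINT \<omega>|M. cos (b * ?I \<omega>) *\<^sub>R iexp (t * ?R \<omega>)) = of_real (\<phi> t b)" for t b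
  proof -
    have e: "cos (b * ?I \<omega>) *\<^sub>R iexp (t * ?R \<omega>) = (iexp (t * ?R \<omega> + b * ?I \<omega>) + iexp (t * ?R \<omega> + (- b) * ?I \<omega>)) / 2" for \<omega>
      by (simp add: complex_eq_iff Re_exp Im_exp cos_add sin_add cos_diff sin_diff algebra_simps)
    show ?thesis unfolding e using ie[of t b] ie[of t "- b"] ch[of t b] ch[of t "- b"] by (simp add: \<phi>_def)
  qed
  have sinw: "(LINT \<omega>|M. sin (b * ?I \<omega>) *\<^sub>R iexp (t * ?R \<omega>)) = 0" for t b
  proof -
    have e: "sin (b * ?I \<omega>) *\<^sub>R iexp (t * ?R \<omega>) = (iexp (t * ?R \<omega> + b * ?I \<omega>) - iexp (t * ?R \<omega> + (- b) * ?I \<omega>)) / (2 * \<i>)" for \<omega>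
      by (simp add: complex_eq_iff Re_exp Im_exp cos_add sin_add cos_diff sin_diff algebra_simps Re_divide Im_divide)
    show ?thesis unfolding e using ie[of t b] ie[of t "- b"] ch[of t b] ch[of t "- b"] by (simp add: \<phi>_def)
  qed
  have ci: "integrable M (\<lambda>\<omega>. cos (b * ?I \<omega>) *\<^sub>R iexp (t * ?R \<omega>))" "integrable M (\<lambda>\<omega>. sin (b * ?I \<omega>) *\<^sub>R iexp (t * ?R \<omega>))" for b t
    by (rule integrable_const_bound[where B = 1]; simp)+
  have cr: "integrable M (\<lambda>\<omega>. cos (b * ?I \<omega>))" "integrable M (\<lambda>\<omega>. sin (b * ?I \<omega>))" for b
    by (rule integrable_const_bound[where B = 1]; simp)+
  have Ec: "expectation (\<lambda>\<omega>. cos (b * ?I \<omega>)) = \<phi> 0 b" for b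
  proof -
    have "complex_of_real (expectation (\<lambda>\<omega>. cos (b * ?I \<omega>))) = of_real (\<phi> 0 b)"
      using cosw[of b 0] by (simp add: scaleR_conv_of_real)
    then show ?thesis by (simp only: of_real_eq_iff)
  qed
  have Es: "expectation (\<lambda>\<omega>. sin (b * ?I \<omega>)) = 0" for b
  proof -
    have "complex_of_real (expectation (\<lambda>\<omega>. sin (b * ?I \<omega>))) = 0"
      using sinw[of b 0] by (simp add: scaleR_conv_of_real)
    then show ?thesis by simp
  qed
  \<comment> \<open>This factorisation is the source of the independence.\<close>
  have split: "\<phi> t b = \<phi> t 0 * \<phi> 0 b" for t b by (simp add: \<phi>_def add_divide_distrib flip: exp_add)
  have iA: "integrable M (\<lambda>\<omega>. h \<omega> * indicator A (?R \<omega>))" if "h \<in> borel_measurable M" "\<And>\<omega>. \<bar>h \<omega>\<bar> \<le> 1" for h :: "'a \<Rightarrow> real"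
    using that by (intro integrable_const_bound[where B = 1]) (auto simp: indicator_def)
  let ?PA = "prob {\<omega> \<in> space M. ?R \<omega> \<in> A}"
  have PA: "expectation (\<lambda>\<omega>. indicat_real A (?R \<omega>)) = ?PA"
  proof -
    have "expectation (\<lambda>\<omega>. indicat_real A (?R \<omega>)) = expectation (indicator {\<omega> \<in> space M. ?R \<omega> \<in> A})"
      by (rule Bochner_Integration.integral_cong) (auto simp: indicator_def)
    then show ?thesis by simp
  qed
  have half: "1 + \<bar>x\<bar> / 2 \<le> 2" "0 \<le> 1 + x / 2" if "\<bar>x\<bar> \<le> 1" for x :: real using that by auto
  have cosA: "expectation (\<lambda>\<omega>. cos (b * ?I \<omega>) * indicator A (?R \<omega>)) = \<phi> 0 b * ?PA" for b
  proof -
    \<comment> \<open>The mean of the weight before normalisation. Half the cosine is added to 1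
      because a weight must be nonnegative.\<close>
    define z where "z = 1 + \<phi> 0 b / 2"
    have z: "z \<ge> 1" by (simp add: z_def \<phi>_def)
    define w where "w = (\<lambda>\<omega>. (1 + cos (b * ?I \<omega>) / 2) / z)"
    have wm [measurable]: "w \<in> borel_measurable M" unfolding w_def by measurable
    have "expectation (\<lambda>\<omega>. w \<omega> * indicator A (?R \<omega>)) = ?PA"
    proof (rule weighted_Levy_uniqueness[where C = 2])
      show "0 \<le> w \<omega>" for \<omega> unfolding w_def using z half(2)[of "cos (b * ?I \<omega>)"] by simp
      show "w \<omega> \<le> 2" for \<omega>
      proof -
        have "1 + cos (b * ?I \<omega>) / 2 \<le> 2 * z" using z cos_le_one[of "b * ?I \<omega>"] by linarith
        then show ?thesis unfolding w_def using z by (simp add: divide_le_eq)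
      qed
      show "expectation w = 1" unfolding w_def using z cr Ec[of b] by (simp add: prob_space z_def)
      show "(LINT \<omega>|M. w \<omega> *\<^sub>R iexp (t * ?R \<omega>)) = (LINT \<omega>|M. iexp (t * ?R \<omega>))" for t
      proof -
        have "(LINT \<omega>|M. w \<omega> *\<^sub>R iexp (t * ?R \<omega>)) = (LINT \<omega>|M. (iexp (t * ?R \<omega> + 0 * ?I \<omega>) + (cos (b * ?I \<omega>) *\<^sub>R iexp (t * ?R \<omega>)) / 2) / of_real z)"
          by (rule Bochner_Integration.integral_cong) (auto simp: w_def scaleR_conv_of_real algebra_simps add_divide_distrib)
        also have "\<dots> = (of_real (\<phi> t 0) + of_real (\<phi> t b) / 2) / of_real z"
          unfolding integral_divide_zero using ie[of t 0] ci[of b t] ch[of t 0] cosw[of b t] by simp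
        also have "\<dots> = of_real (\<phi> t 0 * (1 + \<phi> 0 b / 2) / z)" unfolding split[of t b] by (simp add: algebra_simps)
        also have "\<dots> = of_real (\<phi> t 0)" using z by (simp add: z_def)
        finally show ?thesis using ch[of t 0] by simp
      qed
    qed measurable
    moreover have "expectation (\<lambda>\<omega>. w \<omega> * indicator A (?R \<omega>)) = (?PA + expectation (\<lambda>\<omega>. cos (b * ?I \<omega>) * indicator A (?R \<omega>)) / 2) / z"
    proof -
      have "expectation (\<lambda>\<omega>. w \<omega> * indicator A (?R \<omega>)) = expectation (\<lambda>\<omega>. (1 * indicator A (?R \<omega>) + (cos (b * ?I \<omega>) * indicator A (?R \<omega>)) / 2) / z)"
        by (rule Bochner_Integration.integral_cong) (auto simp: w_def field_simps)
      also have "\<dots> = (?PA + expectation (\<lambda>\<omega>. cos (b * ?I \<omega>) * indicator A (?R \<omega>)) / 2) / z"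
        unfolding integral_divide_zero using iA[of "\<lambda>_. 1"] iA[of "\<lambda>\<omega>. cos (b * ?I \<omega>)"] PA by simp
      finally show ?thesis .
    qed
    ultimately show ?thesis using z by (simp add: z_def field_simps)
  qed
  have sinA: "expectation (\<lambda>\<omega>. sin (b * ?I \<omega>) * indicator A (?R \<omega>)) = 0" for b
  proof -
    define w where "w = (\<lambda>\<omega>. 1 + sin (b * ?I \<omega>) / 2)"
    have wm [measurable]: "w \<in> borel_measurable M" unfolding w_def by measurable
    have "expectation (\<lambda>\<omega>. w \<omega> * indicator A (?R \<omega>)) = ?PA"
    proof (rule weighted_Levy_uniqueness[where C = 2])
      show "0 \<le> w \<omega>" for \<omega> unfolding w_def using half(2)[of "sin (b * ?I \<omega>)"] by simp
      show "w \<omega> \<le> 2" for \<omega> unfolding w_def using sin_le_one[of "b * ?I \<omega>"] by linarith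
      show "expectation w = 1" unfolding w_def using cr Es[of b] by (simp add: prob_space)
      show "(LINT \<omega>|M. w \<omega> *\<^sub>R iexp (t * ?R \<omega>)) = (LINT \<omega>|M. iexp (t * ?R \<omega>))" for t
      proof -
        have "(LINT \<omega>|M. w \<omega> *\<^sub>R iexp (t * ?R \<omega>)) = (LINT \<omega>|M. iexp (t * ?R \<omega> + 0 * ?I \<omega>) + (sin (b * ?I \<omega>) *\<^sub>R iexp (t * ?R \<omega>)) / 2)"
          by (rule Bochner_Integration.integral_cong) (auto simp: w_def scaleR_conv_of_real algebra_simps)
        also have "\<dots> = (LINT \<omega>|M. iexp (t * ?R \<omega>))"
          using ie[of t 0] ci[of b t] sinw[of b t] by simp
        finally show ?thesis .
      qed
    qed measurable
    moreover have "expectation (\<lambda>\<omega>. w \<omega> * indicator A (?R \<omega>)) = ?PA + expectation (\<lambda>\<omega>. sin (b * ?I \<omega>) * indicator A (?R \<omega>)) / 2"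
    proof -
      have "expectation (\<lambda>\<omega>. w \<omega> * indicator A (?R \<omega>)) = expectation (\<lambda>\<omega>. 1 * indicator A (?R \<omega>) + (sin (b * ?I \<omega>) * indicator A (?R \<omega>)) / 2)"
        by (rule Bochner_Integration.integral_cong) (auto simp: w_def algebra_simps)
      then show ?thesis using iA[of "\<lambda>_. 1"] iA[of "\<lambda>\<omega>. sin (b * ?I \<omega>)"] PA by simp
    qed
    ultimately show ?thesis by simp
  qed
  show ?thesis
  proof (cases "?PA = 0")
    case True
    have "prob {\<omega> \<in> space M. ?R \<omega> \<in> A \<and> ?I \<omega> \<in> B} \<le> ?PA" by (rule finite_measure_mono) auto
    then show ?thesis using True measure_nonneg[of M] by (simp add: antisym)
  next
    case False
    then have P: "?PA > 0" using measure_nonneg[of M "{\<omega> \<in> space M. ?R \<omega> \<in> A}"] by linarith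
    \<comment> \<open>The density of conditioning on the real part being in \<open>A\<close>: the
      conditional law of the imaginary part is compared with the unconditional one.\<close>
    define w where "w = (\<lambda>\<omega>. indicator A (?R \<omega>) / ?PA)"
    have wm [measurable]: "w \<in> borel_measurable M" unfolding w_def by measurable
    have "expectation (\<lambda>\<omega>. w \<omega> * indicator B (?I \<omega>)) = prob {\<omega> \<in> space M. ?I \<omega> \<in> B}"
    proof (rule weighted_Levy_uniqueness[where C = "1 / ?PA"])
      show "0 \<le> w \<omega>" "w \<omega> \<le> 1 / ?PA" for \<omega> using P by (auto simp: w_def indicator_def)
      show "expectation w = 1" unfolding w_def using PA P by simp
      show "(LINT \<omega>|M. w \<omega> *\<^sub>R iexp (t * ?I \<omega>)) = (LINT \<omega>|M. iexp (t * ?I \<omega>))" for t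
      proof -
        have "(LINT \<omega>|M. w \<omega> *\<^sub>R iexp (t * ?I \<omega>)) = (LINT \<omega>|M. (of_real (cos (t * ?I \<omega>) * indicator A (?R \<omega>)) + \<i> * of_real (sin (t * ?I \<omega>) * indicator A (?R \<omega>))) / of_real ?PA)"
          by (rule Bochner_Integration.integral_cong) (auto simp: w_def complex_eq_iff Re_exp Im_exp indicator_def)
        also have "\<dots> = (of_real (\<phi> 0 t * ?PA) + \<i> * of_real 0) / of_real ?PA"
          unfolding integral_divide_zero
          using iA[of "\<lambda>\<omega>. cos (t * ?I \<omega>)"] iA[of "\<lambda>\<omega>. sin (t * ?I \<omega>)"] cosA[of t] sinA[of t]
          by (simp del: of_real_mult)
        also have "\<dots> = of_real (\<phi> 0 t)" using P by simp
        finally show ?thesis using ch[of 0 t] by simp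
      qed
    qed measurable
    moreover have "expectation (\<lambda>\<omega>. w \<omega> * indicator B (?I \<omega>)) = prob {\<omega> \<in> space M. ?R \<omega> \<in> A \<and> ?I \<omega> \<in> B} / ?PA"
    proof -
      have "expectation (\<lambda>\<omega>. w \<omega> * indicator B (?I \<omega>)) = expectation (\<lambda>\<omega>. indicator {\<omega> \<in> space M. ?R \<omega> \<in> A \<and> ?I \<omega> \<in> B} \<omega> / ?PA)"
        by (rule Bochner_Integration.integral_cong) (auto simp: w_def indicator_def)
      then show ?thesis by simp
    qed
    ultimately show ?thesis using P by (simp add: field_simps)
  qed
qed

section \<open>The law of a standard complex Gaussian and its symmetries\<close>

abbreviation (input) "NH \<equiv> density lborel (\<lambda>x. ennreal (normal_density 0 (sqrt (1/2)) x))"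

lemma prob_space_NH: "prob_space NH"
  by (rule prob_space_normal_density) simp

lemma cgauss_joint:
  assumes M: "prob_space M" and X: "std_cgauss M X"
  shows "distr M (borel \<Otimes>\<^sub>M borel) (\<lambda>\<omega>. (Re (X \<omega>), Im (X \<omega>))) = NH \<Otimes>\<^sub>M NH"
proof (rule pair_measure_eqI[symmetric])
  interpret prob_space M by fact
  interpret N: prob_space NH by (rule prob_space_NH)
  have [measurable]: "X \<in> borel_measurable M" by (rule std_cgauss_measurable[OF X])
  have [measurable]: "(\<lambda>\<omega>. Re (X \<omega>)) \<in> borel_measurable M" "(\<lambda>\<omega>. Im (X \<omega>)) \<in> borel_measurable M"
    by (rule Re_Im_measurable; measurable)+
  show "sigma_finite_measure NH" "sigma_finite_measure NH" by unfold_locales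
  show "sets (NH \<Otimes>\<^sub>M NH) = sets (distr M (borel \<Otimes>\<^sub>M borel) (\<lambda>\<omega>. (Re (X \<omega>), Im (X \<omega>))))"
    by (simp only: sets_distr) (rule sets_pair_measure_cong; simp)
  have DR: "distributed M lborel (\<lambda>\<omega>. Re (X \<omega>)) (normal_density 0 (sqrt (1/2)))"
    "distributed M lborel (\<lambda>\<omega>. Im (X \<omega>)) (normal_density 0 (sqrt (1/2)))"
  proof -
    have "distributed M lborel (\<lambda>\<omega>. 1 * Re (X \<omega>) + 0 * Im (X \<omega>)) (normal_density 0 (sqrt ((1\<^sup>2 + 0\<^sup>2) / 2)))"
      "distributed M lborel (\<lambda>\<omega>. 0 * Re (X \<omega>) + 1 * Im (X \<omega>)) (normal_density 0 (sqrt ((0\<^sup>2 + 1\<^sup>2) / 2)))"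
      using X[unfolded std_cgauss_def, THEN conjunct2, rule_format, of 1 0]
        X[unfolded std_cgauss_def, THEN conjunct2, rule_format, of 0 1] by simp_all
    then show "distributed M lborel (\<lambda>\<omega>. Re (X \<omega>)) (normal_density 0 (sqrt (1/2)))"
      "distributed M lborel (\<lambda>\<omega>. Im (X \<omega>)) (normal_density 0 (sqrt (1/2)))" by simp_all
  qed
  have law: "emeasure NH A = ennreal (prob {\<omega> \<in> space M. Y \<omega> \<in> A})"
    if "distributed M lborel Y (normal_density 0 (sqrt (1/2)))" and A: "A \<in> sets borel" for Y A
  proof -
    have [measurable]: "Y \<in> measurable M lborel" by (rule distributed_measurable[OF that(1)])
    have "emeasure NH A = emeasure (distr M lborel Y) A" by (simp only: distributed_distr_eq_density[OF that(1)])
    also have "\<dots> = emeasure M (Y -` A \<inter> space M)" by (rule emeasure_distr) (use A distributed_measurable[OF that(1)] in auto)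
    also have "Y -` A \<inter> space M = {\<omega> \<in> space M. Y \<omega> \<in> A}" by auto
    finally show ?thesis by (simp add: emeasure_eq_measure)
  qed
  show "emeasure NH A * emeasure NH B = emeasure (distr M (borel \<Otimes>\<^sub>M borel) (\<lambda>\<omega>. (Re (X \<omega>), Im (X \<omega>)))) (A \<times> B)"
    if "A \<in> sets NH" "B \<in> sets NH" for A B
  proof -
    have AB [measurable]: "A \<in> sets borel" "B \<in> sets borel" using that by auto
    have "emeasure (distr M (borel \<Otimes>\<^sub>M borel) (\<lambda>\<omega>. (Re (X \<omega>), Im (X \<omega>)))) (A \<times> B) = emeasure M ((\<lambda>\<omega>. (Re (X \<omega>), Im (X \<omega>))) -` (A \<times> B) \<inter> space M)"
      by (rule emeasure_distr) auto
    also have "(\<lambda>\<omega>. (Re (X \<omega>), Im (X \<omega>))) -` (A \<times> B) \<inter> space M = {\<omega> \<in> space M. Re (X \<omega>) \<in> A \<and> Im (X \<omega>) \<in> B}" by auto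
    also have "emeasure M \<dots> = ennreal (prob {\<omega> \<in> space M. Re (X \<omega>) \<in> A} * prob {\<omega> \<in> space M. Im (X \<omega>) \<in> B})"
      by (simp add: emeasure_eq_measure cgauss_indep[OF X AB])
    also have "\<dots> = emeasure NH A * emeasure NH B"
      by (simp add: law[OF DR(1) AB(1)] law[OF DR(2) AB(2)] ennreal_mult)
    finally show ?thesis by simp
  qed
qed

definition CG :: "complex measure" where
  "CG = distr (NH \<Otimes>\<^sub>M NH) borel (\<lambda>(x, y). Complex x y)"

lemma Complex_measurable: "(\<lambda>(x, y). Complex x y) \<in> borel_measurable (borel \<Otimes>\<^sub>M borel)"
proof -
  have "(\<lambda>z. of_real (fst z) + \<i> * of_real (snd z)) \<in> borel_measurable (borel \<Otimes>\<^sub>M borel)" by measurable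
  then show ?thesis by (simp add: Complex_eq case_prod_beta')
qed

text \<open>The joint law of the two coordinates is a product of fixed normal laws, so neither the
  variable nor its probability space matters. A variable is compared with its rotations in this
  way.\<close>

lemma cgauss_distr:
  assumes M: "prob_space M" and X: "std_cgauss M X"
  shows "distr M borel X = CG"
proof -
  have [measurable]: "X \<in> borel_measurable M" by (rule std_cgauss_measurable[OF X])
  have [measurable]: "(\<lambda>\<omega>. Re (X \<omega>)) \<in> borel_measurable M" "(\<lambda>\<omega>. Im (X \<omega>)) \<in> borel_measurable M"
    by (rule Re_Im_measurable; measurable)+
  have "CG = distr (distr M (borel \<Otimes>\<^sub>M borel) (\<lambda>\<omega>. (Re (X \<omega>), Im (X \<omega>)))) borel (\<lambda>(x, y). Complex x y)"
    unfolding CG_def cgauss_joint[OF M X] ..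
  also have "\<dots> = distr M borel ((\<lambda>(x, y). Complex x y) \<circ> (\<lambda>\<omega>. (Re (X \<omega>), Im (X \<omega>))))"
    by (rule distr_distr[OF Complex_measurable]) measurable
  also have "\<dots> = distr M borel X" by (simp add: o_def)
  finally show ?thesis by simp
qed

text \<open>A linear form of the rotated variable is a rotated linear form of the original one, with
  the same norm.\<close>

lemma cgauss_rotate:
  assumes X: "std_cgauss M X" shows "std_cgauss M (\<lambda>\<omega>. cis \<alpha> * X \<omega>)"
  unfolding std_cgauss_def
proof (intro conjI allI impI)
  have [measurable]: "X \<in> borel_measurable M" by (rule std_cgauss_measurable[OF X])
  show "(\<lambda>\<omega>. cis \<alpha> * X \<omega>) \<in> borel_measurable M" by measurable
  fix a b :: real assume ab: "(a, b) \<noteq> (0, 0)"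
  let ?a = "a * cos \<alpha> + b * sin \<alpha>" and ?b = "b * cos \<alpha> - a * sin \<alpha>"
  have n: "?a\<^sup>2 + ?b\<^sup>2 = a\<^sup>2 + b\<^sup>2"
  proof -
    have "?a\<^sup>2 + ?b\<^sup>2 = (a\<^sup>2 + b\<^sup>2) * ((sin \<alpha>)\<^sup>2 + (cos \<alpha>)\<^sup>2)" by algebra
    then show ?thesis by simp
  qed
  then have nz: "(?a, ?b) \<noteq> (0, 0)" using ab sum_power2_eq_zero_iff[of a b] sum_power2_eq_zero_iff[of ?a ?b] by auto
  have e: "a * Re (cis \<alpha> * X \<omega>) + b * Im (cis \<alpha> * X \<omega>) = ?a * Re (X \<omega>) + ?b * Im (X \<omega>)" for \<omega>
    by (simp add: algebra_simps)
  have "distributed M lborel (\<lambda>\<omega>. ?a * Re (X \<omega>) + ?b * Im (X \<omega>)) (normal_density 0 (sqrt ((?a\<^sup>2 + ?b\<^sup>2) / 2)))"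
    using X nz unfolding std_cgauss_def by blast
  then show "distributed M lborel (\<lambda>\<omega>. a * Re (cis \<alpha> * X \<omega>) + b * Im (cis \<alpha> * X \<omega>)) (normal_density 0 (sqrt ((a\<^sup>2 + b\<^sup>2) / 2)))"
    unfolding e n .
qed

lemma cgauss_transfer:
  assumes X: "std_cgauss M X" and Z [measurable]: "Z \<in> borel_measurable M" and eq: "distr M borel Z = distr M borel X"
  shows "std_cgauss M Z"
  unfolding std_cgauss_def
proof (intro conjI allI impI Z)
  have [measurable]: "X \<in> borel_measurable M" by (rule std_cgauss_measurable[OF X])
  fix a b :: real assume ab: "(a, b) \<noteq> (0, 0)"
  let ?f = "\<lambda>z. a * Re z + b * Im z"
  have f [measurable]: "?f \<in> borel_measurable borel" by (rule borel_measurable_continuous_onI) (intro continuous_intros)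
  have D: "distributed M lborel (\<lambda>\<omega>. ?f (X \<omega>)) (normal_density 0 (sqrt ((a\<^sup>2 + b\<^sup>2) / 2)))"
    using X ab unfolding std_cgauss_def by blast
  have "distr M lborel (\<lambda>\<omega>. ?f (Z \<omega>)) = distr (distr M borel Z) lborel ?f"
    by (subst distr_distr) (auto simp: o_def)
  also have "\<dots> = distr M lborel (\<lambda>\<omega>. ?f (X \<omega>))"
    unfolding eq by (subst distr_distr) (auto simp: o_def)
  also have "\<dots> = density lborel (normal_density 0 (sqrt ((a\<^sup>2 + b\<^sup>2) / 2)))" by (rule distributed_distr_eq_density[OF D])
  finally show "distributed M lborel (\<lambda>\<omega>. ?f (Z \<omega>)) (normal_density 0 (sqrt ((a\<^sup>2 + b\<^sup>2) / 2)))"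
    unfolding distributed_def by auto
qed

lemma nn_integral_circle_shift:
  fixes F :: "real \<Rightarrow> ennreal"
  assumes [measurable]: "F \<in> borel_measurable borel" and per: "\<And>x. F (x + 2 * pi) = F x"
  shows "(\<integral>\<^sup>+\<alpha>. F (\<alpha> + \<psi>) \<partial>CM) = (\<integral>\<^sup>+\<alpha>. F \<alpha> \<partial>CM)"
proof -
  have perz: "F (x + 2 * pi * of_int n) = F x" for x n
    by (rule periodic_shift_int) (simp add: periodic_def per)
  define n where "n = \<lfloor>\<psi> / (2 * pi)\<rfloor>"
  \<comment> \<open>The shift is reduced to less than one turn, so that only the part beyond 2 pi
    has to be moved back, by a single period.\<close>
  define \<theta> where "\<theta> = \<psi> - 2 * pi * of_int n"
  have th: "0 \<le> \<theta>" "\<theta> < 2 * pi"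
  proof -
    have "of_int n \<le> \<psi> / (2 * pi)" "\<psi> / (2 * pi) < of_int n + 1" unfolding n_def by linarith+
    then show "0 \<le> \<theta>" "\<theta> < 2 * pi" by (simp_all add: \<theta>_def field_simps)
  qed
  have 1: "F (\<alpha> + \<psi>) = F (\<alpha> + \<theta>)" for \<alpha>
    using perz[of "\<alpha> + \<theta>" n] by (simp add: \<theta>_def algebra_simps)
  have cm: "(\<integral>\<^sup>+\<alpha>. G \<alpha> \<partial>CM) = (\<integral>\<^sup>+\<alpha>. G \<alpha> * indicator {0..<2*pi} \<alpha> \<partial>lborel)" for G :: "real \<Rightarrow> ennreal"
    unfolding circle_measure_def by (rule nn_integral_restrict_space) auto
  have "(\<integral>\<^sup>+\<alpha>. F (\<alpha> + \<theta>) \<partial>CM) = (\<integral>\<^sup>+\<alpha>. F (\<theta> + 1 * \<alpha>) * indicator {\<theta>..<\<theta> + 2*pi} (\<theta> + 1 * \<alpha>) \<partial>lborel)"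
    unfolding cm by (rule nn_integral_cong) (auto simp: indicator_def add.commute)
  also have "\<dots> = (\<integral>\<^sup>+x. F x * indicator {\<theta>..<\<theta> + 2*pi} x \<partial>lborel)"
    using nn_integral_real_affine[of "\<lambda>x. F x * indicator {\<theta>..<\<theta> + 2*pi} x" 1 \<theta>] by simp
  also have "\<dots> = (\<integral>\<^sup>+x. F x * indicator {\<theta>..<2*pi} x + F x * indicator {2*pi..<\<theta> + 2*pi} x \<partial>lborel)"
    by (rule nn_integral_cong) (use th in \<open>auto simp: indicator_def\<close>)
  also have "\<dots> = (\<integral>\<^sup>+x. F x * indicator {\<theta>..<2*pi} x \<partial>lborel) + (\<integral>\<^sup>+x. F x * indicator {2*pi..<\<theta> + 2*pi} x \<partial>lborel)"
    by (rule nn_integral_add) auto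
  also have "(\<integral>\<^sup>+x. F x * indicator {2*pi..<\<theta> + 2*pi} x \<partial>lborel) = (\<integral>\<^sup>+x. F (2 * pi + 1 * x) * indicator {2*pi..<\<theta> + 2*pi} (2 * pi + 1 * x) \<partial>lborel)"
    using nn_integral_real_affine[of "\<lambda>x. F x * indicator {2*pi..<\<theta> + 2*pi} x" 1 "2 * pi"] by simp
  also have "\<dots> = (\<integral>\<^sup>+x. F x * indicator {0..<\<theta>} x \<partial>lborel)"
    by (rule nn_integral_cong) (use per in \<open>auto simp: indicator_def add.commute\<close>)
  also have "(\<integral>\<^sup>+x. F x * indicator {\<theta>..<2*pi} x \<partial>lborel) + \<dots> = (\<integral>\<^sup>+x. F x * indicator {\<theta>..<2*pi} x + F x * indicator {0..<\<theta>} x \<partial>lborel)"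
    by (rule nn_integral_add[symmetric]) auto
  also have "\<dots> = (\<integral>\<^sup>+x. F x \<partial>CM)"
    unfolding cm by (rule nn_integral_cong) (use th in \<open>auto simp: indicator_def\<close>)
  finally show ?thesis unfolding 1 .
qed

text \<open>Average the rotation invariance over all constant angles.\<close>

lemma cgauss_twist:
  assumes M: "prob_space M" and X: "std_cgauss M X" and \<psi> [measurable]: "\<psi> \<in> borel_measurable borel"
  shows "std_cgauss M (\<lambda>\<omega>. X \<omega> * cis (\<psi> (cmod (X \<omega>))))"
proof (rule cgauss_transfer[OF X])
  interpret prob_space M by fact
  interpret P: pair_sigma_finite M CM by unfold_locales
  have Xm [measurable]: "X \<in> borel_measurable M" by (rule std_cgauss_measurable[OF X])
  have cism [measurable]: "cis \<in> borel_measurable borel"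
    by (rule borel_measurable_continuous_onI) (intro continuous_intros)
  define \<beta> where "\<beta> = (\<lambda>z. z * cis (\<psi> (cmod z)))"
  have \<beta>m [measurable]: "\<beta> \<in> borel_measurable borel" unfolding \<beta>_def by measurable
  show Zm: "(\<lambda>\<omega>. X \<omega> * cis (\<psi> (cmod (X \<omega>)))) \<in> borel_measurable M" by measurable
  have idm: "(\<lambda>\<alpha>. \<alpha>) \<in> borel_measurable CM" by (rule borel_measurable_CM) simp
  show "distr M borel (\<lambda>\<omega>. X \<omega> * cis (\<psi> (cmod (X \<omega>)))) = distr M borel X"
  proof (rule measure_eqI)
    fix B assume "B \<in> sets (distr M borel (\<lambda>\<omega>. X \<omega> * cis (\<psi> (cmod (X \<omega>)))))"
    then have B [measurable]: "B \<in> sets borel" by simp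
    let ?I = "indicator B :: complex \<Rightarrow> ennreal"
    have rot: "(\<integral>\<^sup>+\<omega>. ?I (f (cis \<alpha> * X \<omega>)) \<partial>M) = (\<integral>\<^sup>+\<omega>. ?I (f (X \<omega>)) \<partial>M)" if [measurable]: "f \<in> borel_measurable borel" for f \<alpha>
    proof -
      have "(\<integral>\<^sup>+\<omega>. ?I (f (cis \<alpha> * X \<omega>)) \<partial>M) = (\<integral>\<^sup>+z. ?I (f z) \<partial>distr M borel (\<lambda>\<omega>. cis \<alpha> * X \<omega>))"
        by (subst nn_integral_distr) auto
      also have "\<dots> = (\<integral>\<^sup>+z. ?I (f z) \<partial>distr M borel X)"
        unfolding cgauss_distr[OF M X] cgauss_distr[OF M cgauss_rotate[OF X]] ..
      also have "\<dots> = (\<integral>\<^sup>+\<omega>. ?I (f (X \<omega>)) \<partial>M)" by (subst nn_integral_distr) auto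
      finally show ?thesis .
    qed
    have mm: "(\<lambda>(\<omega>, \<alpha>). ?I (cis \<alpha> * f (X \<omega>))) \<in> borel_measurable (M \<Otimes>\<^sub>M CM)" if [measurable]: "f \<in> borel_measurable borel" for f
    proof -
      have [measurable]: "(\<lambda>z. snd z) \<in> borel_measurable (M \<Otimes>\<^sub>M CM)" by (rule measurable_compose[OF measurable_snd idm])
      show ?thesis unfolding case_prod_beta' by measurable
    qed
    have av: "(\<integral>\<^sup>+\<alpha>. \<integral>\<^sup>+\<omega>. ?I (cis \<alpha> * f (X \<omega>)) \<partial>M \<partial>CM) = (\<integral>\<^sup>+\<omega>. \<integral>\<^sup>+\<alpha>. ?I (cis \<alpha> * f (X \<omega>)) \<partial>CM \<partial>M)" if "f \<in> borel_measurable borel" for f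
      using P.Fubini'[OF mm[OF that]] by simp
    \<comment> \<open>The twist depends on the modulus alone and therefore commutes with rotations.
      At a fixed outcome it then acts as a shift of the rotation angle, which the integral over the
      circle does not see.\<close>
    have b: "\<beta> (cis \<alpha> * z) = cis \<alpha> * \<beta> z" for \<alpha> z by (simp add: \<beta>_def norm_mult mult_ac)
    have "(\<integral>\<^sup>+\<alpha>. \<integral>\<^sup>+\<omega>. ?I (\<beta> (X \<omega>)) \<partial>M \<partial>CM) = (\<integral>\<^sup>+\<alpha>. \<integral>\<^sup>+\<omega>. ?I (cis \<alpha> * \<beta> (X \<omega>)) \<partial>M \<partial>CM)"
      using rot[OF \<beta>m] by (simp add: b)
    also have "\<dots> = (\<integral>\<^sup>+\<omega>. \<integral>\<^sup>+\<alpha>. ?I (cis \<alpha> * \<beta> (X \<omega>)) \<partial>CM \<partial>M)" by (rule av) simp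
    also have "\<dots> = (\<integral>\<^sup>+\<omega>. \<integral>\<^sup>+\<alpha>. ?I (cis \<alpha> * X \<omega>) \<partial>CM \<partial>M)"
    proof (rule nn_integral_cong)
      fix \<omega>
      have "cis (x + 2 * pi) = cis x" for x by (simp add: complex_eq_iff)
      then have "(\<integral>\<^sup>+\<alpha>. ?I (cis (\<alpha> + \<psi> (cmod (X \<omega>))) * X \<omega>) \<partial>CM) = (\<integral>\<^sup>+\<alpha>. ?I (cis \<alpha> * X \<omega>) \<partial>CM)"
        by (intro nn_integral_circle_shift[of "\<lambda>\<alpha>. ?I (cis \<alpha> * X \<omega>)"]) auto
      then show "(\<integral>\<^sup>+\<alpha>. ?I (cis \<alpha> * \<beta> (X \<omega>)) \<partial>CM) = (\<integral>\<^sup>+\<alpha>. ?I (cis \<alpha> * X \<omega>) \<partial>CM)"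
        by (simp add: \<beta>_def cis_mult[symmetric] mult_ac)
    qed
    also have "\<dots> = (\<integral>\<^sup>+\<alpha>. \<integral>\<^sup>+\<omega>. ?I (cis \<alpha> * X \<omega>) \<partial>M \<partial>CM)" using av[of "\<lambda>z. z"] by simp
    also have "\<dots> = (\<integral>\<^sup>+\<alpha>. \<integral>\<^sup>+\<omega>. ?I (X \<omega>) \<partial>M \<partial>CM)" using rot[of "\<lambda>z. z"] by simp
    finally have E: "(\<integral>\<^sup>+\<omega>. ?I (\<beta> (X \<omega>)) \<partial>M) * emeasure CM (space CM) = (\<integral>\<^sup>+\<omega>. ?I (X \<omega>) \<partial>M) * emeasure CM (space CM)"
      by (simp del: space_CM)
    have eq: "(\<integral>\<^sup>+\<omega>. ?I (\<beta> (X \<omega>)) \<partial>M) = (\<integral>\<^sup>+\<omega>. ?I (X \<omega>) \<partial>M)"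
    proof -
      have c: "x * ennreal (2 * pi) * ennreal (1 / (2 * pi)) = x" for x
        by (simp add: mult.assoc flip: ennreal_mult)
      show ?thesis using arg_cong[OF E, of "\<lambda>x. x * ennreal (1 / (2 * pi))"] unfolding emeasure_CM c .
    qed
    have "emeasure (distr M borel (\<lambda>\<omega>. X \<omega> * cis (\<psi> (cmod (X \<omega>))))) B = (\<integral>\<^sup>+z. ?I z \<partial>distr M borel (\<lambda>\<omega>. X \<omega> * cis (\<psi> (cmod (X \<omega>)))))" by simp
    also have "\<dots> = (\<integral>\<^sup>+\<omega>. ?I (\<beta> (X \<omega>)) \<partial>M)" unfolding \<beta>_def by (rule nn_integral_distr[OF Zm]) simp
    also have "\<dots> = (\<integral>\<^sup>+z. ?I z \<partial>distr M borel X)" unfolding eq by (rule nn_integral_distr[OF Xm, symmetric]) simp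
    finally show "emeasure (distr M borel (\<lambda>\<omega>. X \<omega> * cis (\<psi> (cmod (X \<omega>))))) B = emeasure (distr M borel X) B" by simp
  qed simp
qed

text \<open>Each coordinate contributes the factor (1 - a)^(-1/2), from a Gaussian integral with
  variance 1 / (2 (1 - a)); a = 1 is the threshold of integrability.\<close>

lemma cgauss_exp_square:
  assumes a: "0 < a" "a < 1"
  shows "\<exists>K\<ge>1. \<forall>M X. prob_space M \<longrightarrow> std_cgauss M X \<longrightarrow> (\<integral>\<^sup>+\<omega>. ennreal (exp (a * (cmod (X \<omega>))\<^sup>2)) \<partial>M) = ennreal K"
proof -
  define G where "G = (\<integral>\<^sup>+x. ennreal (exp (a * x\<^sup>2)) \<partial>NH)"
  interpret N: prob_space NH by (rule prob_space_NH)
  interpret NN: pair_prob_space NH NH ..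
  define \<sigma> where "\<sigma> = sqrt (1 / (2 * (1 - a)))"
  have \<sigma>: "\<sigma> > 0" "\<sigma>\<^sup>2 = 1 / (2 * (1 - a))" using a by (auto simp: \<sigma>_def)
  have d: "normal_density 0 (sqrt (1/2)) x * exp (a * x\<^sup>2) = sqrt (1 / (1 - a)) * normal_density 0 \<sigma> x" for x
  proof -
    have e: "exp (- x\<^sup>2) * exp (a * x\<^sup>2) = exp (- x\<^sup>2 / (2 * \<sigma>\<^sup>2))"
      unfolding \<sigma> using a by (simp add: algebra_simps flip: exp_add)
    have "normal_density 0 (sqrt (1/2)) x * exp (a * x\<^sup>2) = 1 / sqrt pi * (exp (- x\<^sup>2) * exp (a * x\<^sup>2))"
      by (simp add: normal_density_def)
    also have "1 / sqrt pi = sqrt (1 / (1 - a)) * (1 / sqrt (2 * pi * \<sigma>\<^sup>2))"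
    proof -
      have "2 * pi * \<sigma>\<^sup>2 = pi / (1 - a)" unfolding \<sigma> using a by (simp add: field_simps)
      then show ?thesis using a by (simp add: real_sqrt_divide)
    qed
    finally show ?thesis unfolding e by (simp add: normal_density_def)
  qed
  have "G = (\<integral>\<^sup>+x. ennreal (normal_density 0 (sqrt (1/2)) x) * ennreal (exp (a * x\<^sup>2)) \<partial>lborel)"
    unfolding G_def by (rule nn_integral_density) auto
  also have "\<dots> = (\<integral>\<^sup>+x. ennreal (sqrt (1 / (1 - a))) * ennreal (normal_density 0 \<sigma> x) \<partial>lborel)"
    using a by (simp add: d ennreal_mult[symmetric])
  also have "\<dots> = ennreal (sqrt (1 / (1 - a))) * (\<integral>\<^sup>+x. ennreal (normal_density 0 \<sigma> x) \<partial>lborel)" by (rule nn_integral_cmult) simp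
  also have "(\<integral>\<^sup>+x. ennreal (normal_density 0 \<sigma> x) \<partial>lborel) = 1"
    using \<sigma> by (simp add: nn_integral_eq_integral)
  finally have G: "G = ennreal (sqrt (1 / (1 - a)))" by simp
  have "(\<integral>\<^sup>+\<omega>. ennreal (exp (a * (cmod (X \<omega>))\<^sup>2)) \<partial>M) = ennreal (1 / (1 - a))" if M: "prob_space M" and X: "std_cgauss M X" for M X
  proof -
    have [measurable]: "X \<in> borel_measurable M" by (rule std_cgauss_measurable[OF X])
    have [measurable]: "(\<lambda>\<omega>. Re (X \<omega>)) \<in> borel_measurable M" "(\<lambda>\<omega>. Im (X \<omega>)) \<in> borel_measurable M"
      by (rule Re_Im_measurable; measurable)+
    have "(\<integral>\<^sup>+\<omega>. ennreal (exp (a * (cmod (X \<omega>))\<^sup>2)) \<partial>M) = (\<integral>\<^sup>+\<omega>. (\<lambda>(x, y). ennreal (exp (a * x\<^sup>2)) * ennreal (exp (a * y\<^sup>2))) (Re (X \<omega>), Im (X \<omega>)) \<partial>M)"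
      by (simp add: cmod_power2 distrib_left exp_add ennreal_mult)
    also have "\<dots> = (\<integral>\<^sup>+z. (\<lambda>(x, y). ennreal (exp (a * x\<^sup>2)) * ennreal (exp (a * y\<^sup>2))) z \<partial>distr M (borel \<Otimes>\<^sub>M borel) (\<lambda>\<omega>. (Re (X \<omega>), Im (X \<omega>))))"
      by (rule nn_integral_distr[symmetric]) measurable
    also have "\<dots> = (\<integral>\<^sup>+x. \<integral>\<^sup>+y. ennreal (exp (a * x\<^sup>2)) * ennreal (exp (a * y\<^sup>2)) \<partial>NH \<partial>NH)"
      unfolding cgauss_joint[OF M X] by (subst N.nn_integral_fst[symmetric]) auto
    also have "\<dots> = G * G"
      unfolding G_def by (simp add: nn_integral_cmult nn_integral_multc)
    also have "\<dots> = ennreal (1 / (1 - a))" unfolding G using a by (simp flip: ennreal_mult)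
    finally show ?thesis .
  qed
  moreover have "1 / (1 - a) \<ge> 1" using a by simp
  ultimately show ?thesis by blast
qed

text \<open>A constant factor per mode would be lost infinitely often in a product over all
  frequencies, so it is absorbed into an exponent linear in \<theta>, which summable weights can pay
  for. For \<theta> \<ge> 1 the constant \<open>K\<close> is absorbed directly; for smaller \<theta>
  convexity of the exponential is used. The coefficient of \<theta>^2 approaches 1/4 as
  \<open>a\<close> tends to 1.\<close>

lemma cgauss_exp_moment:
  assumes a: "0 < a" "a < 1"
  shows "\<exists>C\<ge>0. \<forall>(M :: 'a measure) X \<theta>. prob_space M \<longrightarrow> std_cgauss M X \<longrightarrow> \<theta> \<ge> 0 \<longrightarrow>
    (\<integral>\<^sup>+\<omega>. ennreal (exp (\<theta> * cmod (X \<omega>))) \<partial>M) \<le> ennreal (exp (C * \<theta> + \<theta>\<^sup>2 / (4 * a)))"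
proof -
  obtain K where K: "K \<ge> 1" "\<And>(M :: 'a measure) X. prob_space M \<Longrightarrow> std_cgauss M X \<Longrightarrow> (\<integral>\<^sup>+\<omega>. ennreal (exp (a * (cmod (X \<omega>))\<^sup>2)) \<partial>M) = ennreal K"
    using cgauss_exp_square[OF a] by blast
  \<comment> \<open>This value bounds the mean of the exponential of the modulus and is at least
    \<open>K\<close>, so it serves both ranges of \<theta>.\<close>
  define C where "C = K * exp (1 / (4 * a))"
  have C: "C \<ge> K" unfolding C_def using K a mult_left_mono[of 1 "exp (1 / (4 * a))" K] by simp
  have young: "\<theta> * r \<le> \<theta>\<^sup>2 / (4 * a) + a * r\<^sup>2" for \<theta> r :: real
  proof -
    have "0 \<le> (\<theta> - 2 * a * r)\<^sup>2 / (4 * a)" using a by simp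
    also have "\<dots> = \<theta>\<^sup>2 / (4 * a) + a * r\<^sup>2 - \<theta> * r" using a by (simp add: power2_eq_square field_simps)
    finally show ?thesis by simp
  qed
  have "(\<integral>\<^sup>+\<omega>. ennreal (exp (\<theta> * cmod (X \<omega>))) \<partial>M) \<le> ennreal (exp (C * \<theta> + \<theta>\<^sup>2 / (4 * a)))"
    if M: "prob_space M" and X: "std_cgauss M X" and \<theta>: "\<theta> \<ge> 0" for M :: "'a measure" and X \<theta>
  proof -
    interpret prob_space M by fact
    have [measurable]: "X \<in> borel_measurable M" by (rule std_cgauss_measurable[OF X])
    have E: "(\<integral>\<^sup>+\<omega>. ennreal (exp (t * cmod (X \<omega>))) \<partial>M) \<le> ennreal (K * exp (t\<^sup>2 / (4 * a)))" for t
    proof -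
      have "(\<integral>\<^sup>+\<omega>. ennreal (exp (t * cmod (X \<omega>))) \<partial>M) \<le> (\<integral>\<^sup>+\<omega>. ennreal (exp (t\<^sup>2 / (4 * a))) * ennreal (exp (a * (cmod (X \<omega>))\<^sup>2)) \<partial>M)"
        by (rule nn_integral_mono) (simp add: young flip: ennreal_mult exp_add)
      also have "\<dots> = ennreal (exp (t\<^sup>2 / (4 * a))) * ennreal K"
        by (subst nn_integral_cmult) (auto simp: K(2)[OF M X])
      also have "\<dots> = ennreal (K * exp (t\<^sup>2 / (4 * a)))" using K(1) by (simp add: mult.commute flip: ennreal_mult)
      finally show ?thesis .
    qed
    show ?thesis
    proof (cases "\<theta> \<ge> 1")
      case True
      have "K \<le> exp (C * \<theta>)"
      proof -
        have "K \<le> 1 + C * \<theta>" using C K(1) mult_left_mono[OF True, of C] by linarith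
        also have "\<dots> \<le> exp (C * \<theta>)" by (rule exp_ge_add_one_self)
        finally show ?thesis .
      qed
      then have "K * exp (\<theta>\<^sup>2 / (4 * a)) \<le> exp (C * \<theta> + \<theta>\<^sup>2 / (4 * a))" by (simp add: exp_add mult_right_mono)
      then show ?thesis using E[of \<theta>] by (meson ennreal_leI order_trans)
    next
      case False
      have cv: "exp (\<theta> * r) \<le> 1 + \<theta> * exp r" if "r \<ge> 0" for r
      proof -
        have "exp ((1 - \<theta>) *\<^sub>R 0 + \<theta> *\<^sub>R r) \<le> (1 - \<theta>) * exp 0 + \<theta> * exp r"
          by (rule convex_onD[OF exp_convex]) (use \<theta> False in auto)
        then show ?thesis using \<theta> by simp
      qed
      have "(\<integral>\<^sup>+\<omega>. ennreal (exp (\<theta> * cmod (X \<omega>))) \<partial>M) \<le> (\<integral>\<^sup>+\<omega>. 1 + ennreal \<theta> * ennreal (exp (1 * cmod (X \<omega>))) \<partial>M)"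
      proof (rule nn_integral_mono)
        fix \<omega>
        have "ennreal (exp (\<theta> * cmod (X \<omega>))) \<le> ennreal (1 + \<theta> * exp (cmod (X \<omega>)))" by (rule ennreal_leI[OF cv]) simp
        then show "ennreal (exp (\<theta> * cmod (X \<omega>))) \<le> 1 + ennreal \<theta> * ennreal (exp (1 * cmod (X \<omega>)))"
          using \<theta> by (simp add: ennreal_plus ennreal_mult)
      qed
      also have "\<dots> = 1 + ennreal \<theta> * (\<integral>\<^sup>+\<omega>. ennreal (exp (1 * cmod (X \<omega>))) \<partial>M)"
        by (subst nn_integral_add) (auto simp: nn_integral_cmult emeasure_space_1)
      also have "\<dots> \<le> 1 + ennreal \<theta> * ennreal (K * exp (1\<^sup>2 / (4 * a)))" by (intro add_left_mono mult_left_mono E) simp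
      also have "\<dots> = ennreal (1 + \<theta> * C)" using \<theta> K(1) by (simp add: C_def ennreal_plus ennreal_mult)
      also have "\<dots> \<le> ennreal (exp (C * \<theta> + \<theta>\<^sup>2 / (4 * a)))"
      proof (rule ennreal_leI)
        have "1 + \<theta> * C \<le> exp (C * \<theta>)" using exp_ge_add_one_self[of "C * \<theta>"] by (simp add: mult.commute)
        also have "\<dots> \<le> exp (C * \<theta> + \<theta>\<^sup>2 / (4 * a))" using a by simp
        finally show "1 + \<theta> * C \<le> exp (C * \<theta> + \<theta>\<^sup>2 / (4 * a))" .
      qed
      finally show ?thesis .
    qed
  qed
  moreover have "C \<ge> 0" using C K(1) by simp
  ultimately show ?thesis by blast
qed

section \<open>Tails of weighted sums\<close>

text \<open>The constant is independent of the variable and of \<theta>, so that one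
  \<open>C\<close> serves all modes and all Chernoff parameters.\<close>

definition exp_moment_bound :: "'a measure \<Rightarrow> real \<Rightarrow> real \<Rightarrow> bool" where
  "exp_moment_bound M a C \<longleftrightarrow> (\<forall>X \<theta>. std_cgauss M X \<longrightarrow> \<theta> \<ge> 0 \<longrightarrow>
     (\<integral>\<^sup>+\<omega>. ennreal (exp (\<theta> * cmod (X \<omega>))) \<partial>M) \<le> ennreal (exp (C * \<theta> + \<theta>\<^sup>2 / (4 * a))))"

lemma (in prob_space) exp_moment_boundI:
  assumes "0 < a" "a < 1" shows "\<exists>C\<ge>0. exp_moment_bound M a C"
proof -
  obtain C where "C \<ge> 0" "\<forall>(M' :: 'a measure) X \<theta>. prob_space M' \<longrightarrow> std_cgauss M' X \<longrightarrow> \<theta> \<ge> 0 \<longrightarrow>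
     (\<integral>\<^sup>+\<omega>. ennreal (exp (\<theta> * cmod (X \<omega>))) \<partial>M') \<le> ennreal (exp (C * \<theta> + \<theta>\<^sup>2 / (4 * a)))"
    using cgauss_exp_moment[OF assms, where 'a='a] by blast
  then show ?thesis unfolding exp_moment_bound_def using prob_space_axioms by blast
qed

text \<open>Exponential Markov inequality and independence; the factor of mode \<open>k\<close> is a
  moment bound with parameter \<open>\<theta> * c k\<close>.\<close>

lemma (in prob_space) chernoff_finite:
  assumes ind: "indep_vars (\<lambda>_. borel) g J" and J: "finite J" and g: "\<And>k. k \<in> J \<Longrightarrow> std_cgauss M (g k)"
    and c: "\<And>k. c k \<ge> 0" and C: "exp_moment_bound M a C" and \<theta>: "\<theta> \<ge> 0"
  shows "emeasure M {\<omega> \<in> space M. (\<Sum>k\<in>J. c k * cmod (g k \<omega>)) > r}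
    \<le> ennreal (exp (- \<theta> * r + C * \<theta> * (\<Sum>k\<in>J. c k) + \<theta>\<^sup>2 * (\<Sum>k\<in>J. (c k)\<^sup>2) / (4 * a)))"
proof -
  let ?S = "\<lambda>\<omega>. \<Sum>k\<in>J. c k * cmod (g k \<omega>)"
  have gm [measurable]: "\<And>k. k \<in> J \<Longrightarrow> g k \<in> borel_measurable M" by (rule std_cgauss_measurable[OF g])
  have Sm [measurable]: "?S \<in> borel_measurable M" by measurable
  have "emeasure M {\<omega> \<in> space M. ?S \<omega> > r} = (\<integral>\<^sup>+\<omega>. indicator {\<omega> \<in> space M. ?S \<omega> > r} \<omega> \<partial>M)" by simp
  also have "\<dots> \<le> (\<integral>\<^sup>+\<omega>. ennreal (exp (- \<theta> * r)) * ennreal (exp (\<theta> * ?S \<omega>)) \<partial>M)"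
  proof (rule nn_integral_mono)
    fix \<omega>
    have "1 \<le> exp (- \<theta> * r + \<theta> * ?S \<omega>)" if "?S \<omega> > r"
      using that \<theta> mult_left_mono[of r "?S \<omega>" \<theta>] by simp
    then show "indicator {\<omega> \<in> space M. ?S \<omega> > r} \<omega> \<le> ennreal (exp (- \<theta> * r)) * ennreal (exp (\<theta> * ?S \<omega>))"
      by (auto simp: indicator_def simp flip: ennreal_mult exp_add)
  qed
  also have "\<dots> = ennreal (exp (- \<theta> * r)) * (\<integral>\<^sup>+\<omega>. ennreal (exp (\<theta> * ?S \<omega>)) \<partial>M)"
    by (rule nn_integral_cmult) measurable
  also have "(\<integral>\<^sup>+\<omega>. ennreal (exp (\<theta> * ?S \<omega>)) \<partial>M) = (\<integral>\<^sup>+\<omega>. (\<Prod>k\<in>J. ennreal (exp (\<theta> * c k * cmod (g k \<omega>)))) \<partial>M)"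
    by (rule nn_integral_cong) (simp add: sum_distrib_left mult.assoc exp_sum J prod_ennreal)
  also have "\<dots> = (\<Prod>k\<in>J. \<integral>\<^sup>+\<omega>. ennreal (exp (\<theta> * c k * cmod (g k \<omega>))) \<partial>M)"
    by (rule indep_vars_nn_integral[OF J indep_vars_compose2[OF ind]]) auto
  also have "\<dots> \<le> (\<Prod>k\<in>J. ennreal (exp (C * (\<theta> * c k) + (\<theta> * c k)\<^sup>2 / (4 * a))))"
    by (rule prod_mono_ennreal) (use C g c \<theta> in \<open>auto simp: exp_moment_bound_def\<close>)
  also have "\<dots> = ennreal (exp (C * \<theta> * (\<Sum>k\<in>J. c k) + \<theta>\<^sup>2 * (\<Sum>k\<in>J. (c k)\<^sup>2) / (4 * a)))"
    by (simp add: prod_ennreal flip: exp_sum[OF J])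
      (simp add: sum.distrib sum_distrib_left power_mult_distrib mult.assoc sum_divide_distrib)
  finally show ?thesis by (simp add: mult_right_mono algebra_simps flip: ennreal_mult exp_add)
qed

text \<open>The events for the partial sums increase, so the uniform bound passes to their union.
  Phrased through partial sums, the event covers divergence of the full sum as well.\<close>

lemma (in prob_space) chernoff:
  assumes ind: "indep_vars (\<lambda>_. borel) g UNIV" and g: "\<And>k. std_cgauss M (g k)"
    and c: "\<And>k. c k \<ge> 0" and C: "exp_moment_bound M a C" "C \<ge> 0" and a: "a > 0" and \<theta>: "\<theta> \<ge> 0"
    and s1: "\<And>n. (\<Sum>k\<in>{- int n..int n}. c k) \<le> s1" and s2: "\<And>n. (\<Sum>k\<in>{- int n..int n}. (c k)\<^sup>2) \<le> s2"
  shows "prob {\<omega> \<in> space M. \<exists>n. (\<Sum>k\<in>{- int n..int n}. c k * cmod (g k \<omega>)) > r}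
    \<le> exp (- \<theta> * r + C * \<theta> * s1 + \<theta>\<^sup>2 * s2 / (4 * a))"
proof -
  let ?S = "\<lambda>n \<omega>. \<Sum>k\<in>{- int n..int n}. c k * cmod (g k \<omega>)"
  let ?B = "exp (- \<theta> * r + C * \<theta> * s1 + \<theta>\<^sup>2 * s2 / (4 * a))"
  have gm [measurable]: "\<And>k. g k \<in> borel_measurable M" by (rule std_cgauss_measurable[OF g])
  have inc: "incseq (\<lambda>n. {\<omega> \<in> space M. ?S n \<omega> > r})"
  proof (rule incseq_SucI, safe)
    fix n \<omega> assume "r < ?S n \<omega>"
    also have "?S n \<omega> \<le> ?S (Suc n) \<omega>" by (rule sum_mono2) (use c in auto)
    finally show "r < ?S (Suc n) \<omega>" .
  qed
  have "emeasure M {\<omega> \<in> space M. ?S n \<omega> > r} \<le> ennreal ?B" for n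
  proof -
    have "emeasure M {\<omega> \<in> space M. ?S n \<omega> > r}
      \<le> ennreal (exp (- \<theta> * r + C * \<theta> * (\<Sum>k\<in>{- int n..int n}. c k) + \<theta>\<^sup>2 * (\<Sum>k\<in>{- int n..int n}. (c k)\<^sup>2) / (4 * a)))"
      by (rule chernoff_finite[OF indep_vars_subset[OF ind]]) (use g c C \<theta> in auto)
    also have "\<dots> \<le> ennreal ?B"
      by (intro ennreal_leI exp_le_cancel_iff[THEN iffD2] add_mono mult_left_mono divide_right_mono s1 s2 order_refl) (use C \<theta> a in auto)
    finally show ?thesis .
  qed
  moreover have "emeasure M {\<omega> \<in> space M. \<exists>n. ?S n \<omega> > r} = (SUP n. emeasure M {\<omega> \<in> space M. ?S n \<omega> > r})"
  proof -
    have "{\<omega> \<in> space M. \<exists>n. ?S n \<omega> > r} = (\<Union>n. {\<omega> \<in> space M. ?S n \<omega> > r})" by auto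
    then show ?thesis using SUP_emeasure_incseq[OF _ inc] by (simp add: image_subset_iff)
  qed
  ultimately have "emeasure M {\<omega> \<in> space M. \<exists>n. ?S n \<omega> > r} \<le> ennreal ?B" by (simp add: SUP_le_iff)
  then show ?thesis by (simp add: emeasure_eq_measure)
qed

text \<open>Between \<open>r\<close> and \<open>r + 1\<close> the density is smallest at the right
  end.\<close>

lemma (in prob_space) normal_tail:
  assumes D: "distributed M lborel Y (normal_density 0 \<sigma>)" and s: "\<sigma> > 0" and l: "r \<ge> 0"
  shows "prob {\<omega> \<in> space M. Y \<omega> > r} \<ge> exp (- (r + 1)\<^sup>2 / (2 * \<sigma>\<^sup>2)) / sqrt (2 * pi * \<sigma>\<^sup>2)"
proof -
  let ?B = "exp (- (r + 1)\<^sup>2 / (2 * \<sigma>\<^sup>2)) / sqrt (2 * pi * \<sigma>\<^sup>2)"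
  have [measurable]: "Y \<in> measurable M lborel" by (rule distributed_measurable[OF D])
  have "ennreal ?B = (\<integral>\<^sup>+x. ennreal ?B * indicator {r<..r + 1} x \<partial>lborel)" by (simp add: nn_integral_cmult_indicator)
  also have "\<dots> \<le> (\<integral>\<^sup>+x. ennreal (normal_density 0 \<sigma> x) * indicator {r<..} x \<partial>lborel)"
  proof (rule nn_integral_mono)
    fix x
    have "?B \<le> normal_density 0 \<sigma> x" if x: "r < x" "x \<le> r + 1"
    proof -
      have "x\<^sup>2 \<le> (r + 1)\<^sup>2" by (rule power_mono) (use x l in auto)
      then have "- (r + 1)\<^sup>2 / (2 * \<sigma>\<^sup>2) \<le> - x\<^sup>2 / (2 * \<sigma>\<^sup>2)" using s by (intro divide_right_mono) auto
      then show ?thesis unfolding normal_density_def using s by (simp add: divide_right_mono)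
    qed
    then show "ennreal ?B * indicator {r<..r + 1} x \<le> ennreal (normal_density 0 \<sigma> x) * indicator {r<..} x"
      by (auto simp: indicator_def ennreal_leI)
  qed
  also have "\<dots> = emeasure M (Y -` {r<..} \<inter> space M)" by (rule distributed_emeasure[OF D, symmetric]) simp
  also have "Y -` {r<..} \<inter> space M = {\<omega> \<in> space M. Y \<omega> > r}" by auto
  finally show ?thesis by (simp add: emeasure_eq_measure)
qed

text \<open>Twisting leaves the variables independent and standard, so the real part of the weighted
  sum is normal with variance half the sum of the squared weights, and the tail bound
  applies.\<close>

lemma (in prob_space) gauss_lower:
  assumes ind: "indep_vars (\<lambda>_. borel) g F" and F: "finite F" "F \<noteq> {}" and g: "\<And>k. k \<in> F \<Longrightarrow> std_cgauss M (g k)"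
    and c: "\<And>k. k \<in> F \<Longrightarrow> c k > 0" and \<psi>: "\<And>k. k \<in> F \<Longrightarrow> \<psi> k \<in> borel_measurable borel" and l: "r \<ge> 0"
  shows "prob {\<omega> \<in> space M. Re (\<Sum>k\<in>F. of_real (c k) * (g k \<omega> * cis (\<psi> k (cmod (g k \<omega>))))) > r}
     \<ge> exp (- (r + 1)\<^sup>2 / (\<Sum>k\<in>F. (c k)\<^sup>2)) / sqrt (pi * (\<Sum>k\<in>F. (c k)\<^sup>2))"
proof -
  let ?h = "\<lambda>k \<omega>. g k \<omega> * cis (\<psi> k (cmod (g k \<omega>)))"
  let ?s = "\<Sum>k\<in>F. (c k)\<^sup>2"
  have s: "?s > 0" by (rule sum_pos) (use F c in \<open>auto simp: less_imp_neq[symmetric]\<close>)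
  have cism [measurable]: "cis \<in> borel_measurable borel"
    by (rule borel_measurable_continuous_onI) (intro continuous_intros)
  have h: "std_cgauss M (?h k)" if "k \<in> F" for k
    by (rule cgauss_twist[OF prob_space_axioms g \<psi>]) (use that in auto)
  have hi: "indep_vars (\<lambda>_. borel) (\<lambda>k \<omega>. c k * Re (?h k \<omega>)) F"
  proof (rule indep_vars_compose2[OF ind])
    fix k assume "k \<in> F"
    then have [measurable]: "\<psi> k \<in> borel_measurable borel" by (rule \<psi>)
    have "(\<lambda>z. z * cis (\<psi> k (cmod z))) \<in> borel_measurable borel" by measurable
    then have "(\<lambda>z. Re (z * cis (\<psi> k (cmod z)))) \<in> borel_measurable borel" by (rule Re_Im_measurable)
    then show "(\<lambda>z. c k * Re (z * cis (\<psi> k (cmod z)))) \<in> borel_measurable borel" by measurable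
  qed
  have D: "distributed M lborel (\<lambda>\<omega>. \<Sum>k\<in>F. c k * Re (?h k \<omega>)) (normal_density (\<Sum>k\<in>F. 0) (sqrt (\<Sum>k\<in>F. (sqrt ((c k)\<^sup>2 / 2))\<^sup>2)))"
  proof (rule sum_indep_normal[OF F hi])
    fix k assume k: "k \<in> F"
    show "0 < sqrt ((c k)\<^sup>2 / 2)" using c[OF k] by simp
    show "distributed M lborel (\<lambda>\<omega>. c k * Re (?h k \<omega>)) (normal_density 0 (sqrt ((c k)\<^sup>2 / 2)))"
      using h[OF k, unfolded std_cgauss_def, THEN conjunct2, rule_format, of "c k" 0] c[OF k] by simp
  qed
  have v: "(\<Sum>k\<in>F. (sqrt ((c k)\<^sup>2 / 2))\<^sup>2) = ?s / 2" by (simp add: sum_divide_distrib)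
  have "prob {\<omega> \<in> space M. (\<Sum>k\<in>F. c k * Re (?h k \<omega>)) > r}
    \<ge> exp (- (r + 1)\<^sup>2 / (2 * (sqrt (?s / 2))\<^sup>2)) / sqrt (2 * pi * (sqrt (?s / 2))\<^sup>2)"
    by (rule normal_tail[OF D[unfolded v sum.neutral_const]]) (use s l in auto)
  moreover have "(\<Sum>k\<in>F. c k * Re (?h k \<omega>)) = Re (\<Sum>k\<in>F. of_real (c k) * ?h k \<omega>)" for \<omega> by simp
  ultimately show ?thesis using s by simp
qed

section \<open>Supremum bounds for random data\<close>

text \<open>The continuous representative of \<open>f\<close> when its Fourier coefficients are
  summable.\<close>

definition wave :: "(real \<Rightarrow> complex) \<Rightarrow> real \<Rightarrow> complex" where
  "wave f x = (LINT k|CS. fc f k * cis (of_int k * x))"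

lemma sup_circle_wave:
  assumes f: "sqint f" and c: "integrable CS (fc f)"
  shows "sup_circle f = (SUP x. ereal (cmod (wave f x)))" and "continuous_on UNIV (wave f)"
proof -
  note [measurable] = sqint_measurable[OF f]
  show cont: "continuous_on UNIV (wave f)" unfolding wave_def by (rule wiener_continuous[OF c])
  have [measurable]: "wave f \<in> borel_measurable CM" by (rule borel_measurable_CM, rule borel_measurable_continuous_onI[OF cont])
  have "cis (of_int k * (x + 2 * pi)) = cis (of_int k * x)" for k :: int and x
  proof -
    have "of_int k * (x + 2 * pi) = of_int k * x + 2 * pi * of_int k" by (simp add: algebra_simps)
    then show ?thesis by (simp add: cis_mult[symmetric] cis_multiple_2pi)
  qed
  then have per: "periodic (wave f)" by (simp add: periodic_def wave_def)
  have "AE x in CM. f x = wave f x" unfolding wave_def by (rule wiener_reconstruct[OF f c])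
  then have "sup_circle f = sup_circle (wave f)"
    unfolding sup_circle_def by (intro esssup_AE_cong) (auto elim!: eventually_mono)
  then show "sup_circle f = (SUP x. ereal (cmod (wave f x)))" by (simp add: sup_circle_continuous[OF per cont])
qed

lemma wave_norm_le: "ennreal (cmod (wave f x)) \<le> (\<integral>\<^sup>+k. cmod (fc f k) \<partial>CS)"
  using csum_norm_le[of "\<lambda>k. fc f k * cis (of_int k * x)"] by (simp add: wave_def norm_mult)

lemma umode_zero: "nls_solution \<epsilon> u0 u \<Longrightarrow> umode u k 0 = fc u0 k"
  by (rule nls_mode_AC(2)[where T = 1]) auto

lemma norm_umode [simp]: "cmod (umode u k s) = cmod (fc (u s) k)"
  by (simp add: umode_def norm_mult)

lemma fc_umode: "fc (u s) k = cis (- ((of_int k)\<^sup>2 * s)) * umode u k s"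
  by (simp add: umode_def mult.assoc[symmetric] cis_mult)

text \<open>Collects what is used of a solution at a single time. The random datum meets the
  summability premise at every outcome, by \<open>random_data_summable\<close>.\<close>

lemma nls_modes_summable:
  assumes sol: "nls_solution \<epsilon> u0 u" and T: "T \<ge> 0" and Y: "(\<integral>\<^sup>+k. cmod (fc u0 k) \<partial>CS) < \<infinity>"
  shows "integrable CS (fc (u T))" and "sqint (u T)"
    and "(\<lambda>n. euler (\<epsilon>\<^sup>2) (T / real n) (fc u0) n k) \<longlonglongrightarrow> umode u k T"
proof -
  obtain V W \<mu> where "cubic_modes (\<epsilon>\<^sup>2) (umode u) (nmode u) V W T \<mu>" using nls_cubic_modes[OF sol T] by blast
  then interpret m: cubic_modes "\<epsilon>\<^sup>2" "umode u" "nmode u" V W T \<mu> .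
  obtain y where y: "(\<integral>\<^sup>+k. cmod (fc u0 k) \<partial>CS) \<le> ennreal y" "y \<ge> 0"
    using Y by (cases "\<integral>\<^sup>+k. cmod (fc u0 k) \<partial>CS" rule: ennreal_cases) auto
  then have "(\<integral>\<^sup>+k. cmod (umode u k 0) \<partial>CS) \<le> ennreal y" by (simp only: umode_zero[OF sol])
  from m.l1_propagation[OF this y(2)] obtain L where "\<forall>s\<in>{0..T}. (\<integral>\<^sup>+k. cmod (umode u k s) \<partial>CS) \<le> ennreal L" by blast
  then have "(\<integral>\<^sup>+k. cmod (umode u k T) \<partial>CS) \<le> ennreal L" using T by auto
  then show "integrable CS (fc (u T))" by (simp add: integrable_csum_iff le_less_trans)
  show "sqint (u T)" using sol T by (intro sqint_of_solution) (auto simp: nls_solution_def)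
  show "(\<lambda>n. euler (\<epsilon>\<^sup>2) (T / real n) (fc u0) n k) \<longlonglongrightarrow> umode u k T"
    using m.euler_limit[of k] Y by (simp only: umode_zero[OF sol])
qed

text \<open>From above the supremum is at most the Wiener norm; from below it is at least the value
  at 0. The resonant flow keeps all moduli, and the part of its phase that comes from the mass is
  common to all modes, hence invisible in the modulus. The bootstrap is run at level
  \<open>2 * y\<close>.\<close>

lemma nls_sup_bounds:
  assumes sol: "nls_solution \<epsilon> u0 u" and T: "T \<ge> 0" and Y: "(\<integral>\<^sup>+k. cmod (fc u0 k) \<partial>CS) \<le> ennreal y" "y > 0"
    and k1: "\<epsilon>\<^sup>2 * (2 * y)\<^sup>2 \<le> 1" and k2: "drift (\<epsilon>\<^sup>2 * (2 * y)\<^sup>2) T < 1/2"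
  shows "sup_circle (u T) \<le> ereal (y + 2 * y * drift (\<epsilon>\<^sup>2 * (2 * y)\<^sup>2) T)" (is "_ \<le> ereal (y + ?e)")
    and "sup_circle (u T) \<ge> ereal (cmod (LINT k|CS. fc u0 k * cis (\<epsilon>\<^sup>2 * T * (cmod (fc u0 k))\<^sup>2 - (of_int k)\<^sup>2 * T))
      - 2 * y * drift (\<epsilon>\<^sup>2 * (2 * y)\<^sup>2) T)"
proof -
  have Yf: "(\<integral>\<^sup>+k. cmod (fc u0 k) \<partial>CS) < \<infinity>" using Y by (simp add: le_less_trans)
  note s = nls_modes_summable[OF sol T Yf]
  obtain V W \<mu> where "cubic_modes (\<epsilon>\<^sup>2) (umode u) (nmode u) V W T \<mu>" using nls_cubic_modes[OF sol T] by blast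
  then interpret m: cubic_modes "\<epsilon>\<^sup>2" "umode u" "nmode u" V W T \<mu> .
  define R where "R = (\<lambda>k. cis (- (\<epsilon>\<^sup>2 * m.rho k 0 * T)) * fc u0 k)"
  have e0: "?e \<ge> 0" using Y T by (simp add: drift_def)
  have app: "(\<integral>\<^sup>+k. cmod (umode u k T - R k) \<partial>CS) \<le> ennreal ?e"
    using m.long_time_approximation(1)[of "2 * y"] Y k1 k2 by (simp add: umode_zero[OF sol] R_def)
  have nR: "cmod (R k) = cmod (fc u0 k)" for k by (simp add: R_def norm_mult)
  have "(\<integral>\<^sup>+k. cmod (fc (u T) k) \<partial>CS) \<le> (\<integral>\<^sup>+k. ennreal (cmod (R k)) + ennreal (cmod (umode u k T - R k)) \<partial>CS)"
  proof (rule nn_integral_mono)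
    fix k
    have "cmod (fc (u T) k) \<le> cmod (R k) + cmod (umode u k T - R k)"
      using norm_triangle_ineq[of "R k" "umode u k T - R k"] by simp
    then show "ennreal (cmod (fc (u T) k)) \<le> ennreal (cmod (R k)) + ennreal (cmod (umode u k T - R k))"
      by (simp flip: ennreal_plus)
  qed
  also have "\<dots> = (\<integral>\<^sup>+k. ennreal (cmod (R k)) \<partial>CS) + (\<integral>\<^sup>+k. ennreal (cmod (umode u k T - R k)) \<partial>CS)" by (rule nn_integral_add) auto
  also have "\<dots> \<le> ennreal y + ennreal ?e" using Y app by (intro add_mono) (simp_all add: nR)
  also have "\<dots> = ennreal (y + ?e)" using Y e0 by simp
  finally have U: "ennreal (cmod (wave (u T) x)) \<le> ennreal (y + ?e)" for x by (rule order_trans[OF wave_norm_le])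
  have U': "cmod (wave (u T) x) \<le> y + ?e" for x by (rule ennreal_le_iff[THEN iffD1, OF _ U]) (use Y e0 in linarith)
  show "sup_circle (u T) \<le> ereal (y + ?e)"
    unfolding sup_circle_wave(1)[OF s(2,1)] by (rule SUP_least) (simp only: ereal_less_eq U')
  define p where "p = (\<lambda>k. cis (- ((of_int k)\<^sup>2 * T)) :: complex)"
  have iR: "integrable CS R" using Yf by (simp add: integrable_csum_iff nR)
  have ipR: "integrable CS (\<lambda>k. p k * R k)" using Yf by (simp add: integrable_csum_iff nR p_def norm_mult)
  \<comment> \<open>The phase due to the mass is split off; mode \<open>k\<close> keeps its free
    phase and the correction by its own squared modulus.\<close>
  have ph: "p k * R k = cis (- (2 * \<epsilon>\<^sup>2 * m.ms 0 * T)) * (fc u0 k * cis (\<epsilon>\<^sup>2 * T * (cmod (fc u0 k))\<^sup>2 - (of_int k)\<^sup>2 * T))" for k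
  proof -
    have "- ((of_int k)\<^sup>2 * T) + - (\<epsilon>\<^sup>2 * m.rho k 0 * T) = - (2 * \<epsilon>\<^sup>2 * m.ms 0 * T) + (\<epsilon>\<^sup>2 * T * (cmod (fc u0 k))\<^sup>2 - (of_int k)\<^sup>2 * T)"
      by (simp only: m.rho_def umode_zero[OF sol]) (simp add: algebra_simps)
    then have "cis (- ((of_int k)\<^sup>2 * T)) * cis (- (\<epsilon>\<^sup>2 * m.rho k 0 * T)) = cis (- (2 * \<epsilon>\<^sup>2 * m.ms 0 * T)) * cis (\<epsilon>\<^sup>2 * T * (cmod (fc u0 k))\<^sup>2 - (of_int k)\<^sup>2 * T)"
      by (simp only: cis_mult)
    then show ?thesis unfolding p_def R_def by (simp only: mult.assoc[symmetric]) (simp only: mult_ac)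
  qed
  have "(LINT k|CS. p k * R k) = cis (- (2 * \<epsilon>\<^sup>2 * m.ms 0 * T)) * (LINT k|CS. fc u0 k * cis (\<epsilon>\<^sup>2 * T * (cmod (fc u0 k))\<^sup>2 - (of_int k)\<^sup>2 * T))"
    unfolding ph by simp
  then have n: "cmod (LINT k|CS. p k * R k) = cmod (LINT k|CS. fc u0 k * cis (\<epsilon>\<^sup>2 * T * (cmod (fc u0 k))\<^sup>2 - (of_int k)\<^sup>2 * T))"
    by (simp add: norm_mult)
  have "wave (u T) 0 - (LINT k|CS. p k * R k) = (LINT k|CS. p k * (umode u k T - R k))"
  proof -
    have "fc (u T) k * cis (of_int k * 0) - p k * R k = p k * (umode u k T - R k)" for k
      by (simp add: fc_umode[of u T] p_def right_diff_distrib)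
    moreover have "integrable CS (\<lambda>k. fc (u T) k * cis (of_int k * 0))" using s(1) by simp
    ultimately show ?thesis unfolding wave_def by (simp only: Bochner_Integration.integral_diff[OF _ ipR, symmetric])
  qed
  then have "ennreal (cmod (wave (u T) 0 - (LINT k|CS. p k * R k))) \<le> ennreal ?e"
    using order_trans[OF csum_norm_le[of "\<lambda>k. p k * (umode u k T - R k)"]] app by (simp add: norm_mult p_def)
  then have "cmod (wave (u T) 0 - (LINT k|CS. p k * R k)) \<le> ?e" using e0 by simp
  then have "cmod (LINT k|CS. p k * R k) - ?e \<le> cmod (wave (u T) 0)"
    using norm_triangle_ineq2[of "LINT k|CS. p k * R k" "wave (u T) 0"] by (simp add: norm_minus_commute)
  then have "ereal (cmod (LINT k|CS. p k * R k) - ?e) \<le> ereal (cmod (wave (u T) 0))" by simp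
  also have "\<dots> \<le> sup_circle (u T)" unfolding sup_circle_wave(1)[OF s(2,1)] by (rule SUP_upper) simp
  finally show "sup_circle (u T) \<ge> ereal (cmod (LINT k|CS. fc u0 k * cis (\<epsilon>\<^sup>2 * T * (cmod (fc u0 k))\<^sup>2 - (of_int k)\<^sup>2 * T)) - ?e)"
    unfolding n .
qed

text \<open>Absolute summability of the series does not depend on \<open>x\<close>. Where it fails
  the datum is 0, so the coefficients are summable at every outcome and no exceptional set has to be
  carried along.\<close>

lemma fourier_coeff_random_data:
  "fc (random_data c g \<omega>) k = (if (\<integral>\<^sup>+k. cmod (of_real (c k) * g k \<omega>) \<partial>CS) < \<infinity> then of_real (c k) * g k \<omega> else 0)"
proof -
  have D: "(\<lambda>k. of_real (c k) * g k \<omega> * cis (of_int k * x)) summable_on UNIV \<longleftrightarrow> (\<integral>\<^sup>+k. cmod (of_real (c k) * g k \<omega>) \<partial>CS) < \<infinity>" for x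
    unfolding summable_on_iff_abs_summable_on_complex abs_summable_equivalent
    by (simp add: Infinite_Set_Sum.abs_summable_on_def integrable_csum_iff norm_mult)
  show ?thesis
  proof (cases "(\<integral>\<^sup>+k. cmod (of_real (c k) * g k \<omega>) \<partial>CS) < \<infinity>")
    case True
    then have i: "integrable CS (\<lambda>k. of_real (c k) * g k \<omega>)" by (simp add: integrable_csum_iff)
    have "random_data c g \<omega> = (\<lambda>x. LINT k|CS. of_real (c k) * g k \<omega> * cis (of_int k * x))"
    proof
      fix x
      have "integrable CS (\<lambda>k. of_real (c k) * g k \<omega> * cis (of_int k * x))" using True by (simp add: integrable_csum_iff norm_mult)
      then show "random_data c g \<omega> x = (LINT k|CS. of_real (c k) * g k \<omega> * cis (of_int k * x))"
        unfolding random_data_def by (subst infsetsum_infsum[symmetric]) (simp_all add: Infinite_Set_Sum.abs_summable_on_def infsetsum_def)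
    qed
    then show ?thesis using fourier_coeff_wiener[OF i, of k] True by simp
  next
    case False
    then have "random_data c g \<omega> = (\<lambda>x. 0)" unfolding random_data_def using D by (intro ext infsum_not_exists) simp
    then show ?thesis using False by (simp add: fourier_coeff_def)
  qed
qed

lemma random_data_summable: "(\<integral>\<^sup>+k. cmod (fc (random_data c g \<omega>) k) \<partial>CS) < \<infinity>"
  by (cases "(\<integral>\<^sup>+k. cmod (of_real (c k) * g k \<omega>) \<partial>CS) < \<infinity>") (simp_all add: fourier_coeff_random_data)

lemma fourier_coeff_random_data_measurable:
  assumes [measurable]: "\<And>k. g k \<in> borel_measurable M"
  shows "(\<lambda>\<omega>. fc (random_data c g \<omega>) k) \<in> borel_measurable M"
  unfolding fourier_coeff_random_data by measurable

text \<open>The modes are limits of the Euler scheme, whose iterates are measurable functions of the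
  outcome. As the representative is continuous, the supremum may be tested on the rationals.\<close>

lemma sup_event_measurable:
  assumes [measurable]: "\<And>k. g k \<in> borel_measurable M" and T: "T \<ge> 0"
    and sol: "\<And>\<omega>. \<omega> \<in> space M \<Longrightarrow> nls_solution \<epsilon> (random_data c g \<omega>) (u \<omega>)"
  shows "{\<omega> \<in> space M. sup_circle (u \<omega> T) > ereal r} \<in> sets M"
proof -
  note s = nls_modes_summable[OF sol T random_data_summable]
  have [measurable]: "(\<lambda>\<omega>. umode (u \<omega>) k T) \<in> borel_measurable M" for k
    by (rule borel_measurable_LIMSEQ_metric[OF euler_measurable[OF fourier_coeff_random_data_measurable] s(3)]) auto
  have [measurable]: "(\<lambda>\<omega>. wave (u \<omega> T) x) \<in> borel_measurable M" for x
    unfolding wave_def fc_umode by measurable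
  have "sup_circle (u \<omega> T) > ereal r \<longleftrightarrow> (\<exists>q\<in>\<rat>. cmod (wave (u \<omega> T) q) > r)" if \<omega>: "\<omega> \<in> space M" for \<omega>
  proof -
    note w = sup_circle_wave[OF s(2)[OF \<omega>] s(1)[OF \<omega>]]
    have "\<exists>q\<in>\<rat>. cmod (wave (u \<omega> T) q) > r" if x: "cmod (wave (u \<omega> T) x) > r" for x
    proof -
      have "open {x. cmod (wave (u \<omega> T) x) > r}" by (intro open_Collect_less continuous_intros w(2))
      moreover have "x \<in> {x. cmod (wave (u \<omega> T) x) > r}" using x by simp
      ultimately obtain d where d: "d > 0" "ball x d \<subseteq> {x. cmod (wave (u \<omega> T) x) > r}" by (rule openE)
      obtain q where "q \<in> \<rat>" "x < q" "q < x + d" using Rats_dense_in_real[of x "x + d"] d by auto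
      moreover have "q \<in> ball x d" using calculation by (simp add: dist_real_def)
      ultimately show ?thesis using d by blast
    qed
    then show ?thesis unfolding w(1) less_SUP_iff by auto
  qed
  then have "{\<omega> \<in> space M. sup_circle (u \<omega> T) > ereal r} = (\<Union>q\<in>\<rat>. {\<omega> \<in> space M. cmod (wave (u \<omega> T) q) > r})" by auto
  moreover have "{\<omega> \<in> space M. cmod (wave (u \<omega> T) q) > r} \<in> sets M" for q by measurable
  then have "(\<Union>q\<in>\<rat>. {\<omega> \<in> space M. cmod (wave (u \<omega> T) q) > r}) \<in> sets M" by (intro sets.countable_UN'[OF countable_rat]) blast
  ultimately show ?thesis by simp
qed

section \<open>Bounds for a single outcome\<close>

abbreviation (input) "S c g \<equiv> \<lambda>n \<omega>. \<Sum>k\<in>{- int n..int n}. c k * cmod (g k \<omega>)"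

lemma abs_sum_bound:
  fixes f :: "int \<Rightarrow> complex"
  assumes r: "\<not> (\<exists>n. S c g n \<omega> > r)" and f: "\<And>k. cmod (f k) = c k * cmod (g k \<omega>)"
  shows "(\<integral>\<^sup>+k. cmod (f k) \<partial>CS) \<le> ennreal r" and "integrable CS f"
proof -
  have b: "(\<Sum>k\<in>{- int n..int n}. norm (f k)) \<le> r" for n using r by (simp add: f not_less)
  note B = csum_integrable_bound[OF b]
  show "integrable CS f" by (rule B(1))
  then show "(\<integral>\<^sup>+k. cmod (f k) \<partial>CS) \<le> ennreal r"
    using B(2) by (simp add: nn_integral_eq_integral ennreal_leI)
qed

text \<open>When the partial sums stay below \<open>r\<close> the series converges absolutely, so
  the default value of the datum does not occur.\<close>

lemma random_data_modes:
  assumes c: "\<And>k. c k \<ge> 0" and r: "\<not> (\<exists>n. S c g n \<omega> > r)"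
  shows "fc (random_data c g \<omega>) k = of_real (c k) * g k \<omega>"
  using abs_sum_bound(1)[where c = c and g = g and f = "\<lambda>k. of_real (c k) * g k \<omega>", OF r] c
  by (simp add: fourier_coeff_random_data norm_mult le_less_trans)

lemma sup_upper:
  assumes sol: "nls_solution \<epsilon> (random_data c g \<omega>) u" and T: "T \<ge> 0" and c: "\<And>k. c k \<ge> 0"
    and y: "\<not> (\<exists>n. S c g n \<omega> > y)" "y > 0"
    and k: "\<epsilon>\<^sup>2 * (2 * y)\<^sup>2 \<le> 1" "drift (\<epsilon>\<^sup>2 * (2 * y)\<^sup>2) T < 1/2"
  shows "sup_circle (u T) \<le> ereal (y + 2 * y * drift (\<epsilon>\<^sup>2 * (2 * y)\<^sup>2) T)"
proof (rule nls_sup_bounds(1)[OF sol T _ y(2) k])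
  show "(\<integral>\<^sup>+k. cmod (fc (random_data c g \<omega>) k) \<partial>CS) \<le> ennreal y"
    unfolding random_data_modes[where c = c and g = g, OF c y(1)] by (rule abs_sum_bound(1)[where c = c and g = g, OF y(1)]) (use c in \<open>simp add: norm_mult\<close>)
qed

text \<open>Only the frequencies in \<open>F\<close> are kept; the others move the value at 0 by at
  most \<open>w\<close>, whatever their phases. The real part makes the main term a sum of real
  variables to which \<open>gauss_lower\<close> applies.\<close>

lemma sup_lower:
  assumes sol: "nls_solution \<epsilon> (random_data c g \<omega>) u" and T: "T \<ge> 0" and c: "\<And>k. c k \<ge> 0"
    and y: "\<not> (\<exists>n. S c g n \<omega> > y)" "y > 0" and F: "finite F"
    and w: "\<not> (\<exists>n. S (\<lambda>k. if k \<in> F then 0 else c k) g n \<omega> > w)"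
    and k: "\<epsilon>\<^sup>2 * (2 * y)\<^sup>2 \<le> 1" "drift (\<epsilon>\<^sup>2 * (2 * y)\<^sup>2) T < 1/2"
  shows "sup_circle (u T) \<ge> ereal (Re (\<Sum>k\<in>F. of_real (c k) * (g k \<omega> * cis (\<epsilon>\<^sup>2 * T * (c k * cmod (g k \<omega>))\<^sup>2 - (of_int k)\<^sup>2 * T)))
     - w - 2 * y * drift (\<epsilon>\<^sup>2 * (2 * y)\<^sup>2) T)"
proof -
  define f where "f = (\<lambda>k. of_real (c k) * (g k \<omega> * cis (\<epsilon>\<^sup>2 * T * (c k * cmod (g k \<omega>))\<^sup>2 - (of_int k)\<^sup>2 * T)))"
  have nf: "cmod (f k) = c k * cmod (g k \<omega>)" for k using c by (simp add: f_def norm_mult)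
  have Y: "(\<integral>\<^sup>+k. cmod (fc (random_data c g \<omega>) k) \<partial>CS) \<le> ennreal y"
    unfolding random_data_modes[where c = c and g = g, OF c y(1)] by (rule abs_sum_bound(1)[where c = c and g = g, OF y(1)]) (use c in \<open>simp add: norm_mult\<close>)
  have e: "fc (random_data c g \<omega>) k * cis (\<epsilon>\<^sup>2 * T * (cmod (fc (random_data c g \<omega>) k))\<^sup>2 - (of_int k)\<^sup>2 * T) = f k" for k
    using c by (simp add: random_data_modes[where c = c and g = g, OF c y(1)] f_def norm_mult)
  have low: "sup_circle (u T) \<ge> ereal (cmod (LINT k|CS. f k) - 2 * y * drift (\<epsilon>\<^sup>2 * (2 * y)\<^sup>2) T)"
    using nls_sup_bounds(2)[OF sol T Y y(2) k] unfolding e .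
  let ?h = "\<lambda>k. if k \<in> F then 0 else f k"
  have b: "(\<Sum>k\<in>{- int n..int n}. norm (?h k)) \<le> w" for n
  proof -
    have "norm (?h k) = (if k \<in> F then 0 else c k) * cmod (g k \<omega>)" for k by (simp add: nf)
    then show ?thesis using w by (simp only: not_ex not_less)
  qed
  note B = csum_integrable_bound[OF b]
  have "cmod (LINT k|CS. ?h k) \<le> w" using B(2) integral_norm_bound[of CS ?h] by linarith
  moreover have "(LINT k|CS. f k) = (LINT k|CS. indicator F k *\<^sub>R f k + ?h k)"
    by (rule Bochner_Integration.integral_cong) auto
  moreover have "\<dots> = (\<Sum>k\<in>F. f k) + (LINT k|CS. ?h k)"
    using Bochner_Integration.integral_add[OF csum_finite(2)[OF F, of f] B(1)] by (simp only: csum_finite(1)[OF F])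
  ultimately have "cmod (\<Sum>k\<in>F. f k) - w \<le> cmod (LINT k|CS. f k)"
    using norm_diff_ineq[of "\<Sum>k\<in>F. f k" "LINT k|CS. ?h k"] by simp
  then have "Re (\<Sum>k\<in>F. f k) - w \<le> cmod (LINT k|CS. f k)" using complex_Re_le_cmod[of "\<Sum>k\<in>F. f k"] by linarith
  then have "ereal (Re (\<Sum>k\<in>F. f k) - w - 2 * y * drift (\<epsilon>\<^sup>2 * (2 * y)\<^sup>2) T) \<le> ereal (cmod (LINT k|CS. f k) - 2 * y * drift (\<epsilon>\<^sup>2 * (2 * y)\<^sup>2) T)"
    by simp
  then show ?thesis using low unfolding f_def by (rule order_trans)
qed

section \<open>The large deviation rate\<close>

locale nls_data = prob_space M for M :: "'a measure" +
  fixes g :: "int \<Rightarrow> 'a \<Rightarrow> complex" and c :: "int \<Rightarrow> real" and u :: "real \<Rightarrow> 'a \<Rightarrow> real \<Rightarrow> real \<Rightarrow> complex"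
    and t :: "real \<Rightarrow> real" and s1 s2 :: real
  assumes ind: "indep_vars (\<lambda>_. borel) g UNIV" and g: "\<And>k. std_cgauss M (g k)" and c: "\<And>k. c k \<ge> 0"
    and s1: "\<And>n. (\<Sum>k\<in>{- int n..int n}. c k) \<le> s1"
    and s2: "\<And>n. (\<Sum>k\<in>{- int n..int n}. (c k)\<^sup>2) \<le> s2" "(\<lambda>n. \<Sum>k\<in>{- int n..int n}. (c k)\<^sup>2) \<longlonglongrightarrow> s2" "s2 > 0"
    and sol: "\<And>\<epsilon> \<omega>. \<epsilon> > 0 \<Longrightarrow> \<omega> \<in> space M \<Longrightarrow> nls_solution \<epsilon> (random_data c g \<omega>) (u \<epsilon> \<omega>)"
    and t: "\<And>\<epsilon>. \<epsilon> > 0 \<Longrightarrow> t \<epsilon> \<ge> 0" "t \<in> O[at_right 0](\<lambda>\<epsilon>. inverse \<epsilon> * \<bar>ln \<epsilon>\<bar>)"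
begin

lemma g_measurable [measurable]: "g k \<in> borel_measurable M" by (rule std_cgauss_measurable[OF g])

definition exceedance :: "real \<Rightarrow> real \<Rightarrow> real" where
  "exceedance z \<epsilon> = prob {\<omega> \<in> space M. sup_circle (u \<epsilon> \<omega> (t \<epsilon>)) > ereal (z * \<epsilon> powr (- 1 / 2))}"

lemma sup_event: "\<epsilon> > 0 \<Longrightarrow> {\<omega> \<in> space M. sup_circle (u \<epsilon> \<omega> (t \<epsilon>)) > ereal r} \<in> events"
  by (rule sup_event_measurable[OF g_measurable t(1) sol])

text \<open>The parameter \<eta> L^2 of the approximation for coupling \<epsilon>^2 and L = 2 A
  \<epsilon>^(-1/2): it is of order \<epsilon>.\<close>

lemma kappa:
  fixes \<epsilon> :: real
  assumes e: "\<epsilon> > 0" shows "\<epsilon>\<^sup>2 * (2 * (A * \<epsilon> powr (- 1 / 2)))\<^sup>2 = 4 * A\<^sup>2 * \<epsilon>"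
proof -
  have "(\<epsilon> powr (- 1 / 2))\<^sup>2 = 1 / \<epsilon>" using e by (simp add: power2_eq_square powr_minus_divide flip: powr_add)
  then show ?thesis using e by (simp add: power_mult_distrib power2_eq_square)
qed

text \<open>The growth condition on the times enters here: it bounds \<kappa> t by a multiple of
  |log \<epsilon>|, so the drift is O(\<epsilon> |log \<epsilon>|^2).\<close>

lemma drift_small: "((\<lambda>\<epsilon>. drift (4 * A\<^sup>2 * \<epsilon>) (t \<epsilon>)) \<longlongrightarrow> 0) (at_right 0)"
proof -
  obtain K where K: "K > 0" "eventually (\<lambda>\<epsilon>. norm (t \<epsilon>) \<le> K * norm (inverse \<epsilon> * \<bar>ln \<epsilon>\<bar>)) (at_right 0)"
    using t(2) by (auto elim!: landau_o.bigE)
  let ?B = "\<lambda>\<epsilon>. 4 * A\<^sup>2 * \<epsilon> * (1 + 17 * (4 * A\<^sup>2 * K * \<bar>ln \<epsilon>\<bar>) + 41 * (4 * A\<^sup>2 * K * \<bar>ln \<epsilon>\<bar>)\<^sup>2)"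
  have pos: "eventually (\<lambda>\<epsilon>::real. \<epsilon> > 0) (at_right 0)" by (simp add: eventually_at_right_less)
  have le: "eventually (\<lambda>\<epsilon>. drift (4 * A\<^sup>2 * \<epsilon>) (t \<epsilon>) \<le> ?B \<epsilon>) (at_right 0)"
    using K(2) pos
  proof eventually_elim
    case (elim \<epsilon>)
    have t0: "t \<epsilon> \<ge> 0" using elim by (intro t) auto
    have "4 * A\<^sup>2 * \<epsilon> * t \<epsilon> \<le> 4 * A\<^sup>2 * \<epsilon> * (K * (inverse \<epsilon> * \<bar>ln \<epsilon>\<bar>))"
      by (rule mult_left_mono) (use elim in \<open>auto simp: abs_mult\<close>)
    also have "\<dots> = 4 * A\<^sup>2 * K * \<bar>ln \<epsilon>\<bar>" using elim by (simp add: field_simps)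
    finally show ?case unfolding drift_def
      by (intro mult_left_mono add_mono power_mono) (use elim t0 in auto)
  qed
  have B: "(?B \<longlongrightarrow> 0) (at_right 0)" proof -
    \<comment> \<open>The numbers 272 = 17 * 16 and 2624 = 41 * 64 come from expanding
      \<open>?B\<close>; in this form only limits of \<epsilon> times powers of the logarithm are
      left.\<close>
    have "((\<lambda>\<epsilon>. 4 * A\<^sup>2 * \<epsilon> + 272 * A ^ 4 * K * (\<epsilon> * \<bar>ln \<epsilon>\<bar>) + 2624 * A ^ 6 * K\<^sup>2 * (\<epsilon> * \<bar>ln \<epsilon>\<bar>\<^sup>2)) \<longlongrightarrow> 4 * A\<^sup>2 * 0 + 272 * A ^ 4 * K * 0 + 2624 * A ^ 6 * K\<^sup>2 * 0) (at_right 0)"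
      by (intro tendsto_add tendsto_mult tendsto_const tendsto_ident_at; real_asymp)
    moreover have "?B \<epsilon> = 4 * A\<^sup>2 * \<epsilon> + 272 * A ^ 4 * K * (\<epsilon> * \<bar>ln \<epsilon>\<bar>) + 2624 * A ^ 6 * K\<^sup>2 * (\<epsilon> * \<bar>ln \<epsilon>\<bar>\<^sup>2)" for \<epsilon>
      by algebra
    ultimately show ?thesis by simp
  qed
  have ge: "eventually (\<lambda>\<epsilon>. 0 \<le> drift (4 * A\<^sup>2 * \<epsilon>) (t \<epsilon>)) (at_right 0)"
    using pos by eventually_elim (simp add: drift_def t(1))
  show ?thesis by (rule tendsto_sandwich[OF ge le tendsto_const B])
qed

text \<open>The threshold \<kappa> / (2 A) for the drift makes the absolute error an arbitrarily
  small fraction of \<epsilon>^(-1/2).\<close>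

lemma drift_ok:
  assumes A: "A > 0" and \<kappa>: "\<kappa> > 0"
  shows "eventually (\<lambda>\<epsilon>. \<epsilon> > 0 \<and> \<epsilon>\<^sup>2 * (2 * (A * \<epsilon> powr (- 1 / 2)))\<^sup>2 \<le> 1 \<and>
    drift (\<epsilon>\<^sup>2 * (2 * (A * \<epsilon> powr (- 1 / 2)))\<^sup>2) (t \<epsilon>) < 1/2 \<and>
    2 * (A * \<epsilon> powr (- 1 / 2)) * drift (\<epsilon>\<^sup>2 * (2 * (A * \<epsilon> powr (- 1 / 2)))\<^sup>2) (t \<epsilon>) \<le> \<kappa> * \<epsilon> powr (- 1 / 2)) (at_right 0)"
proof -
  have pos: "eventually (\<lambda>\<epsilon>::real. \<epsilon> > 0) (at_right 0)" by (simp add: eventually_at_right_less)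
  have 1: "eventually (\<lambda>\<epsilon>. 4 * A\<^sup>2 * \<epsilon> < 1) (at_right 0)"
    by (rule order_tendstoD(2)[where y = 0]) (auto intro!: tendsto_eq_intros)
  have 2: "eventually (\<lambda>\<epsilon>. drift (4 * A\<^sup>2 * \<epsilon>) (t \<epsilon>) < min (1/2) (\<kappa> / (2 * A))) (at_right 0)"
    by (rule order_tendstoD(2)[OF drift_small]) (use A \<kappa> in auto)
  show ?thesis using pos 1 2
  proof eventually_elim
    case (elim \<epsilon>)
    have "2 * A * drift (4 * A\<^sup>2 * \<epsilon>) (t \<epsilon>) \<le> \<kappa>" using elim A by (simp add: field_simps)
    then have "2 * A * drift (4 * A\<^sup>2 * \<epsilon>) (t \<epsilon>) * \<epsilon> powr (- 1 / 2) \<le> \<kappa> * \<epsilon> powr (- 1 / 2)" by (rule mult_right_mono) simp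
    then show ?case using elim unfolding kappa[OF elim(1)] by (simp add: mult_ac)
  qed
qed

text \<open>While the Wiener norm of the datum is at most z' \<epsilon>^(-1/2), the supremum exceeds
  this level by no more than (z - z') \<epsilon>^(-1/2) for small \<epsilon>.\<close>

lemma upper_event:
  assumes z: "0 < z'" "z' < z"
  shows "eventually (\<lambda>\<epsilon>. exceedance z \<epsilon> \<le> prob {\<omega> \<in> space M. \<exists>n. S c g n \<omega> > z' * \<epsilon> powr (- 1 / 2)}) (at_right 0)"
proof -
  have "z - z' > 0" using z by simp
  from drift_ok[OF z(1) this] show ?thesis
proof eventually_elim
  case (elim \<epsilon>)
  let ?y = "z' * \<epsilon> powr (- 1 / 2)"
  have e: "\<epsilon> > 0" using elim by simp
  then have y: "?y > 0" using z by simp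
  have "{\<omega> \<in> space M. sup_circle (u \<epsilon> \<omega> (t \<epsilon>)) > ereal (z * \<epsilon> powr (- 1 / 2))} \<subseteq> {\<omega> \<in> space M. \<exists>n. S c g n \<omega> > ?y}"
  proof safe
    fix \<omega> assume w: "\<omega> \<in> space M" "sup_circle (u \<epsilon> \<omega> (t \<epsilon>)) > ereal (z * \<epsilon> powr (- 1 / 2))"
    show "\<exists>n. S c g n \<omega> > ?y"
    proof (rule ccontr)
      assume n: "\<not> (\<exists>n. S c g n \<omega> > ?y)"
      have "sup_circle (u \<epsilon> \<omega> (t \<epsilon>)) \<le> ereal (?y + 2 * ?y * drift (\<epsilon>\<^sup>2 * (2 * ?y)\<^sup>2) (t \<epsilon>))"
        by (rule sup_upper[OF sol[OF e w(1)] t(1)[OF e] c n y]) (use elim in auto)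
      also have "\<dots> \<le> ereal (z * \<epsilon> powr (- 1 / 2))" using elim by (simp add: left_diff_distrib)
      finally show False using w(2) by simp
    qed
  qed
  then show ?case unfolding exceedance_def by (rule finite_measure_mono) measurable
qed
qed

text \<open>With r = \<epsilon>^(-1/2), a Gaussian sum above (z + 2 \<kappa>) r forces the supremum
  above z r, unless the Wiener norm or the tail of the modes is large. One \<kappa> pays for the
  tail, the other for the error of the resonant flow.\<close>

lemma lower_event:
  assumes A: "A > 0" and \<kappa>: "\<kappa> > 0" and F: "finite F" "F \<noteq> {}" "\<forall>k\<in>F. c k > 0" and z: "z > 0"
  shows "eventually (\<lambda>\<epsilon>. exp (- ((z + 2 * \<kappa>) * \<epsilon> powr (- 1 / 2) + 1)\<^sup>2 / (\<Sum>k\<in>F. (c k)\<^sup>2)) / sqrt (pi * (\<Sum>k\<in>F. (c k)\<^sup>2))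
      \<le> exceedance z \<epsilon> + prob {\<omega> \<in> space M. \<exists>n. S c g n \<omega> > A * \<epsilon> powr (- 1 / 2)}
        + prob {\<omega> \<in> space M. \<exists>n. S (\<lambda>k. if k \<in> F then 0 else c k) g n \<omega> > \<kappa> * \<epsilon> powr (- 1 / 2)}) (at_right 0)"
  using drift_ok[OF A \<kappa>]
proof eventually_elim
  case (elim \<epsilon>)
  let ?r = "\<epsilon> powr (- 1 / 2)"
  let ?y = "A * ?r"
  let ?Z = "\<lambda>\<omega>. Re (\<Sum>k\<in>F. of_real (c k) * (g k \<omega> * cis (\<epsilon>\<^sup>2 * t \<epsilon> * (c k * cmod (g k \<omega>))\<^sup>2 - (of_int k)\<^sup>2 * t \<epsilon>)))"
  let ?P = "{\<omega> \<in> space M. sup_circle (u \<epsilon> \<omega> (t \<epsilon>)) > ereal (z * ?r)}"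
  let ?E = "{\<omega> \<in> space M. \<exists>n. S c g n \<omega> > ?y}"
  let ?G = "{\<omega> \<in> space M. \<exists>n. S (\<lambda>k. if k \<in> F then 0 else c k) g n \<omega> > \<kappa> * ?r}"
  have e: "\<epsilon> > 0" using elim by simp
  then have y: "?y > 0" using A by simp
  have EG: "?E \<in> events" "?G \<in> events" by measurable
  have P: "?P \<in> events" by (rule sup_event[OF e])
  have "exp (- ((z + 2 * \<kappa>) * ?r + 1)\<^sup>2 / (\<Sum>k\<in>F. (c k)\<^sup>2)) / sqrt (pi * (\<Sum>k\<in>F. (c k)\<^sup>2))
    \<le> prob {\<omega> \<in> space M. ?Z \<omega> > (z + 2 * \<kappa>) * ?r}"
    by (rule gauss_lower[OF indep_vars_subset[OF ind] F(1,2) g bspec[OF F(3)]]) (use z \<kappa> in auto)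
  also have "\<dots> \<le> prob (?P \<union> ?E \<union> ?G)"
  proof (rule finite_measure_mono)
    show "?P \<union> ?E \<union> ?G \<in> events" using P EG by blast
    show "{\<omega> \<in> space M. ?Z \<omega> > (z + 2 * \<kappa>) * ?r} \<subseteq> ?P \<union> ?E \<union> ?G"
    proof
      fix \<omega> assume "\<omega> \<in> {\<omega> \<in> space M. ?Z \<omega> > (z + 2 * \<kappa>) * ?r}"
      then have w: "\<omega> \<in> space M" "?Z \<omega> > (z + 2 * \<kappa>) * ?r" by auto
      show "\<omega> \<in> ?P \<union> ?E \<union> ?G"
      proof (rule ccontr)
        assume "\<omega> \<notin> ?P \<union> ?E \<union> ?G"
        then have n: "\<not> sup_circle (u \<epsilon> \<omega> (t \<epsilon>)) > ereal (z * ?r)" "\<not> (\<exists>n. S c g n \<omega> > ?y)"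
          "\<not> (\<exists>n. S (\<lambda>k. if k \<in> F then 0 else c k) g n \<omega> > \<kappa> * ?r)" using w(1) by blast+
        have d: "\<epsilon>\<^sup>2 * (2 * ?y)\<^sup>2 \<le> 1" "drift (\<epsilon>\<^sup>2 * (2 * ?y)\<^sup>2) (t \<epsilon>) < 1/2"
          "2 * ?y * drift (\<epsilon>\<^sup>2 * (2 * ?y)\<^sup>2) (t \<epsilon>) \<le> \<kappa> * ?r" using elim by blast+
        have "z * ?r < ?Z \<omega> - \<kappa> * ?r - 2 * ?y * drift (\<epsilon>\<^sup>2 * (2 * ?y)\<^sup>2) (t \<epsilon>)"
          using w(2) d(3) unfolding distrib_right mult.assoc by linarith
        then have "ereal (z * ?r) < ereal (?Z \<omega> - \<kappa> * ?r - 2 * ?y * drift (\<epsilon>\<^sup>2 * (2 * ?y)\<^sup>2) (t \<epsilon>))" by simp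
        also have "\<dots> \<le> sup_circle (u \<epsilon> \<omega> (t \<epsilon>))"
          by (rule sup_lower[OF sol[OF e w(1)] t(1)[OF e] c n(2) y F(1) n(3) d(1,2)])
        finally show False using n(1) by simp
      qed
    qed
  qed
  also have "\<dots> \<le> prob (?P \<union> ?E) + prob ?G" by (intro measure_Un_le sets.Un P EG)
  also have "prob (?P \<union> ?E) \<le> prob ?P + prob ?E" by (intro measure_Un_le sets.Un P EG)
  finally show ?case unfolding exceedance_def by simp
qed

end

text \<open>In units of 1/\<epsilon> the main term has exponent -b^2/s up to a vanishing error, the
  subtracted one -(m' + 1). Since b^2/s \<le> m' and e \<le> 1, a gap of at least 1/2 remains after
  giving up e/2, which beats the term of order \<epsilon>^(-1/2) and the constants.\<close>

lemma gaussian_term_dominates: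
  fixes b s e q m' Q :: real
  assumes m: "b\<^sup>2 / s \<le> m'" and s: "s > 0" and e: "0 < e" "e \<le> 1" and q: "q > 0"
  shows "eventually (\<lambda>\<epsilon>. exp (- (b\<^sup>2 / s + e) / \<epsilon>) \<le> exp (- (b * \<epsilon> powr (- 1 / 2) + 1)\<^sup>2 / s) / q - 2 * exp (- (m' + 1) / \<epsilon> + Q * \<epsilon> powr (- 1 / 2))) (at_right 0)"
proof -
  define m where "m = b\<^sup>2 / s"
  have pos: "eventually (\<lambda>\<epsilon>::real. \<epsilon> > 0) (at_right 0)" by (simp add: eventually_at_right_less)
  have sq0: "((\<lambda>\<epsilon>::real. \<epsilon> powr (1/2)) \<longlongrightarrow> 0) (at_right 0)" by real_asymp
  have "((\<lambda>\<epsilon>. (b + \<epsilon> powr (1/2))\<^sup>2 / s) \<longlongrightarrow> (b + 0)\<^sup>2 / s) (at_right 0)"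
    by (intro tendsto_intros sq0) (use s in simp)
  then have 1: "eventually (\<lambda>\<epsilon>. (b + \<epsilon> powr (1/2))\<^sup>2 / s < m + e / 2) (at_right 0)"
    by (rule order_tendstoD(2)) (use e in \<open>simp add: m_def\<close>)
  have inv: "filterlim (\<lambda>\<epsilon>::real. inverse \<epsilon>) at_top (at_right 0)" by (rule filterlim_inverse_at_top_right)
  have "((\<lambda>\<epsilon>. - (1/2) + Q * \<epsilon> powr (1/2)) \<longlongrightarrow> - (1/2) + Q * 0) (at_right 0)" by (intro tendsto_intros sq0)
  then have l1: "((\<lambda>\<epsilon>. exp ((- (1/2) + Q * \<epsilon> powr (1/2)) * inverse \<epsilon>)) \<longlongrightarrow> 0) (at_right 0)"
    by (intro filterlim_compose[OF exp_at_bot] filterlim_tendsto_neg_mult_at_bot[OF _ _ inv]) auto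
  have l2: "((\<lambda>\<epsilon>. exp (- (e / 2) * inverse \<epsilon>)) \<longlongrightarrow> 0) (at_right 0)"
    by (intro filterlim_compose[OF exp_at_bot] filterlim_tendsto_neg_mult_at_bot[OF tendsto_const _ inv]) (use e in simp)
  have "((\<lambda>\<epsilon>. 2 * exp ((- (1/2) + Q * \<epsilon> powr (1/2)) * inverse \<epsilon>) + exp (- (e / 2) * inverse \<epsilon>)) \<longlongrightarrow> 2 * 0 + 0) (at_right 0)"
    by (intro tendsto_intros l1 l2)
  then have 2: "eventually (\<lambda>\<epsilon>. 2 * exp ((- (1/2) + Q * \<epsilon> powr (1/2)) * inverse \<epsilon>) + exp (- (e / 2) * inverse \<epsilon>) < 1 / q) (at_right 0)"
    by (rule order_tendstoD(2)) (use q in simp)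
  show ?thesis using pos 1 2
  proof eventually_elim
    case (elim \<epsilon>)
    define w where "w = \<epsilon> powr (1/2)"
    have w: "w > 0" "\<epsilon> = w\<^sup>2" "\<epsilon> powr (- 1 / 2) = 1 / w"
      using elim(1) by (simp_all add: w_def powr_minus_divide power2_eq_square flip: powr_add)
    have ex: "(- (1/2) + Q * \<epsilon> powr (1/2)) * inverse \<epsilon> = - (1/2) / \<epsilon> + Q * \<epsilon> powr (- 1 / 2)"
      unfolding w(3) w_def[symmetric] unfolding w(2) using w(1) by (simp add: power2_eq_square field_simps)
    have lt: "2 * exp (- (1/2) / \<epsilon> + Q * \<epsilon> powr (- 1 / 2)) + exp (- (e / 2) / \<epsilon>) < 1 / q"
      using elim(3) unfolding ex by (simp only: divide_inverse)
    let ?X = "exp (- (m + e / 2) / \<epsilon>)"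
    have "(b * \<epsilon> powr (- 1 / 2) + 1)\<^sup>2 = (b + w)\<^sup>2 / \<epsilon>"
      unfolding w(3) unfolding w(2) using w(1) by (simp add: power2_eq_square field_simps)
    then have "(b * \<epsilon> powr (- 1 / 2) + 1)\<^sup>2 / s = (b + w)\<^sup>2 / s / \<epsilon>" by simp
    also have "\<dots> \<le> (m + e / 2) / \<epsilon>" using elim by (intro divide_right_mono) (auto simp: w_def)
    finally have "?X \<le> exp (- (b * \<epsilon> powr (- 1 / 2) + 1)\<^sup>2 / s)"
      by (simp only: exp_le_cancel_iff minus_divide_left[symmetric] neg_le_iff_le)
    then have a: "?X * (1 / q) \<le> exp (- (b * \<epsilon> powr (- 1 / 2) + 1)\<^sup>2 / s) / q" using q by (simp add: divide_right_mono)
    have "- (m' + 1) / \<epsilon> \<le> - (m + e / 2) / \<epsilon> + - (1/2) / \<epsilon>"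
      using m e elim(1) unfolding m_def[symmetric] add_divide_distrib[symmetric] by (intro divide_right_mono) auto
    then have "exp (- (m' + 1) / \<epsilon> + Q * \<epsilon> powr (- 1 / 2)) \<le> exp (- (m + e / 2) / \<epsilon> + (- (1/2) / \<epsilon> + Q * \<epsilon> powr (- 1 / 2)))"
      unfolding exp_le_cancel_iff by linarith
    then have b: "exp (- (m' + 1) / \<epsilon> + Q * \<epsilon> powr (- 1 / 2)) \<le> ?X * exp (- (1/2) / \<epsilon> + Q * \<epsilon> powr (- 1 / 2))" by (simp only: exp_add)
    have "- (m + e) / \<epsilon> = - (m + e / 2) / \<epsilon> + - (e / 2) / \<epsilon>" unfolding add_divide_distrib[symmetric] by simp
    then have c: "exp (- (m + e) / \<epsilon>) = ?X * exp (- (e / 2) / \<epsilon>)" by (simp only: exp_add)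
    have "?X * (2 * exp (- (1/2) / \<epsilon> + Q * \<epsilon> powr (- 1 / 2)) + exp (- (e / 2) / \<epsilon>)) \<le> ?X * (1 / q)"
      by (rule mult_left_mono[OF less_imp_le[OF lt]]) simp
    then have "2 * (?X * exp (- (1/2) / \<epsilon> + Q * \<epsilon> powr (- 1 / 2))) + ?X * exp (- (e / 2) / \<epsilon>) \<le> ?X * (1 / q)"
      by (simp only: distrib_left mult.left_commute)
    then show ?case using a b c unfolding m_def[symmetric] by linarith
  qed
qed

section \<open>The upper and the lower rate\<close>

context nls_data
begin

lemma s1_nonneg: "s1 \<ge> 0" using s1[of 0] c[of 0] by simp

text \<open>The Chernoff parameter is \<tau> \<epsilon>^(-1/2), which gives the quadratic terms the
  size 1/\<epsilon> and leaves the linear moment term at \<epsilon>^(-1/2).\<close>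

lemma chernoff_scaled:
  assumes C: "exp_moment_bound M a C" "C \<ge> 0" and a: "a > 0" and \<tau>: "\<tau> \<ge> 0" and e: "\<epsilon> > 0"
    and d: "\<And>k. 0 \<le> d k" "\<And>k. d k \<le> c k" "\<And>n. (\<Sum>k\<in>{- int n..int n}. (d k)\<^sup>2) \<le> v"
  shows "prob {\<omega> \<in> space M. \<exists>n. S d g n \<omega> > A * \<epsilon> powr (- 1 / 2)} \<le> exp ((\<tau>\<^sup>2 * v / (4 * a) - \<tau> * A) / \<epsilon> + C * \<tau> * s1 * \<epsilon> powr (- 1 / 2))"
proof -
  let ?r = "\<epsilon> powr (- 1 / 2)"
  have r: "?r * ?r = 1 / \<epsilon>" using e by (simp add: powr_minus_divide flip: powr_add)
  have d1: "(\<Sum>k\<in>{- int n..int n}. d k) \<le> s1" for n by (rule order_trans[OF sum_mono s1]) (rule d)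
  have "prob {\<omega> \<in> space M. \<exists>n. S d g n \<omega> > A * ?r} \<le> exp (- (\<tau> * ?r) * (A * ?r) + C * (\<tau> * ?r) * s1 + (\<tau> * ?r)\<^sup>2 * v / (4 * a))"
    by (rule chernoff[OF ind g d(1) C a _ d1 d(3)]) (use \<tau> in simp)
  also have "- (\<tau> * ?r) * (A * ?r) + C * (\<tau> * ?r) * s1 + (\<tau> * ?r)\<^sup>2 * v / (4 * a) = (\<tau>\<^sup>2 * v / (4 * a) - \<tau> * A) * (?r * ?r) + C * \<tau> * s1 * ?r"
    using a by (simp add: power2_eq_square field_simps)
  finally show ?thesis by (simp only: r times_divide_eq_right mult_1_right)
qed

text \<open>A number \<open>r\<close> close to 1 plays two parts: it lowers the level from
  \<open>z\<close> to \<open>r * z\<close>, which absorbs the drift, and it is the parameter of the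
  moment bound. Positivity of the probability is a premise inside the claim because the logarithm is
  informative only then; the lower rate supplies it.\<close>

lemma rate_upper:
  assumes z: "z > 0" and e: "e > 0"
  shows "eventually (\<lambda>\<epsilon>. exceedance z \<epsilon> > 0 \<longrightarrow> \<epsilon> * ln (exceedance z \<epsilon>) < - (z\<^sup>2 / s2) + e) (at_right 0)"
proof -
  have "((\<lambda>r::real. r ^ 3 * (z\<^sup>2 / s2)) \<longlongrightarrow> 1 ^ 3 * (z\<^sup>2 / s2)) (at_left 1)" by (intro tendsto_intros)
  then have "eventually (\<lambda>r::real. r ^ 3 * (z\<^sup>2 / s2) > z\<^sup>2 / s2 - e / 2) (at_left 1)"
    by (rule order_tendstoD(1)) (use e in simp)
  moreover have "eventually (\<lambda>r::real. r \<in> {0<..<1}) (at_left 1)" by (rule eventually_at_left_real) simp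
  ultimately have "eventually (\<lambda>r::real. r ^ 3 * (z\<^sup>2 / s2) > z\<^sup>2 / s2 - e / 2 \<and> r \<in> {0<..<1}) (at_left 1)" by (rule eventually_conj)
  from eventually_happens[OF this]
  obtain r where r: "r ^ 3 * (z\<^sup>2 / s2) > z\<^sup>2 / s2 - e / 2" "0 < r" "r < 1"
    by (auto simp: trivial_limit_at_left_real)
  obtain C where C: "C \<ge> 0" "exp_moment_bound M r C" using exp_moment_boundI[OF r(2,3)] by blast
  \<comment> \<open>Minimises \<tau>^2 s2 / (4 r) - \<tau> r z, with minimum -r^3 z^2 / s2.\<close>
  define \<tau> where "\<tau> = 2 * r * (r * z) / s2"
  define Q where "Q = C * \<tau> * s1"
  have \<tau>: "\<tau> \<ge> 0" using r z s2(3) by (simp add: \<tau>_def)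
  have pos: "eventually (\<lambda>\<epsilon>::real. \<epsilon> > 0) (at_right 0)" by (simp add: eventually_at_right_less)
  have sq0: "((\<lambda>\<epsilon>::real. \<epsilon> powr (1/2)) \<longlongrightarrow> 0) (at_right 0)" by real_asymp
  have "((\<lambda>\<epsilon>. Q * \<epsilon> powr (1/2)) \<longlongrightarrow> Q * 0) (at_right 0)" by (intro tendsto_intros sq0)
  then have 1: "eventually (\<lambda>\<epsilon>. Q * \<epsilon> powr (1/2) < e / 2) (at_right 0)" by (rule order_tendstoD(2)) (use e in simp)
  have rz: "0 < r * z" "r * z < z" using r z by auto
  show ?thesis using pos 1 upper_event[OF rz]
  proof eventually_elim
    case (elim \<epsilon>)
    show ?case
    proof
      assume pp: "exceedance z \<epsilon> > 0"
      have "exceedance z \<epsilon> \<le> exp ((\<tau>\<^sup>2 * s2 / (4 * r) - \<tau> * (r * z)) / \<epsilon> + C * \<tau> * s1 * \<epsilon> powr (- 1 / 2))"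
        by (rule order_trans[OF elim(3) chernoff_scaled[OF C(2,1) r(2) \<tau> elim(1) c order_refl s2(1)]])
      also have "\<tau>\<^sup>2 * s2 / (4 * r) - \<tau> * (r * z) = - (r ^ 3 * (z\<^sup>2 / s2))"
        using r s2(3) by (simp add: \<tau>_def power2_eq_square power3_eq_cube field_simps)
      finally have "ln (exceedance z \<epsilon>) \<le> ln (exp (- (r ^ 3 * (z\<^sup>2 / s2)) / \<epsilon> + Q * \<epsilon> powr (- 1 / 2)))"
        using pp unfolding Q_def by (subst ln_le_cancel_iff) auto
      then have "ln (exceedance z \<epsilon>) \<le> - (r ^ 3 * (z\<^sup>2 / s2)) / \<epsilon> + Q * \<epsilon> powr (- 1 / 2)"
        by (simp only: ln_exp)
      then have "\<epsilon> * ln (exceedance z \<epsilon>) \<le> \<epsilon> * (- (r ^ 3 * (z\<^sup>2 / s2)) / \<epsilon> + Q * \<epsilon> powr (- 1 / 2))"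
        by (rule mult_left_mono) (use elim in simp)
      also have "\<dots> = - (r ^ 3 * (z\<^sup>2 / s2)) + Q * (\<epsilon> powr 1 * \<epsilon> powr (- 1 / 2))" using elim(1) by (simp add: field_simps)
      also have "\<epsilon> powr 1 * \<epsilon> powr (- 1 / 2) = \<epsilon> powr (1 / 2)" by (subst powr_add[symmetric]) simp
      finally show "\<epsilon> * ln (exceedance z \<epsilon>) < - (z\<^sup>2 / s2) + e" using elim(2) r(1) by linarith
    qed
  qed
qed

text \<open>Finitely many modes with nearly the full square sum give the main Gaussian term. The
  other parameters are chosen so that both error events have an exponent of at most -(m + 1) in
  units of 1/\<epsilon>, up to order \<epsilon>^(-1/2), which is below that of the main
  term.\<close>

lemma rate_lower:
  assumes z: "z > 0" and e: "0 < e" "e \<le> 1"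
  shows "eventually (\<lambda>\<epsilon>. exceedance z \<epsilon> > 0 \<and> \<epsilon> * ln (exceedance z \<epsilon>) > - (z\<^sup>2 / s2) - e) (at_right 0)"
proof -
  have pos: "eventually (\<lambda>\<epsilon>::real. \<epsilon> > 0) (at_right 0)" by (simp add: eventually_at_right_less)
  have "((\<lambda>\<kappa>::real. (z + 2 * \<kappa>)\<^sup>2 / s2) \<longlongrightarrow> (z + 2 * 0)\<^sup>2 / s2) (at_right 0)" by (intro tendsto_intros) (use s2 in simp)
  then have "eventually (\<lambda>\<kappa>::real. (z + 2 * \<kappa>)\<^sup>2 / s2 < z\<^sup>2 / s2 + e / 4) (at_right 0)"
    by (rule order_tendstoD(2)) (use e in simp)
  from eventually_happens[OF eventually_conj[OF this pos]]
  obtain \<kappa> where \<kappa>: "(z + 2 * \<kappa>)\<^sup>2 / s2 < z\<^sup>2 / s2 + e / 4" "\<kappa> > 0" by (auto simp: trivial_limit_at_right_real)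
  define b where "b = z + 2 * \<kappa>"
  \<comment> \<open>Bounds \<open>b\<^sup>2\<close> divided by the square sum over the window, since
    the latter will exceed \<open>s2 / 2\<close>.\<close>
  define m where "m = 2 * b\<^sup>2 / s2"
  have m0: "m \<ge> 0" using s2(3) by (simp add: m_def)
  \<comment> \<open>Makes \<open>\<tau> * \<kappa>\<close> equal to \<open>2 * (m + 1)\<close>, half
    of which may be spent on the quadratic term.\<close>
  define \<tau> where "\<tau> = 2 * (m + 1) / \<kappa>"
  have \<tau>: "\<tau> > 0" using m0 \<kappa> by (simp add: \<tau>_def)
  \<comment> \<open>Makes the Chernoff exponent \<open>s2 / 2 - A\<close>, for parameter 1 and
    moment parameter 1/2, equal to \<open>- (m + 1)\<close>.\<close>
  define A where "A = s2 / 2 + m + 1"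
  have A: "A > 0" using m0 s2(3) by (simp add: A_def)
  let ?s = "\<lambda>n. \<Sum>k\<in>{- int n..int n}. (c k)\<^sup>2"
  have "(\<lambda>n. b\<^sup>2 / ?s n) \<longlonglongrightarrow> b\<^sup>2 / s2" by (intro tendsto_intros s2) (use s2(3) in simp)
  then have n1: "eventually (\<lambda>n. b\<^sup>2 / ?s n < b\<^sup>2 / s2 + e / 4) sequentially" by (rule order_tendstoD(2)) (use e in simp)
  have n2: "eventually (\<lambda>n. ?s n > s2 / 2) sequentially" by (rule order_tendstoD(1)[OF s2(2)]) (use s2(3) in simp)
  \<comment> \<open>The remaining square sum is so small that the quadratic term of the Chernoff
    bound for the tail is at most \<open>m + 1\<close>.\<close>
  have n3: "eventually (\<lambda>n. ?s n > s2 - 2 * (m + 1) / \<tau>\<^sup>2) sequentially"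
    by (rule order_tendstoD(1)[OF s2(2)]) (use \<tau> m0 in simp)
  obtain N where N: "b\<^sup>2 / ?s N < b\<^sup>2 / s2 + e / 4" "?s N > s2 / 2" "?s N > s2 - 2 * (m + 1) / \<tau>\<^sup>2"
    using eventually_happens[OF eventually_conj[OF n1 eventually_conj[OF n2 n3]]] by auto
  \<comment> \<open>Only positive weights, as \<open>gauss_lower\<close> demands; the omitted ones
    vanish and do not change the square sum.\<close>
  define F where "F = {k \<in> {- int N..int N}. c k > 0}"
  have F: "finite F" "\<forall>k\<in>F. c k > 0"
    by (rule finite_subset[of _ "{- int N..int N}"]) (auto simp: F_def)
  have sF: "(\<Sum>k\<in>F. (c k)\<^sup>2) = ?s N"
  proof (rule sum.mono_neutral_left)
    show "\<forall>k\<in>{- int N..int N} - F. (c k)\<^sup>2 = 0"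
    proof
      fix k assume "k \<in> {- int N..int N} - F"
      then have "\<not> c k > 0" by (simp add: F_def)
      then show "(c k)\<^sup>2 = 0" using c[of k] by simp
    qed
  qed (auto simp: F_def)
  have s0: "?s N > 0" using N(2) s2(3) by linarith
  have Fne: "F \<noteq> {}"
  proof
    assume "F = {}"
    then show False using sF s0 by simp
  qed
  define d where "d = (\<lambda>k. if k \<in> F then 0 else c k)"
  have d2: "(\<Sum>k\<in>{- int n..int n}. (d k)\<^sup>2) \<le> s2 - ?s N" for n
  proof -
    let ?K = "max n N"
    have "(\<Sum>k\<in>{- int n..int n}. (d k)\<^sup>2) \<le> (\<Sum>k\<in>{- int ?K..int ?K}. (d k)\<^sup>2)" by (rule sum_mono2) auto
    also have "\<dots> = (\<Sum>k\<in>{- int ?K..int ?K} - F. (c k)\<^sup>2)"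
      by (rule sum.mono_neutral_cong_right) (auto simp: d_def)
    also have "\<dots> = ?s ?K - (\<Sum>k\<in>F. (c k)\<^sup>2)" by (rule sum_diff) (auto simp: F_def)
    also have "\<dots> \<le> s2 - ?s N" unfolding sF using s2(1)[of ?K] by linarith
    finally show ?thesis .
  qed
  have d1: "0 \<le> d k" "d k \<le> c k" for k using c[of k] by (simp_all add: d_def)
  obtain C where C: "C \<ge> 0" "exp_moment_bound M (1/2) C" using exp_moment_boundI[of "1/2"] by auto
  define Q where "Q = C * s1 * (1 + \<tau>)"
  have Q: "C * 1 * s1 \<le> Q" "C * \<tau> * s1 \<le> Q"
  proof -
    have "0 \<le> C * s1" "0 \<le> C * s1 * \<tau>" using C s1_nonneg \<tau> by simp_all
    then show "C * 1 * s1 \<le> Q" "C * \<tau> * s1 \<le> Q" by (simp_all add: Q_def algebra_simps)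
  qed
  have bs: "b\<^sup>2 / ?s N \<le> m"
  proof -
    have "b\<^sup>2 / ?s N \<le> b\<^sup>2 / (s2 / 2)" using N(2) s2(3) s0 by (intro divide_left_mono mult_pos_pos) auto
    then show ?thesis by (simp add: m_def mult.commute)
  qed
  have \<tau>k: "\<tau>\<^sup>2 * (s2 - ?s N) / (4 * (1/2)) - \<tau> * \<kappa> \<le> - (m + 1)"
  proof -
    have gen: "x / (4 * (1/2)) - y \<le> - (m + 1)" if "x \<le> 2 * (m + 1)" "y = 2 * (m + 1)" for x y :: real
      using that by simp
    have "s2 - ?s N \<le> 2 * (m + 1) / \<tau>\<^sup>2" using N(3) by linarith
    then have "\<tau>\<^sup>2 * (s2 - ?s N) \<le> \<tau>\<^sup>2 * (2 * (m + 1) / \<tau>\<^sup>2)" by (rule mult_left_mono) simp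
    also have "\<dots> = 2 * (m + 1)" using \<tau> by simp
    finally show ?thesis by (rule gen) (use \<kappa>(2) in \<open>simp add: \<tau>_def\<close>)
  qed
  \<comment> \<open>Of the total loss \<open>e\<close>, one quarter went into \<kappa>, one quarter
    into the window, and half is left for the Gaussian term.\<close>
  have e2: "0 < e / 2" "e / 2 \<le> 1" using e by auto
  have q: "sqrt (pi * ?s N) > 0" using s0 by simp
  show ?thesis using pos lower_event[OF A \<kappa>(2) F(1) Fne F(2) z] gaussian_term_dominates[OF bs s0 e2 q, of Q]
  proof eventually_elim
    case (elim \<epsilon>)
    let ?r = "\<epsilon> powr (- 1 / 2)"
    have E1: "prob {\<omega> \<in> space M. \<exists>n. S c g n \<omega> > A * ?r} \<le> exp (- (m + 1) / \<epsilon> + Q * ?r)"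
    proof -
      have "prob {\<omega> \<in> space M. \<exists>n. S c g n \<omega> > A * ?r} \<le> exp ((1\<^sup>2 * s2 / (4 * (1/2)) - 1 * A) / \<epsilon> + C * 1 * s1 * ?r)"
        by (rule chernoff_scaled[OF C(2,1) _ _ elim(1) c order_refl s2(1)]) auto
      also have "\<dots> \<le> exp (- (m + 1) / \<epsilon> + Q * ?r)"
        unfolding exp_le_cancel_iff by (intro add_mono divide_right_mono mult_right_mono Q(1)) (use elim(1) in \<open>auto simp: A_def\<close>)
      finally show ?thesis .
    qed
    have E2: "prob {\<omega> \<in> space M. \<exists>n. S d g n \<omega> > \<kappa> * ?r} \<le> exp (- (m + 1) / \<epsilon> + Q * ?r)"
    proof -
      have "prob {\<omega> \<in> space M. \<exists>n. S d g n \<omega> > \<kappa> * ?r} \<le> exp ((\<tau>\<^sup>2 * (s2 - ?s N) / (4 * (1/2)) - \<tau> * \<kappa>) / \<epsilon> + C * \<tau> * s1 * ?r)"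
        by (rule chernoff_scaled[OF C(2,1) _ less_imp_le[OF \<tau>] elim(1) d1 d2]) auto
      also have "\<dots> \<le> exp (- (m + 1) / \<epsilon> + Q * ?r)"
        unfolding exp_le_cancel_iff by (intro add_mono divide_right_mono mult_right_mono Q(2) \<tau>k) (use elim(1) in auto)
      finally show ?thesis .
    qed
    have "exp (- (b\<^sup>2 / ?s N + e / 2) / \<epsilon>) \<le> exceedance z \<epsilon>"
      using elim(2,3) E1 E2[unfolded d_def] unfolding b_def[symmetric] sF by linarith
    then have pp: "exceedance z \<epsilon> > 0" "- (b\<^sup>2 / ?s N + e / 2) / \<epsilon> \<le> ln (exceedance z \<epsilon>)"
      using less_le_trans[OF exp_gt_zero] by (blast, simp add: ln_ge_iff less_le_trans[OF exp_gt_zero])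
    have "\<epsilon> * (- (b\<^sup>2 / ?s N + e / 2) / \<epsilon>) \<le> \<epsilon> * ln (exceedance z \<epsilon>)" by (rule mult_left_mono[OF pp(2)]) (use elim(1) in simp)
    moreover have "\<epsilon> * (- (b\<^sup>2 / ?s N + e / 2) / \<epsilon>) = - (b\<^sup>2 / ?s N + e / 2)" using elim(1) by simp
    ultimately show ?case using pp(1) N(1) \<kappa>(1) e(1) unfolding b_def[symmetric] by linarith
  qed
qed

theorem large_deviation:
  assumes z: "z > 0"
  shows "((\<lambda>\<epsilon>. \<epsilon> * ln (exceedance z \<epsilon>)) \<longlongrightarrow> - (z\<^sup>2 / s2)) (at_right 0)"
proof (rule tendstoI)
  fix e :: real assume e: "e > 0"
  have e': "0 < min e 1" "min e 1 \<le> 1" using e by auto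
  show "eventually (\<lambda>\<epsilon>. dist (\<epsilon> * ln (exceedance z \<epsilon>)) (- (z\<^sup>2 / s2)) < e) (at_right 0)"
    using rate_upper[OF z e] rate_lower[OF z e']
  proof eventually_elim
    case (elim \<epsilon>)
    then show ?case unfolding dist_real_def abs_less_iff by linarith
  qed
qed

end

theorem corollary1p4:
  fixes M :: "'a measure"
    and g :: "int \<Rightarrow> 'a \<Rightarrow> complex"
    and c :: "int \<Rightarrow> real"
    and u :: "real \<Rightarrow> 'a \<Rightarrow> real \<Rightarrow> real \<Rightarrow> complex"
    and t :: "real \<Rightarrow> real"
    and z0 :: real
  assumes "prob_space M"
    and "iid_standard_complex_gaussians M g"
    and "\<forall>k. c k \<ge> 0"
    and "\<exists>k. c k \<noteq> 0"
    and "(\<lambda>k. \<bar>c k\<bar>) summable_on UNIV"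
    and "\<forall>\<epsilon>>0. \<forall>\<omega>\<in>space M. nls_solution \<epsilon> (random_data c g \<omega>) (u \<epsilon> \<omega>)"
    and "\<forall>\<epsilon>>0. t \<epsilon> \<ge> 0"
    and "t \<in> O[at_right 0](\<lambda>\<epsilon>. inverse \<epsilon> * \<bar>ln \<epsilon>\<bar>)"
    and "z0 > 0"
  shows "((\<lambda>\<epsilon>. \<epsilon> * ln (measure M
            {\<omega> \<in> space M. sup_circle (u \<epsilon> \<omega> (t \<epsilon>)) > ereal (z0 * \<epsilon> powr (- 1 / 2))}))
          \<longlongrightarrow> - (z0\<^sup>2 / (\<Sum>\<^sub>\<infinity>k\<in>UNIV. (c k)\<^sup>2))) (at_right 0)"
proof -
  interpret prob_space M by fact
  have c0: "c k \<ge> 0" for k using assms(3) by simp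
  have c1: "integrable CS c"
    using assms(5) abs_summable_equivalent[of c UNIV] by (simp add: Infinite_Set_Sum.abs_summable_on_def)
  define s1 where "s1 = (LINT k|CS. c k)"
  have cle: "c k \<le> s1" for k unfolding s1_def using cseq_lim_nn[OF c1 c0, of "{k}"] by simp
  \<comment> \<open>The weights are bounded by their sum \<open>s1\<close>, so their squares are
    summable along with them.\<close>
  have c2: "integrable CS (\<lambda>k. (c k)\<^sup>2)"
  proof (rule Bochner_Integration.integrable_bound)
    show "integrable CS (\<lambda>k. s1 * c k)" using c1 by simp
    have "norm ((c k)\<^sup>2) \<le> norm (s1 * c k)" for k
      using mult_right_mono[OF cle c0, of k k] c0[of k] order_trans[OF c0[of k] cle[of k]] by (simp add: power2_eq_square abs_mult)
    then show "AE k in CS. norm ((c k)\<^sup>2) \<le> norm (s1 * c k)" by simp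
  qed simp
  have sq_sum: "(\<Sum>\<^sub>\<infinity>k\<in>UNIV. (c k)\<^sup>2) = (LINT k|CS. (c k)\<^sup>2)"
    using infsetsum_infsum[of "\<lambda>k. (c k)\<^sup>2" UNIV] c2 by (simp add: Infinite_Set_Sum.abs_summable_on_def infsetsum_def)
  have g: "std_cgauss M (g k)" for k
    using assms(2) unfolding iid_standard_complex_gaussians_def by (intro std_cgaussI) auto
  obtain k0 where k0: "c k0 \<noteq> 0" using assms(4) by blast
  interpret nls_data M g c u t s1 "LINT k|CS. (c k)\<^sup>2"
  proof
    show "indep_vars (\<lambda>_. borel) g UNIV" using assms(2) by (simp add: iid_standard_complex_gaussians_def)
    show "(\<Sum>k\<in>{- int n..int n}. c k) \<le> s1" for n unfolding s1_def by (rule cseq_lim_nn[OF c1 c0]) simp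
    show "(\<Sum>k\<in>{- int n..int n}. (c k)\<^sup>2) \<le> (LINT k|CS. (c k)\<^sup>2)" for n by (rule cseq_lim_nn[OF c2]) auto
    show "(\<lambda>n. \<Sum>k\<in>{- int n..int n}. (c k)\<^sup>2) \<longlonglongrightarrow> (LINT k|CS. (c k)\<^sup>2)" by (rule csum_lim[OF c2])
    have "0 < (c k0)\<^sup>2" using k0 by simp
    also have "\<dots> \<le> (LINT k|CS. (c k)\<^sup>2)" using cseq_lim_nn[OF c2, of "{k0}"] by simp
    finally show "(LINT k|CS. (c k)\<^sup>2) > 0" .
  qed (use assms g in auto)
  show ?thesis unfolding sq_sum using large_deviation[OF assms(9)] unfolding exceedance_def .
qed

end
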